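(* For $2\le n<\infty$ let $\mathfrak{N}_n$ be the set of nonperiodic vectors in $\bigcup_{m\ge1}(\mathcal{V}_{n,m})_1$, let $\mathcal{P}_{n,sub}$ be the set of all pure sub-Cuntz states on $\mathcal{O}_n$, and let $q:\mathfrak{N}_n\to\mathcal{P}_{n,sub}$, $q(z):=\tilde{\omega}_z$. Put $\mathfrak{N}_*:=\bigcup_{n\ge2}\mathfrak{N}_n$, which is a semigroup with the product $*$. Then the set $\mathcal{P}_{*,sub}:=\bigcup_{n\ge2}\mathcal{P}_{n,sub}$ is a semigroup with the product $\otimes_\varphi$, and $q$ can be extended to an isomorphism of semigroups from $(\mathfrak{N}_*,* )$ onto $(\mathcal{P}_{*,sub},\otimes_\varphi)$.
   Context: $\mathcal{O}_n$ ($2\le n<\infty$) is the Cuntz algebra, the universal C$^*$-algebra generated by $s_1^{(n)},\ldots,s_n^{(n)}$ with $(s_i^{(n)})^*s_j^{(n)}=\delta_{ij}I$ and $\sum_{i=1}^n s_i^{(n)}(s_i^{(n)})^*=I$. For $J=(j_1,\ldots,j_k)\in\{1,\ldots,n\}^k$, $s_J^{(n)}:=s_{j_1}^{(n)}\cdots s_{j_k}^{(n)}$. Unions over $n$ range over integers $2\le n<\infty$ and are disjoint unions. $\mathcal{V}_{n,m}:=\ell^2(\{1,\ldots,n\}^m)$ is the Hilbert space with orthonormal basis $\{e_J\}$, identified with $(\mathbb{C}^n)^{\otimes m}$ via $e_J\leftrightarrow e_{j_1}\otimes\cdots\otimes e_{j_m}$; $(\mathcal{V}_{n,m})_1$ is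 the set of unit vectors. For $z\in(\mathcal{V}_{n,m})_1$, a sub-Cuntz state on $\mathcal{O}_n$ by $z$ is a state $\omega$ with $\omega(s_J^{(n)})=\overline{z_J}$ for all $J\in\{1,\ldots,n\}^m$. $z$ is nonperiodic if $z=x^{\otimes p}$ for some $p\ge1$ and some $x\in\bigcup_{k\ge1}\mathcal{V}_{n,k}$ implies $p=1$; then there is exactly one sub-Cuntz state by $z$, denoted $\tilde{\omega}_z$, and it is pure. $\varphi_{n,n'}:\mathcal{O}_{nn'}\to\mathcal{O}_n\otimes\mathcal{O}_{n'}$ is the unital $*$-embedding with $\varphi_{n,n'}(s^{(nn')}_{n'(i-1)+j})=s_i^{(n)}\otimes s_j^{(n')}$ ($1\le i\le n$, $1\le j\le n'$), and $\omega_1\otimes_\varphi\omega_2:=(\omega_1\otimes\omega_2)\circ\varphi_{n,n'}$ for states $\omega_1$ on $\mathcal{O}_n$, $\omega_2$ on $\mathcal{O}_{n'}$. For $J\in\{1,\ldots,n\}^m$, $K\in\{1,\ldots,n'\}^m$, $J\boxtimes K=(l_1,\ldots,l_m)\in\{1,\ldots,nn'\}^m$ with $l_t:=n'(j_t-1)+k_t$ (a bijection). For $z\in\mathcal{V}_{n,m}$, $y\in\mathcal{V}_{n',m}$, $z\boxtimes y\in\mathcal{V}_{nn',m}$ has coordinates $(z\boxtimes y)_{J\boxtimes K}:=z_Jy_K$. For $z\in\mathcal{V}_{n,m}$, $y\in\mathcal{V}_{n',l}$, $z*y:=z^{\otimes\alpha}\boxtimes y^{\otimes\beta}\in\mathcal{V}_{nn',d}$,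 where $\alpha,\beta\ge1$ are determined by $d:=\alpha m=\beta l$ being the least common multiple of $m$ and $l$. *)

theory Defs
  imports Complex_Main "HOL-Algebra.Module" "HOL-Library.FuncSet" "HOL-Library.Nonpos_Ints"
begin

section \<open>Unital *-algebras and C*-algebras presented by generators and relations\<close>

text \<open>
  The library has no C*-algebras. Complex unital *-algebras are records extending the ring and
  module records of HOL-Algebra; a C*-algebra additionally carries its norm.
\<close>

record 'a star_algebra = "(complex, 'a) module" +
  adj :: "'a \<Rightarrow> 'a"

record 'a normed_star_algebra = "'a star_algebra" +
  nrm :: "'a \<Rightarrow> real"

definition cstar_seminorm :: "('a, 'x) star_algebra_scheme \<Rightarrow> ('a \<Rightarrow> real) \<Rightarrow> bool" where
  "cstar_seminorm A p \<longleftrightarrow>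
     (\<forall>x\<in>carrier A. 0 \<le> p x) \<and>
     (\<forall>c. \<forall>x\<in>carrier A. p (c \<odot>\<^bsub>A\<^esub> x) = cmod c * p x) \<and>
     (\<forall>x\<in>carrier A. \<forall>y\<in>carrier A. p (x \<oplus>\<^bsub>A\<^esub> y) \<le> p x + p y) \<and>
     (\<forall>x\<in>carrier A. \<forall>y\<in>carrier A. p (x \<otimes>\<^bsub>A\<^esub> y) \<le> p x * p y) \<and>
     (\<forall>x\<in>carrier A. p (adj A x \<otimes>\<^bsub>A\<^esub> x) = (p x)\<^sup>2)"

text \<open>
  The largest C*-seminorm in which all elements of \<open>R\<close> vanish. For a C*-seminorm \<open>p\<close>, the
  completion of the quotient by the kernel of \<open>p\<close> is a C*-algebra, and every *-homomorphism into
  a C*-algebra gives a C*-seminorm; so this is the supremum of \<open>\<parallel>\<pi>(x)\<parallel>\<close> over all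
  representations \<open>\<pi>\<close> of \<open>A\<close> that respect the relations \<open>r = 0\<close> for \<open>r \<in> R\<close>. The family is
  never empty (it contains \<open>0\<close>), and it is pointwise bounded on the carrier in both uses below:
  there the generators are isometries, or elements of given C*-algebras, on whose embedded
  copies every C*-seminorm is at most the norm.
\<close>

definition universal_seminorm ::
    "('a, 'x) star_algebra_scheme \<Rightarrow> 'a set \<Rightarrow> 'a \<Rightarrow> real" where
  "universal_seminorm A R x = (SUP p\<in>{p. cstar_seminorm A p \<and> (\<forall>r\<in>R. p r = 0)}. p x)"

text \<open>
  Hausdorff completion of a *-algebra \<open>A\<close> in a seminorm \<open>N\<close>: Cauchy sequences in \<open>A\<close> modulo
  sequences converging to zero.
\<close>

definition cauchy_seqs :: "('a, 'x) star_algebra_scheme \<Rightarrow> ('a \<Rightarrow> real) \<Rightarrow> (nat \<Rightarrow> 'a) set" where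
  "cauchy_seqs A N =
     {X. (\<forall>k. X k \<in> carrier A) \<and>
         (\<forall>e>0. \<exists>M. \<forall>j\<ge>M. \<forall>k\<ge>M. N (X j \<ominus>\<^bsub>A\<^esub> X k) < e)}"

definition null_rel :: "('a, 'x) star_algebra_scheme \<Rightarrow> ('a \<Rightarrow> real) \<Rightarrow> (nat \<Rightarrow> 'a) rel" where
  "null_rel A N =
     {(X, Y). X \<in> cauchy_seqs A N \<and> Y \<in> cauchy_seqs A N \<and>
              (\<lambda>k. N (X k \<ominus>\<^bsub>A\<^esub> Y k)) \<longlonglongrightarrow> 0}"

definition rep :: "(nat \<Rightarrow> 'a) set \<Rightarrow> nat \<Rightarrow> 'a" where
  "rep C = (SOME X. X \<in> C)"

definition embed ::
    "('a, 'x) star_algebra_scheme \<Rightarrow> ('a \<Rightarrow> real) \<Rightarrow> 'a \<Rightarrow> (nat \<Rightarrow> 'a) set" where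
  "embed A N x = null_rel A N `` {\<lambda>_. x}"

definition completion ::
    "('a, 'x) star_algebra_scheme \<Rightarrow> ('a \<Rightarrow> real) \<Rightarrow> (nat \<Rightarrow> 'a) set normed_star_algebra" where
  "completion A N =
     \<lparr>carrier = cauchy_seqs A N // null_rel A N,
      mult = (\<lambda>C D. null_rel A N `` {\<lambda>k. rep C k \<otimes>\<^bsub>A\<^esub> rep D k}),
      one = embed A N \<one>\<^bsub>A\<^esub>,
      zero = embed A N \<zero>\<^bsub>A\<^esub>,
      add = (\<lambda>C D. null_rel A N `` {\<lambda>k. rep C k \<oplus>\<^bsub>A\<^esub> rep D k}),
      smult = (\<lambda>c C. null_rel A N `` {\<lambda>k. c \<odot>\<^bsub>A\<^esub> rep C k}),
      adj = (\<lambda>C. null_rel A N `` {\<lambda>k. adj A (rep C k)}),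
      nrm = (\<lambda>C. lim (\<lambda>k. N (rep C k)))\<rparr>"

text \<open>
  The complex *-algebra of a monoid with involution: finitely supported functions on the monoid
  with convolution as product. It yields both the free *-algebra (from words) and, modulo
  bilinearity, algebraic tensor products (from pairs).
\<close>

record 'm star_monoid = "'m monoid" +
  invol :: "'m \<Rightarrow> 'm"

definition delta :: "'m \<Rightarrow> 'm \<Rightarrow> complex" where
  "delta a = (\<lambda>m. if m = a then 1 else 0)"

definition monoid_algebra :: "('m, 'x) star_monoid_scheme \<Rightarrow> ('m \<Rightarrow> complex) star_algebra" where
  "monoid_algebra M =
     \<lparr>carrier = {f. finite {a. f a \<noteq> 0} \<and> {a. f a \<noteq> 0} \<subseteq> carrier M},
      mult = (\<lambda>f g m. \<Sum>(a, b)\<in>{(a, b). f a \<noteq> 0 \<and> g b \<noteq> 0 \<and> a \<otimes>\<^bsub>M\<^esub> b = m}. f a * g b),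
      one = delta \<one>\<^bsub>M\<^esub>,
      zero = (\<lambda>m. 0),
      add = (\<lambda>f g m. f m + g m),
      smult = (\<lambda>c f m. c * f m),
      adj = (\<lambda>f m. \<Sum>a\<in>{a. f a \<noteq> 0 \<and> invol M a = m}. cnj (f a))\<rparr>"

definition universal_cstar ::
    "('m, 'x) star_monoid_scheme \<Rightarrow> ('m \<Rightarrow> complex) set \<Rightarrow>
      (nat \<Rightarrow> 'm \<Rightarrow> complex) set normed_star_algebra" where
  "universal_cstar M R = completion (monoid_algebra M) (universal_seminorm (monoid_algebra M) R)"

definition universal_gen ::
    "('m, 'x) star_monoid_scheme \<Rightarrow> ('m \<Rightarrow> complex) set \<Rightarrow> 'm \<Rightarrow> (nat \<Rightarrow> 'm \<Rightarrow> complex) set" where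
  "universal_gen M R a =
     embed (monoid_algebra M) (universal_seminorm (monoid_algebra M) R) (delta a)"


section \<open>Cuntz algebras\<close>

text \<open>\<open>Gen i\<close> and \<open>Gen_adj i\<close> stand for the generator \<open>s\<^sub>i\<close> and its adjoint.\<close>

datatype letter = Gen nat | Gen_adj nat

fun letter_adj :: "letter \<Rightarrow> letter" where
  "letter_adj (Gen i) = Gen_adj i"
| "letter_adj (Gen_adj i) = Gen i"

definition word_monoid :: "nat \<Rightarrow> letter list star_monoid" where
  "word_monoid n =
     \<lparr>carrier = lists (Gen ` {1..n} \<union> Gen_adj ` {1..n}),
      mult = (@),
      one = [],
      invol = (\<lambda>w. rev (map letter_adj w))\<rparr>"

definition cuntz_relations :: "nat \<Rightarrow> (letter list \<Rightarrow> complex) set" where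
  "cuntz_relations n =
     {(\<lambda>w. delta [Gen_adj i, Gen j] w - (if i = j then delta [] w else 0)) | i j.
         i \<in> {1..n} \<and> j \<in> {1..n}}
     \<union> {\<lambda>w. (\<Sum>i\<in>{1..n}. delta [Gen i, Gen_adj i] w) - delta [] w}"

type_synonym cuntz_elem = "(nat \<Rightarrow> letter list \<Rightarrow> complex) set"

definition cuntz :: "nat \<Rightarrow> cuntz_elem normed_star_algebra" where
  "cuntz n = universal_cstar (word_monoid n) (cuntz_relations n)"

definition cuntz_gen :: "nat \<Rightarrow> nat \<Rightarrow> cuntz_elem" where
  "cuntz_gen n i = universal_gen (word_monoid n) (cuntz_relations n) [Gen i]"

definition cuntz_word :: "nat \<Rightarrow> nat list \<Rightarrow> cuntz_elem" where
  "cuntz_word n J = foldr (\<lambda>j x. cuntz_gen n j \<otimes>\<^bsub>cuntz n\<^esub> x) J \<one>\<^bsub>cuntz n\<^esub>"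


section \<open>States and *-homomorphisms\<close>

text \<open>
  A state is a positive linear functional of norm one; for a positive functional the latter means
  that it is bounded by the norm and takes the value 1 at the unit. Functionals and homomorphisms
  are extensional, so that equality of functions is equality on the algebra.
\<close>

definition state :: "('a, 'x) normed_star_algebra_scheme \<Rightarrow> ('a \<Rightarrow> complex) \<Rightarrow> bool" where
  "state A \<omega> \<longleftrightarrow>
     \<omega> \<in> extensional (carrier A) \<and>
     (\<forall>x\<in>carrier A. \<forall>y\<in>carrier A. \<omega> (x \<oplus>\<^bsub>A\<^esub> y) = \<omega> x + \<omega> y) \<and>
     (\<forall>c. \<forall>x\<in>carrier A. \<omega> (c \<odot>\<^bsub>A\<^esub> x) = c * \<omega> x) \<and>
     (\<forall>x\<in>carrier A. \<omega> (adj A x \<otimes>\<^bsub>A\<^esub> x) \<in> \<real>\<^sub>\<ge>\<^sub>0) \<and>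
     (\<forall>x\<in>carrier A. cmod (\<omega> x) \<le> nrm A x) \<and>
     \<omega> \<one>\<^bsub>A\<^esub> = 1"

definition pure_state :: "('a, 'x) normed_star_algebra_scheme \<Rightarrow> ('a \<Rightarrow> complex) \<Rightarrow> bool" where
  "pure_state A \<omega> \<longleftrightarrow>
     state A \<omega> \<and>
     (\<forall>\<omega>1 \<omega>2. \<forall>t::real. state A \<omega>1 \<and> state A \<omega>2 \<and> 0 < t \<and> t < 1 \<and>
        (\<forall>x\<in>carrier A. \<omega> x = of_real t * \<omega>1 x + of_real (1 - t) * \<omega>2 x) \<longrightarrow>
        \<omega>1 = \<omega> \<and> \<omega>2 = \<omega>)"

text \<open>Between C*-algebras the norm condition holds automatically.\<close>

definition unital_star_hom ::
    "('a, 'x) normed_star_algebra_scheme \<Rightarrow> ('b, 'y) normed_star_algebra_scheme \<Rightarrow>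
      ('a \<Rightarrow> 'b) \<Rightarrow> bool" where
  "unital_star_hom A B f \<longleftrightarrow>
     f \<in> carrier A \<rightarrow>\<^sub>E carrier B \<and>
     (\<forall>x\<in>carrier A. \<forall>y\<in>carrier A. f (x \<oplus>\<^bsub>A\<^esub> y) = f x \<oplus>\<^bsub>B\<^esub> f y) \<and>
     (\<forall>c. \<forall>x\<in>carrier A. f (c \<odot>\<^bsub>A\<^esub> x) = c \<odot>\<^bsub>B\<^esub> f x) \<and>
     (\<forall>x\<in>carrier A. \<forall>y\<in>carrier A. f (x \<otimes>\<^bsub>A\<^esub> y) = f x \<otimes>\<^bsub>B\<^esub> f y) \<and>
     (\<forall>x\<in>carrier A. f (adj A x) = adj B (f x)) \<and>
     f \<one>\<^bsub>A\<^esub> = \<one>\<^bsub>B\<^esub> \<and>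
     (\<forall>x\<in>carrier A. nrm B (f x) \<le> nrm A x)"


section \<open>Tensor products\<close>

text \<open>
  The algebraic tensor product of \<open>A\<close> and \<open>B\<close> is the free vector space on pairs modulo
  bilinearity; it is completed in its largest C*-norm. Cuntz algebras are nuclear, so for them
  there is only one C*-norm to choose.
\<close>

definition pair_monoid ::
    "('a, 'x) normed_star_algebra_scheme \<Rightarrow> ('b, 'y) normed_star_algebra_scheme \<Rightarrow>
      ('a \<times> 'b) star_monoid" where
  "pair_monoid A B =
     \<lparr>carrier = carrier A \<times> carrier B,
      mult = (\<lambda>(a, b) (a', b'). (a \<otimes>\<^bsub>A\<^esub> a', b \<otimes>\<^bsub>B\<^esub> b')),
      one = (\<one>\<^bsub>A\<^esub>, \<one>\<^bsub>B\<^esub>),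
      invol = (\<lambda>(a, b). (adj A a, adj B b))\<rparr>"

definition bilinear_relations ::
    "('a, 'x) normed_star_algebra_scheme \<Rightarrow> ('b, 'y) normed_star_algebra_scheme \<Rightarrow>
      ('a \<times> 'b \<Rightarrow> complex) set" where
  "bilinear_relations A B =
     {(\<lambda>m. delta (a \<oplus>\<^bsub>A\<^esub> a', b) m - delta (a, b) m - delta (a', b) m) | a a' b.
         a \<in> carrier A \<and> a' \<in> carrier A \<and> b \<in> carrier B} \<union>
     {(\<lambda>m. delta (a, b \<oplus>\<^bsub>B\<^esub> b') m - delta (a, b) m - delta (a, b') m) | a b b'.
         a \<in> carrier A \<and> b \<in> carrier B \<and> b' \<in> carrier B} \<union>
     {(\<lambda>m. delta (c \<odot>\<^bsub>A\<^esub> a, b) m - c * delta (a, b) m) | c a b.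
         a \<in> carrier A \<and> b \<in> carrier B} \<union>
     {(\<lambda>m. delta (a, c \<odot>\<^bsub>B\<^esub> b) m - c * delta (a, b) m) | c a b.
         a \<in> carrier A \<and> b \<in> carrier B}"

definition cstar_tensor ::
    "('a, 'x) normed_star_algebra_scheme \<Rightarrow> ('b, 'y) normed_star_algebra_scheme \<Rightarrow>
      (nat \<Rightarrow> 'a \<times> 'b \<Rightarrow> complex) set normed_star_algebra" where
  "cstar_tensor A B = universal_cstar (pair_monoid A B) (bilinear_relations A B)"

definition elem_tensor ::
    "('a, 'x) normed_star_algebra_scheme \<Rightarrow> ('b, 'y) normed_star_algebra_scheme \<Rightarrow>
      'a \<Rightarrow> 'b \<Rightarrow> (nat \<Rightarrow> 'a \<times> 'b \<Rightarrow> complex) set" where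
  "elem_tensor A B a b = universal_gen (pair_monoid A B) (bilinear_relations A B) (a, b)"

definition product_state ::
    "('a, 'x) normed_star_algebra_scheme \<Rightarrow> ('b, 'y) normed_star_algebra_scheme \<Rightarrow>
      ('a \<Rightarrow> complex) \<Rightarrow> ('b \<Rightarrow> complex) \<Rightarrow> (nat \<Rightarrow> 'a \<times> 'b \<Rightarrow> complex) set \<Rightarrow> complex" where
  "product_state A B \<omega>1 \<omega>2 =
     (THE \<omega>. state (cstar_tensor A B) \<omega> \<and>
        (\<forall>a\<in>carrier A. \<forall>b\<in>carrier B. \<omega> (elem_tensor A B a b) = \<omega>1 a * \<omega>2 b))"

text \<open>
  The embedding \<open>\<phi>\<^bsub>n,n'\<^esub>\<close>. Its values on the generators determine it among all unital
  *-homomorphisms; it is injective because \<open>\<O>\<^bsub>nn'\<^esub>\<close> is simple.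
\<close>

definition cuntz_embedding ::
    "nat \<Rightarrow> nat \<Rightarrow> cuntz_elem \<Rightarrow> (nat \<Rightarrow> cuntz_elem \<times> cuntz_elem \<Rightarrow> complex) set" where
  "cuntz_embedding n n' =
     (THE f. unital_star_hom (cuntz (n * n')) (cstar_tensor (cuntz n) (cuntz n')) f \<and>
        (\<forall>i\<in>{1..n}. \<forall>j\<in>{1..n'}.
           f (cuntz_gen (n * n') (n' * (i - 1) + j)) =
             elem_tensor (cuntz n) (cuntz n') (cuntz_gen n i) (cuntz_gen n' j)))"

text \<open>The disjoint union over \<open>n\<close> consists of pairs \<open>(n, \<omega>)\<close>.\<close>

fun state_prod ::
    "nat \<times> (cuntz_elem \<Rightarrow> complex) \<Rightarrow> nat \<times> (cuntz_elem \<Rightarrow> complex) \<Rightarrow>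
      nat \<times> (cuntz_elem \<Rightarrow> complex)" where
  "state_prod (n, \<omega>1) (n', \<omega>2) =
     (n * n',
      compose (carrier (cuntz (n * n')))
        (product_state (cuntz n) (cuntz n') \<omega>1 \<omega>2) (cuntz_embedding n n'))"


section \<open>Vectors\<close>

definition words :: "nat \<Rightarrow> nat \<Rightarrow> nat list set" where
  "words n m = {J. length J = m \<and> set J \<subseteq> {1..n}}"

text \<open>
  Elements of \<open>\<V>\<^bsub>n,m\<^esub>\<close> are coordinate functions vanishing off \<open>{1,\<dots>,n}\<^sup>m\<close>. The degree \<open>m\<close>
  is carried along explicitly.
\<close>

definition vectors :: "nat \<Rightarrow> nat \<Rightarrow> (nat list \<Rightarrow> complex) set" where
  "vectors n m = {z. \<forall>J. J \<notin> words n m \<longrightarrow> z J = 0}"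

definition unit_vectors :: "nat \<Rightarrow> nat \<Rightarrow> (nat list \<Rightarrow> complex) set" where
  "unit_vectors n m = {z \<in> vectors n m. (\<Sum>J\<in>words n m. (cmod (z J))\<^sup>2) = 1}"

text \<open>For \<open>x\<close> of degree \<open>k\<close>, the tensor power of degree \<open>p * k\<close>; off the words of this length it
  vanishes because \<open>x\<close> vanishes off words of length \<open>k\<close>.\<close>

fun tensor_power :: "nat \<Rightarrow> (nat list \<Rightarrow> complex) \<Rightarrow> nat \<Rightarrow> nat list \<Rightarrow> complex" where
  "tensor_power k x 0 J = (if J = [] then 1 else 0)"
| "tensor_power k x (Suc p) J = x (take k J) * tensor_power k x p (drop k J)"

definition nonperiodic :: "nat \<Rightarrow> nat \<Rightarrow> (nat list \<Rightarrow> complex) \<Rightarrow> bool" where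
  "nonperiodic n m z \<longleftrightarrow>
     (\<forall>p\<ge>1. \<forall>k\<ge>1. \<forall>x\<in>vectors n k. m = p * k \<and> z = tensor_power k x p \<longrightarrow> p = 1)"

definition boxtimes_word :: "nat \<Rightarrow> nat list \<Rightarrow> nat list \<Rightarrow> nat list" where
  "boxtimes_word n' J K = map2 (\<lambda>j k. n' * (j - 1) + k) J K"

text \<open>As \<open>(J, K) \<mapsto> J \<boxtimes> K\<close> is a bijection, the sum has exactly one term if \<open>L\<close> is a word of
  length \<open>m\<close> over \<open>{1,\<dots>,nn'}\<close>, and none otherwise.\<close>

definition boxtimes ::
    "nat \<Rightarrow> nat \<Rightarrow> nat \<Rightarrow> (nat list \<Rightarrow> complex) \<Rightarrow> (nat list \<Rightarrow> complex) \<Rightarrow> nat list \<Rightarrow> complex" where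
  "boxtimes n n' m z y L =
     (\<Sum>(J, K)\<in>{(J, K). J \<in> words n m \<and> K \<in> words n' m \<and> boxtimes_word n' J K = L}. z J * y K)"

type_synonym graded_vector = "nat \<times> nat \<times> (nat list \<Rightarrow> complex)"

fun vector_prod :: "graded_vector \<Rightarrow> graded_vector \<Rightarrow> graded_vector" where
  "vector_prod (n, m, z) (n', l, y) =
     (n * n', lcm m l,
      boxtimes n n' (lcm m l)
        (tensor_power m z (lcm m l div m)) (tensor_power l y (lcm m l div l)))"

definition nonperiodic_vectors :: "nat \<Rightarrow> (nat \<times> (nat list \<Rightarrow> complex)) set" where
  "nonperiodic_vectors n = {(m, z). 1 \<le> m \<and> z \<in> unit_vectors n m \<and> nonperiodic n m z}"

definition nonperiodic_all :: "graded_vector set" where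
  "nonperiodic_all = Sigma {2..} nonperiodic_vectors"


section \<open>Sub-Cuntz states\<close>

definition is_sub_cuntz_state ::
    "nat \<Rightarrow> nat \<Rightarrow> (nat list \<Rightarrow> complex) \<Rightarrow> (cuntz_elem \<Rightarrow> complex) \<Rightarrow> bool" where
  "is_sub_cuntz_state n m z \<omega> \<longleftrightarrow>
     state (cuntz n) \<omega> \<and> (\<forall>J\<in>words n m. \<omega> (cuntz_word n J) = cnj (z J))"

text \<open>The state \<open>\<omega>\<close> attached to a nonperiodic unit vector, that is, the map \<open>q\<close>.\<close>

definition sub_cuntz_state ::
    "nat \<Rightarrow> nat \<times> (nat list \<Rightarrow> complex) \<Rightarrow> cuntz_elem \<Rightarrow> complex" where
  "sub_cuntz_state n = (\<lambda>(m, z). THE \<omega>. is_sub_cuntz_state n m z \<omega>)"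

definition pure_sub_cuntz_states :: "nat \<Rightarrow> (cuntz_elem \<Rightarrow> complex) set" where
  "pure_sub_cuntz_states n =
     {\<omega>. pure_state (cuntz n) \<omega> \<and>
         (\<exists>m\<ge>1. \<exists>z\<in>unit_vectors n m. is_sub_cuntz_state n m z \<omega>)}"

definition pure_sub_cuntz_all :: "(nat \<times> (cuntz_elem \<Rightarrow> complex)) set" where
  "pure_sub_cuntz_all = Sigma {2..} pure_sub_cuntz_states"


section \<open>Semigroups\<close>

definition semigroup_on :: "'a set \<Rightarrow> ('a \<Rightarrow> 'a \<Rightarrow> 'a) \<Rightarrow> bool" where
  "semigroup_on A f \<longleftrightarrow>
     (\<forall>x\<in>A. \<forall>y\<in>A. f x y \<in> A) \<and>
     (\<forall>x\<in>A. \<forall>y\<in>A. \<forall>z\<in>A. f (f x y) z = f x (f y z))"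

definition semigroup_iso ::
    "'a set \<Rightarrow> ('a \<Rightarrow> 'a \<Rightarrow> 'a) \<Rightarrow> 'b set \<Rightarrow> ('b \<Rightarrow> 'b \<Rightarrow> 'b) \<Rightarrow> ('a \<Rightarrow> 'b) \<Rightarrow> bool" where
  "semigroup_iso A f B g h \<longleftrightarrow>
     bij_betw h A B \<and> (\<forall>x\<in>A. \<forall>y\<in>A. h (f x y) = g (h x) (h y))"

end

theory Submission
  imports Defs
begin

text \<open>
  By the GNS construction, a state of \<open>O\<^sub>n\<close> is the same thing as a positive functional on words in
  the generators and their adjoints that respects the Cuntz relations. For a sub-Cuntz state by
  \<open>z\<close>, the isometry \<open>s(z)\<close> fixes the cyclic vector \<open>\<Omega>\<close>, so the state is determined by the coordinates
  \<open>w\<close> of \<open>\<Omega>\<close> along words of each fixed length. The vector \<open>z \<otimes> w\<close> then equals \<open>w \<otimes> z\<close> by equality in the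
  Cauchy-Schwarz inequality, and commuting tensors are powers of a common root up to scalars.
  For nonperiodic \<open>z\<close> this leaves only the powers of \<open>z\<close>, which gives uniqueness, purity and
  injectivity of \<open>q\<close>. If a pure state is sub-Cuntz by \<open>x\<^sup>p\<close> with \<open>x\<close> nonperiodic, conjugating
  it by \<open>2 + c s(x)\<close> with \<open>|c| = 1\<close> shows that \<open>\<Omega>\<close> is an eigenvector of \<open>s(x)\<close>, so the state is
  already sub-Cuntz by a multiple of \<open>x\<close>; hence \<open>q\<close> is onto.

  A product of positive functionals is positive by Schur's product theorem, and evaluating it on
  words shows that \<open>q(z) \<otimes> q(y)\<close> is sub-Cuntz by \<open>z * y\<close>. Slicing a root of \<open>z * y\<close> in one of
  the two factors shows that \<open>z * y\<close> is again nonperiodic.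
\<close>

section \<open>*-algebras and monoid algebras\<close>

text \<open>No Hilbert space is built: the vectors of the GNS picture are the elements of the
  algebra, which acts on itself from the left, with the degenerate inner product F(x^* y). The price
  is that left multiplication has to be shown bounded for each functional. Once it is, its operator
  norm is a C*-seminorm, hence a competitor in the supremum defining the universal seminorm, and the
  functional extends to a state. For the Cuntz relations boundedness is a computation with letters.
  For tensor products it is a comparison of positive forms, and there even the finiteness of the
  universal seminorm rests on the fact that no C*-seminorm on a complete C*-algebra exceeds the
  norm. In the surjectivity of q, conjugation by s(x) alone reproduces the state, because s(x) is an
  isometry and the moments <Omega, s(x)^b Omega> determine the state. Hence the conjugates by 2 + c
  s(x) and 2 - c s(x) add up to a multiple of it. The constant 2 keeps both from annihilating Omega,
  as s(x) Omega has norm 1.\<close>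

locale star_alg = ring A for A :: "('a, 'x) star_algebra_scheme" (structure) +
  assumes smult_closed [simp, intro]: "x \<in> carrier A \<Longrightarrow> c \<odot> x \<in> carrier A"
    and smult_r_distr: "\<lbrakk>x \<in> carrier A; y \<in> carrier A\<rbrakk> \<Longrightarrow> c \<odot> (x \<oplus> y) = c \<odot> x \<oplus> c \<odot> y"
    and smult_l_distr: "x \<in> carrier A \<Longrightarrow> (c + d) \<odot> x = c \<odot> x \<oplus> d \<odot> x"
    and smult_smult: "x \<in> carrier A \<Longrightarrow> c \<odot> (d \<odot> x) = (c * d) \<odot> x"
    and smult_one [simp]: "x \<in> carrier A \<Longrightarrow> 1 \<odot> x = x"
    and smult_mult_l: "\<lbrakk>x \<in> carrier A; y \<in> carrier A\<rbrakk> \<Longrightarrow> (c \<odot> x) \<otimes> y = c \<odot> (x \<otimes> y)"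
    and smult_mult_r: "\<lbrakk>x \<in> carrier A; y \<in> carrier A\<rbrakk> \<Longrightarrow> x \<otimes> (c \<odot> y) = c \<odot> (x \<otimes> y)"
    and adj_closed [simp, intro]: "x \<in> carrier A \<Longrightarrow> adj A x \<in> carrier A"
    and adj_adj [simp]: "x \<in> carrier A \<Longrightarrow> adj A (adj A x) = x"
    and adj_add: "\<lbrakk>x \<in> carrier A; y \<in> carrier A\<rbrakk> \<Longrightarrow> adj A (x \<oplus> y) = adj A x \<oplus> adj A y"
    and adj_smult: "x \<in> carrier A \<Longrightarrow> adj A (c \<odot> x) = cnj c \<odot> adj A x"
    and adj_mult: "\<lbrakk>x \<in> carrier A; y \<in> carrier A\<rbrakk> \<Longrightarrow> adj A (x \<otimes> y) = adj A y \<otimes> adj A x"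
begin

lemma smult_zero_l [simp]: "x \<in> carrier A \<Longrightarrow> 0 \<odot> x = \<zero>"
  using add.l_cancel_one[of "0 \<odot> x" "0 \<odot> x"] by (simp flip: smult_l_distr)

lemma smult_zero_r [simp]: "c \<odot> \<zero> = \<zero>"
  using smult_smult[of \<zero> c 0] by simp

lemma a_inv_smult: "x \<in> carrier A \<Longrightarrow> \<ominus> x = (-1) \<odot> x"
  using smult_l_distr[of x "-1" 1] by (intro minus_equality) auto

lemma minus_smult: "\<lbrakk>x \<in> carrier A; y \<in> carrier A\<rbrakk> \<Longrightarrow> x \<ominus> y = x \<oplus> (-1) \<odot> y"
  by (simp add: a_inv_smult minus_eq)

lemma adj_one [simp]: "adj A \<one> = \<one>"
  using adj_mult[of "adj A \<one>" \<one>] by simp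

lemma adj_zero [simp]: "adj A \<zero> = \<zero>"
  using adj_smult[of \<zero> 0] by simp

lemma adj_minus: "\<lbrakk>x \<in> carrier A; y \<in> carrier A\<rbrakk> \<Longrightarrow> adj A (x \<ominus> y) = adj A x \<ominus> adj A y"
  by (simp add: minus_smult adj_add adj_smult)

lemma smult_minus: "\<lbrakk>x \<in> carrier A; y \<in> carrier A\<rbrakk> \<Longrightarrow> c \<odot> (x \<ominus> y) = c \<odot> x \<ominus> c \<odot> y"
  by (simp add: minus_smult smult_r_distr smult_smult mult.commute)

lemma mult_minus_r:
  "\<lbrakk>x \<in> carrier A; y \<in> carrier A; z \<in> carrier A\<rbrakk> \<Longrightarrow> x \<otimes> (y \<ominus> z) = x \<otimes> y \<ominus> x \<otimes> z"
  by (simp add: minus_smult r_distr smult_mult_r)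

lemma mult_minus_l:
  "\<lbrakk>x \<in> carrier A; y \<in> carrier A; z \<in> carrier A\<rbrakk> \<Longrightarrow> (y \<ominus> z) \<otimes> x = y \<otimes> x \<ominus> z \<otimes> x"
  by (simp add: minus_smult l_distr smult_mult_l)

lemma add_minus_add:
  "\<lbrakk>x \<in> carrier A; y \<in> carrier A; x' \<in> carrier A; y' \<in> carrier A\<rbrakk> \<Longrightarrow>
    (x \<oplus> y) \<ominus> (x' \<oplus> y') = (x \<ominus> x') \<oplus> (y \<ominus> y')"
  by (simp add: minus_eq minus_add a_ac)

lemma minus_minus_split:
  "\<lbrakk>x \<in> carrier A; y \<in> carrier A; z \<in> carrier A\<rbrakk> \<Longrightarrow> x \<ominus> z = (x \<ominus> y) \<oplus> (y \<ominus> z)"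
  by (simp add: ring_simprules)

lemma mult_minus_mult:
  "\<lbrakk>x \<in> carrier A; y \<in> carrier A; x' \<in> carrier A; y' \<in> carrier A\<rbrakk> \<Longrightarrow>
    x \<otimes> y \<ominus> x' \<otimes> y' = x \<otimes> (y \<ominus> y') \<oplus> (x \<ominus> x') \<otimes> y'"
  using minus_minus_split[of "x \<otimes> y" "x \<otimes> y'" "x' \<otimes> y'"] by (simp add: mult_minus_r mult_minus_l)

end

section \<open>Monoids with involution and their convolution algebras\<close>

locale star_mon = monoid M for M :: "('m, 'x) star_monoid_scheme" (structure) +
  assumes invol_closed [simp, intro]: "a \<in> carrier M \<Longrightarrow> invol M a \<in> carrier M"
    and invol_invol [simp]: "a \<in> carrier M \<Longrightarrow> invol M (invol M a) = a"
    and invol_mult: "\<lbrakk>a \<in> carrier M; b \<in> carrier M\<rbrakk> \<Longrightarrow> invol M (a \<otimes> b) = invol M b \<otimes> invol M a"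

text \<open>Functionals on a monoid algebra are handled through this linear extension: only their
  values on the monoid are stored.\<close>

definition lin :: "('m \<Rightarrow> complex) \<Rightarrow> ('m \<Rightarrow> complex) \<Rightarrow> complex" where
  "lin \<phi> f = (\<Sum>a | f a \<noteq> 0. f a * \<phi> a)"

lemma lin_superset: "\<lbrakk>finite S; {a. f a \<noteq> 0} \<subseteq> S\<rbrakk> \<Longrightarrow> lin \<phi> f = (\<Sum>a\<in>S. f a * \<phi> a)"
  unfolding lin_def by (rule sum.mono_neutral_left) auto

lemma lin_zero [simp]: "lin \<phi> (\<lambda>m. 0) = 0"
  by (simp add: lin_def)

lemma finite_support_add:
  "\<lbrakk>finite {a. f a \<noteq> 0}; finite {a. g a \<noteq> 0}\<rbrakk> \<Longrightarrow> finite {a. f a + g a \<noteq> (0::complex)}"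
  by (rule finite_subset[of _ "{a. f a \<noteq> 0} \<union> {a. g a \<noteq> 0}"]) auto

lemma lin_add:
  assumes "finite {a. f a \<noteq> 0}" "finite {a. g a \<noteq> 0}"
  shows "lin \<phi> (\<lambda>m. f m + g m) = lin \<phi> f + lin \<phi> g"
proof -
  let ?S = "{a. f a \<noteq> 0} \<union> {a. g a \<noteq> 0}"
  have "lin \<phi> (\<lambda>m. f m + g m) = (\<Sum>a\<in>?S. (f a + g a) * \<phi> a)"
       "lin \<phi> f = (\<Sum>a\<in>?S. f a * \<phi> a)" "lin \<phi> g = (\<Sum>a\<in>?S. g a * \<phi> a)"
    using assms by (auto intro!: lin_superset)
  then show ?thesis by (simp add: sum.distrib distrib_right)
qed

lemma lin_smult: "lin \<phi> (\<lambda>m. c * f m) = c * lin \<phi> f"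
  by (cases "c = 0") (simp_all add: lin_def sum_distrib_left mult.assoc)

lemma lin_diff:
  assumes "finite {a. f a \<noteq> 0}" "finite {a. g a \<noteq> 0}"
  shows "lin \<phi> (\<lambda>m. f m - g m) = lin \<phi> f - lin \<phi> g"
  using lin_add[of f "\<lambda>m. (-1) * g m" \<phi>] lin_smult[of \<phi> "-1" g] assms by simp

lemma support_delta: "{x. delta a x \<noteq> 0} = {a}"
  by (auto simp: delta_def)

lemma lin_delta [simp]: "lin \<phi> (delta a) = \<phi> a"
  by (simp add: lin_def support_delta) (simp add: delta_def)

lemma lin_sum:
  assumes "finite I" "\<And>i. i \<in> I \<Longrightarrow> finite {a. f i a \<noteq> 0}"
  shows "finite {a. (\<Sum>i\<in>I. f i a) \<noteq> 0}" "lin \<phi> (\<lambda>m. \<Sum>i\<in>I. f i m) = (\<Sum>i\<in>I. lin \<phi> (f i))"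
proof -
  have "finite {a. (\<Sum>i\<in>I. f i a) \<noteq> 0} \<and> lin \<phi> (\<lambda>m. \<Sum>i\<in>I. f i m) = (\<Sum>i\<in>I. lin \<phi> (f i))"
    using assms by (induction I rule: finite_induct) (auto simp: lin_add finite_support_add)
  then show "finite {a. (\<Sum>i\<in>I. f i a) \<noteq> 0}" "lin \<phi> (\<lambda>m. \<Sum>i\<in>I. f i m) = (\<Sum>i\<in>I. lin \<phi> (f i))"
    by auto
qed

lemma lin_cong: "(\<And>a. f a \<noteq> 0 \<Longrightarrow> \<phi> a = \<psi> a) \<Longrightarrow> lin \<phi> f = lin \<psi> f"
  by (simp add: lin_def)

lemma lin_fun_add: "lin (\<lambda>a. \<phi> a + \<psi> a) f = lin \<phi> f + lin \<psi> f"
  by (simp add: lin_def sum.distrib distrib_left)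

lemma lin_fun_smult: "lin (\<lambda>a. c * \<phi> a) f = c * lin \<phi> f"
  by (simp add: lin_def sum_distrib_left mult.left_commute)

lemma lin_fun_sum: "lin (\<lambda>a. \<Sum>i\<in>I. \<phi> i a) f = (\<Sum>i\<in>I. lin (\<phi> i) f)"
  by (simp add: lin_def sum_distrib_left) (rule sum.swap)

lemma lin_swap: "lin (\<lambda>a. lin (\<lambda>b. \<phi> a b) g) f = lin (\<lambda>b. lin (\<lambda>a. \<phi> a b) f) g"
  by (simp add: lin_def sum_distrib_left mult.left_commute) (rule sum.swap)

lemma lin_eval: "finite {a. f a \<noteq> 0} \<Longrightarrow> lin (\<lambda>a. if a = m then 1 else 0) f = f m"
  by (simp add: lin_def if_distrib[of "\<lambda>x. _ * x"] cong: if_cong)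

text \<open>Indicator functions recover each value by \<open>lin_eval\<close>. Algebra laws can then
  be checked against an arbitrary \<open>\<phi>\<close>, where convolution and involution merely
  change the argument of \<open>\<phi>\<close>.\<close>

lemma lin_ext:
  assumes "finite {a. f a \<noteq> 0}" "finite {a. g a \<noteq> 0}" "\<And>\<phi>. lin \<phi> f = lin \<phi> g"
  shows "f = g"
  using assms(3)[of "\<lambda>a. if a = m then 1 else 0" for m] lin_eval[OF assms(1)] lin_eval[OF assms(2)] by auto

lemma monoid_algebra_simps [simp]:
  "carrier (monoid_algebra M) = {f. finite {a. f a \<noteq> 0} \<and> {a. f a \<noteq> 0} \<subseteq> carrier M}"
  "one (monoid_algebra M) = delta \<one>\<^bsub>M\<^esub>"
  "zero (monoid_algebra M) = (\<lambda>m. 0)"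
  "add (monoid_algebra M) = (\<lambda>f g m. f m + g m)"
  "smult (monoid_algebra M) = (\<lambda>c f m. c * f m)"
  by (simp_all add: monoid_algebra_def)

lemma mult_monoid_algebra:
  "f \<otimes>\<^bsub>monoid_algebra M\<^esub> g =
    (\<lambda>m. \<Sum>(a, b)\<in>{(a, b). f a \<noteq> 0 \<and> g b \<noteq> 0 \<and> a \<otimes>\<^bsub>M\<^esub> b = m}. f a * g b)"
  by (simp add: monoid_algebra_def)

lemma adj_monoid_algebra:
  "adj (monoid_algebra M) f = (\<lambda>m. \<Sum>a\<in>{a. f a \<noteq> 0 \<and> invol M a = m}. cnj (f a))"
  by (simp add: monoid_algebra_def)

text \<open>A convolution groups the pairs of support points by their product. Regrouping with
  \<open>sum.image_gen\<close> undoes this and leaves a plain double sum.\<close>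

lemma
  assumes "finite {a. f a \<noteq> 0}" "finite {a. g a \<noteq> 0}"
  shows support_mult: "{m. (f \<otimes>\<^bsub>monoid_algebra M\<^esub> g) m \<noteq> 0} \<subseteq>
      (\<lambda>(a, b). a \<otimes>\<^bsub>M\<^esub> b) ` ({a. f a \<noteq> 0} \<times> {a. g a \<noteq> 0})"
    and finite_support_mult: "finite {m. (f \<otimes>\<^bsub>monoid_algebra M\<^esub> g) m \<noteq> 0}"
    and lin_mult: "lin \<phi> (f \<otimes>\<^bsub>monoid_algebra M\<^esub> g) = lin (\<lambda>a. lin (\<lambda>b. \<phi> (a \<otimes>\<^bsub>M\<^esub> b)) g) f"
proof -
  let ?S = "{a. f a \<noteq> 0} \<times> {a. g a \<noteq> 0}" and ?m = "\<lambda>(a, b). a \<otimes>\<^bsub>M\<^esub> b"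
  have fin: "finite ?S" using assms by simp
  have conv: "(f \<otimes>\<^bsub>monoid_algebra M\<^esub> g) m = (\<Sum>(a, b)\<in>{x \<in> ?S. ?m x = m}. f a * g b)" for m
    unfolding mult_monoid_algebra by (rule sum.cong) auto
  show sub: "{m. (f \<otimes>\<^bsub>monoid_algebra M\<^esub> g) m \<noteq> 0} \<subseteq> ?m ` ?S"
  proof
    fix m assume m: "m \<in> {m. (f \<otimes>\<^bsub>monoid_algebra M\<^esub> g) m \<noteq> 0}"
    have "{x \<in> ?S. ?m x = m} \<noteq> {}"
    proof
      assume e: "{x \<in> ?S. ?m x = m} = {}"
      have "(f \<otimes>\<^bsub>monoid_algebra M\<^esub> g) m = 0" unfolding conv e by simp
      then show False using m by simp
    qed
    then show "m \<in> ?m ` ?S" by blast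
  qed
  then show "finite {m. (f \<otimes>\<^bsub>monoid_algebra M\<^esub> g) m \<noteq> 0}" using fin by (meson finite_imageI finite_subset)
  have "lin \<phi> (f \<otimes>\<^bsub>monoid_algebra M\<^esub> g) = (\<Sum>m\<in>?m ` ?S. (f \<otimes>\<^bsub>monoid_algebra M\<^esub> g) m * \<phi> m)"
    using sub fin by (intro lin_superset) auto
  also have "\<dots> = (\<Sum>m\<in>?m ` ?S. \<Sum>x\<in>{x \<in> ?S. ?m x = m}. f (fst x) * g (snd x) * \<phi> (?m x))"
    unfolding conv sum_distrib_right by (intro sum.cong) (auto simp: case_prod_beta)
  also have "\<dots> = (\<Sum>x\<in>?S. f (fst x) * g (snd x) * \<phi> (?m x))"
    by (rule sum.image_gen[OF fin, symmetric])
  also have "\<dots> = lin (\<lambda>a. lin (\<lambda>b. \<phi> (a \<otimes>\<^bsub>M\<^esub> b)) g) f"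
    by (simp add: lin_def sum_distrib_left sum.cartesian_product case_prod_beta mult.assoc)
  finally show "lin \<phi> (f \<otimes>\<^bsub>monoid_algebra M\<^esub> g) = lin (\<lambda>a. lin (\<lambda>b. \<phi> (a \<otimes>\<^bsub>M\<^esub> b)) g) f" .
qed

lemma
  assumes "finite {a. f a \<noteq> 0}"
  shows support_adj: "{m. adj (monoid_algebra M) f m \<noteq> 0} \<subseteq> invol M ` {a. f a \<noteq> 0}"
    and finite_support_adj: "finite {m. adj (monoid_algebra M) f m \<noteq> 0}"
    and lin_adj: "lin \<phi> (adj (monoid_algebra M) f) = cnj (lin (\<lambda>a. cnj (\<phi> (invol M a))) f)"
proof -
  let ?S = "{a. f a \<noteq> 0}"
  have conv: "adj (monoid_algebra M) f m = (\<Sum>a\<in>{x \<in> ?S. invol M x = m}. cnj (f a))" for m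
    unfolding adj_monoid_algebra by (rule sum.cong) auto
  show sub: "{m. adj (monoid_algebra M) f m \<noteq> 0} \<subseteq> invol M ` ?S"
  proof
    fix m assume m: "m \<in> {m. adj (monoid_algebra M) f m \<noteq> 0}"
    have "{x \<in> ?S. invol M x = m} \<noteq> {}"
    proof
      assume e: "{x \<in> ?S. invol M x = m} = {}"
      have "adj (monoid_algebra M) f m = 0" unfolding conv e by simp
      then show False using m by simp
    qed
    then show "m \<in> invol M ` ?S" by blast
  qed
  then show "finite {m. adj (monoid_algebra M) f m \<noteq> 0}" using assms by (meson finite_imageI finite_subset)
  have "lin \<phi> (adj (monoid_algebra M) f) = (\<Sum>m\<in>invol M ` ?S. adj (monoid_algebra M) f m * \<phi> m)"
    using sub assms by (intro lin_superset) auto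
  also have "\<dots> = (\<Sum>m\<in>invol M ` ?S. \<Sum>x\<in>{x \<in> ?S. invol M x = m}. cnj (f x) * \<phi> (invol M x))"
    unfolding conv sum_distrib_right by (intro sum.cong) auto
  also have "\<dots> = (\<Sum>x\<in>?S. cnj (f x) * \<phi> (invol M x))"
    by (rule sum.image_gen[OF assms, symmetric])
  also have "\<dots> = cnj (lin (\<lambda>a. cnj (\<phi> (invol M a))) f)"
    by (simp add: lin_def)
  finally show "lin \<phi> (adj (monoid_algebra M) f) = cnj (lin (\<lambda>a. cnj (\<phi> (invol M a))) f)" .
qed

lemma monoid_algebra_add_closed:
  assumes "f \<in> carrier (monoid_algebra M)" "g \<in> carrier (monoid_algebra M)"
  shows "(\<lambda>m. f m + g m) \<in> carrier (monoid_algebra M)"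
proof -
  have "{m. f m + g m \<noteq> 0} \<subseteq> {m. f m \<noteq> 0} \<union> {m. g m \<noteq> 0}" by auto
  also have "\<dots> \<subseteq> carrier M" using assms by simp
  finally show ?thesis using assms by (simp add: finite_support_add)
qed

text \<open>A finitely supported function is the sum of its values times point masses, so properties
  stable under sums can be proved without computing supports.\<close>

lemma monoid_algebra_induct [consumes 1, case_names zero add delta]:
  assumes f: "f \<in> carrier (monoid_algebra M)"
    and zero: "P (\<lambda>m. 0)"
    and add: "\<And>f g. \<lbrakk>f \<in> carrier (monoid_algebra M); g \<in> carrier (monoid_algebra M); P f; P g\<rbrakk> \<Longrightarrow> P (\<lambda>m. f m + g m)"
    and delta: "\<And>c a. a \<in> carrier M \<Longrightarrow> P (\<lambda>m. c * delta a m)"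
  shows "P f"
proof -
  have *: "P (\<lambda>m. \<Sum>a\<in>S. c a * delta a m) \<and> (\<lambda>m. \<Sum>a\<in>S. c a * delta a m) \<in> carrier (monoid_algebra M)"
    if "finite S" "S \<subseteq> carrier M" for S and c :: "'a \<Rightarrow> complex"
    using that
  proof (induction S rule: finite_induct)
    case (insert b S)
    have c: "(\<lambda>m. c b * delta b m) \<in> carrier (monoid_algebra M)"
      using insert.prems by (auto simp: delta_def)
    have ih: "P (\<lambda>m. \<Sum>a\<in>S. c a * delta a m)" "(\<lambda>m. \<Sum>a\<in>S. c a * delta a m) \<in> carrier (monoid_algebra M)"
      using insert by auto
    have "P (\<lambda>m. c b * delta b m + (\<Sum>a\<in>S. c a * delta a m))"
      using add[OF c ih(2) delta ih(1)] insert.prems by simp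
    moreover have "(\<lambda>m. c b * delta b m + (\<Sum>a\<in>S. c a * delta a m)) \<in> carrier (monoid_algebra M)"
      using c ih(2) by (rule monoid_algebra_add_closed)
    ultimately show ?case using insert by simp
  qed (simp add: zero)
  have "f m = (\<Sum>a | f a \<noteq> 0. f a * delta a m)" for m
  proof -
    have "delta a m = (if a = m then 1 else 0)" for a by (simp add: delta_def)
    then show ?thesis using lin_eval[of f m] f by (simp add: lin_def)
  qed
  then have "f = (\<lambda>m. \<Sum>a | f a \<noteq> 0. f a * delta a m)" by (rule ext)
  then show ?thesis using *[of "{a. f a \<noteq> 0}" f] f by simp
qed

context star_mon begin

abbreviation "MA \<equiv> monoid_algebra M"

lemma MA_closed:
  assumes "f \<in> carrier MA" "g \<in> carrier MA"
  shows "f \<otimes>\<^bsub>MA\<^esub> g \<in> carrier MA" "f \<oplus>\<^bsub>MA\<^esub> g \<in> carrier MA" "c \<odot>\<^bsub>MA\<^esub> f \<in> carrier MA" "adj MA f \<in> carrier MA"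
proof -
  have fin: "finite {a. f a \<noteq> 0}" "finite {a. g a \<noteq> 0}" and sub: "{a. f a \<noteq> 0} \<subseteq> carrier M" "{a. g a \<noteq> 0} \<subseteq> carrier M"
    using assms by auto
  have "(\<lambda>(a, b). a \<otimes> b) ` ({a. f a \<noteq> 0} \<times> {a. g a \<noteq> 0}) \<subseteq> carrier M"
    using sub by auto
  then have "{m. (f \<otimes>\<^bsub>MA\<^esub> g) m \<noteq> 0} \<subseteq> carrier M"
    using support_mult[OF fin, of M] by (rule subset_trans[rotated])
  then show "f \<otimes>\<^bsub>MA\<^esub> g \<in> carrier MA"
    using finite_support_mult[OF fin, of M] by simp
  have "invol M ` {a. f a \<noteq> 0} \<subseteq> carrier M" using sub by auto
  then have "{m. adj MA f m \<noteq> 0} \<subseteq> carrier M"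
    using support_adj[OF fin(1), of M] by (rule subset_trans[rotated])
  then show "adj MA f \<in> carrier MA"
    using finite_support_adj[OF fin(1), of M] by simp
  show "f \<oplus>\<^bsub>MA\<^esub> g \<in> carrier MA"
    using monoid_algebra_add_closed[OF assms] by simp
  show "c \<odot>\<^bsub>MA\<^esub> f \<in> carrier MA" using fin sub by auto
qed

lemma delta_closed [simp, intro]: "a \<in> carrier M \<Longrightarrow> delta a \<in> carrier MA"
  by (simp add: support_delta)

lemma MA_ext:
  assumes "f \<in> carrier MA" "g \<in> carrier MA" "\<And>\<phi>. lin \<phi> f = lin \<phi> g"
  shows "f = g"
  using assms by (intro lin_ext) auto

lemma MA_lin_mult:
  "\<lbrakk>f \<in> carrier MA; g \<in> carrier MA\<rbrakk> \<Longrightarrow> lin \<phi> (f \<otimes>\<^bsub>MA\<^esub> g) = lin (\<lambda>a. lin (\<lambda>b. \<phi> (a \<otimes> b)) g) f"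
  by (rule lin_mult) auto

lemma MA_lin_adj:
  "f \<in> carrier MA \<Longrightarrow> lin \<phi> (adj MA f) = cnj (lin (\<lambda>a. cnj (\<phi> (invol M a))) f)"
  by (rule lin_adj) auto

lemma MA_lin_add:
  "\<lbrakk>f \<in> carrier MA; g \<in> carrier MA\<rbrakk> \<Longrightarrow> lin \<phi> (f \<oplus>\<^bsub>MA\<^esub> g) = lin \<phi> f + lin \<phi> g"
  by (simp add: lin_add)

lemma MA_lin_smult: "lin \<phi> (c \<odot>\<^bsub>MA\<^esub> f) = c * lin \<phi> f"
  by (simp add: lin_smult)

lemma MA_lin_cong: "\<lbrakk>f \<in> carrier MA; \<And>a. a \<in> carrier M \<Longrightarrow> \<phi> a = \<psi> a\<rbrakk> \<Longrightarrow> lin \<phi> f = lin \<psi> f"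
  by (rule lin_cong) auto

lemma star_alg_MA: "star_alg MA"
proof -
  note lins = MA_lin_mult MA_lin_adj MA_lin_add MA_lin_smult MA_closed lin_fun_add lin_fun_smult
  note [simp del] = monoid_algebra_simps
  note [simp] = monoid_algebra_simps(2,3)
  have zc: "(\<lambda>m. 0) \<in> carrier MA" by (simp add: monoid_algebra_simps)
  have sc: "(\<lambda>m. c * f m) \<in> carrier MA" if "f \<in> carrier MA" for c f
    using MA_closed(3)[OF that that, of c] by (simp only: monoid_algebra_simps(5))
  have *: "f \<otimes>\<^bsub>MA\<^esub> g \<otimes>\<^bsub>MA\<^esub> h = f \<otimes>\<^bsub>MA\<^esub> (g \<otimes>\<^bsub>MA\<^esub> h)"
    if f: "f \<in> carrier MA" and g: "g \<in> carrier MA" and h: "h \<in> carrier MA" for f g h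
  proof (rule MA_ext)
    fix \<phi>
    have "lin \<phi> (f \<otimes>\<^bsub>MA\<^esub> g \<otimes>\<^bsub>MA\<^esub> h) = lin (\<lambda>a. lin (\<lambda>b. lin (\<lambda>c. \<phi> (a \<otimes> b \<otimes> c)) h) g) f"
      using f g h by (simp add: lins)
    also have "\<dots> = lin (\<lambda>a. lin (\<lambda>b. lin (\<lambda>c. \<phi> (a \<otimes> (b \<otimes> c))) h) g) f"
      by (intro MA_lin_cong[OF f] MA_lin_cong[OF g] MA_lin_cong[OF h]) (simp add: m_assoc)
    also have "\<dots> = lin \<phi> (f \<otimes>\<^bsub>MA\<^esub> (g \<otimes>\<^bsub>MA\<^esub> h))"
      using f g h by (simp add: lins)
    finally show "lin \<phi> (f \<otimes>\<^bsub>MA\<^esub> g \<otimes>\<^bsub>MA\<^esub> h) = lin \<phi> (f \<otimes>\<^bsub>MA\<^esub> (g \<otimes>\<^bsub>MA\<^esub> h))" .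
  qed (use f g h in \<open>auto intro!: MA_closed\<close>)
  have mon: "monoid MA"
  proof (rule monoidI)
    fix f assume f: "f \<in> carrier MA"
    show "\<one>\<^bsub>MA\<^esub> \<otimes>\<^bsub>MA\<^esub> f = f" "f \<otimes>\<^bsub>MA\<^esub> \<one>\<^bsub>MA\<^esub> = f"
      by (rule MA_ext; use f in \<open>auto simp: lins intro!: MA_closed MA_lin_cong[OF f]\<close>)+
  qed (use * in \<open>auto intro!: MA_closed\<close>)
  have ab: "abelian_group MA"
  proof (rule abelian_groupI)
    fix f assume f: "f \<in> carrier MA"
    show "\<exists>g\<in>carrier MA. g \<oplus>\<^bsub>MA\<^esub> f = \<zero>\<^bsub>MA\<^esub>"
      by (rule bexI[of _ "(-1) \<odot>\<^bsub>MA\<^esub> f"]) (simp add: monoid_algebra_simps(4,5), rule MA_closed(3)[OF f f])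
  qed (use zc in \<open>auto simp: monoid_algebra_simps(3,4) monoid_algebra_add_closed algebra_simps\<close>)
  interpret ring MA
  proof (rule ringI[OF ab mon])
    fix x y z assume xyz: "x \<in> carrier MA" "y \<in> carrier MA" "z \<in> carrier MA"
    show "(x \<oplus>\<^bsub>MA\<^esub> y) \<otimes>\<^bsub>MA\<^esub> z = x \<otimes>\<^bsub>MA\<^esub> z \<oplus>\<^bsub>MA\<^esub> y \<otimes>\<^bsub>MA\<^esub> z"
         "z \<otimes>\<^bsub>MA\<^esub> (x \<oplus>\<^bsub>MA\<^esub> y) = z \<otimes>\<^bsub>MA\<^esub> x \<oplus>\<^bsub>MA\<^esub> z \<otimes>\<^bsub>MA\<^esub> y"
      by (rule MA_ext; use xyz in \<open>auto simp: lins intro!: MA_closed\<close>)+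
  qed
  show ?thesis
  proof
    fix x y c d assume xy: "x \<in> carrier MA" "y \<in> carrier MA"
    show "adj MA (x \<otimes>\<^bsub>MA\<^esub> y) = adj MA y \<otimes>\<^bsub>MA\<^esub> adj MA x"
    proof (rule MA_ext)
      fix \<phi>
      have "lin \<phi> (adj MA y \<otimes>\<^bsub>MA\<^esub> adj MA x) = cnj (lin (\<lambda>b. lin (\<lambda>a. cnj (\<phi> (invol M b \<otimes> invol M a))) x) y)"
        using xy by (simp add: lins)
      \<comment> \<open>The involution reverses factors, so the two summations must trade places
        before the arguments match.\<close>
      also have "\<dots> = cnj (lin (\<lambda>a. lin (\<lambda>b. cnj (\<phi> (invol M b \<otimes> invol M a))) y) x)"
        by (subst lin_swap) (rule refl)
      also have "\<dots> = cnj (lin (\<lambda>a. lin (\<lambda>b. cnj (\<phi> (invol M (a \<otimes> b)))) y) x)"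
        using xy by (intro arg_cong[where f = cnj] MA_lin_cong) (auto simp: invol_mult)
      finally show "lin \<phi> (adj MA (x \<otimes>\<^bsub>MA\<^esub> y)) = lin \<phi> (adj MA y \<otimes>\<^bsub>MA\<^esub> adj MA x)"
        using xy by (simp add: lins)
    qed (use xy in \<open>auto intro!: MA_closed\<close>)
    show "adj MA (adj MA x) = x"
      by (rule MA_ext; use xy in \<open>auto simp: lins intro!: MA_closed MA_lin_cong[OF xy(1)]\<close>)
    show "adj MA (x \<oplus>\<^bsub>MA\<^esub> y) = adj MA x \<oplus>\<^bsub>MA\<^esub> adj MA y" "adj MA (c \<odot>\<^bsub>MA\<^esub> x) = cnj c \<odot>\<^bsub>MA\<^esub> adj MA x"
         "(c \<odot>\<^bsub>MA\<^esub> x) \<otimes>\<^bsub>MA\<^esub> y = c \<odot>\<^bsub>MA\<^esub> (x \<otimes>\<^bsub>MA\<^esub> y)" "x \<otimes>\<^bsub>MA\<^esub> (c \<odot>\<^bsub>MA\<^esub> y) = c \<odot>\<^bsub>MA\<^esub> (x \<otimes>\<^bsub>MA\<^esub> y)"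
      by (rule MA_ext; use xy in \<open>auto simp: lins intro!: MA_closed\<close>)+
  qed (auto intro!: MA_closed(4) simp: sc monoid_algebra_simps(4,5) algebra_simps)
qed

lemma MA_minus:
  assumes "f \<in> carrier MA" "g \<in> carrier MA"
  shows "f \<ominus>\<^bsub>MA\<^esub> g = (\<lambda>m. f m - g m)"
proof -
  interpret star_alg MA by (rule star_alg_MA)
  show ?thesis using assms by (subst minus_smult) auto
qed

lemma delta_mult: "\<lbrakk>a \<in> carrier M; b \<in> carrier M\<rbrakk> \<Longrightarrow> delta a \<otimes>\<^bsub>MA\<^esub> delta b = delta (a \<otimes> b)"
  by (rule MA_ext) (auto simp del: monoid_algebra_simps simp: MA_lin_mult intro!: MA_closed)

lemma delta_adj: "a \<in> carrier M \<Longrightarrow> adj MA (delta a) = delta (invol M a)"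
  by (rule MA_ext) (auto simp del: monoid_algebra_simps simp: MA_lin_adj intro!: MA_closed)

end

section \<open>C*-seminorms and completions\<close>

lemma LIMSEQ_eqI:
  fixes f g :: "nat \<Rightarrow> 'a::t2_space"
  assumes "f \<longlonglongrightarrow> a" "g \<longlonglongrightarrow> b" "\<And>k. f k = g k" shows "a = b"
proof -
  have "f = g" using assms(3) by (rule ext)
  then show ?thesis using assms LIMSEQ_unique by blast
qed

lemma nonneg_Reals_LIMSEQ:
  fixes f :: "nat \<Rightarrow> complex"
  assumes lim: "f \<longlonglongrightarrow> a" and f: "\<And>k. f k \<in> \<real>\<^sub>\<ge>\<^sub>0" shows "a \<in> \<real>\<^sub>\<ge>\<^sub>0"
proof -
  have "0 \<le> Re a" using f by (intro LIMSEQ_le_const[OF tendsto_Re[OF lim]]) (auto simp: complex_nonneg_Reals_iff)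
  moreover have "Im a = 0"
    using f by (intro LIMSEQ_eqI[OF tendsto_Im[OF lim] tendsto_const]) (auto simp: complex_nonneg_Reals_iff)
  ultimately show ?thesis by (simp add: complex_nonneg_Reals_iff)
qed

lemma tendsto_zero_norm_le:
  fixes f :: "nat \<Rightarrow> 'a::real_normed_vector"
  assumes "\<And>k. norm (f k) \<le> g k" "g \<longlonglongrightarrow> 0" shows "f \<longlonglongrightarrow> 0"
  by (rule tendsto_norm_zero_cancel, rule tendsto_sandwich[OF _ _ tendsto_const assms(2)]) (use assms(1) in auto)

locale seminormed_star_alg = star_alg A for A :: "('a, 'x) star_algebra_scheme" (structure) +
  fixes N :: "'a \<Rightarrow> real"
  assumes cstar: "cstar_seminorm A N"
begin

lemma N_nonneg: "x \<in> carrier A \<Longrightarrow> 0 \<le> N x"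
  and N_smult: "x \<in> carrier A \<Longrightarrow> N (c \<odot> x) = cmod c * N x"
  and N_triangle: "\<lbrakk>x \<in> carrier A; y \<in> carrier A\<rbrakk> \<Longrightarrow> N (x \<oplus> y) \<le> N x + N y"
  and N_mult: "\<lbrakk>x \<in> carrier A; y \<in> carrier A\<rbrakk> \<Longrightarrow> N (x \<otimes> y) \<le> N x * N y"
  and N_star: "x \<in> carrier A \<Longrightarrow> N (adj A x \<otimes> x) = (N x)\<^sup>2"
  using cstar by (auto simp: cstar_seminorm_def)

lemma N_zero [simp]: "N \<zero> = 0"
  using N_smult[of \<zero> 0] by simp

text \<open>The C*-identity makes \<open>N \<one>\<close> idempotent, hence 0 or 1. The value 0 does
  occur, for the zero seminorm.\<close>

lemma N_one_le: "N \<one> \<le> 1"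
proof -
  have "(N \<one>)\<^sup>2 = N \<one>" using N_star[of \<one>] by simp
  then show ?thesis by (auto simp: power2_eq_square)
qed

text \<open>The C*-identity and submultiplicativity bound the square of \<open>N x\<close> by
  \<open>N (adj A x) * N x\<close>; cancelling gives one inequality, and applying it to the adjoint
  gives the other.\<close>

lemma N_adj [simp]:
  assumes x: "x \<in> carrier A" shows "N (adj A x) = N x"
proof -
  have *: "N x \<le> N (adj A x)" if x: "x \<in> carrier A" for x
  proof (cases "N x = 0")
    case False
    then have "0 < N x" using N_nonneg[OF x] by simp
    moreover have "N x * N x \<le> N (adj A x) * N x"
      using N_star[OF x] N_mult[of "adj A x" x] x by (simp add: power2_eq_square)
    ultimately show ?thesis by simp
  qed (use x N_nonneg in auto)
  show ?thesis using *[OF x] *[of "adj A x"] x by simp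
qed

lemma N_minus_commute: "\<lbrakk>x \<in> carrier A; y \<in> carrier A\<rbrakk> \<Longrightarrow> N (x \<ominus> y) = N (y \<ominus> x)"
proof -
  assume xy: "x \<in> carrier A" "y \<in> carrier A"
  have "y \<ominus> x = (-1) \<odot> (x \<ominus> y)"
    using xy by (simp add: minus_smult smult_r_distr smult_smult a_comm)
  then show ?thesis using xy by (simp add: N_smult)
qed

lemma N_minus_triangle:
  "\<lbrakk>x \<in> carrier A; y \<in> carrier A; z \<in> carrier A\<rbrakk> \<Longrightarrow> N (x \<ominus> z) \<le> N (x \<ominus> y) + N (y \<ominus> z)"
  using minus_minus_split[of x y z] N_triangle[of "x \<ominus> y" "y \<ominus> z"] by simp

lemma N_diff_le:
  assumes "x \<in> carrier A" "y \<in> carrier A" shows "\<bar>N x - N y\<bar> \<le> N (x \<ominus> y)"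
proof -
  have *: "N x \<le> N (x \<ominus> y) + N y" if "x \<in> carrier A" "y \<in> carrier A" for x y
    using N_minus_triangle[of x y \<zero>] that by (simp add: minus_eq)
  show ?thesis using *[of x y] *[of y x] N_minus_commute[of x y] assms by linarith
qed

abbreviation "CS \<equiv> cauchy_seqs A N"
abbreviation "cls X \<equiv> null_rel A N `` {X}"
abbreviation "C \<equiv> completion A N"
abbreviation null :: "(nat \<Rightarrow> 'a) \<Rightarrow> (nat \<Rightarrow> 'a) \<Rightarrow> bool" where
  "null X Y \<equiv> (\<lambda>k. N (X k \<ominus> Y k)) \<longlonglongrightarrow> 0"

lemma CS_closed: "X \<in> CS \<Longrightarrow> X k \<in> carrier A"
  by (simp add: cauchy_seqs_def)

lemma CS_D: "\<lbrakk>X \<in> CS; 0 < e\<rbrakk> \<Longrightarrow> \<exists>M. \<forall>j\<ge>M. \<forall>k\<ge>M. N (X j \<ominus> X k) < e"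
  by (simp add: cauchy_seqs_def)

lemma CS_I:
  assumes "\<And>k. X k \<in> carrier A" "\<And>e. 0 < e \<Longrightarrow> \<exists>M. \<forall>j\<ge>M. \<forall>k\<ge>M. N (X j \<ominus> X k) < e"
  shows "X \<in> CS"
  using assms by (simp add: cauchy_seqs_def)

lemma N_convergent: assumes X: "X \<in> CS" shows "convergent (\<lambda>k. N (X k))"
proof -
  have "Cauchy (\<lambda>k. N (X k))"
  proof (rule metric_CauchyI)
    fix e :: real assume "0 < e"
    then obtain M where M: "\<And>j k. \<lbrakk>j \<ge> M; k \<ge> M\<rbrakk> \<Longrightarrow> N (X j \<ominus> X k) < e" using CS_D[OF X] by blast
    have "dist (N (X j)) (N (X k)) < e" if "j \<ge> M" "k \<ge> M" for j k
      using M[OF that] N_diff_le[OF CS_closed[OF X] CS_closed[OF X], of j k] by (simp add: dist_real_def)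
    then show "\<exists>M. \<forall>m\<ge>M. \<forall>n\<ge>M. dist (N (X m)) (N (X n)) < e" by blast
  qed
  then show ?thesis by (rule Cauchy_convergent)
qed

lemma CS_bounded: assumes X: "X \<in> CS" obtains B where "0 < B" "\<And>k. N (X k) \<le> B"
proof -
  have "Bseq (\<lambda>k. N (X k))" by (rule convergent_imp_Bseq[OF N_convergent[OF X]])
  then obtain B where "0 < B" "\<And>k. norm (N (X k)) \<le> B" by (auto elim: BseqE)
  then show ?thesis using that by (metis abs_ge_self order_trans real_norm_def)
qed

lemma CS_const: "x \<in> carrier A \<Longrightarrow> (\<lambda>_. x) \<in> CS"
  by (rule CS_I) (auto simp: minus_eq r_neg)

lemma CS_lipschitz:
  assumes X: "X \<in> CS" and "\<And>k. Y k \<in> carrier A" "\<And>j k. N (Y j \<ominus> Y k) \<le> K * N (X j \<ominus> X k)"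
  shows "Y \<in> CS"
proof (rule CS_I)
  fix e :: real assume e: "0 < e"
  \<comment> \<open>The constant \<open>K\<close> may be 0, so a positive majorant is needed before
    dividing by it.\<close>
  define L where "L = max K 1"
  have L: "0 < L" "K \<le> L" by (auto simp: L_def)
  obtain M where M: "\<And>j k. \<lbrakk>j \<ge> M; k \<ge> M\<rbrakk> \<Longrightarrow> N (X j \<ominus> X k) < e / L" using CS_D[OF X, of "e / L"] e L by auto
  have "N (Y j \<ominus> Y k) < e" if "j \<ge> M" "k \<ge> M" for j k
  proof -
    have "K * N (X j \<ominus> X k) \<le> L * N (X j \<ominus> X k)"
      using CS_closed[OF X] by (intro mult_right_mono L(2) N_nonneg) simp
    then have "N (Y j \<ominus> Y k) \<le> L * N (X j \<ominus> X k)"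
      using assms(3)[of j k] by (rule order_trans[rotated])
    also have "\<dots> < L * (e / L)" using M[OF that] L by (intro mult_strict_left_mono)
    finally show ?thesis using L by simp
  qed
  then show "\<exists>M. \<forall>j\<ge>M. \<forall>k\<ge>M. N (Y j \<ominus> Y k) < e" by blast
qed (rule assms)

lemma CS_smult: "X \<in> CS \<Longrightarrow> (\<lambda>k. c \<odot> X k) \<in> CS"
  by (rule CS_lipschitz[where X = X and K = "cmod c"]) (auto simp: CS_closed smult_minus[symmetric] N_smult)

lemma CS_adj: "X \<in> CS \<Longrightarrow> (\<lambda>k. adj A (X k)) \<in> CS"
  by (rule CS_lipschitz[where X = X and K = 1]) (auto simp: CS_closed adj_minus[symmetric])

lemma CS_add: assumes X: "X \<in> CS" and Y: "Y \<in> CS" shows "(\<lambda>k. X k \<oplus> Y k) \<in> CS"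
proof (rule CS_I)
  fix e :: real assume e: "0 < e"
  obtain M where M: "\<And>j k. \<lbrakk>j \<ge> M; k \<ge> M\<rbrakk> \<Longrightarrow> N (X j \<ominus> X k) < e / 2" using CS_D[OF X, of "e / 2"] e by auto
  obtain M' where M': "\<And>j k. \<lbrakk>j \<ge> M'; k \<ge> M'\<rbrakk> \<Longrightarrow> N (Y j \<ominus> Y k) < e / 2" using CS_D[OF Y, of "e / 2"] e by auto
  have "N ((X j \<oplus> Y j) \<ominus> (X k \<oplus> Y k)) < e" if "j \<ge> max M M'" "k \<ge> max M M'" for j k
    using M[of j k] M'[of j k] that N_triangle[of "X j \<ominus> X k" "Y j \<ominus> Y k"]
    by (simp add: add_minus_add CS_closed[OF X] CS_closed[OF Y])
  then show "\<exists>M. \<forall>j\<ge>M. \<forall>k\<ge>M. N ((X j \<oplus> Y j) \<ominus> (X k \<oplus> Y k)) < e" by blast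
qed (simp add: CS_closed[OF X] CS_closed[OF Y])

lemma N_mult_diff:
  assumes "x \<in> carrier A" "y \<in> carrier A" "x' \<in> carrier A" "y' \<in> carrier A"
  shows "N (x \<otimes> y \<ominus> x' \<otimes> y') \<le> N x * N (y \<ominus> y') + N (x \<ominus> x') * N y'"
  using N_triangle[of "x \<otimes> (y \<ominus> y')" "(x \<ominus> x') \<otimes> y'"] N_mult[of x "y \<ominus> y'"] N_mult[of "x \<ominus> x'" y'] assms
  by (simp add: mult_minus_mult)

lemma CS_mult: assumes X: "X \<in> CS" and Y: "Y \<in> CS" shows "(\<lambda>k. X k \<otimes> Y k) \<in> CS"
proof (rule CS_I)
  fix e :: real assume e: "0 < e"
  obtain B where B: "0 < B" "\<And>k. N (X k) \<le> B" using CS_bounded[OF X] by blast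
  obtain D where D: "0 < D" "\<And>k. N (Y k) \<le> D" using CS_bounded[OF Y] by blast
  obtain M where M: "\<And>j k. \<lbrakk>j \<ge> M; k \<ge> M\<rbrakk> \<Longrightarrow> N (X j \<ominus> X k) < e / (2 * D)" using CS_D[OF X, of "e / (2 * D)"] e D(1) by auto
  obtain M' where M': "\<And>j k. \<lbrakk>j \<ge> M'; k \<ge> M'\<rbrakk> \<Longrightarrow> N (Y j \<ominus> Y k) < e / (2 * B)" using CS_D[OF Y, of "e / (2 * B)"] e B(1) by auto
  have "N ((X j \<otimes> Y j) \<ominus> (X k \<otimes> Y k)) < e" if jk: "j \<ge> max M M'" "k \<ge> max M M'" for j k
  proof -
    have "N (X j) * N (Y j \<ominus> Y k) \<le> B * N (Y j \<ominus> Y k)"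
      using B(2)[of j] by (intro mult_right_mono N_nonneg) (simp_all add: CS_closed[OF Y])
    also have "\<dots> < B * (e / (2 * B))" using M'[of j k] jk B by (intro mult_strict_left_mono) auto
    finally have 1: "N (X j) * N (Y j \<ominus> Y k) < e / 2" using B by simp
    have "N (X j \<ominus> X k) * N (Y k) \<le> N (X j \<ominus> X k) * D"
      using D(2)[of k] by (intro mult_left_mono N_nonneg) (simp_all add: CS_closed[OF X])
    also have "\<dots> < (e / (2 * D)) * D" using M[of j k] jk D by (intro mult_strict_right_mono) auto
    finally have 2: "N (X j \<ominus> X k) * N (Y k) < e / 2" using D by simp
    show ?thesis
      using N_mult_diff[of "X j" "Y j" "X k" "Y k"] 1 2 by (simp add: CS_closed[OF X] CS_closed[OF Y])
  qed
  then show "\<exists>M. \<forall>j\<ge>M. \<forall>k\<ge>M. N ((X j \<otimes> Y j) \<ominus> (X k \<otimes> Y k)) < e" by blast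
qed (simp add: CS_closed[OF X] CS_closed[OF Y])

lemma null_squeeze:
  assumes "h \<longlonglongrightarrow> 0" "\<And>k. X k \<in> carrier A" "\<And>k. Y k \<in> carrier A" "\<And>k. N (X k \<ominus> Y k) \<le> h k"
  shows "null X Y"
  by (rule tendsto_sandwich[OF _ _ tendsto_const assms(1)]) (use assms N_nonneg in auto)

lemma null_refl: "(\<And>k. X k \<in> carrier A) \<Longrightarrow> null X X"
  by (simp add: minus_eq r_neg)

lemma equiv_null_rel: "equiv CS (null_rel A N)"
proof (rule equivI)
  show "refl_on CS (null_rel A N)" by (auto simp: refl_on_def null_rel_def CS_closed minus_eq r_neg)
  show "sym (null_rel A N)"
    by (auto simp: sym_def null_rel_def CS_closed N_minus_commute)
  show "trans (null_rel A N)"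
  proof (rule transI)
    fix X Y Z assume "(X, Y) \<in> null_rel A N" "(Y, Z) \<in> null_rel A N"
    then have XYZ: "X \<in> CS" "Y \<in> CS" "Z \<in> CS" "null X Y" "null Y Z" by (auto simp: null_rel_def)
    have "null X Z"
      by (rule null_squeeze[where h = "\<lambda>k. N (X k \<ominus> Y k) + N (Y k \<ominus> Z k)"])
        (use XYZ tendsto_add[OF XYZ(4,5)] in \<open>auto simp: CS_closed intro!: N_minus_triangle\<close>)
    then show "(X, Z) \<in> null_rel A N" using XYZ by (simp add: null_rel_def)
  qed
qed (auto simp: null_rel_def)

lemma cls_eq_iff: "\<lbrakk>X \<in> CS; Y \<in> CS\<rbrakk> \<Longrightarrow> cls X = cls Y \<longleftrightarrow> null X Y"
  using eq_equiv_class_iff[OF equiv_null_rel, of X Y] by (simp add: null_rel_def)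

lemma carrier_C: "carrier C = (\<lambda>X. cls X) ` CS"
  by (auto simp: completion_def quotient_def)

lemma C_cases: assumes "x \<in> carrier C" obtains X where "X \<in> CS" "x = cls X"
  using assms by (auto simp: carrier_C)

lemma cls_closed: "X \<in> CS \<Longrightarrow> cls X \<in> carrier C"
  by (simp add: carrier_C)

text \<open>Operations of the completion compute with a chosen representative. That it is Cauchy and
  differs from \<open>X\<close> by a null sequence is all that the choice guarantees.\<close>

lemma rep_cls:
  assumes X: "X \<in> CS" shows "rep (cls X) \<in> CS" "null X (rep (cls X))"
proof -
  have "X \<in> cls X" using equiv_class_self[OF equiv_null_rel X] .
  then have "rep (cls X) \<in> cls X" unfolding rep_def by (rule someI[where P = "\<lambda>Y. Y \<in> cls X"])
  then show "rep (cls X) \<in> CS" "null X (rep (cls X))" by (auto simp: null_rel_def)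
qed

lemma null_add:
  assumes "X \<in> CS" "Y \<in> CS" "X' \<in> CS" "Y' \<in> CS" "null X X'" "null Y Y'"
  shows "null (\<lambda>k. X k \<oplus> Y k) (\<lambda>k. X' k \<oplus> Y' k)"
  by (rule null_squeeze[where h = "\<lambda>k. N (X k \<ominus> X' k) + N (Y k \<ominus> Y' k)"])
    (use assms tendsto_add[OF assms(5,6)] in \<open>auto simp: CS_closed add_minus_add intro!: N_triangle\<close>)

lemma null_smult: "\<lbrakk>X \<in> CS; X' \<in> CS; null X X'\<rbrakk> \<Longrightarrow> null (\<lambda>k. c \<odot> X k) (\<lambda>k. c \<odot> X' k)"
  using tendsto_mult_left[of "\<lambda>k. N (X k \<ominus> X' k)" 0 sequentially "cmod c"]
  by (simp add: smult_minus[symmetric] N_smult CS_closed)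

lemma null_adj: "\<lbrakk>X \<in> CS; X' \<in> CS; null X X'\<rbrakk> \<Longrightarrow> null (\<lambda>k. adj A (X k)) (\<lambda>k. adj A (X' k))"
  by (simp add: adj_minus[symmetric] CS_closed)

lemma null_mult:
  assumes X: "X \<in> CS" and Y: "Y \<in> CS" and X': "X' \<in> CS" and Y': "Y' \<in> CS" and n: "null X X'" "null Y Y'"
  shows "null (\<lambda>k. X k \<otimes> Y k) (\<lambda>k. X' k \<otimes> Y' k)"
proof -
  obtain B where B: "0 < B" "\<And>k. N (X k) \<le> B" using CS_bounded[OF X] by blast
  obtain D where D: "0 < D" "\<And>k. N (Y' k) \<le> D" using CS_bounded[OF Y'] by blast
  have lim: "(\<lambda>k. B * N (Y k \<ominus> Y' k) + N (X k \<ominus> X' k) * D) \<longlonglongrightarrow> 0"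
    using tendsto_add[OF tendsto_mult_left[OF n(2), of B] tendsto_mult_right[OF n(1), of D]] by simp
  show ?thesis
  proof (rule null_squeeze[OF lim])
    fix k
    have "N (X k) * N (Y k \<ominus> Y' k) \<le> B * N (Y k \<ominus> Y' k)"
         "N (X k \<ominus> X' k) * N (Y' k) \<le> N (X k \<ominus> X' k) * D"
      using B(2) D(2) assms by (auto intro!: mult_right_mono mult_left_mono N_nonneg simp: CS_closed)
    then show "N (X k \<otimes> Y k \<ominus> X' k \<otimes> Y' k) \<le> B * N (Y k \<ominus> Y' k) + N (X k \<ominus> X' k) * D"
      using N_mult_diff[of "X k" "Y k" "X' k" "Y' k"] assms by (simp add: CS_closed)
  qed (simp_all add: CS_closed assms)
qed

lemma C_mult: "\<lbrakk>X \<in> CS; Y \<in> CS\<rbrakk> \<Longrightarrow> cls X \<otimes>\<^bsub>C\<^esub> cls Y = cls (\<lambda>k. X k \<otimes> Y k)"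
  using rep_cls[of X] rep_cls[of Y] null_mult[of X Y "rep (cls X)" "rep (cls Y)"]
  by (simp add: completion_def) (subst eq_commute, simp add: cls_eq_iff CS_mult)

lemma C_add: "\<lbrakk>X \<in> CS; Y \<in> CS\<rbrakk> \<Longrightarrow> cls X \<oplus>\<^bsub>C\<^esub> cls Y = cls (\<lambda>k. X k \<oplus> Y k)"
  using rep_cls[of X] rep_cls[of Y] null_add[of X Y "rep (cls X)" "rep (cls Y)"]
  by (simp add: completion_def) (subst eq_commute, simp add: cls_eq_iff CS_add)

lemma C_smult: "X \<in> CS \<Longrightarrow> c \<odot>\<^bsub>C\<^esub> cls X = cls (\<lambda>k. c \<odot> X k)"
  using rep_cls[of X] null_smult[of X "rep (cls X)" c]
  by (simp add: completion_def) (subst eq_commute, simp add: cls_eq_iff CS_smult)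

lemma C_adj: "X \<in> CS \<Longrightarrow> adj C (cls X) = cls (\<lambda>k. adj A (X k))"
  using rep_cls[of X] null_adj[of X "rep (cls X)"]
  by (simp add: completion_def) (subst eq_commute, simp add: cls_eq_iff CS_adj)

lemma C_one: "\<one>\<^bsub>C\<^esub> = cls (\<lambda>_. \<one>)" and C_zero: "\<zero>\<^bsub>C\<^esub> = cls (\<lambda>_. \<zero>)"
  by (simp_all add: completion_def embed_def)

text \<open>The definition takes the limit along the chosen representative. As \<open>N\<close> is
  1-Lipschitz, every representative gives the same limit, and the laws of \<open>N\<close> pass to
  the norm by taking limits.\<close>

lemma C_nrm: assumes X: "X \<in> CS" shows "(\<lambda>k. N (X k)) \<longlonglongrightarrow> nrm C (cls X)"
proof -
  let ?R = "rep (cls X)"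
  have R: "?R \<in> CS" "null X ?R" using rep_cls[OF X] by auto
  have lim: "(\<lambda>k. N (?R k)) \<longlonglongrightarrow> nrm C (cls X)"
    using N_convergent[OF R(1)] by (simp add: completion_def convergent_LIMSEQ_iff)
  have "(\<lambda>k. N (X k) - N (?R k)) \<longlonglongrightarrow> 0"
    by (rule tendsto_zero_norm_le[OF _ R(2)]) (use N_diff_le X R in \<open>auto simp: CS_closed\<close>)
  from tendsto_add[OF this lim] show ?thesis by simp
qed

lemmas CS_closeds = CS_const CS_smult CS_adj CS_add CS_mult
lemmas C_ops = C_mult C_add C_smult C_adj C_one C_zero

lemma star_alg_C: "star_alg C"
proof -
  have mon: "monoid C"
    by (rule monoidI) (auto elim!: C_cases simp: C_ops CS_closeds CS_closed m_assoc intro!: cls_closed)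
  have ab: "abelian_group C"
  proof (rule abelian_groupI)
    fix x assume "x \<in> carrier C"
    then obtain X where X: "X \<in> CS" "x = cls X" by (rule C_cases)
    have "(\<lambda>k. (-1) \<odot> X k \<oplus> X k) = (\<lambda>k. \<zero>)"
      using CS_closed[OF X(1)] by (simp add: a_inv_smult[symmetric] l_neg)
    then show "\<exists>y\<in>carrier C. y \<oplus>\<^bsub>C\<^esub> x = \<zero>\<^bsub>C\<^esub>"
      using X by (intro bexI[of _ "cls (\<lambda>k. (-1) \<odot> X k)"]) (auto simp: C_ops CS_closeds intro!: cls_closed)
  qed (auto elim!: C_cases simp: C_ops CS_closeds CS_closed a_ac intro!: cls_closed)
  interpret ring C
    by (rule ringI[OF ab mon]) (auto elim!: C_cases simp: C_ops CS_closeds CS_closed l_distr r_distr intro!: cls_closed)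
  show ?thesis
    by standard (auto elim!: C_cases simp: C_ops CS_closeds CS_closed smult_r_distr smult_l_distr smult_smult
        smult_mult_l smult_mult_r adj_add adj_smult adj_mult intro!: cls_closed)
qed

lemma cstar_C: "cstar_seminorm C (nrm C)"
  unfolding cstar_seminorm_def
proof (intro conjI ballI allI)
  fix x y c assume "x \<in> carrier C" "y \<in> carrier C"
  then obtain X Y where X: "X \<in> CS" "x = cls X" and Y: "Y \<in> CS" "y = cls Y" by (metis C_cases)
  note [simp] = X Y C_ops CS_closeds CS_closed[OF X(1)] CS_closed[OF Y(1)]
  note Xl = C_nrm[OF X(1)] and Yl = C_nrm[OF Y(1)]
  show "0 \<le> nrm C x" using LIMSEQ_le_const[OF Xl, of 0] N_nonneg by auto
  show "nrm C (c \<odot>\<^bsub>C\<^esub> x) = cmod c * nrm C x"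
    using LIMSEQ_eqI[OF C_nrm[OF CS_smult[OF X(1), of c]] tendsto_mult_left[OF Xl, of "cmod c"]]
    by (simp add: N_smult)
  show "nrm C (x \<oplus>\<^bsub>C\<^esub> y) \<le> nrm C x + nrm C y"
    using LIMSEQ_le[OF C_nrm[OF CS_add[OF X(1) Y(1)]] tendsto_add[OF Xl Yl]] N_triangle by auto
  show "nrm C (x \<otimes>\<^bsub>C\<^esub> y) \<le> nrm C x * nrm C y"
    using LIMSEQ_le[OF C_nrm[OF CS_mult[OF X(1) Y(1)]] tendsto_mult[OF Xl Yl]] N_mult by auto
  show "nrm C (adj C x \<otimes>\<^bsub>C\<^esub> x) = (nrm C x)\<^sup>2"
    using LIMSEQ_eqI[OF C_nrm[OF CS_mult[OF CS_adj[OF X(1)] X(1)]] tendsto_power[OF Xl, of 2]]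
    by (simp add: N_star)
qed

lemma seminormed_C: "seminormed_star_alg C (nrm C)"
  using star_alg_C cstar_C by (simp add: seminormed_star_alg_def seminormed_star_alg_axioms_def)

lemma embed_eq: "embed A N x = cls (\<lambda>_. x)"
  by (simp add: embed_def)

lemma embed_closed [simp, intro]: "x \<in> carrier A \<Longrightarrow> embed A N x \<in> carrier C"
  by (simp add: embed_eq cls_closed CS_const)

lemma embed_mult: "\<lbrakk>x \<in> carrier A; y \<in> carrier A\<rbrakk> \<Longrightarrow> embed A N (x \<otimes> y) = embed A N x \<otimes>\<^bsub>C\<^esub> embed A N y"
  and embed_add: "\<lbrakk>x \<in> carrier A; y \<in> carrier A\<rbrakk> \<Longrightarrow> embed A N (x \<oplus> y) = embed A N x \<oplus>\<^bsub>C\<^esub> embed A N y"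
  and embed_smult: "x \<in> carrier A \<Longrightarrow> embed A N (c \<odot> x) = c \<odot>\<^bsub>C\<^esub> embed A N x"
  and embed_adj: "x \<in> carrier A \<Longrightarrow> embed A N (adj A x) = adj C (embed A N x)"
  and embed_one: "embed A N \<one> = \<one>\<^bsub>C\<^esub>"
  and embed_zero: "embed A N \<zero> = \<zero>\<^bsub>C\<^esub>"
  by (simp_all add: embed_eq C_ops CS_const)

lemma embed_nrm: "x \<in> carrier A \<Longrightarrow> nrm C (embed A N x) = N x"
  using LIMSEQ_unique[OF C_nrm[OF CS_const] tendsto_const] by (simp add: embed_eq)

lemma embed_eq_iff: "\<lbrakk>x \<in> carrier A; y \<in> carrier A\<rbrakk> \<Longrightarrow> embed A N x = embed A N y \<longleftrightarrow> N (x \<ominus> y) = 0"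
  by (simp add: embed_eq cls_eq_iff CS_const LIMSEQ_const_iff)

lemma C_minus:
  assumes X: "X \<in> CS" and Y: "Y \<in> CS"
  shows "(\<lambda>k. X k \<ominus> Y k) \<in> CS" "cls X \<ominus>\<^bsub>C\<^esub> cls Y = cls (\<lambda>k. X k \<ominus> Y k)"
proof -
  interpret C: seminormed_star_alg C "nrm C" by (rule seminormed_C)
  have eq: "(\<lambda>k. X k \<ominus> Y k) = (\<lambda>k. X k \<oplus> (-1) \<odot> Y k)"
    using CS_closed[OF X] CS_closed[OF Y] by (simp add: minus_smult)
  show "(\<lambda>k. X k \<ominus> Y k) \<in> CS" unfolding eq using X Y by (simp add: CS_closeds)
  show "cls X \<ominus>\<^bsub>C\<^esub> cls Y = cls (\<lambda>k. X k \<ominus> Y k)"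
    unfolding eq using X Y by (simp add: C.minus_smult cls_closed C_ops CS_closeds)
qed

lemma C_definite: "x \<in> carrier C \<Longrightarrow> nrm C x = 0 \<Longrightarrow> x = \<zero>\<^bsub>C\<^esub>"
proof -
  assume "x \<in> carrier C" "nrm C x = 0"
  then obtain X where X: "X \<in> CS" "x = cls X" "(\<lambda>k. N (X k)) \<longlonglongrightarrow> 0" using C_nrm by (metis C_cases)
  then show "x = \<zero>\<^bsub>C\<^esub>"
    unfolding X(2) C_zero by (subst cls_eq_iff) (simp_all add: CS_const minus_eq CS_closed)
qed

lemma C_eqI:
  assumes "x \<in> carrier C" "y \<in> carrier C" "nrm C (x \<ominus>\<^bsub>C\<^esub> y) = 0" shows "x = y"
proof -
  interpret C: seminormed_star_alg C "nrm C" by (rule seminormed_C)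
  have "x \<ominus>\<^bsub>C\<^esub> y = \<zero>\<^bsub>C\<^esub>" using assms by (intro C_definite) auto
  moreover have "x = (x \<ominus>\<^bsub>C\<^esub> y) \<oplus>\<^bsub>C\<^esub> y" using assms by (simp add: C.minus_eq C.a_assoc C.l_neg)
  ultimately show ?thesis using assms by simp
qed

text \<open>Density of the algebra in its completion: the Cauchy condition with one of its two
  indices sent to infinity.\<close>

lemma embed_tendsto:
  assumes X: "X \<in> CS" shows "(\<lambda>j. nrm C (cls X \<ominus>\<^bsub>C\<^esub> embed A N (X j))) \<longlonglongrightarrow> 0"
proof (rule LIMSEQ_I)
  interpret C: seminormed_star_alg C "nrm C" by (rule seminormed_C)
  fix e :: real assume e: "0 < e"
  then obtain M where M: "\<And>j k. \<lbrakk>j \<ge> M; k \<ge> M\<rbrakk> \<Longrightarrow> N (X j \<ominus> X k) < e / 2" using CS_D[OF X, of "e / 2"] by auto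
  \<comment> \<open>A strict bound becomes a weak one in the limit, hence the margin
    \<open>e / 2\<close>.\<close>
  have "nrm C (cls X \<ominus>\<^bsub>C\<^esub> embed A N (X j)) \<le> e / 2" if "j \<ge> M" for j
  proof (rule LIMSEQ_le_const2)
    show "(\<lambda>k. N (X k \<ominus> X j)) \<longlonglongrightarrow> nrm C (cls X \<ominus>\<^bsub>C\<^esub> embed A N (X j))"
      using C_nrm[OF C_minus(1)[OF X CS_const]] CS_closed[OF X] by (simp add: embed_eq C_minus(2)[OF X CS_const])
    show "\<exists>M. \<forall>k\<ge>M. N (X k \<ominus> X j) \<le> e / 2"
      using M that by (intro exI[of _ M]) (auto intro: less_imp_le)
  qed
  moreover have "0 \<le> nrm C (cls X \<ominus>\<^bsub>C\<^esub> embed A N (X j))" for j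
    using CS_closed[OF X] cls_closed[OF X] by (intro C.N_nonneg) auto
  ultimately show "\<exists>M. \<forall>j\<ge>M. norm (nrm C (cls X \<ominus>\<^bsub>C\<^esub> embed A N (X j)) - 0) < e"
    using e by (intro exI[of _ M]) force
qed

text \<open>Diagonal argument: the k-th class is replaced by an element of the algebra at distance
  below 1/(k+1). The elements so chosen form a Cauchy sequence, and its class is the limit.\<close>

lemma C_complete:
  assumes Z: "Z \<in> cauchy_seqs C (nrm C)"
  obtains x where "x \<in> carrier C" "(\<lambda>k. nrm C (Z k \<ominus>\<^bsub>C\<^esub> x)) \<longlonglongrightarrow> 0"
proof -
  interpret C: seminormed_star_alg C "nrm C" by (rule seminormed_C)
  have Zc: "Z k \<in> carrier C" for k using Z by (rule C.CS_closed)
  have "\<exists>a. a \<in> carrier A \<and> nrm C (Z k \<ominus>\<^bsub>C\<^esub> embed A N a) < inverse (real (Suc k))" for k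
  proof -
    obtain X where X: "X \<in> CS" "Z k = cls X" using Zc by (rule C_cases)
    have "\<forall>\<^sub>F j in sequentially. nrm C (Z k \<ominus>\<^bsub>C\<^esub> embed A N (X j)) < inverse (real (Suc k))"
      using order_tendstoD(2)[OF embed_tendsto[OF X(1)]] X by simp
    then show ?thesis using CS_closed[OF X(1)] eventually_happens by fastforce
  qed
  then obtain a where a: "\<And>k. a k \<in> carrier A" "\<And>k. nrm C (Z k \<ominus>\<^bsub>C\<^esub> embed A N (a k)) < inverse (real (Suc k))"
    by metis
  have d: "(\<lambda>k. nrm C (Z k \<ominus>\<^bsub>C\<^esub> embed A N (a k))) \<longlonglongrightarrow> 0"
  proof (rule tendsto_zero_norm_le[OF _ LIMSEQ_inverse_real_of_nat])
    show "norm (nrm C (Z k \<ominus>\<^bsub>C\<^esub> embed A N (a k))) \<le> inverse (real (Suc k))" for k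
      using a(2)[of k] a(1)[of k] Zc[of k] C.N_nonneg[of "Z k \<ominus>\<^bsub>C\<^esub> embed A N (a k)"]
      unfolding real_norm_def by (subst abs_of_nonneg) auto
  qed
  have E: "N (a j \<ominus> a k) = nrm C (embed A N (a j) \<ominus>\<^bsub>C\<^esub> embed A N (a k))" for j k
    using a embed_nrm[of "a j \<ominus> a k"] by (simp add: embed_eq C_minus CS_const)
  have aC: "a \<in> CS"
  proof (rule CS_I)
    fix e :: real assume e: "0 < e"
    then obtain M where M: "\<And>j k. \<lbrakk>j \<ge> M; k \<ge> M\<rbrakk> \<Longrightarrow> nrm C (Z j \<ominus>\<^bsub>C\<^esub> Z k) < e / 3"
      using C.CS_D[OF Z, of "e / 3"] by auto
    have "\<forall>\<^sub>F k in sequentially. nrm C (Z k \<ominus>\<^bsub>C\<^esub> embed A N (a k)) < e / 3"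
      using order_tendstoD(2)[OF d, of "e / 3"] e by simp
    then obtain M' where M': "\<And>k. k \<ge> M' \<Longrightarrow> nrm C (Z k \<ominus>\<^bsub>C\<^esub> embed A N (a k)) < e / 3"
      by (auto simp: eventually_sequentially)
    have "N (a j \<ominus> a k) < e" if "j \<ge> max M M'" "k \<ge> max M M'" for j k
      using M[of j k] M'[of j] M'[of k] that a Zc
        C.N_minus_triangle[of "embed A N (a j)" "Z j" "embed A N (a k)"]
        C.N_minus_triangle[of "Z j" "Z k" "embed A N (a k)"]
        C.N_minus_commute[of "embed A N (a j)" "Z j"] E[of j k] by simp
    then show "\<exists>M. \<forall>j\<ge>M. \<forall>k\<ge>M. N (a j \<ominus> a k) < e" by blast
  qed (rule a)
  have "(\<lambda>k. nrm C (Z k \<ominus>\<^bsub>C\<^esub> cls a)) \<longlonglongrightarrow> 0"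
  proof (rule C.null_squeeze)
    show "(\<lambda>k. nrm C (Z k \<ominus>\<^bsub>C\<^esub> embed A N (a k)) + nrm C (cls a \<ominus>\<^bsub>C\<^esub> embed A N (a k))) \<longlonglongrightarrow> 0"
      using tendsto_add[OF d embed_tendsto[OF aC]] by simp
    show "nrm C (Z k \<ominus>\<^bsub>C\<^esub> cls a) \<le> nrm C (Z k \<ominus>\<^bsub>C\<^esub> embed A N (a k)) + nrm C (cls a \<ominus>\<^bsub>C\<^esub> embed A N (a k))" for k
      using C.N_minus_triangle[of "Z k" "embed A N (a k)" "cls a"] C.N_minus_commute[of "embed A N (a k)" "cls a"]
        Zc a cls_closed[OF aC] by simp
  qed (use Zc cls_closed[OF aC] in auto)
  then show thesis using that cls_closed[OF aC] by blast
qed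

section \<open>States and homomorphisms on a completion: uniqueness and extension\<close>

lemma state_diff:
  assumes s: "state C \<omega>" and x: "x \<in> carrier C" and y: "y \<in> carrier C"
  shows "cmod (\<omega> x - \<omega> y) \<le> nrm C (x \<ominus>\<^bsub>C\<^esub> y)"
proof -
  interpret C: seminormed_star_alg C "nrm C" by (rule seminormed_C)
  have "\<omega> (x \<ominus>\<^bsub>C\<^esub> y) = \<omega> x - \<omega> y" using s x y by (simp add: C.minus_smult state_def)
  then show ?thesis using s x y unfolding state_def by (metis C.minus_closed)
qed

lemma state_lim:
  assumes s: "state C \<omega>" and X: "X \<in> CS"
  shows "(\<lambda>j. \<omega> (embed A N (X j))) \<longlonglongrightarrow> \<omega> (cls X)"
proof -
  have "(\<lambda>j. \<omega> (cls X) - \<omega> (embed A N (X j))) \<longlonglongrightarrow> 0"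
    by (rule tendsto_zero_norm_le[OF _ embed_tendsto[OF X]])
      (use X in \<open>auto intro!: state_diff[OF s] cls_closed CS_closed\<close>)
  from tendsto_diff[OF tendsto_const[of "\<omega> (cls X)"] this] show ?thesis by simp
qed

lemma state_eqI:
  assumes s: "state C \<omega>" "state C \<omega>'" and eq: "\<And>x. x \<in> carrier A \<Longrightarrow> \<omega> (embed A N x) = \<omega>' (embed A N x)"
  shows "\<omega> = \<omega>'"
proof (rule extensionalityI)
  show "\<omega> \<in> extensional (carrier C)" "\<omega>' \<in> extensional (carrier C)" using s by (auto simp: state_def)
  fix x assume "x \<in> carrier C"
  then obtain X where X: "X \<in> CS" "x = cls X" by (rule C_cases)
  then show "\<omega> x = \<omega>' x"
    using LIMSEQ_unique[OF state_lim[OF s(1) X(1)]] state_lim[OF s(2) X(1)] eq CS_closed[OF X(1)] by simp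
qed

text \<open>A linear functional bounded by \<open>N\<close> is Lipschitz and extends by continuity;
  linearity, positivity and the norm bound are closed conditions.\<close>

lemma state_extend:
  assumes add: "\<And>x y. \<lbrakk>x \<in> carrier A; y \<in> carrier A\<rbrakk> \<Longrightarrow> g (x \<oplus> y) = g x + g y"
    and smult: "\<And>c x. x \<in> carrier A \<Longrightarrow> g (c \<odot> x) = c * g x"
    and pos: "\<And>x. x \<in> carrier A \<Longrightarrow> g (adj A x \<otimes> x) \<in> \<real>\<^sub>\<ge>\<^sub>0"
    and bd: "\<And>x. x \<in> carrier A \<Longrightarrow> cmod (g x) \<le> N x"
    and one: "g \<one> = 1"
  obtains \<omega> where "state C \<omega>" "\<And>x. x \<in> carrier A \<Longrightarrow> \<omega> (embed A N x) = g x"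
proof -
  define \<omega> where "\<omega> = restrict (\<lambda>c. lim (\<lambda>k. g (rep c k))) (carrier C)"
  have diff: "cmod (g x - g y) \<le> N (x \<ominus> y)" if "x \<in> carrier A" "y \<in> carrier A" for x y
    using bd[of "x \<ominus> y"] that add[of x "(-1) \<odot> y"] smult[of y "-1"] by (simp add: minus_smult)
  have lim: "(\<lambda>k. g (X k)) \<longlonglongrightarrow> \<omega> (cls X)" if X: "X \<in> CS" for X
  proof -
    let ?R = "rep (cls X)"
    have R: "?R \<in> CS" "null X ?R" using rep_cls[OF X] by auto
    have "Cauchy (\<lambda>k. g (?R k))"
    proof (rule metric_CauchyI)
      fix e :: real assume "0 < e"
      then obtain M where M: "\<And>j k. \<lbrakk>j \<ge> M; k \<ge> M\<rbrakk> \<Longrightarrow> N (?R j \<ominus> ?R k) < e" using CS_D[OF R(1)] by blast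
      have "dist (g (?R j)) (g (?R k)) < e" if "j \<ge> M" "k \<ge> M" for j k
        using M[OF that] diff[OF CS_closed[OF R(1)] CS_closed[OF R(1)], of j k] by (simp add: dist_norm)
      then show "\<exists>M. \<forall>m\<ge>M. \<forall>n\<ge>M. dist (g (?R m)) (g (?R n)) < e" by blast
    qed
    then have 1: "(\<lambda>k. g (?R k)) \<longlonglongrightarrow> \<omega> (cls X)"
      by (simp add: \<omega>_def cls_closed[OF X] Cauchy_convergent_iff convergent_LIMSEQ_iff)
    have "(\<lambda>k. g (X k) - g (?R k)) \<longlonglongrightarrow> 0"
      by (rule tendsto_zero_norm_le[OF _ R(2)]) (use diff X R in \<open>auto simp: CS_closed\<close>)
    from tendsto_add[OF this 1] show ?thesis by simp
  qed
  have emb: "\<omega> (embed A N x) = g x" if "x \<in> carrier A" for x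
    using LIMSEQ_unique[OF lim[OF CS_const[OF that]] tendsto_const] by (simp add: embed_eq)
  have "state C \<omega>"
    unfolding state_def
  proof (intro conjI ballI allI)
    show "\<omega> \<in> extensional (carrier C)" by (simp add: \<omega>_def)
    show "\<omega> \<one>\<^bsub>C\<^esub> = 1" using emb[of \<one>] one by (simp add: embed_one)
    fix x y c assume "x \<in> carrier C" "y \<in> carrier C"
    then obtain X Y where X: "X \<in> CS" "x = cls X" and Y: "Y \<in> CS" "y = cls Y" by (metis C_cases)
    note [simp] = X Y C_ops CS_closeds CS_closed[OF X(1)] CS_closed[OF Y(1)]
    note Xl = lim[OF X(1)] and Yl = lim[OF Y(1)]
    show "\<omega> (x \<oplus>\<^bsub>C\<^esub> y) = \<omega> x + \<omega> y"
      using LIMSEQ_eqI[OF lim[OF CS_add[OF X(1) Y(1)]] tendsto_add[OF Xl Yl]] by (simp add: add)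
    show "\<omega> (c \<odot>\<^bsub>C\<^esub> x) = c * \<omega> x"
      using LIMSEQ_eqI[OF lim[OF CS_smult[OF X(1), of c]] tendsto_mult_left[OF Xl, of c]] by (simp add: smult)
    show "\<omega> (adj C x \<otimes>\<^bsub>C\<^esub> x) \<in> \<real>\<^sub>\<ge>\<^sub>0"
      using nonneg_Reals_LIMSEQ[OF lim[OF CS_mult[OF CS_adj[OF X(1)] X(1)]]] pos by simp
    show "cmod (\<omega> x) \<le> nrm C x"
      using LIMSEQ_le[OF tendsto_norm[OF Xl] C_nrm[OF X(1)]] bd by auto
  qed
  then show thesis using that emb by blast
qed

end

text \<open>A contractive homomorphism maps Cauchy sequences to Cauchy sequences and preserves null
  differences, so it can be applied entrywise to a representative.\<close>

lemma hom_extend: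
  assumes "seminormed_star_alg A N" "seminormed_star_alg B P"
    and f: "\<And>x. x \<in> carrier A \<Longrightarrow> f x \<in> carrier B"
    and add: "\<And>x y. \<lbrakk>x \<in> carrier A; y \<in> carrier A\<rbrakk> \<Longrightarrow> f (x \<oplus>\<^bsub>A\<^esub> y) = f x \<oplus>\<^bsub>B\<^esub> f y"
    and smult: "\<And>c x. x \<in> carrier A \<Longrightarrow> f (c \<odot>\<^bsub>A\<^esub> x) = c \<odot>\<^bsub>B\<^esub> f x"
    and mult: "\<And>x y. \<lbrakk>x \<in> carrier A; y \<in> carrier A\<rbrakk> \<Longrightarrow> f (x \<otimes>\<^bsub>A\<^esub> y) = f x \<otimes>\<^bsub>B\<^esub> f y"
    and adj: "\<And>x. x \<in> carrier A \<Longrightarrow> f (adj A x) = adj B (f x)"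
    and one: "f \<one>\<^bsub>A\<^esub> = \<one>\<^bsub>B\<^esub>"
    and bd: "\<And>x. x \<in> carrier A \<Longrightarrow> P (f x) \<le> N x"
  obtains h where "unital_star_hom (completion A N) (completion B P) h"
    "\<And>x. x \<in> carrier A \<Longrightarrow> h (embed A N x) = embed B P (f x)"
proof -
  interpret A: seminormed_star_alg A N by fact
  interpret B: seminormed_star_alg B P by fact
  define h where "h = restrict (\<lambda>c. B.cls (\<lambda>k. f (rep c k))) (carrier A.C)"
  have minus: "f (x \<ominus>\<^bsub>A\<^esub> y) = f x \<ominus>\<^bsub>B\<^esub> f y" if "x \<in> carrier A" "y \<in> carrier A" for x y
    using that by (simp add: A.minus_smult B.minus_smult f add smult)
  have fX: "(\<lambda>k. f (X k)) \<in> B.CS" if X: "X \<in> A.CS" for X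
  proof (rule B.CS_I)
    fix e :: real assume "0 < e"
    then obtain M where M: "\<And>j k. \<lbrakk>j \<ge> M; k \<ge> M\<rbrakk> \<Longrightarrow> N (X j \<ominus>\<^bsub>A\<^esub> X k) < e" using A.CS_D[OF X] by blast
    have "P (f (X j) \<ominus>\<^bsub>B\<^esub> f (X k)) < e" if "j \<ge> M" "k \<ge> M" for j k
      using M[OF that] bd[of "X j \<ominus>\<^bsub>A\<^esub> X k"] A.CS_closed[OF X] by (simp add: minus)
    then show "\<exists>M. \<forall>j\<ge>M. \<forall>k\<ge>M. P (f (X j) \<ominus>\<^bsub>B\<^esub> f (X k)) < e" by blast
  qed (use f A.CS_closed[OF X] in auto)
  have h: "h (A.cls X) = B.cls (\<lambda>k. f (X k))" if X: "X \<in> A.CS" for X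
  proof -
    note R = A.rep_cls[OF X]
    have "B.null (\<lambda>k. f (X k)) (\<lambda>k. f (rep (A.cls X) k))"
      by (rule B.null_squeeze[OF R(2)])
        (use X R f bd in \<open>auto simp: A.CS_closed minus[symmetric]\<close>)
    then have "B.cls (\<lambda>k. f (X k)) = B.cls (\<lambda>k. f (rep (A.cls X) k))"
      using B.cls_eq_iff[OF fX[OF X] fX[OF R(1)]] by simp
    then show ?thesis using X by (simp add: h_def A.cls_closed)
  qed
  have emb: "h (embed A N x) = embed B P (f x)" if "x \<in> carrier A" for x
    using that by (simp add: A.embed_eq B.embed_eq h A.CS_const)
  have "unital_star_hom A.C B.C h"
    unfolding unital_star_hom_def
  proof (intro conjI ballI allI)
    show "h \<one>\<^bsub>A.C\<^esub> = \<one>\<^bsub>B.C\<^esub>" using emb[of "\<one>\<^bsub>A\<^esub>"] one by (simp add: A.embed_one B.embed_one)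
    show "h \<in> carrier A.C \<rightarrow>\<^sub>E carrier B.C"
    proof
      show "h x \<in> carrier B.C" if "x \<in> carrier A.C" for x
        using that by (auto elim!: A.C_cases simp: h fX intro!: B.cls_closed)
    qed (simp add: h_def)
    fix x y c assume "x \<in> carrier A.C" "y \<in> carrier A.C"
    then obtain X Y where X: "X \<in> A.CS" "x = A.cls X" and Y: "Y \<in> A.CS" "y = A.cls Y" by (metis A.C_cases)
    note [simp] = X Y A.C_ops A.CS_closeds A.CS_closed[OF X(1)] A.CS_closed[OF Y(1)] h fX B.C_ops
    show "h (x \<oplus>\<^bsub>A.C\<^esub> y) = h x \<oplus>\<^bsub>B.C\<^esub> h y" by (simp add: add)
    show "h (c \<odot>\<^bsub>A.C\<^esub> x) = c \<odot>\<^bsub>B.C\<^esub> h x" by (simp add: smult)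
    show "h (x \<otimes>\<^bsub>A.C\<^esub> y) = h x \<otimes>\<^bsub>B.C\<^esub> h y" by (simp add: mult)
    show "h (adj A.C x) = adj B.C (h x)" by (simp add: adj)
    show "nrm B.C (h x) \<le> nrm A.C x"
      using LIMSEQ_le[OF B.C_nrm[OF fX[OF X(1)]] A.C_nrm[OF X(1)]] bd by auto
  qed
  then show thesis using that emb by blast
qed

text \<open>Both maps are contractive and agree on a dense set, so their distance at a point is at
  most twice the distance from that point to its approximants.\<close>

lemma hom_unique:
  assumes "seminormed_star_alg A N" "seminormed_star_alg B P"
    and h: "unital_star_hom (completion A N) (completion B P) h"
    and h': "unital_star_hom (completion A N) (completion B P) h'"
    and eq: "\<And>x. x \<in> carrier A \<Longrightarrow> h (embed A N x) = h' (embed A N x)"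
  shows "h = h'"
proof (rule extensionalityI)
  interpret A: seminormed_star_alg A N by fact
  interpret B: seminormed_star_alg B P by fact
  interpret CA: seminormed_star_alg A.C "nrm A.C" by (rule A.seminormed_C)
  interpret CB: seminormed_star_alg B.C "nrm B.C" by (rule B.seminormed_C)
  show "h \<in> extensional (carrier A.C)" "h' \<in> extensional (carrier A.C)"
    using h h' by (auto simp: unital_star_hom_def PiE_def)
  have diff: "nrm B.C (g x \<ominus>\<^bsub>B.C\<^esub> g y) \<le> nrm A.C (x \<ominus>\<^bsub>A.C\<^esub> y)"
    if g: "unital_star_hom A.C B.C g" and "x \<in> carrier A.C" "y \<in> carrier A.C" for g x y
  proof -
    have "g x \<in> carrier B.C" "g y \<in> carrier B.C" using that by (auto simp: unital_star_hom_def)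
    then have "g (x \<ominus>\<^bsub>A.C\<^esub> y) = g x \<ominus>\<^bsub>B.C\<^esub> g y"
      using that by (simp add: unital_star_hom_def CA.minus_smult CB.minus_smult)
    then show ?thesis using that unfolding unital_star_hom_def by (metis CA.minus_closed)
  qed
  fix x assume x: "x \<in> carrier A.C"
  then obtain X where X: "X \<in> A.CS" "x = A.cls X" by (rule A.C_cases)
  have hx: "h x \<in> carrier B.C" "h' x \<in> carrier B.C" using x h h' by (auto simp: unital_star_hom_def)
  let ?e = "\<lambda>j. embed A N (X j)"
  have e: "?e j \<in> carrier A.C" "h (?e j) \<in> carrier B.C" "h' (?e j) = h (?e j)" for j
    using A.CS_closed[OF X(1)] h h' eq by (auto simp: unital_star_hom_def PiE_iff)
  have "nrm B.C (h x \<ominus>\<^bsub>B.C\<^esub> h' x) \<le> nrm A.C (x \<ominus>\<^bsub>A.C\<^esub> ?e j) + nrm A.C (x \<ominus>\<^bsub>A.C\<^esub> ?e j)" for j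
    using CB.N_minus_triangle[of "h x" "h (?e j)" "h' x"] diff[OF h x e(1)[of j]] diff[OF h' x e(1)[of j]]
      CB.N_minus_commute[of "h (?e j)" "h' x"] hx e[of j] by simp
  then have "nrm B.C (h x \<ominus>\<^bsub>B.C\<^esub> h' x) \<le> 0"
    using tendsto_add[OF A.embed_tendsto[OF X(1)] A.embed_tendsto[OF X(1)]] X(2)
    by (intro LIMSEQ_le_const[where X = "\<lambda>j. nrm A.C (x \<ominus>\<^bsub>A.C\<^esub> ?e j) + nrm A.C (x \<ominus>\<^bsub>A.C\<^esub> ?e j)"]) auto
  then show "h x = h' x" using hx CB.N_nonneg[of "h x \<ominus>\<^bsub>B.C\<^esub> h' x"] by (intro B.C_eqI) auto
qed

section \<open>The universal seminorm\<close>

lemma zero_cstar_seminorm: "cstar_seminorm A (\<lambda>_. 0)"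
  by (simp add: cstar_seminorm_def)

text \<open>A pointwise finite supremum of C*-seminorms is again a C*-seminorm. The zero seminorm
  makes the family nonempty and the supremum nonnegative.\<close>

lemma universal_seminorm_cstar:
  fixes A :: "('a, 'x) star_algebra_scheme" (structure)
  assumes "star_alg A"
    and bdd: "\<forall>x\<in>carrier A. \<exists>B. \<forall>p. cstar_seminorm A p \<and> (\<forall>r\<in>R. p r = 0) \<longrightarrow> p x \<le> B"
  shows "seminormed_star_alg A (universal_seminorm A R)"
    and "\<And>p x. \<lbrakk>cstar_seminorm A p; \<And>r. r \<in> R \<Longrightarrow> p r = 0; x \<in> carrier A\<rbrakk> \<Longrightarrow> p x \<le> universal_seminorm A R x"
    and "\<And>r. r \<in> R \<Longrightarrow> universal_seminorm A R r = 0"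
proof -
  interpret star_alg A by fact
  let ?P = "{p. cstar_seminorm A p \<and> (\<forall>r\<in>R. p r = 0)}" and ?N = "universal_seminorm A R"
  have ne: "?P \<noteq> {}" using zero_cstar_seminorm[of A] by blast
  have upper: "p x \<le> ?N x" if p: "p \<in> ?P" and x: "x \<in> carrier A" for p x
  proof -
    obtain B where "\<forall>p. cstar_seminorm A p \<and> (\<forall>r\<in>R. p r = 0) \<longrightarrow> p x \<le> B" using bdd x by auto
    then have "bdd_above ((\<lambda>p. p x) ` ?P)" by (intro bdd_aboveI2[where M = B]) blast
    then show ?thesis unfolding universal_seminorm_def by (rule cSUP_upper[OF p])
  qed
  have least: "?N x \<le> b" if "\<And>p. p \<in> ?P \<Longrightarrow> p x \<le> b" for x b
    unfolding universal_seminorm_def using ne that by (rule cSUP_least)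
  show "\<And>p x. \<lbrakk>cstar_seminorm A p; \<And>r. r \<in> R \<Longrightarrow> p r = 0; x \<in> carrier A\<rbrakk> \<Longrightarrow> p x \<le> ?N x"
    using upper by blast
  show "?N r = 0" if "r \<in> R" for r
  proof -
    have "(\<lambda>p. p r) ` ?P = {0}" using that ne zero_cstar_seminorm[of A] by force
    then show ?thesis unfolding universal_seminorm_def by simp
  qed
  have nonneg: "0 \<le> ?N x" if "x \<in> carrier A" for x
    using upper[of "\<lambda>_. 0" x] that zero_cstar_seminorm[of A] by simp
  have P: "seminormed_star_alg A p" if "p \<in> ?P" for p
    using that by (simp add: seminormed_star_alg_def seminormed_star_alg_axioms_def star_alg_axioms)
  have smult_le: "?N (c \<odot> x) \<le> cmod c * ?N x" if x: "x \<in> carrier A" for c x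
    by (rule least) (use upper x P in \<open>auto simp: seminormed_star_alg.N_smult[OF P] intro!: mult_left_mono\<close>)
  have "cstar_seminorm A ?N"
    unfolding cstar_seminorm_def
  proof (intro conjI ballI allI)
    fix x y c assume xy: "x \<in> carrier A" "y \<in> carrier A"
    show "0 \<le> ?N x" using nonneg xy by blast
    show "?N (c \<odot> x) = cmod c * ?N x"
    proof (cases "c = 0")
      case True
      then show ?thesis using smult_le[OF xy(1), of c] nonneg[of "c \<odot> x"] xy by auto
    next
      case False
      \<comment> \<open>The inequality already proved, used for \<open>inverse c\<close> at
        \<open>c \<odot> x\<close>, gives the reverse direction.\<close>
      have "?N x \<le> cmod (inverse c) * ?N (c \<odot> x)"
        using smult_le[of "c \<odot> x" "inverse c"] xy False by (simp add: smult_smult)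
      then have "cmod c * ?N x \<le> cmod c * (cmod (inverse c) * ?N (c \<odot> x))" by (intro mult_left_mono) auto
      also have "\<dots> = ?N (c \<odot> x)" using False by (simp add: norm_inverse)
      finally show ?thesis using smult_le[OF xy(1), of c] by simp
    qed
    show "?N (x \<oplus> y) \<le> ?N x + ?N y"
    proof (rule least)
      fix p assume p: "p \<in> ?P"
      show "p (x \<oplus> y) \<le> ?N x + ?N y"
        using seminormed_star_alg.N_triangle[OF P[OF p] xy] upper[OF p xy(1)] upper[OF p xy(2)] by linarith
    qed
    show "?N (x \<otimes> y) \<le> ?N x * ?N y"
    proof (rule least)
      fix p assume p: "p \<in> ?P"
      have "p x * p y \<le> ?N x * ?N y"
        using upper[OF p xy(1)] upper[OF p xy(2)] nonneg[OF xy(1)] seminormed_star_alg.N_nonneg[OF P[OF p]] xy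
        by (intro mult_mono) auto
      then show "p (x \<otimes> y) \<le> ?N x * ?N y"
        using seminormed_star_alg.N_mult[OF P[OF p] xy] by linarith
    qed
    show "?N (adj A x \<otimes> x) = (?N x)\<^sup>2"
    proof (rule antisym)
      show "?N (adj A x \<otimes> x) \<le> (?N x)\<^sup>2"
      proof (rule least)
        fix p assume p: "p \<in> ?P"
        show "p (adj A x \<otimes> x) \<le> (?N x)\<^sup>2"
          using seminormed_star_alg.N_star[OF P[OF p] xy(1)] upper[OF p xy(1)] seminormed_star_alg.N_nonneg[OF P[OF p] xy(1)]
          by (simp add: power_mono)
      qed
      \<comment> \<open>A least upper bound can be compared with \<open>p x\<close>, not with its
        square; hence the root on the other side.\<close>
      have "?N x \<le> sqrt (?N (adj A x \<otimes> x))"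
      proof (rule least)
        fix p assume p: "p \<in> ?P"
        have "(p x)\<^sup>2 \<le> ?N (adj A x \<otimes> x)"
          using seminormed_star_alg.N_star[OF P[OF p] xy(1)] upper[OF p, of "adj A x \<otimes> x"] xy by simp
        then show "p x \<le> sqrt (?N (adj A x \<otimes> x))" by (rule real_le_rsqrt)
      qed
      then have "(?N x)\<^sup>2 \<le> (sqrt (?N (adj A x \<otimes> x)))\<^sup>2" using nonneg xy by (intro power_mono) auto
      then show "(?N x)\<^sup>2 \<le> ?N (adj A x \<otimes> x)" using nonneg xy by simp
    qed
  qed
  then show "seminormed_star_alg A ?N"
    by (simp add: seminormed_star_alg_def seminormed_star_alg_axioms_def star_alg_axioms)
qed

section \<open>Positive forms and functionals\<close>

text \<open>Forms are isolated from functionals because the tensor product needs positive forms such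
  as the difference of ||a||^2 F(x^* y) and F(x^* a^* a y), in which an operator stands between the
  two arguments.\<close>

locale pos_form = star_alg A for A :: "('a, 'x) star_algebra_scheme" (structure) +
  fixes S :: "'a \<Rightarrow> 'a \<Rightarrow> complex"
  assumes S_add_r: "\<lbrakk>x \<in> carrier A; y \<in> carrier A; z \<in> carrier A\<rbrakk> \<Longrightarrow> S x (y \<oplus> z) = S x y + S x z"
    and S_add_l: "\<lbrakk>x \<in> carrier A; y \<in> carrier A; z \<in> carrier A\<rbrakk> \<Longrightarrow> S (y \<oplus> z) x = S y x + S z x"
    and S_smult_r: "\<lbrakk>x \<in> carrier A; y \<in> carrier A\<rbrakk> \<Longrightarrow> S x (c \<odot> y) = c * S x y"
    and S_smult_l: "\<lbrakk>x \<in> carrier A; y \<in> carrier A\<rbrakk> \<Longrightarrow> S (c \<odot> y) x = cnj c * S y x"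
    and S_pos: "x \<in> carrier A \<Longrightarrow> S x x \<in> \<real>\<^sub>\<ge>\<^sub>0"
begin

definition snorm :: "'a \<Rightarrow> real" where "snorm x = sqrt (Re (S x x))"

lemma S_self: "x \<in> carrier A \<Longrightarrow> S x x = of_real (Re (S x x))" "x \<in> carrier A \<Longrightarrow> 0 \<le> Re (S x x)"
  using S_pos[of x] by (auto simp: complex_nonneg_Reals_iff complex_eq_iff)

lemma snorm_nonneg: "x \<in> carrier A \<Longrightarrow> 0 \<le> snorm x"
  and snorm_sq: "x \<in> carrier A \<Longrightarrow> (snorm x)\<^sup>2 = Re (S x x)"
  using S_self(2)[of x] by (simp_all add: snorm_def)

lemma S_self_snorm: "x \<in> carrier A \<Longrightarrow> S x x = of_real ((snorm x)\<^sup>2)"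
  using S_self(1) snorm_sq by simp

lemma S_expand:
  assumes "x \<in> carrier A" "y \<in> carrier A"
  shows "S (x \<oplus> c \<odot> y) (x \<oplus> c \<odot> y) = S x x + c * S x y + cnj c * S y x + cnj c * c * S y y"
  using assms by (simp add: S_add_r S_add_l S_smult_r S_smult_l algebra_simps)

text \<open>Positivity already forces hermitian symmetry: the values at x + y and x + i y are real,
  and their imaginary parts compare \<open>S x y\<close> with \<open>S y x\<close>.\<close>

lemma S_cnj:
  assumes x: "x \<in> carrier A" and y: "y \<in> carrier A" shows "S y x = cnj (S x y)"
proof -
  have im: "Im (S z z) = 0" if "z \<in> carrier A" for z
    using S_pos[OF that] by (simp add: complex_nonneg_Reals_iff)
  have "Im (S (x \<oplus> 1 \<odot> y) (x \<oplus> 1 \<odot> y)) = 0" "Im (S (x \<oplus> \<i> \<odot> y) (x \<oplus> \<i> \<odot> y)) = 0"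
    by (rule im; use x y in simp)+
  then have "Im (S x y) + Im (S y x) = 0" "Re (S x y) - Re (S y x) = 0"
    unfolding S_expand[OF x y] using im[OF x] im[OF y] by simp_all
  then show ?thesis by (simp add: complex_eq_iff)
qed

lemma S_expand_Re:
  assumes x: "x \<in> carrier A" and y: "y \<in> carrier A"
  shows "Re (S (x \<oplus> c \<odot> y) (x \<oplus> c \<odot> y)) = Re (S x x) + 2 * Re (c * S x y) + (cmod c)\<^sup>2 * Re (S y y)"
proof -
  have "cnj c * S y x = cnj (c * S x y)" unfolding complex_cnj_mult S_cnj[OF x y] ..
  then have 1: "Re (cnj c * S y x) = Re (c * S x y)" by (simp only: cnj.simps)
  have "cnj c * c = of_real ((cmod c)\<^sup>2)"
    by (metis complex_norm_square mult.commute)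
  then have "Re (cnj c * c * S y y) = (cmod c)\<^sup>2 * Re (S y y)" by (simp del: of_real_power)
  then show ?thesis unfolding S_expand[OF x y] plus_complex.sel using 1 by linarith
qed

lemma Cauchy_Schwarz:
  assumes x: "x \<in> carrier A" and y: "y \<in> carrier A" shows "cmod (S x y) \<le> snorm x * snorm y"
proof -
  define a b c where "a = Re (S x x)" and "b = Re (S y y)" and "c = S x y"
  have ab: "0 \<le> a" "0 \<le> b" using S_self(2) x y by (auto simp: a_def b_def)
  \<comment> \<open>The phase \<open>cnj c\<close> in the coefficient makes the cross term real;
    only the real parameter \<open>r\<close> remains to be chosen.\<close>
  have *: "0 \<le> a - 2 * r * (cmod c)\<^sup>2 + r\<^sup>2 * (cmod c)\<^sup>2 * b" for r :: real
  proof -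
    have 1: "Re (- (complex_of_real r) * cnj c * c) = - r * (cmod c)\<^sup>2"
      by (simp add: cmod_power2) (simp add: power2_eq_square algebra_simps)
    have 2: "(cmod (- (complex_of_real r) * cnj c))\<^sup>2 = r\<^sup>2 * (cmod c)\<^sup>2"
      by (simp add: norm_mult power_mult_distrib)
    have "0 \<le> Re (S (x \<oplus> (- of_real r * cnj c) \<odot> y) (x \<oplus> (- of_real r * cnj c) \<odot> y))"
      using x y by (intro S_self(2)) auto
    also have "\<dots> = a + 2 * (- r * (cmod c)\<^sup>2) + r\<^sup>2 * (cmod c)\<^sup>2 * b"
      unfolding S_expand_Re[OF x y] a_def[symmetric] b_def[symmetric] c_def[symmetric] 1 2 ..
    finally show ?thesis by simp
  qed
  have "(cmod c)\<^sup>2 \<le> a * b"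
  proof (cases "b = 0")
    case True
    have "c = 0"
    proof (rule ccontr)
      assume "c \<noteq> 0"
      \<comment> \<open>With \<open>b = 0\<close> the bound is affine in \<open>r\<close>, and at
        this \<open>r\<close> it equals -1.\<close>
      then show False using *[of "(a + 1) / (2 * (cmod c)\<^sup>2)"] True ab by simp
    qed
    then show ?thesis using ab by simp
  next
    case False
    \<comment> \<open>The quadratic in \<open>r\<close> has its minimum at
      \<open>1 / b\<close>.\<close>
    then have "0 \<le> a - (cmod c)\<^sup>2 / b" using *[of "1 / b"] by (simp add: power2_eq_square)
    then show ?thesis using False ab by (simp add: field_simps)
  qed
  then have "(cmod c)\<^sup>2 \<le> (snorm x * snorm y)\<^sup>2"
    using x y by (simp add: power_mult_distrib snorm_sq a_def b_def)
  then show ?thesis unfolding c_def by (rule power2_le_imp_le) (simp add: snorm_nonneg x y)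
qed

lemma snorm_smult: "x \<in> carrier A \<Longrightarrow> snorm (c \<odot> x) = cmod c * snorm x"
proof -
  assume x: "x \<in> carrier A"
  have "S (c \<odot> x) (c \<odot> x) = of_real ((cmod c)\<^sup>2) * S x x"
    using x by (simp add: S_smult_r S_smult_l complex_norm_square mult.assoc mult.left_commute del: of_real_power)
  then show ?thesis by (simp add: snorm_def real_sqrt_mult)
qed

lemma snorm_triangle:
  assumes x: "x \<in> carrier A" and y: "y \<in> carrier A" shows "snorm (x \<oplus> y) \<le> snorm x + snorm y"
proof (rule power2_le_imp_le)
  have "Re (S x y) \<le> snorm x * snorm y" using Cauchy_Schwarz[OF x y] complex_Re_le_cmod order_trans by blast
  then show "(snorm (x \<oplus> y))\<^sup>2 \<le> (snorm x + snorm y)\<^sup>2"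
    using S_expand_Re[OF x y, of 1] x y by (simp add: snorm_sq power2_sum)
qed (use x y snorm_nonneg in auto)

lemma S_null: "\<lbrakk>x \<in> carrier A; y \<in> carrier A; S x x = 0\<rbrakk> \<Longrightarrow> S x y = 0"
  "\<lbrakk>x \<in> carrier A; y \<in> carrier A; S x x = 0\<rbrakk> \<Longrightarrow> S y x = 0"
  using Cauchy_Schwarz[of x y] Cauchy_Schwarz[of y x] by (simp_all add: snorm_def)

text \<open>Schur's product theorem, by Gram-Schmidt elimination of one vector at a time.\<close>

lemma schur_product:
  assumes "finite I" "\<And>i. i \<in> I \<Longrightarrow> b i \<in> carrier A"
    and "\<And>c. (\<Sum>i\<in>I. \<Sum>j\<in>I. cnj (c i) * c j * M i j) \<in> \<real>\<^sub>\<ge>\<^sub>0"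
  shows "(\<Sum>i\<in>I. \<Sum>j\<in>I. M i j * S (b i) (b j)) \<in> \<real>\<^sub>\<ge>\<^sub>0"
  using assms
proof (induction I arbitrary: b rule: finite_induct)
  case (insert k I)
  let ?e = "b k" and ?J = "insert k I"
  have e: "?e \<in> carrier A" and b: "\<And>i. i \<in> ?J \<Longrightarrow> b i \<in> carrier A" using insert.prems by auto
  define N where "N = S ?e ?e"
  \<comment> \<open>The component of \<open>b i\<close> orthogonal to \<open>?e\<close>. If
    \<open>N = 0\<close>, division by zero returns 0, so \<open>b' i\<close> is \<open>b i\<close>
    and the correction term in \<open>split\<close> is 0 too.\<close>
  define b' where "b' i = b i \<oplus> (- (S ?e (b i) / N)) \<odot> ?e" for i
  have b': "b' i \<in> carrier A" if "i \<in> ?J" for i using b[OF that] e by (simp add: b'_def)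
  have Nr: "cnj N = N" using S_self(1)[OF e] unfolding N_def by (metis complex_cnj_complex_of_real)
  have split: "S (b i) (b j) = S (b' i) (b' j) + cnj (S ?e (b i)) * S ?e (b j) / N" if "i \<in> ?J" "j \<in> ?J" for i j
  proof (cases "N = 0")
    case True then show ?thesis using b[OF that(1)] b[OF that(2)] e by (simp add: b'_def)
  next
    case False
    then show ?thesis
      using b[OF that(1)] b[OF that(2)] e S_cnj[OF e b[OF that(1)]] Nr
      by (simp add: b'_def S_add_r S_add_l S_smult_r S_smult_l N_def[symmetric] field_simps)
  qed
  have kz: "S (b' k) x = 0" "S x (b' k) = 0" if x: "x \<in> carrier A" for x
  proof -
    have "S (b' k) (b' k) = 0"
      using e Nr by (cases "N = 0") (auto simp: b'_def S_add_r S_add_l S_smult_r S_smult_l N_def[symmetric])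
    then show "S (b' k) x = 0" "S x (b' k) = 0" using S_null[OF b'[of k] x] by auto
  qed
  have A1: "(\<Sum>i\<in>I. \<Sum>j\<in>I. M i j * S (b' i) (b' j)) \<in> \<real>\<^sub>\<ge>\<^sub>0"
  proof (rule insert.IH)
    fix c :: "'b \<Rightarrow> complex"
    \<comment> \<open>Testing the matrix on vectors that vanish at \<open>k\<close> restricts its
      positivity to \<open>I\<close>.\<close>
    define c' where "c' i = (if i = k then 0 else c i)" for i
    have "(\<Sum>i\<in>?J. \<Sum>j\<in>?J. cnj (c' i) * c' j * M i j) = (\<Sum>i\<in>I. \<Sum>j\<in>I. cnj (c i) * c j * M i j)"
      using insert.hyps by (auto simp: c'_def intro!: sum.cong)
    then show "(\<Sum>i\<in>I. \<Sum>j\<in>I. cnj (c i) * c j * M i j) \<in> \<real>\<^sub>\<ge>\<^sub>0" using insert.prems(2)[of c'] by simp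
  qed (use b' in auto)
  \<comment> \<open>The vector \<open>b' k\<close> is null, so the index \<open>k\<close> can be put
    back at no cost.\<close>
  have A2: "(\<Sum>i\<in>I. \<Sum>j\<in>I. M i j * S (b' i) (b' j)) = (\<Sum>i\<in>?J. \<Sum>j\<in>?J. M i j * S (b' i) (b' j))"
    using insert.hyps kz b' by simp
  \<comment> \<open>The eliminated part is rank one: up to the factor \<open>inverse N\<close> it is
    the matrix \<open>M\<close> tested on the vector with entries \<open>S ?e (b i)\<close>.\<close>
  have A3: "(\<Sum>i\<in>?J. \<Sum>j\<in>?J. M i j * (cnj (S ?e (b i)) * S ?e (b j) / N)) \<in> \<real>\<^sub>\<ge>\<^sub>0"
  proof -
    have "N \<in> \<real>\<^sub>\<ge>\<^sub>0" unfolding N_def by (rule S_pos[OF e])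
    then have "inverse N * (\<Sum>i\<in>?J. \<Sum>j\<in>?J. cnj (S ?e (b i)) * S ?e (b j) * M i j) \<in> \<real>\<^sub>\<ge>\<^sub>0"
      using insert.prems(2) by (intro nonneg_Reals_mult_I nonneg_Reals_inverse_I)
    also have "inverse N * (\<Sum>i\<in>?J. \<Sum>j\<in>?J. cnj (S ?e (b i)) * S ?e (b j) * M i j) =
        (\<Sum>i\<in>?J. \<Sum>j\<in>?J. M i j * (cnj (S ?e (b i)) * S ?e (b j) / N))"
      unfolding sum_distrib_left by (intro sum.cong refl) (simp add: divide_inverse mult_ac)
    finally show ?thesis .
  qed
  have "(\<Sum>i\<in>?J. \<Sum>j\<in>?J. M i j * S (b' i) (b' j)) +
      (\<Sum>i\<in>?J. \<Sum>j\<in>?J. M i j * (cnj (S ?e (b i)) * S ?e (b j) / N)) \<in> \<real>\<^sub>\<ge>\<^sub>0"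
    by (rule nonneg_Reals_add_I[OF A1[unfolded A2] A3])
  also have "(\<Sum>i\<in>?J. \<Sum>j\<in>?J. M i j * S (b' i) (b' j)) +
      (\<Sum>i\<in>?J. \<Sum>j\<in>?J. M i j * (cnj (S ?e (b i)) * S ?e (b j) / N)) =
      (\<Sum>i\<in>?J. \<Sum>j\<in>?J. M i j * S (b i) (b j))"
    unfolding sum.distrib[symmetric] by (intro sum.cong refl) (simp only: split distrib_left[symmetric])
  finally show ?case .
qed simp

end

lemma psd_rank_one: "(\<Sum>i\<in>I. \<Sum>j\<in>I. cnj (c i) * c j * (cnj (d i) * d j)) \<in> \<real>\<^sub>\<ge>\<^sub>0"
proof -
  have "(\<Sum>i\<in>I. \<Sum>j\<in>I. cnj (c i) * c j * (cnj (d i) * d j)) = cnj (\<Sum>i\<in>I. c i * d i) * (\<Sum>i\<in>I. c i * d i)"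
    unfolding cnj_sum sum_product by (intro sum.cong refl) (simp add: mult_ac)
  also have "\<dots> = of_real ((cmod (\<Sum>i\<in>I. c i * d i))\<^sup>2)"
    by (metis complex_norm_square mult.commute)
  finally show ?thesis by (simp only: nonneg_Reals_of_real_iff zero_le_power2)
qed

text \<open>Two applications of Schur's theorem: a rank-one matrix against \<open>S\<close> shows
  that the weighted Gram matrix of the \<open>a i\<close> is positive, and this matrix is then
  paired with \<open>T\<close>.\<close>

lemma schur_product_forms:
  assumes "pos_form A S" "pos_form B T"
    and I: "finite I" and a: "\<And>i. i \<in> I \<Longrightarrow> a i \<in> carrier A" and b: "\<And>i. i \<in> I \<Longrightarrow> b i \<in> carrier B"
  shows "(\<Sum>i\<in>I. \<Sum>j\<in>I. cnj (x i) * x j * (S (a i) (a j) * T (b i) (b j))) \<in> \<real>\<^sub>\<ge>\<^sub>0"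
proof -
  have "(\<Sum>i\<in>I. \<Sum>j\<in>I. cnj (c i) * c j * (cnj (x i) * x j * S (a i) (a j))) \<in> \<real>\<^sub>\<ge>\<^sub>0" for c
  proof -
    have "(\<Sum>i\<in>I. \<Sum>j\<in>I. cnj (d i) * d j * (cnj (c i * x i) * (c j * x j))) \<in> \<real>\<^sub>\<ge>\<^sub>0" for d
      by (rule psd_rank_one)
    from pos_form.schur_product[OF assms(1) I a this] show ?thesis by (simp add: mult_ac)
  qed
  from pos_form.schur_product[OF assms(2) I b this] show ?thesis by (simp add: mult_ac)
qed

section \<open>Positive functionals and the operator norm of their GNS action\<close>

locale pos_functional = star_alg A for A :: "('a, 'x) star_algebra_scheme" (structure) +
  fixes F :: "'a \<Rightarrow> complex"
  assumes F_add: "\<lbrakk>x \<in> carrier A; y \<in> carrier A\<rbrakk> \<Longrightarrow> F (x \<oplus> y) = F x + F y"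
    and F_smult: "x \<in> carrier A \<Longrightarrow> F (c \<odot> x) = c * F x"
    and F_pos: "x \<in> carrier A \<Longrightarrow> F (adj A x \<otimes> x) \<in> \<real>\<^sub>\<ge>\<^sub>0"
begin

sublocale pos_form A "\<lambda>x y. F (adj A x \<otimes> y)"
  by standard (simp_all add: F_add F_smult F_pos l_distr r_distr smult_mult_l smult_mult_r adj_add adj_smult)

lemma F_adj: "x \<in> carrier A \<Longrightarrow> F (adj A x) = cnj (F x)"
  using S_cnj[of \<one> x] by simp

text \<open>In the GNS picture ||x y||^2 = <y, x^* x y>, to which Cauchy-Schwarz applies. Both the
  C*-identity for \<open>gns\<close> and the bound \<open>snorm_mult_le\<close> come from
  this.\<close>

lemma snorm_mult_sq:
  "\<lbrakk>x \<in> carrier A; y \<in> carrier A\<rbrakk> \<Longrightarrow> (snorm (x \<otimes> y))\<^sup>2 \<le> snorm y * snorm (adj A x \<otimes> x \<otimes> y)"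
  using Cauchy_Schwarz[of y "adj A x \<otimes> x \<otimes> y"] complex_Re_le_cmod[of "F (adj A y \<otimes> (adj A x \<otimes> x \<otimes> y))"]
  by (simp add: snorm_sq adj_mult m_assoc)

end

text \<open>The assumption says that the GNS operators are bounded; a positive functional on a bare
  algebra need not give such operators.\<close>

locale bounded_functional = pos_functional +
  assumes bounded: "x \<in> carrier A \<Longrightarrow> \<exists>c. \<forall>y\<in>carrier A. snorm (x \<otimes> y) \<le> c * snorm y"
begin

text \<open>The operator norm of \<open>x\<close> in the GNS representation, computed on the algebra
  before any completion or quotient by null vectors.\<close>

definition gns :: "'a \<Rightarrow> real" where
  "gns x = (SUP y\<in>{y \<in> carrier A. snorm y \<le> 1}. snorm (x \<otimes> y))"

lemma snorm_zero [simp]: "snorm \<zero> = 0"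
  using snorm_smult[of \<zero> 0] by simp

lemma snorm_gns:
  assumes x: "x \<in> carrier A" and y: "y \<in> carrier A" shows "snorm (x \<otimes> y) \<le> gns x * snorm y"
proof -
  obtain c where c: "\<And>y. y \<in> carrier A \<Longrightarrow> snorm (x \<otimes> y) \<le> c * snorm y" using bounded[OF x] by blast
  show ?thesis
  proof (cases "snorm y = 0")
    case True then show ?thesis using c[OF y] by simp
  next
    case False
    define y' where "y' = of_real (inverse (snorm y)) \<odot> y"
    have pos: "0 < snorm y" using False snorm_nonneg[OF y] by simp
    have y': "y' \<in> carrier A" "snorm y' = 1" using y pos by (simp_all add: y'_def snorm_smult norm_inverse)
    have "snorm (x \<otimes> y) = snorm y * snorm (x \<otimes> y')"
      using x y pos by (simp add: y'_def smult_mult_r snorm_smult norm_inverse)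
    moreover have "snorm (x \<otimes> y') \<le> gns x"
      unfolding gns_def
    proof (rule cSUP_upper)
      show "bdd_above ((\<lambda>y. snorm (x \<otimes> y)) ` {y \<in> carrier A. snorm y \<le> 1})"
      proof (rule bdd_aboveI2)
        fix z assume z: "z \<in> {y \<in> carrier A. snorm y \<le> 1}"
        have "snorm (x \<otimes> z) \<le> max c 0 * snorm z"
          using c[of z] z mult_right_mono[OF max.cobounded1[of c 0] snorm_nonneg[of z]] by auto
        also have "\<dots> \<le> max c 0 * 1" using z by (intro mult_left_mono) auto
        finally show "snorm (x \<otimes> z) \<le> max c 0" by simp
      qed
    qed (use y' in auto)
    ultimately show ?thesis using pos by (simp add: mult.commute)
  qed
qed

lemma gns_least:
  assumes "0 \<le> c" "\<And>y. y \<in> carrier A \<Longrightarrow> snorm (x \<otimes> y) \<le> c * snorm y" shows "gns x \<le> c"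
  unfolding gns_def
proof (rule cSUP_least)
  show "{y \<in> carrier A. snorm y \<le> 1} \<noteq> {}" using snorm_zero by force
  fix y assume "y \<in> {y \<in> carrier A. snorm y \<le> 1}"
  then have "snorm (x \<otimes> y) \<le> c * snorm y" "c * snorm y \<le> c * 1"
    using assms mult_left_mono[of "snorm y" 1 c] by auto
  then show "snorm (x \<otimes> y) \<le> c" by simp
qed

lemma gns_nonneg:
  assumes x: "x \<in> carrier A" shows "0 \<le> gns x"
proof -
  obtain c where c: "\<And>y. y \<in> carrier A \<Longrightarrow> snorm (x \<otimes> y) \<le> c * snorm y" using bounded[OF x] by blast
  have "snorm (x \<otimes> \<zero>) \<le> gns x"
    unfolding gns_def
  proof (rule cSUP_upper)
    show "bdd_above ((\<lambda>y. snorm (x \<otimes> y)) ` {y \<in> carrier A. snorm y \<le> 1})"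
      using snorm_gns[OF x]
    proof (intro bdd_aboveI2)
      fix z assume z: "z \<in> {y \<in> carrier A. snorm y \<le> 1}"
      have "snorm (x \<otimes> z) \<le> \<bar>gns x\<bar> * snorm z"
        using snorm_gns[OF x, of z] z mult_right_mono[OF abs_ge_self[of "gns x"] snorm_nonneg[of z]] by auto
      also have "\<dots> \<le> \<bar>gns x\<bar> * 1" using z by (intro mult_left_mono) auto
      finally show "snorm (x \<otimes> z) \<le> \<bar>gns x\<bar>" by simp
    qed
  qed (use snorm_zero in auto)
  then show ?thesis using x by simp
qed

text \<open>\<open>snorm_mult_sq\<close> bounds the square of \<open>gns x\<close> by
  \<open>gns (adj A x \<otimes> x)\<close>. The same inequality yields equality of
  \<open>gns\<close> at \<open>x\<close> and at its adjoint, and submultiplicativity then supplies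
  the converse bound.\<close>

lemma cstar_gns: "cstar_seminorm A gns"
proof -
  have smult_le: "gns (c \<odot> x) \<le> cmod c * gns x" if x: "x \<in> carrier A" for c x
  proof (rule gns_least)
    fix y assume y: "y \<in> carrier A"
    have "cmod c * snorm (x \<otimes> y) \<le> cmod c * (gns x * snorm y)" using snorm_gns[OF x y] by (intro mult_left_mono) auto
    then show "snorm (c \<odot> x \<otimes> y) \<le> cmod c * gns x * snorm y"
      using x y by (simp add: smult_mult_l snorm_smult mult.assoc)
  qed (use gns_nonneg[OF x] in auto)
  have mult: "gns (x \<otimes> y) \<le> gns x * gns y" if x: "x \<in> carrier A" and y: "y \<in> carrier A" for x y
  proof (rule gns_least)
    fix z assume z: "z \<in> carrier A"
    have "snorm (x \<otimes> (y \<otimes> z)) \<le> gns x * snorm (y \<otimes> z)" using x y z by (intro snorm_gns) auto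
    also have "\<dots> \<le> gns x * (gns y * snorm z)" using snorm_gns[OF y z] gns_nonneg[OF x] by (rule mult_left_mono)
    finally show "snorm (x \<otimes> y \<otimes> z) \<le> gns x * gns y * snorm z" using x y z by (simp add: m_assoc mult.assoc)
  qed (use gns_nonneg x y in auto)
  have star1: "(gns x)\<^sup>2 \<le> gns (adj A x \<otimes> x)" if x: "x \<in> carrier A" for x
  proof -
    have nn: "0 \<le> gns (adj A x \<otimes> x)" using gns_nonneg x by simp
    have "gns x \<le> sqrt (gns (adj A x \<otimes> x))"
    proof (rule gns_least)
      fix y assume y: "y \<in> carrier A"
      have "(snorm (x \<otimes> y))\<^sup>2 \<le> snorm y * (gns (adj A x \<otimes> x) * snorm y)"
        using snorm_mult_sq[OF x y] mult_left_mono[OF snorm_gns[of "adj A x \<otimes> x" y] snorm_nonneg[OF y]] x y by simp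
      also have "\<dots> = (sqrt (gns (adj A x \<otimes> x)) * snorm y)\<^sup>2"
        using nn by (simp add: power_mult_distrib) (simp add: power2_eq_square)
      finally show "snorm (x \<otimes> y) \<le> sqrt (gns (adj A x \<otimes> x)) * snorm y"
        by (rule power2_le_imp_le) (use nn snorm_nonneg[OF y] in auto)
    qed (use nn in auto)
    then have "(gns x)\<^sup>2 \<le> (sqrt (gns (adj A x \<otimes> x)))\<^sup>2" using gns_nonneg[OF x] by (intro power_mono) auto
    then show ?thesis using nn by simp
  qed
  have adj_le: "gns x \<le> gns (adj A x)" if x: "x \<in> carrier A" for x
  proof (cases "gns x = 0")
    case False
    then have "0 < gns x" using gns_nonneg[OF x] by simp
    moreover have "gns x * gns x \<le> gns (adj A x) * gns x"
      using star1[OF x] mult[of "adj A x" x] x by (simp add: power2_eq_square)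
    ultimately show ?thesis by simp
  qed (use x gns_nonneg in auto)
  show ?thesis
    unfolding cstar_seminorm_def
  proof (intro conjI ballI allI)
    fix x y c assume x: "x \<in> carrier A" and y: "y \<in> carrier A"
    show "0 \<le> gns x" by (rule gns_nonneg[OF x])
    show "gns (x \<otimes> y) \<le> gns x * gns y" by (rule mult[OF x y])
    show "gns (c \<odot> x) = cmod c * gns x"
    proof (cases "c = 0")
      case True
      then show ?thesis using smult_le[OF x, of c] gns_nonneg[of "c \<odot> x"] x by auto
    next
      case False
      have "gns x \<le> cmod (inverse c) * gns (c \<odot> x)"
        using smult_le[of "c \<odot> x" "inverse c"] x False by (simp add: smult_smult)
      then have "cmod c * gns x \<le> cmod c * (cmod (inverse c) * gns (c \<odot> x))" by (intro mult_left_mono) auto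
      also have "\<dots> = gns (c \<odot> x)" using False by (simp add: norm_inverse)
      finally show ?thesis using smult_le[OF x, of c] by simp
    qed
    show "gns (x \<oplus> y) \<le> gns x + gns y"
    proof (rule gns_least)
      fix z assume z: "z \<in> carrier A"
      show "snorm ((x \<oplus> y) \<otimes> z) \<le> (gns x + gns y) * snorm z"
        using snorm_triangle[of "x \<otimes> z" "y \<otimes> z"] snorm_gns[OF x z] snorm_gns[OF y z] x y z
        by (simp add: l_distr distrib_right)
    qed (use gns_nonneg x y in auto)
    show "gns (adj A x \<otimes> x) = (gns x)\<^sup>2"
    proof (rule antisym[OF _ star1[OF x]])
      have "gns (adj A x) = gns x" using adj_le[OF x] adj_le[of "adj A x"] x by simp
      then show "gns (adj A x \<otimes> x) \<le> (gns x)\<^sup>2" using mult[of "adj A x" x] x by (simp add: power2_eq_square)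
    qed
  qed
qed

lemma F_le_gns:
  assumes one: "F \<one> = 1" and x: "x \<in> carrier A" shows "cmod (F x) \<le> gns x"
proof -
  have "snorm \<one> = 1" using one by (simp add: snorm_def)
  then show ?thesis using Cauchy_Schwarz[of \<one> x] snorm_gns[OF x, of \<one>] x by simp
qed

lemma gns_null: "(\<And>y. y \<in> carrier A \<Longrightarrow> F (adj A (x \<otimes> y) \<otimes> (x \<otimes> y)) = 0) \<Longrightarrow> x \<in> carrier A \<Longrightarrow> gns x = 0"
  by (rule antisym[OF gns_least gns_nonneg]) (auto simp: snorm_def)

end

text \<open>Relations that act as zero make \<open>gns\<close> a competitor in the supremum, so the
  functional is dominated by the universal seminorm and extends continuously.\<close>

lemma (in bounded_functional) extend_universal:
  assumes one: "F \<one> = 1"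
    and null: "\<And>r y. \<lbrakk>r \<in> R; y \<in> carrier A\<rbrakk> \<Longrightarrow> F (adj A (r \<otimes> y) \<otimes> (r \<otimes> y)) = 0"
    and R: "R \<subseteq> carrier A"
    and bdd: "\<forall>x\<in>carrier A. \<exists>B. \<forall>p. cstar_seminorm A p \<and> (\<forall>r\<in>R. p r = 0) \<longrightarrow> p x \<le> B"
  obtains \<omega> where "state (completion A (universal_seminorm A R)) \<omega>"
    "\<And>x. x \<in> carrier A \<Longrightarrow> \<omega> (embed A (universal_seminorm A R) x) = F x"
proof -
  note U = universal_seminorm_cstar[OF star_alg_axioms bdd]
  interpret U: seminormed_star_alg A "universal_seminorm A R" by (rule U(1))
  have "gns x \<le> universal_seminorm A R x" if "x \<in> carrier A" for x
    using U(2)[OF cstar_gns] gns_null null R that by blast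
  then have "cmod (F x) \<le> universal_seminorm A R x" if "x \<in> carrier A" for x
    using F_le_gns[OF one that] that by force
  then show thesis using U.state_extend[of F] F_add F_smult F_pos one that by blast
qed

text \<open>If \<open>M < t\<close>, the powers of \<open>t / M\<close> outgrow every constant
  \<open>K\<close>. This removes the constant from an estimate that holds along repeated
  squaring.\<close>

lemma power_power_bound:
  fixes t M K :: real
  assumes t: "0 \<le> t" and M: "0 \<le> M" and le: "\<And>k. t ^ (2 ^ k) \<le> K * M ^ (2 ^ k)" shows "t \<le> M"
proof (rule ccontr)
  assume "\<not> t \<le> M"
  then have tM: "M < t" by simp
  show False
  proof (cases "M = 0")
    case True then show False using le[of 0] tM by simp
  next
    case False
    then have M0: "0 < M" using M by simp
    then have q: "1 < t / M" using tM by simp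
    obtain n where n: "K < (t / M) ^ n" using real_arch_pow[OF q] by blast
    have "(t / M) ^ n \<le> (t / M) ^ (2 ^ n)" using q by (intro power_increasing) auto
    also have "\<dots> \<le> K" using le[of n] M0 by (simp add: power_divide field_simps)
    finally show False using n by simp
  qed
qed

text \<open>Spectral radius argument. With h = a^* a, repeated use of ||h x||^2 \<le> ||x|| ||h^2
  x|| bounds a 2^k-th power by a quantity that the crude estimate \<open>snorm y \<le> N y\<close>
  controls up to a constant; taking roots removes the constant.\<close>

lemma (in pos_functional) snorm_mult_le:
  assumes "seminormed_star_alg A N" and FN: "\<And>x. x \<in> carrier A \<Longrightarrow> cmod (F x) \<le> N x"
    and a: "a \<in> carrier A" and x: "x \<in> carrier A"
  shows "snorm (a \<otimes> x) \<le> N a * snorm x"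
proof -
  interpret N: seminormed_star_alg A N by fact
  have nN: "snorm y \<le> N y" if y: "y \<in> carrier A" for y
  proof (rule power2_le_imp_le)
    show "(snorm y)\<^sup>2 \<le> (N y)\<^sup>2"
      using FN[of "adj A y \<otimes> y"] complex_Re_le_cmod[of "F (adj A y \<otimes> y)"] N.N_star[OF y] y by (simp add: snorm_sq)
  qed (use N.N_nonneg y in auto)
  define M where "M = (N a)\<^sup>2"
  \<comment> \<open>\<open>h k\<close> is the power of a^* a with exponent 2^k.\<close>
  define h where "h = rec_nat (adj A a \<otimes> a) (\<lambda>_ g. g \<otimes> g)"
  have h0: "h 0 = adj A a \<otimes> a" and hS: "h (Suc k) = h k \<otimes> h k" for k by (simp_all add: h_def)
  have hc: "h k \<in> carrier A \<and> adj A (h k) = h k \<and> N (h k) \<le> M ^ (2 ^ k)" for k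
  proof (induction k)
    case 0 then show ?case using a by (simp add: h0 adj_mult M_def N.N_star)
  next
    case (Suc k)
    have "N (h k) * N (h k) \<le> M ^ 2 ^ k * M ^ 2 ^ k"
      using Suc N.N_nonneg[of "h k"] by (intro mult_mono) (auto simp: M_def)
    then show ?case using Suc N.N_mult[of "h k" "h k"] by (simp add: hS adj_mult power_add[symmetric] mult_2)
  qed
  define r where "r k = snorm (h k \<otimes> x)" for k
  have r0: "0 \<le> r k" for k using hc[of k] x by (simp add: r_def snorm_nonneg)
  have rS: "(r k)\<^sup>2 \<le> snorm x * r (Suc k)" for k
    using snorm_mult_sq[of "h k" x] hc[of k] x by (simp add: r_def hS)
  have rM: "r k \<le> M ^ (2 ^ k) * N x" for k
  proof -
    have "r k \<le> N (h k) * N x" using nN[of "h k \<otimes> x"] N.N_mult[of "h k" x] hc[of k] x by (simp add: r_def)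
    also have "\<dots> \<le> M ^ (2 ^ k) * N x" using hc[of k] N.N_nonneg[OF x] by (intro mult_right_mono) auto
    finally show ?thesis .
  qed
  have ax: "(snorm (a \<otimes> x))\<^sup>2 \<le> snorm x * r 0" using snorm_mult_sq[OF a x] by (simp add: r_def h0)
  show ?thesis
  proof (cases "snorm x = 0")
    case True then show ?thesis using ax by simp
  next
    case False
    then have n: "0 < snorm x" using snorm_nonneg[OF x] by simp
    define t where "t = r 0 / snorm x"
    have "t ^ (2 ^ k) \<le> r k / snorm x" for k
    proof (induction k)
      case (Suc k)
      have "t ^ (2 ^ Suc k) = (t ^ (2 ^ k))\<^sup>2" by (simp add: power_mult[symmetric] mult.commute)
      also have "\<dots> \<le> (r k / snorm x)\<^sup>2" using Suc r0 n by (intro power_mono) (auto simp: t_def)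
      also have "\<dots> \<le> (snorm x * r (Suc k)) / (snorm x)\<^sup>2"
        unfolding power_divide using rS[of k] n by (intro divide_right_mono) auto
      also have "\<dots> = r (Suc k) / snorm x" using n by (simp add: power2_eq_square)
      finally show ?case .
    qed (simp add: t_def)
    moreover have "r k / snorm x \<le> (N x / snorm x) * M ^ (2 ^ k)" for k
      using rM[of k] n by (simp add: field_simps)
    ultimately have tk: "t ^ (2 ^ k) \<le> (N x / snorm x) * M ^ (2 ^ k)" for k by (rule order_trans)
    have "0 \<le> t" "0 \<le> M" using r0[of 0] n by (simp_all add: t_def M_def)
    then have "t \<le> M" using tk by (rule power_power_bound)
    then have "r 0 \<le> M * snorm x" using n by (simp add: t_def field_simps)
    then have "snorm x * r 0 \<le> snorm x * (M * snorm x)" using n by simp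
    then have "(snorm (a \<otimes> x))\<^sup>2 \<le> (N a * snorm x)\<^sup>2"
      using ax by (simp add: M_def power_mult_distrib) (simp add: power2_eq_square mult_ac)
    then show ?thesis by (rule power2_le_imp_le) (use N.N_nonneg a n in auto)
  qed
qed

section \<open>C*-seminorms on a complete C*-algebra\<close>

locale complete_star_alg = seminormed_star_alg +
  assumes complete: "X \<in> CS \<Longrightarrow> \<exists>x\<in>carrier A. null X (\<lambda>_. x)"
    and definite: "\<lbrakk>x \<in> carrier A; y \<in> carrier A; N (x \<ominus> y) = 0\<rbrakk> \<Longrightarrow> x = y"
begin

lemma limit_unique:
  assumes X: "\<And>k. X k \<in> carrier A" and x: "x \<in> carrier A" and y: "y \<in> carrier A"
    and n: "null X (\<lambda>_. x)" "null X (\<lambda>_. y)"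
  shows "x = y"
proof (rule definite[OF x y])
  have "N (x \<ominus> y) \<le> N (X k \<ominus> x) + N (X k \<ominus> y)" for k
    using N_minus_triangle[OF x X y, of k] N_minus_commute[OF x X, of k] by simp
  then have "N (x \<ominus> y) \<le> 0" using tendsto_add[OF n] by (intro LIMSEQ_le_const) auto
  then show "N (x \<ominus> y) = 0" using N_nonneg[of "x \<ominus> y"] x y by simp
qed

lemma ex_sqrt:
  assumes h: "h \<in> carrier A" and sa: "adj A h = h" and small: "N h < 1"
  obtains y where "y \<in> carrier A" "adj A y = y" "h \<otimes> y = y \<otimes> h" "y \<otimes> y \<oplus> h \<otimes> h = \<one>"
proof -
  \<comment> \<open>\<open>y = 1 - w\<close>, where \<open>w\<close> is the fixed point of the contraction \<open>w \<mapsto> (h\<^sup>2 + w\<^sup>2) / 2\<close>.\<close>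
  define W where "W = rec_nat \<zero> (\<lambda>_ w. (1/2) \<odot> (h \<otimes> h \<oplus> w \<otimes> w))"
  have W0: "W 0 = \<zero>" and WS: "W (Suc k) = (1/2) \<odot> (h \<otimes> h \<oplus> W k \<otimes> W k)" for k by (simp_all add: W_def)
  define r where "r = N h"
  have r: "0 \<le> r" "r < 1" using N_nonneg[OF h] small by (auto simp: r_def)
  have W: "W k \<in> carrier A \<and> adj A (W k) = W k \<and> h \<otimes> W k = W k \<otimes> h \<and> N (W k) \<le> r" for k
  proof (induction k)
    case (Suc k)
    then have c: "W k \<in> carrier A" and a: "adj A (W k) = W k" and m: "h \<otimes> W k = W k \<otimes> h" and n: "N (W k) \<le> r" by auto
    have "h \<otimes> (W k \<otimes> W k) = W k \<otimes> W k \<otimes> h"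
      using h c m by (metis m_assoc)
    then have 1: "h \<otimes> W (Suc k) = W (Suc k) \<otimes> h"
      using h c by (simp add: WS smult_mult_l smult_mult_r l_distr r_distr m_assoc)
    have "N (h \<otimes> h) \<le> r * r" "N (W k \<otimes> W k) \<le> r * r"
      using N_mult[OF h h] N_mult[OF c c] mult_mono[OF n n r(1) N_nonneg[OF c]] by (auto simp: r_def)
    moreover have "N (h \<otimes> h \<oplus> W k \<otimes> W k) \<le> N (h \<otimes> h) + N (W k \<otimes> W k)" using h c by (intro N_triangle) auto
    moreover have "r * r \<le> r" using r by (simp add: mult_left_le)
    ultimately have 2: "N (W (Suc k)) \<le> r" using h c by (simp add: WS N_smult norm_divide)
    show ?case using 1 2 h c a sa by (simp add: WS adj_smult adj_add adj_mult)
  qed (use r h in \<open>simp add: W0\<close>)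
  note Wc = conjunct1[OF W]
  define d where "d k = N (W (Suc k) \<ominus> W k)" for k
  \<comment> \<open>A difference of squares is w (w - v) + (w - v) v; as all iterates have norm at
    most \<open>r\<close>, half of it is at most r ||w - v||.\<close>
  have "d (Suc k) \<le> r * d k" for k
  proof -
    have "W (Suc (Suc k)) \<ominus> W (Suc k) = (1/2) \<odot> (W (Suc k) \<otimes> W (Suc k) \<ominus> W k \<otimes> W k)"
    proof -
      have "W (Suc (Suc k)) \<ominus> W (Suc k) = (1/2) \<odot> ((h \<otimes> h \<oplus> W (Suc k) \<otimes> W (Suc k)) \<ominus> (h \<otimes> h \<oplus> W k \<otimes> W k))"
        using h Wc by (simp only: WS[of "Suc k"] WS[of k] smult_minus m_closed a_closed)
          (simp add: smult_minus smult_r_distr)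
      also have "(h \<otimes> h \<oplus> W (Suc k) \<otimes> W (Suc k)) \<ominus> (h \<otimes> h \<oplus> W k \<otimes> W k) = W (Suc k) \<otimes> W (Suc k) \<ominus> W k \<otimes> W k"
        using h Wc by (subst add_minus_add) (simp_all add: minus_eq r_neg)
      finally show ?thesis .
    qed
    then have "d (Suc k) = 1/2 * N (W (Suc k) \<otimes> W (Suc k) \<ominus> W k \<otimes> W k)"
      using Wc by (simp add: d_def N_smult norm_divide)
    also have "\<dots> \<le> 1/2 * (N (W (Suc k)) * d k + d k * N (W k))"
      using N_mult_diff[OF Wc Wc Wc Wc, of "Suc k" "Suc k" k k] by (simp add: d_def)
    also have "\<dots> \<le> 1/2 * (r * d k + d k * r)"
    proof -
      have d0: "0 \<le> d k" using N_nonneg Wc by (simp add: d_def)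
      have "N (W (Suc k)) * d k \<le> r * d k" "d k * N (W k) \<le> d k * r"
        using W[of k] W[of "Suc k"] d0 by (auto intro: mult_right_mono mult_left_mono)
      then show ?thesis by (intro mult_left_mono) (rule add_mono, auto)
    qed
    finally show ?thesis by simp
  qed
  then have dk: "d k \<le> d 0 * r ^ k" for k
  proof (induction k)
    case (Suc k)
    have "r * d k \<le> r * (d 0 * r ^ k)" using Suc r by (intro mult_left_mono) auto
    then show ?case using Suc.prems[of k] by (simp add: mult_ac)
  qed simp
  \<comment> \<open>Geometric tail estimate, multiplied by \<open>1 - r\<close> so that the
    induction telescopes.\<close>
  have step: "N (W (k + i) \<ominus> W k) * (1 - r) \<le> d 0 * (r ^ k - r ^ (k + i))" for k i
  proof (induction i)
    case 0 then show ?case using Wc by (simp add: minus_eq r_neg)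
  next
    case (Suc i)
    have "N (W (k + Suc i) \<ominus> W k) \<le> d (k + i) + N (W (k + i) \<ominus> W k)"
      using N_minus_triangle[OF Wc Wc Wc, of "k + Suc i" k "k + i"] by (simp add: d_def)
    then have "N (W (k + Suc i) \<ominus> W k) * (1 - r) \<le> (d (k + i) + N (W (k + i) \<ominus> W k)) * (1 - r)"
      using r by (intro mult_right_mono) auto
    also have "\<dots> \<le> d 0 * r ^ (k + i) * (1 - r) + d 0 * (r ^ k - r ^ (k + i))"
      unfolding distrib_right using Suc mult_right_mono[OF dk[of "k + i"], of "1 - r"] r by linarith
    also have "\<dots> = d 0 * (r ^ k - r ^ (k + Suc i))" by (simp add: algebra_simps)
    finally show ?case .
  qed
  have d0: "0 \<le> d 0" using N_nonneg Wc by (simp add: d_def)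
  have tail: "N (W (k + i) \<ominus> W k) \<le> d 0 / (1 - r) * r ^ k" for k i
  proof -
    have "N (W (k + i) \<ominus> W k) * (1 - r) \<le> d 0 * r ^ k"
      using step[of k i] mult_left_mono[OF _ d0, of "r ^ k - r ^ (k + i)" "r ^ k"] r by simp
    then show ?thesis using r by (simp add: field_simps)
  qed
  have WCS: "W \<in> CS"
  proof (rule CS_I)
    fix e :: real assume e: "0 < e"
    have "(\<lambda>k. d 0 / (1 - r) * r ^ k) \<longlonglongrightarrow> 0"
      using tendsto_mult_left[OF LIMSEQ_realpow_zero[OF r], of "d 0 / (1 - r)"] by simp
    then have "\<forall>\<^sub>F k in sequentially. d 0 / (1 - r) * r ^ k < e / 2" using e by (intro order_tendstoD(2)) auto
    then obtain K where K: "\<And>k. k \<ge> K \<Longrightarrow> d 0 / (1 - r) * r ^ k < e / 2" by (auto simp: eventually_sequentially)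
    have K': "N (W j \<ominus> W K) < e / 2" if "j \<ge> K" for j
      using le_less_trans[OF tail[of K "j - K"] K[of K]] that by simp
    have "N (W j \<ominus> W k) < e" if "j \<ge> K" "k \<ge> K" for j k
      using N_minus_triangle[OF Wc Wc Wc, of j k K] N_minus_commute[OF Wc Wc, of K k] K'[OF that(1)] K'[OF that(2)] by linarith
    then show "\<exists>M. \<forall>j\<ge>M. \<forall>k\<ge>M. N (W j \<ominus> W k) < e" by blast
  qed (rule Wc)
  obtain w where w: "w \<in> carrier A" and nw: "null W (\<lambda>_. w)" using complete[OF WCS] by blast
  note cw = CS_const[OF w] and ch = CS_const[OF h]
  have wa: "adj A w = w"
    by (rule limit_unique[OF Wc]) (use null_adj[OF WCS cw nw] nw w W in auto)
  have wh: "h \<otimes> w = w \<otimes> h"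
  proof (rule limit_unique[where X = "\<lambda>k. h \<otimes> W k"])
    show "null (\<lambda>k. h \<otimes> W k) (\<lambda>_. h \<otimes> w)"
      by (rule null_mult[OF ch WCS ch cw null_refl nw]) (rule h)
    have "null (\<lambda>k. W k \<otimes> h) (\<lambda>_. w \<otimes> h)"
      by (rule null_mult[OF WCS ch cw ch nw null_refl]) (rule h)
    then show "null (\<lambda>k. h \<otimes> W k) (\<lambda>_. w \<otimes> h)" using W by simp
  qed (use h w Wc in auto)
  have ww: "w = (1/2) \<odot> (h \<otimes> h \<oplus> w \<otimes> w)"
  proof (rule limit_unique[where X = "\<lambda>k. W (Suc k)"])
    show "null (\<lambda>k. W (Suc k)) (\<lambda>_. w)" using nw by (rule LIMSEQ_Suc)
    have "null (\<lambda>k. (1/2) \<odot> (h \<otimes> h \<oplus> W k \<otimes> W k)) (\<lambda>_. (1/2) \<odot> (h \<otimes> h \<oplus> w \<otimes> w))"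
      by (intro null_smult null_add null_mult CS_add CS_mult WCS cw ch nw null_refl h)
    then show "null (\<lambda>k. W (Suc k)) (\<lambda>_. (1/2) \<odot> (h \<otimes> h \<oplus> w \<otimes> w))" by (simp add: WS)
  qed (use Wc w h in auto)
  have "w \<oplus> w = 2 \<odot> w" using smult_l_distr[OF w, of 1 1] w by simp
  also have "\<dots> = h \<otimes> h \<oplus> w \<otimes> w" using w h by (subst ww) (simp add: smult_smult)
  finally have ww': "w \<oplus> w = h \<otimes> h \<oplus> w \<otimes> w" .
  \<comment> \<open>From 2w = h^2 + w^2 it follows that (1 - w)^2 + h^2 = 1.\<close>
  define y where "y = \<one> \<ominus> w"
  have "y \<otimes> y = \<one> \<ominus> (w \<oplus> w) \<oplus> w \<otimes> w" using w by (simp add: y_def ring_simprules)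
  then have "y \<otimes> y \<oplus> h \<otimes> h = \<one> \<ominus> (w \<oplus> w) \<oplus> (h \<otimes> h \<oplus> w \<otimes> w)" using w h by (simp add: a_ac minus_eq)
  also have "\<dots> = \<one>" using w h unfolding ww'[symmetric] by (simp add: minus_eq a_assoc l_neg)
  finally have "y \<otimes> y \<oplus> h \<otimes> h = \<one>" .
  moreover have "h \<otimes> y = y \<otimes> h" using w h wh by (simp add: y_def mult_minus_l mult_minus_r)
  moreover have "y \<in> carrier A" "adj A y = y" using w wa by (auto simp: y_def adj_minus)
  ultimately show thesis using that by blast
qed

text \<open>A self-adjoint contraction \<open>h\<close> is the average of the unitaries \<open>h \<plusminus> \<i> sqrt (1 - h\<^sup>2)\<close>.\<close>

lemma cstar_seminorm_le:
  assumes q: "cstar_seminorm A q" and x: "x \<in> carrier A" shows "q x \<le> N x"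
proof -
  interpret q: seminormed_star_alg A q
    using q by (simp add: seminormed_star_alg_def seminormed_star_alg_axioms_def star_alg_axioms)
  have small: "q h \<le> 1" if h: "h \<in> carrier A" and sa: "adj A h = h" and n: "N h < 1" for h
  proof -
    obtain y where y: "y \<in> carrier A" "adj A y = y" "h \<otimes> y = y \<otimes> h" "y \<otimes> y \<oplus> h \<otimes> h = \<one>" by (rule ex_sqrt[OF h sa n])
    define u where "u = h \<oplus> \<i> \<odot> y"
    have u: "u \<in> carrier A" "adj A u = h \<oplus> (- \<i>) \<odot> y" using h y sa by (auto simp: u_def adj_add adj_smult)
    have "adj A u \<otimes> u = (h \<otimes> h \<oplus> (- \<i>) \<odot> (h \<otimes> y)) \<oplus> (\<i> \<odot> (h \<otimes> y) \<oplus> y \<otimes> y)"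
      unfolding u(2) unfolding u_def using h y
      by (simp add: l_distr r_distr smult_mult_l smult_mult_r smult_smult smult_r_distr a_ac)
    also have "\<dots> = h \<otimes> h \<oplus> ((- \<i>) \<odot> (h \<otimes> y) \<oplus> \<i> \<odot> (h \<otimes> y)) \<oplus> y \<otimes> y"
      using h y by (simp add: a_assoc)
    also have "\<dots> = \<one>" using h y by (simp add: smult_l_distr[symmetric] a_comm)
    finally have "(q u)\<^sup>2 \<le> 1" using q.N_star[OF u(1)] q.N_one_le by simp
    then have qu: "q u \<le> 1" using power2_le_imp_le[of "q u" 1] by simp
    have "u \<oplus> adj A u = (h \<oplus> h) \<oplus> (\<i> \<odot> y \<oplus> (- \<i>) \<odot> y)"
      unfolding u(2) unfolding u_def using h y by (simp add: a_ac)
    also have "\<dots> = 2 \<odot> h" using h y smult_l_distr[OF h, of 1 1] by (simp add: smult_l_distr[symmetric])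
    finally have "2 * q h = q (u \<oplus> adj A u)" using q.N_smult[OF h, of 2] by simp
    also have "\<dots> \<le> q u + q (adj A u)" using u(1) by (intro q.N_triangle) auto
    also have "\<dots> \<le> 2" using qu q.N_adj[OF u(1)] by simp
    finally show ?thesis by simp
  qed
  have sa: "q h \<le> N h" if h: "h \<in> carrier A" and sa: "adj A h = h" for h
  proof (rule field_le_epsilon)
    fix e :: real assume e: "0 < e"
    \<comment> \<open>Dividing by a number above \<open>N h\<close> moves \<open>h\<close> into the
      open unit ball, which the square root requires.\<close>
    define t where "t = N h + e"
    have t: "0 < t" "N h < t" using e N_nonneg[OF h] by (auto simp: t_def)
    have "q (of_real (1 / t) \<odot> h) \<le> 1"
      using t h sa by (intro small) (auto simp: adj_smult N_smult norm_divide)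
    then have "q h / t \<le> 1" using t h by (simp add: q.N_smult norm_divide)
    then show "q h \<le> N h + e" using t by (simp add: t_def[symmetric])
  qed
  \<comment> \<open>The C*-identity for both seminorms reduces a general element to the self-adjoint
    element x^* x.\<close>
  have "(q x)\<^sup>2 \<le> (N x)\<^sup>2"
    using sa[of "adj A x \<otimes> x"] x by (simp add: q.N_star N_star adj_mult)
  then show ?thesis by (rule power2_le_imp_le) (rule N_nonneg[OF x])
qed

end

lemma (in seminormed_star_alg) complete_C: "complete_star_alg C (nrm C)"
proof -
  interpret C: seminormed_star_alg C "nrm C" by (rule seminormed_C)
  show ?thesis
  proof
    fix X assume "X \<in> C.CS"
    then show "\<exists>x\<in>carrier C. C.null X (\<lambda>_. x)" by (metis C_complete)
  qed (rule C_eqI)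
qed

section \<open>Universal C*-algebras of monoids\<close>

text \<open>The linear map of monoid algebras induced by \<open>h\<close>: values are added up along
  the fibres. It is a homomorphism when \<open>h\<close> is one.\<close>

definition push :: "('m \<Rightarrow> 'k) \<Rightarrow> ('m \<Rightarrow> complex) \<Rightarrow> 'k \<Rightarrow> complex" where
  "push h f m = (\<Sum>a | f a \<noteq> 0 \<and> h a = m. f a)"

lemma
  assumes "finite {a. f a \<noteq> 0}"
  shows support_push: "{m. push h f m \<noteq> 0} \<subseteq> h ` {a. f a \<noteq> 0}"
    and finite_support_push: "finite {m. push h f m \<noteq> 0}"
    and lin_push: "lin \<phi> (push h f) = lin (\<lambda>a. \<phi> (h a)) f"
proof -
  let ?S = "{a. f a \<noteq> 0}"
  have conv: "push h f m = (\<Sum>a\<in>{x \<in> ?S. h x = m}. f a)" for m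
    unfolding push_def by (rule sum.cong) auto
  show sub: "{m. push h f m \<noteq> 0} \<subseteq> h ` ?S"
  proof
    fix m assume m: "m \<in> {m. push h f m \<noteq> 0}"
    have "{x \<in> ?S. h x = m} \<noteq> {}"
    proof
      assume e: "{x \<in> ?S. h x = m} = {}"
      have "push h f m = 0" unfolding conv e by simp
      then show False using m by simp
    qed
    then show "m \<in> h ` ?S" by blast
  qed
  then show "finite {m. push h f m \<noteq> 0}" using assms by (meson finite_imageI finite_subset)
  have "lin \<phi> (push h f) = (\<Sum>m\<in>h ` ?S. push h f m * \<phi> m)"
    using sub assms by (intro lin_superset) auto
  also have "\<dots> = (\<Sum>m\<in>h ` ?S. \<Sum>x\<in>{x \<in> ?S. h x = m}. f x * \<phi> (h x))"
    unfolding conv sum_distrib_right by (intro sum.cong) auto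
  also have "\<dots> = (\<Sum>x\<in>?S. f x * \<phi> (h x))"
    by (rule sum.image_gen[OF assms, symmetric])
  finally show "lin \<phi> (push h f) = lin (\<lambda>a. \<phi> (h a)) f" by (simp add: lin_def)
qed

lemma (in star_mon) lin_adj_mult:
  assumes f: "f \<in> carrier MA" and g: "g \<in> carrier MA"
  shows "lin \<phi> (adj MA f \<otimes>\<^bsub>MA\<^esub> g) = (\<Sum>a | f a \<noteq> 0. \<Sum>b | g b \<noteq> 0. cnj (f a) * g b * \<phi> (invol M a \<otimes> b))"
  using MA_closed(4)[OF f f] f g
  by (simp del: monoid_algebra_simps add: MA_lin_mult MA_lin_adj)
    (simp add: lin_def sum_distrib_left mult.assoc)

text \<open>Point masses span the algebra and seminorms are subadditive. The universal seminorm is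
  therefore finite as soon as the monoid elements have uniform bounds.\<close>

lemma (in star_mon) seminorms_bounded:
  assumes cs: "\<And>p. P p \<Longrightarrow> cstar_seminorm MA p"
    and delta: "\<And>a. a \<in> carrier M \<Longrightarrow> \<exists>B. \<forall>p. P p \<longrightarrow> p (delta a) \<le> B"
  shows "\<forall>x\<in>carrier MA. \<exists>B. \<forall>p. P p \<longrightarrow> p x \<le> B"
proof
  have sn: "seminormed_star_alg MA p" if "P p" for p
    using cs[OF that] star_alg_MA by (simp add: seminormed_star_alg_def seminormed_star_alg_axioms_def)
  fix x assume "x \<in> carrier MA"
  then show "\<exists>B. \<forall>p. P p \<longrightarrow> p x \<le> B"
  proof (induction rule: monoid_algebra_induct)
    case zero
    have "p (\<lambda>m. 0) \<le> 0" if "P p" for p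
      using seminormed_star_alg.N_zero[OF sn[OF that]] by simp
    then show ?case by blast
  next
    case (add f g)
    then obtain b b' where b: "\<And>p. P p \<Longrightarrow> p f \<le> b" "\<And>p. P p \<Longrightarrow> p g \<le> b'" by blast
    have "p (\<lambda>m. f m + g m) \<le> b + b'" if p: "P p" for p
      using seminormed_star_alg.N_triangle[OF sn[OF p] add(1,2)] b(1)[OF p] b(2)[OF p] by simp
    then show ?case by blast
  next
    case (delta c a)
    then obtain B where B: "\<And>p. P p \<Longrightarrow> p (delta a) \<le> B" using assms(2) by blast
    have "p (\<lambda>m. c * delta a m) \<le> cmod c * B" if p: "P p" for p
      using seminormed_star_alg.N_smult[OF sn[OF p] delta_closed[OF delta], of c] mult_left_mono[OF B[OF p], of "cmod c"]
      by simp
    then show ?case by blast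
  qed
qed

locale universal = star_mon +
  fixes R
  assumes R_sub: "R \<subseteq> carrier MA"
    and bdd: "\<forall>x\<in>carrier MA. \<exists>B. \<forall>p. cstar_seminorm MA p \<and> (\<forall>r\<in>R. p r = 0) \<longrightarrow> p x \<le> B"
begin

abbreviation "usn \<equiv> universal_seminorm MA R"

sublocale MA: star_alg MA by (rule star_alg_MA)

sublocale U: seminormed_star_alg MA usn
  by (rule universal_seminorm_cstar(1)[OF star_alg_MA bdd])

lemma universal_cstar_eq: "universal_cstar M R = completion MA usn"
  by (simp add: universal_cstar_def)

abbreviation "gen \<equiv> universal_gen M R"

sublocale UC: complete_star_alg "universal_cstar M R" "nrm (universal_cstar M R)"
  unfolding universal_cstar_eq by (rule U.complete_C)

lemma usn_le: "\<lbrakk>cstar_seminorm MA p; \<And>r. r \<in> R \<Longrightarrow> p r = 0; x \<in> carrier MA\<rbrakk> \<Longrightarrow> p x \<le> usn x"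
  by (rule universal_seminorm_cstar(2)[OF star_alg_MA bdd])

lemma usn_R: "r \<in> R \<Longrightarrow> usn r = 0"
  by (rule universal_seminorm_cstar(3)[OF star_alg_MA bdd])

lemma gen_closed [simp, intro]: "a \<in> carrier M \<Longrightarrow> gen a \<in> carrier (universal_cstar M R)"
  unfolding universal_cstar_eq universal_gen_def by (intro U.embed_closed delta_closed)

lemma gen_mult: "\<lbrakk>a \<in> carrier M; b \<in> carrier M\<rbrakk> \<Longrightarrow> gen (a \<otimes> b) = gen a \<otimes>\<^bsub>universal_cstar M R\<^esub> gen b"
  unfolding universal_cstar_eq universal_gen_def
  by (simp add: U.embed_mult[symmetric] delta_mult del: monoid_algebra_simps)

lemma gen_adj: "a \<in> carrier M \<Longrightarrow> gen (invol M a) = adj (universal_cstar M R) (gen a)"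
  unfolding universal_cstar_eq universal_gen_def
  by (simp add: U.embed_adj[symmetric] delta_adj del: monoid_algebra_simps)

lemma gen_one: "gen \<one> = \<one>\<^bsub>universal_cstar M R\<^esub>"
  using U.embed_one unfolding universal_cstar_eq universal_gen_def by simp

lemma state_embed_lin:
  assumes s: "state (universal_cstar M R) \<omega>" and x: "x \<in> carrier MA"
  shows "\<omega> (embed MA usn x) = lin (\<lambda>a. \<omega> (gen a)) x"
proof -
  note s = s[unfolded universal_cstar_eq state_def]
  have ad: "\<omega> (embed MA usn (f \<oplus>\<^bsub>MA\<^esub> g)) = \<omega> (embed MA usn f) + \<omega> (embed MA usn g)"
    if "f \<in> carrier MA" "g \<in> carrier MA" for f g
    unfolding U.embed_add[OF that] using s U.embed_closed[OF that(1)] U.embed_closed[OF that(2)] by blast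
  have sm: "\<omega> (embed MA usn (c \<odot>\<^bsub>MA\<^esub> f)) = c * \<omega> (embed MA usn f)" if "f \<in> carrier MA" for c f
    unfolding U.embed_smult[OF that] using s U.embed_closed[OF that] by blast
  have z: "\<omega> (embed MA usn (\<lambda>m. 0)) = 0"
    using sm[of "\<lambda>m. 0" 0] by simp
  show ?thesis
    using x
  proof (induction rule: monoid_algebra_induct)
    case zero then show ?case using z by simp
  next
    case (add f g)
    then show ?case using ad[of f g] MA_lin_add[of f g] by simp
  next
    case (delta c a)
    have "\<omega> (embed MA usn (\<lambda>m. c * delta a m)) = c * \<omega> (gen a)"
      using sm[OF delta_closed[OF delta], of c] by (simp add: universal_gen_def)
    then show ?case by (simp add: lin_smult)
  qed
qed

lemma state_eqI_gen:
  assumes s: "state (universal_cstar M R) \<omega>" "state (universal_cstar M R) \<omega>'"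
    and eq: "\<And>a. a \<in> carrier M \<Longrightarrow> \<omega> (gen a) = \<omega>' (gen a)"
  shows "\<omega> = \<omega>'"
proof (rule U.state_eqI)
  show "state (completion MA usn) \<omega>" "state (completion MA usn) \<omega>'" using s by (simp_all add: universal_cstar_eq)
  fix x assume x: "x \<in> carrier MA"
  show "\<omega> (embed MA usn x) = \<omega>' (embed MA usn x)"
    unfolding state_embed_lin[OF s(1) x] state_embed_lin[OF s(2) x] by (rule MA_lin_cong[OF x eq])
qed

text \<open>The universal seminorm vanishes on the two-sided ideal generated by the relations, and a
  state is bounded by it.\<close>

lemma lin_R_zero:
  assumes s: "state (universal_cstar M R) \<omega>" and r: "r \<in> R" and y: "y \<in> carrier MA" and z: "z \<in> carrier MA"
  shows "lin (\<lambda>a. \<omega> (gen a)) (y \<otimes>\<^bsub>MA\<^esub> r \<otimes>\<^bsub>MA\<^esub> z) = 0"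
proof -
  have rc: "r \<in> carrier MA" using r R_sub by blast
  have c: "y \<otimes>\<^bsub>MA\<^esub> r \<otimes>\<^bsub>MA\<^esub> z \<in> carrier MA" using y rc z by (intro MA_closed)
  have "usn (y \<otimes>\<^bsub>MA\<^esub> r \<otimes>\<^bsub>MA\<^esub> z) \<le> usn (y \<otimes>\<^bsub>MA\<^esub> r) * usn z" using y rc z by (intro U.N_mult MA_closed)
  moreover have "usn (y \<otimes>\<^bsub>MA\<^esub> r) \<le> usn y * usn r" using y rc by (rule U.N_mult)
  moreover have "0 \<le> usn (y \<otimes>\<^bsub>MA\<^esub> r)" using y rc by (intro U.N_nonneg MA_closed)
  ultimately have "usn (y \<otimes>\<^bsub>MA\<^esub> r \<otimes>\<^bsub>MA\<^esub> z) \<le> 0" using usn_R[OF r] by simp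
  moreover have "cmod (\<omega> (embed MA usn (y \<otimes>\<^bsub>MA\<^esub> r \<otimes>\<^bsub>MA\<^esub> z))) \<le> usn (y \<otimes>\<^bsub>MA\<^esub> r \<otimes>\<^bsub>MA\<^esub> z)"
    using s[unfolded universal_cstar_eq state_def] U.embed_closed[OF c] U.embed_nrm[OF c] by metis
  ultimately have "cmod (\<omega> (embed MA usn (y \<otimes>\<^bsub>MA\<^esub> r \<otimes>\<^bsub>MA\<^esub> z))) \<le> 0" by (rule order_trans[rotated])
  then show ?thesis unfolding state_embed_lin[OF s c, symmetric] by simp
qed

text \<open>The way to construct states from functions on the monoid. By linearity, two-sided
  translates by monoid elements test the relations, and bounds for single monoid elements yield
  boundedness of the whole action.\<close>

lemma state_of_lin:
  assumes one: "\<phi> \<one> = 1"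
    and pos: "\<And>x. x \<in> carrier MA \<Longrightarrow> lin \<phi> (adj MA x \<otimes>\<^bsub>MA\<^esub> x) \<in> \<real>\<^sub>\<ge>\<^sub>0"
    and null: "\<And>r a b. \<lbrakk>r \<in> R; a \<in> carrier M; b \<in> carrier M\<rbrakk> \<Longrightarrow> lin (\<lambda>m. \<phi> (a \<otimes> (m \<otimes> b))) r = 0"
    and bound: "\<And>a. a \<in> carrier M \<Longrightarrow> \<exists>c. \<forall>y\<in>carrier MA.
       Re (lin \<phi> (adj MA (delta a \<otimes>\<^bsub>MA\<^esub> y) \<otimes>\<^bsub>MA\<^esub> (delta a \<otimes>\<^bsub>MA\<^esub> y))) \<le> c\<^sup>2 * Re (lin \<phi> (adj MA y \<otimes>\<^bsub>MA\<^esub> y))"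
  obtains \<omega> where "state (universal_cstar M R) \<omega>" "\<And>a. a \<in> carrier M \<Longrightarrow> \<omega> (gen a) = \<phi> a"
proof -
  note [simp del] = monoid_algebra_simps
  interpret F: pos_functional MA "lin \<phi>"
    by standard (simp_all add: MA_lin_add MA_lin_smult pos)
  interpret F: bounded_functional MA "lin \<phi>"
  proof
    fix x assume x: "x \<in> carrier MA"
    show "\<exists>c. \<forall>y\<in>carrier MA. F.snorm (x \<otimes>\<^bsub>MA\<^esub> y) \<le> c * F.snorm y"
      using x
    proof (induction rule: monoid_algebra_induct)
      case zero
      have "F.snorm \<zero>\<^bsub>MA\<^esub> = 0" using F.snorm_smult[of "\<zero>\<^bsub>MA\<^esub>" 0] by simp
      then have "F.snorm (\<zero>\<^bsub>MA\<^esub> \<otimes>\<^bsub>MA\<^esub> y) \<le> 0 * F.snorm y" if "y \<in> carrier MA" for y using that by simp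
      then show ?case unfolding monoid_algebra_simps(3) by blast
    next
      case (add f g)
      then obtain c d where cd: "\<And>y. y \<in> carrier MA \<Longrightarrow> F.snorm (f \<otimes>\<^bsub>MA\<^esub> y) \<le> c * F.snorm y"
        "\<And>y. y \<in> carrier MA \<Longrightarrow> F.snorm (g \<otimes>\<^bsub>MA\<^esub> y) \<le> d * F.snorm y" by blast
      have "F.snorm ((f \<oplus>\<^bsub>MA\<^esub> g) \<otimes>\<^bsub>MA\<^esub> y) \<le> (c + d) * F.snorm y" if y: "y \<in> carrier MA" for y
        using F.snorm_triangle[of "f \<otimes>\<^bsub>MA\<^esub> y" "g \<otimes>\<^bsub>MA\<^esub> y"] cd(1)[OF y] cd(2)[OF y] add y
        by (simp add: MA.l_distr distrib_right)
      then show ?case unfolding monoid_algebra_simps(4) by blast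
    next
      case (delta e a)
      then obtain c where c: "\<And>y. y \<in> carrier MA \<Longrightarrow>
        Re (lin \<phi> (adj MA (delta a \<otimes>\<^bsub>MA\<^esub> y) \<otimes>\<^bsub>MA\<^esub> (delta a \<otimes>\<^bsub>MA\<^esub> y))) \<le> c\<^sup>2 * Re (lin \<phi> (adj MA y \<otimes>\<^bsub>MA\<^esub> y))"
        using bound by blast
      have d: "delta a \<in> carrier MA" using delta by (rule delta_closed)
      have "F.snorm ((e \<odot>\<^bsub>MA\<^esub> delta a) \<otimes>\<^bsub>MA\<^esub> y) \<le> (cmod e * \<bar>c\<bar>) * F.snorm y" if y: "y \<in> carrier MA" for y
      proof -
        have "(F.snorm (delta a \<otimes>\<^bsub>MA\<^esub> y))\<^sup>2 \<le> (\<bar>c\<bar> * F.snorm y)\<^sup>2"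
          using c[OF y] y d by (simp add: F.snorm_sq power_mult_distrib)
        then have "F.snorm (delta a \<otimes>\<^bsub>MA\<^esub> y) \<le> \<bar>c\<bar> * F.snorm y"
          by (rule power2_le_imp_le) (simp add: F.snorm_nonneg y)
        then have "cmod e * F.snorm (delta a \<otimes>\<^bsub>MA\<^esub> y) \<le> cmod e * (\<bar>c\<bar> * F.snorm y)" by (rule mult_left_mono) simp
        then show ?thesis using d y by (simp add: MA.smult_mult_l F.snorm_smult mult.assoc)
      qed
      then show ?case unfolding monoid_algebra_simps(5) by blast
    qed
  qed
  have nul: "lin \<phi> (adj MA (r \<otimes>\<^bsub>MA\<^esub> y) \<otimes>\<^bsub>MA\<^esub> (r \<otimes>\<^bsub>MA\<^esub> y)) = 0" if r: "r \<in> R" and y: "y \<in> carrier MA" for r y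
  proof -
    have rc: "r \<in> carrier MA" using r R_sub by blast
    let ?z = "adj MA (r \<otimes>\<^bsub>MA\<^esub> y)"
    have z: "?z \<in> carrier MA" using rc y by simp
    have "lin \<phi> (?z \<otimes>\<^bsub>MA\<^esub> (r \<otimes>\<^bsub>MA\<^esub> y)) = lin (\<lambda>a. lin (\<lambda>m. lin (\<lambda>b. \<phi> (a \<otimes> (m \<otimes> b))) y) r) ?z"
      using rc y z by (simp add: MA_lin_mult)
    \<comment> \<open>The variable of the relation moves to the innermost place, where
      \<open>null\<close> applies.\<close>
    also have "\<dots> = lin (\<lambda>a. lin (\<lambda>b. lin (\<lambda>m. \<phi> (a \<otimes> (m \<otimes> b))) r) y) ?z"
      by (subst lin_swap) (rule refl)
    also have "\<dots> = lin (\<lambda>a. lin (\<lambda>b. 0) y) ?z"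
      by (intro MA_lin_cong[OF z] MA_lin_cong[OF y] null[OF r])
    finally show ?thesis by (simp add: lin_def)
  qed
  obtain \<omega> where \<omega>: "state (completion MA usn) \<omega>" "\<And>x. x \<in> carrier MA \<Longrightarrow> \<omega> (embed MA usn x) = lin \<phi> x"
    using F.extend_universal[OF _ nul R_sub bdd] one by (auto simp: monoid_algebra_simps)
  show thesis
    by (rule that[of \<omega>]) (use \<omega> in \<open>simp_all add: universal_cstar_eq universal_gen_def\<close>)
qed

end

text \<open>The universal seminorm of the target, pulled back along \<open>push h\<close>, is a
  C*-seminorm vanishing on \<open>R\<close>, hence at most the universal seminorm of the source; so
  \<open>push h\<close> is contractive and extends.\<close>

lemma universal_hom:
  assumes "universal M R" "universal M' R'"
    and h: "\<And>a. a \<in> carrier M \<Longrightarrow> h a \<in> carrier M'"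
    and h_mult: "\<And>a b. \<lbrakk>a \<in> carrier M; b \<in> carrier M\<rbrakk> \<Longrightarrow> h (a \<otimes>\<^bsub>M\<^esub> b) = h a \<otimes>\<^bsub>M'\<^esub> h b"
    and h_one: "h \<one>\<^bsub>M\<^esub> = \<one>\<^bsub>M'\<^esub>"
    and h_invol: "\<And>a. a \<in> carrier M \<Longrightarrow> h (invol M a) = invol M' (h a)"
    and R: "\<And>r. r \<in> R \<Longrightarrow> universal_seminorm (monoid_algebra M') R' (push h r) = 0"
  obtains f where "unital_star_hom (universal_cstar M R) (universal_cstar M' R') f"
    "\<And>a. a \<in> carrier M \<Longrightarrow> f (universal_gen M R a) = universal_gen M' R' (h a)"
proof -
  interpret U: universal M R by fact
  interpret U': universal M' R' by fact
  note [simp del] = monoid_algebra_simps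
  have fin: "finite {a. x a \<noteq> 0}" if "x \<in> carrier U.MA" for x using that by (simp add: monoid_algebra_simps)
  have closed: "push h x \<in> carrier U'.MA" if x: "x \<in> carrier U.MA" for x
  proof -
    have "h ` {a. x a \<noteq> 0} \<subseteq> carrier M'" using x h by (auto simp: monoid_algebra_simps)
    then have "{m. push h x m \<noteq> 0} \<subseteq> carrier M'" using support_push[OF fin[OF x]] by (rule subset_trans[rotated])
    then show ?thesis using finite_support_push[OF fin[OF x]] by (simp add: monoid_algebra_simps)
  qed
  note lins = U.MA_lin_mult U.MA_lin_adj U.MA_lin_add U.MA_lin_smult U'.MA_lin_mult U'.MA_lin_adj U'.MA_lin_add
    U'.MA_lin_smult closed lin_push[OF fin]
  note eqI = U'.MA_ext[OF closed]
  have add: "push h (x \<oplus>\<^bsub>U.MA\<^esub> y) = push h x \<oplus>\<^bsub>U'.MA\<^esub> push h y" if "x \<in> carrier U.MA" "y \<in> carrier U.MA" for x y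
    by (rule eqI) (use that in \<open>simp_all add: lins\<close>)
  have smult: "push h (c \<odot>\<^bsub>U.MA\<^esub> x) = c \<odot>\<^bsub>U'.MA\<^esub> push h x" if "x \<in> carrier U.MA" for c x
    by (rule eqI) (use that in \<open>simp_all add: lins\<close>)
  have mult: "push h (x \<otimes>\<^bsub>U.MA\<^esub> y) = push h x \<otimes>\<^bsub>U'.MA\<^esub> push h y" if x: "x \<in> carrier U.MA" and y: "y \<in> carrier U.MA" for x y
  proof (rule eqI)
    fix \<phi>
    have "lin \<phi> (push h (x \<otimes>\<^bsub>U.MA\<^esub> y)) = lin (\<lambda>a. lin (\<lambda>b. \<phi> (h (a \<otimes>\<^bsub>M\<^esub> b))) y) x" using x y by (simp add: lins)
    also have "\<dots> = lin (\<lambda>a. lin (\<lambda>b. \<phi> (h a \<otimes>\<^bsub>M'\<^esub> h b)) y) x"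
      by (intro U.MA_lin_cong[OF x] U.MA_lin_cong[OF y]) (simp add: h_mult)
    also have "\<dots> = lin \<phi> (push h x \<otimes>\<^bsub>U'.MA\<^esub> push h y)" using x y by (simp add: lins)
    finally show "lin \<phi> (push h (x \<otimes>\<^bsub>U.MA\<^esub> y)) = lin \<phi> (push h x \<otimes>\<^bsub>U'.MA\<^esub> push h y)" .
  qed (use x y closed in auto)
  have adj: "push h (adj U.MA x) = adj U'.MA (push h x)" if x: "x \<in> carrier U.MA" for x
  proof (rule eqI)
    fix \<phi>
    show "lin \<phi> (push h (adj U.MA x)) = lin \<phi> (adj U'.MA (push h x))"
      using x by (simp add: lins) (rule U.MA_lin_cong[OF x], simp add: h_invol)
  qed (use x closed in auto)
  have del: "push h (delta a) = delta (h a)" if a: "a \<in> carrier M" for a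
    by (rule eqI) (use a h in \<open>simp_all add: lins\<close>)
  have one: "push h \<one>\<^bsub>U.MA\<^esub> = \<one>\<^bsub>U'.MA\<^esub>"
    using del[of "\<one>\<^bsub>M\<^esub>"] h_one by (simp add: monoid_algebra_simps)
  have "cstar_seminorm U.MA (\<lambda>x. U'.usn (push h x))"
    unfolding cstar_seminorm_def
  proof (intro conjI ballI allI)
    fix x y c assume x: "x \<in> carrier U.MA" and y: "y \<in> carrier U.MA"
    note [simp] = closed[OF x] closed[OF y] x y add smult mult adj
    show "0 \<le> U'.usn (push h x)" by (simp add: U'.U.N_nonneg)
    show "U'.usn (push h (c \<odot>\<^bsub>U.MA\<^esub> x)) = cmod c * U'.usn (push h x)" by (simp add: U'.U.N_smult)
    show "U'.usn (push h (x \<oplus>\<^bsub>U.MA\<^esub> y)) \<le> U'.usn (push h x) + U'.usn (push h y)" by (simp add: U'.U.N_triangle)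
    show "U'.usn (push h (x \<otimes>\<^bsub>U.MA\<^esub> y)) \<le> U'.usn (push h x) * U'.usn (push h y)" by (simp add: U'.U.N_mult)
    show "U'.usn (push h (adj U.MA x \<otimes>\<^bsub>U.MA\<^esub> x)) = (U'.usn (push h x))\<^sup>2" by (simp add: U'.U.N_star)
  qed
  then have bd: "U'.usn (push h x) \<le> U.usn x" if "x \<in> carrier U.MA" for x
    by (rule U.usn_le) (use R that in auto)
  show thesis
  proof (rule hom_extend[where f = "push h", OF U.U.seminormed_star_alg_axioms U'.U.seminormed_star_alg_axioms closed add smult mult adj one bd])
    fix f assume "unital_star_hom (completion U.MA U.usn) (completion U'.MA U'.usn) f"
      and f: "\<And>x. x \<in> carrier U.MA \<Longrightarrow> f (embed U.MA U.usn x) = embed U'.MA U'.usn (push h x)"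
    then show thesis
      using that[of f] del by (simp add: universal_gen_def universal_cstar_def)
  qed
qed

section \<open>Tensor products and product states\<close>

locale cstar_pair = A: complete_star_alg A "nrm A" + B: complete_star_alg B "nrm B"
  for A :: "('a, 'x) normed_star_algebra_scheme" and B :: "('b, 'y) normed_star_algebra_scheme"
begin

abbreviation "PM \<equiv> pair_monoid A B"

lemma PM_simps [simp]:
  "carrier PM = carrier A \<times> carrier B"
  "(a, b) \<otimes>\<^bsub>PM\<^esub> (a', b') = (a \<otimes>\<^bsub>A\<^esub> a', b \<otimes>\<^bsub>B\<^esub> b')"
  "\<one>\<^bsub>PM\<^esub> = (\<one>\<^bsub>A\<^esub>, \<one>\<^bsub>B\<^esub>)"
  "invol PM (a, b) = (adj A a, adj B b)"
  by (simp_all add: pair_monoid_def)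

sublocale PM: star_mon PM
  by (intro star_mon.intro monoidI star_mon_axioms.intro)
    (auto simp: A.m_assoc B.m_assoc A.adj_mult B.adj_mult)

abbreviation "T \<equiv> monoid_algebra PM"
abbreviation "BR \<equiv> bilinear_relations A B"

lemma BR_cases:
  assumes "r \<in> BR"
  obtains
    (add_l) a a' b where "a \<in> carrier A" "a' \<in> carrier A" "b \<in> carrier B"
      "r = (\<lambda>m. delta (a \<oplus>\<^bsub>A\<^esub> a', b) m - delta (a, b) m - delta (a', b) m)"
  | (add_r) a b b' where "a \<in> carrier A" "b \<in> carrier B" "b' \<in> carrier B"
      "r = (\<lambda>m. delta (a, b \<oplus>\<^bsub>B\<^esub> b') m - delta (a, b) m - delta (a, b') m)"
  | (smult_l) c a b where "a \<in> carrier A" "b \<in> carrier B"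
      "r = (\<lambda>m. delta (c \<odot>\<^bsub>A\<^esub> a, b) m - c * delta (a, b) m)"
  | (smult_r) c a b where "a \<in> carrier A" "b \<in> carrier B"
      "r = (\<lambda>m. delta (a, c \<odot>\<^bsub>B\<^esub> b) m - c * delta (a, b) m)"
  using assms unfolding bilinear_relations_def Un_iff mem_Collect_eq
  by (elim disjE exE conjE)
    ((rule add_l[rotated 3], assumption+) | (rule add_r[rotated 3], assumption+)
      | (rule smult_l[rotated 2], assumption+) | (rule smult_r[rotated 2], assumption+))+

lemma T_ops:
  assumes "f \<in> carrier T" "g \<in> carrier T"
  shows "(\<lambda>m. f m - g m) = f \<ominus>\<^bsub>T\<^esub> g" "(\<lambda>m. f m - c * g m) = f \<ominus>\<^bsub>T\<^esub> c \<odot>\<^bsub>T\<^esub> g"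
  using PM.MA_minus[OF assms] PM.MA_minus[OF assms(1) PM.MA_closed(3)[OF assms(2,2), of c]] by simp_all

text \<open>The pointwise relations rewritten in the operations of \<open>T\<close>, the form in
  which a seminorm can be applied to them.\<close>

lemma BR_alg:
  assumes "a \<in> carrier A" "a' \<in> carrier A" "b \<in> carrier B" "b' \<in> carrier B"
  shows "delta (a \<oplus>\<^bsub>A\<^esub> a', b) \<ominus>\<^bsub>T\<^esub> delta (a, b) \<ominus>\<^bsub>T\<^esub> delta (a', b) \<in> BR"
    "delta (a, b \<oplus>\<^bsub>B\<^esub> b') \<ominus>\<^bsub>T\<^esub> delta (a, b) \<ominus>\<^bsub>T\<^esub> delta (a, b') \<in> BR"
    "delta (c \<odot>\<^bsub>A\<^esub> a, b) \<ominus>\<^bsub>T\<^esub> c \<odot>\<^bsub>T\<^esub> delta (a, b) \<in> BR"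
    "delta (a, c \<odot>\<^bsub>B\<^esub> b) \<ominus>\<^bsub>T\<^esub> c \<odot>\<^bsub>T\<^esub> delta (a, b) \<in> BR"
proof -
  interpret TA: star_alg T by (rule PM.star_alg_MA)
  have d: "delta (u, v) \<in> carrier T" if "u \<in> carrier A" "v \<in> carrier B" for u v
    using that by (intro PM.delta_closed) simp
  have e1: "delta (u, v) \<ominus>\<^bsub>T\<^esub> delta (u', v') \<ominus>\<^bsub>T\<^esub> delta (u'', v'') =
      (\<lambda>m. delta (u, v) m - delta (u', v') m - delta (u'', v'') m)"
    if "u \<in> carrier A" "v \<in> carrier B" "u' \<in> carrier A" "v' \<in> carrier B" "u'' \<in> carrier A" "v'' \<in> carrier B"
    for u v u' v' u'' v''
  proof -
    note p = PM.MA_minus[OF d[OF that(1,2)] d[OF that(3,4)]]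
    have "delta (u, v) \<ominus>\<^bsub>T\<^esub> delta (u', v') \<ominus>\<^bsub>T\<^esub> delta (u'', v'') =
        (\<lambda>m. (delta (u, v) \<ominus>\<^bsub>T\<^esub> delta (u', v')) m - delta (u'', v'') m)"
      by (rule PM.MA_minus[OF TA.minus_closed[OF d[OF that(1,2)] d[OF that(3,4)]] d[OF that(5,6)]])
    then show ?thesis by (simp only: p)
  qed
  have e2: "delta (u, v) \<ominus>\<^bsub>T\<^esub> c \<odot>\<^bsub>T\<^esub> delta (u', v') = (\<lambda>m. delta (u, v) m - c * delta (u', v') m)"
    if "u \<in> carrier A" "v \<in> carrier B" "u' \<in> carrier A" "v' \<in> carrier B" for u v u' v'
    by (rule T_ops(2)[OF d[OF that(1,2)] d[OF that(3,4)], symmetric])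
  show "delta (a \<oplus>\<^bsub>A\<^esub> a', b) \<ominus>\<^bsub>T\<^esub> delta (a, b) \<ominus>\<^bsub>T\<^esub> delta (a', b) \<in> BR"
    unfolding e1[OF A.a_closed[OF assms(1,2)] assms(3) assms(1,3) assms(2,3)] bilinear_relations_def
    by (rule UnI1, rule UnI1, rule UnI1, rule CollectI, intro exI conjI, rule refl) (rule assms)+
  show "delta (a, b \<oplus>\<^bsub>B\<^esub> b') \<ominus>\<^bsub>T\<^esub> delta (a, b) \<ominus>\<^bsub>T\<^esub> delta (a, b') \<in> BR"
    unfolding e1[OF assms(1) B.a_closed[OF assms(3,4)] assms(1,3) assms(1,4)] bilinear_relations_def
    by (rule UnI1, rule UnI1, rule UnI2, rule CollectI, intro exI conjI, rule refl) (rule assms)+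
  show "delta (c \<odot>\<^bsub>A\<^esub> a, b) \<ominus>\<^bsub>T\<^esub> c \<odot>\<^bsub>T\<^esub> delta (a, b) \<in> BR"
    unfolding e2[OF A.smult_closed[OF assms(1)] assms(3) assms(1,3)] bilinear_relations_def
    by (rule UnI1, rule UnI2, rule CollectI, intro exI conjI, rule refl) (rule assms)+
  show "delta (a, c \<odot>\<^bsub>B\<^esub> b) \<ominus>\<^bsub>T\<^esub> c \<odot>\<^bsub>T\<^esub> delta (a, b) \<in> BR"
    unfolding e2[OF assms(1) B.smult_closed[OF assms(3)] assms(1,3)] bilinear_relations_def
    by (rule UnI2, rule CollectI, intro exI conjI, rule refl) (rule assms)+
qed

lemma BR_sub: "BR \<subseteq> carrier T"
proof
  interpret TA: star_alg T by (rule PM.star_alg_MA)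
  have d: "delta (u, v) \<in> carrier T" if "u \<in> carrier A" "v \<in> carrier B" for u v
    using that by (intro PM.delta_closed) simp
  have m: "(\<lambda>m. f m - g m) \<in> carrier T" if "f \<in> carrier T" "g \<in> carrier T" for f g
    unfolding T_ops(1)[OF that] using that by (rule TA.minus_closed)
  have s: "(\<lambda>m. c * f m) \<in> carrier T" if "f \<in> carrier T" for c f
    using PM.MA_closed(3)[OF that that, of c] by simp
  fix r assume "r \<in> BR"
  then show "r \<in> carrier T"
  proof (cases rule: BR_cases)
    case add_l then show ?thesis by (simp only:) (intro m d A.a_closed)
  next
    case add_r then show ?thesis by (simp only:) (intro m d B.a_closed)
  next
    case smult_l then show ?thesis by (simp only:) (intro m d s A.smult_closed)
  next
    case smult_r then show ?thesis by (simp only:) (intro m d s B.smult_closed)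
  qed
qed

text \<open>Restricted to the tensors of \<open>a\<close> with 1, a C*-seminorm on the tensor
  product is a C*-seminorm on the complete algebra \<open>A\<close>, hence at most its norm;
  likewise for \<open>B\<close>. An elementary tensor is the product of (a, 1) and (1, b).\<close>

lemma seminorm_delta_le:
  assumes p: "cstar_seminorm T p" and R: "\<forall>r\<in>BR. p r = 0" and a: "a \<in> carrier A" and b: "b \<in> carrier B"
  shows "p (delta (a, b)) \<le> nrm A a * nrm B b"
proof -
  interpret p: seminormed_star_alg T p
    using p PM.star_alg_MA by (simp add: seminormed_star_alg_def seminormed_star_alg_axioms_def)
  note [simp del] = monoid_algebra_simps
  have d [simp]: "delta (u, v) \<in> carrier T" if "u \<in> carrier A" "v \<in> carrier B" for u v
    using that by (intro PM.delta_closed) simp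
  have eq: "p x = p y" if "x \<in> carrier T" "y \<in> carrier T" "p (x \<ominus>\<^bsub>T\<^esub> y) = 0" for x y
    using p.N_diff_le[OF that(1,2)] that(3) by simp
  have tri: "p x \<le> p y + p z" if "x \<in> carrier T" "y \<in> carrier T" "z \<in> carrier T" "p (x \<ominus>\<^bsub>T\<^esub> y \<ominus>\<^bsub>T\<^esub> z) = 0" for x y z
    using eq[of "x \<ominus>\<^bsub>T\<^esub> y" z] p.N_diff_le[OF that(1,2)] that by auto
  have mult: "p (delta (u \<otimes>\<^bsub>A\<^esub> u', v \<otimes>\<^bsub>B\<^esub> v')) \<le> p (delta (u, v)) * p (delta (u', v'))"
    if "u \<in> carrier A" "v \<in> carrier B" "u' \<in> carrier A" "v' \<in> carrier B" for u v u' v'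
    using p.N_mult[of "delta (u, v)" "delta (u', v')"] that PM.delta_mult[of "(u, v)" "(u', v')"] by simp
  have star: "p (delta (adj A u \<otimes>\<^bsub>A\<^esub> u, adj B v \<otimes>\<^bsub>B\<^esub> v)) = (p (delta (u, v)))\<^sup>2"
    if "u \<in> carrier A" "v \<in> carrier B" for u v
    using p.N_star[of "delta (u, v)"] that PM.delta_mult[of "(adj A u, adj B v)" "(u, v)"] PM.delta_adj[of "(u, v)"] by simp
  have "cstar_seminorm A (\<lambda>a. p (delta (a, \<one>\<^bsub>B\<^esub>)))"
    unfolding cstar_seminorm_def
  proof (intro conjI ballI allI)
    fix x y c assume x: "x \<in> carrier A" and y: "y \<in> carrier A"
    show "0 \<le> p (delta (x, \<one>\<^bsub>B\<^esub>))" using x by (intro p.N_nonneg) simp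
    have "p (delta (c \<odot>\<^bsub>A\<^esub> x, \<one>\<^bsub>B\<^esub>) \<ominus>\<^bsub>T\<^esub> c \<odot>\<^bsub>T\<^esub> delta (x, \<one>\<^bsub>B\<^esub>)) = 0"
      using R BR_alg(3)[OF x x B.one_closed B.one_closed] by blast
    then show "p (delta (c \<odot>\<^bsub>A\<^esub> x, \<one>\<^bsub>B\<^esub>)) = cmod c * p (delta (x, \<one>\<^bsub>B\<^esub>))"
      using eq[of "delta (c \<odot>\<^bsub>A\<^esub> x, \<one>\<^bsub>B\<^esub>)" "c \<odot>\<^bsub>T\<^esub> delta (x, \<one>\<^bsub>B\<^esub>)"] x by (simp add: p.N_smult)
    show "p (delta (x \<oplus>\<^bsub>A\<^esub> y, \<one>\<^bsub>B\<^esub>)) \<le> p (delta (x, \<one>\<^bsub>B\<^esub>)) + p (delta (y, \<one>\<^bsub>B\<^esub>))"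
      using R BR_alg(1)[OF x y B.one_closed B.one_closed] x y by (intro tri) auto
    show "p (delta (x \<otimes>\<^bsub>A\<^esub> y, \<one>\<^bsub>B\<^esub>)) \<le> p (delta (x, \<one>\<^bsub>B\<^esub>)) * p (delta (y, \<one>\<^bsub>B\<^esub>))"
      using mult[of x "\<one>\<^bsub>B\<^esub>" y "\<one>\<^bsub>B\<^esub>"] x y by simp
    show "p (delta (adj A x \<otimes>\<^bsub>A\<^esub> x, \<one>\<^bsub>B\<^esub>)) = (p (delta (x, \<one>\<^bsub>B\<^esub>)))\<^sup>2"
      using star[of x "\<one>\<^bsub>B\<^esub>"] x by simp
  qed
  then have 1: "p (delta (a, \<one>\<^bsub>B\<^esub>)) \<le> nrm A a" by (rule A.cstar_seminorm_le) (rule a)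
  have "cstar_seminorm B (\<lambda>b. p (delta (\<one>\<^bsub>A\<^esub>, b)))"
    unfolding cstar_seminorm_def
  proof (intro conjI ballI allI)
    fix x y c assume x: "x \<in> carrier B" and y: "y \<in> carrier B"
    show "0 \<le> p (delta (\<one>\<^bsub>A\<^esub>, x))" using x by (intro p.N_nonneg) simp
    have "p (delta (\<one>\<^bsub>A\<^esub>, c \<odot>\<^bsub>B\<^esub> x) \<ominus>\<^bsub>T\<^esub> c \<odot>\<^bsub>T\<^esub> delta (\<one>\<^bsub>A\<^esub>, x)) = 0"
      using R BR_alg(4)[OF A.one_closed A.one_closed x x] by blast
    then show "p (delta (\<one>\<^bsub>A\<^esub>, c \<odot>\<^bsub>B\<^esub> x)) = cmod c * p (delta (\<one>\<^bsub>A\<^esub>, x))"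
      using eq[of "delta (\<one>\<^bsub>A\<^esub>, c \<odot>\<^bsub>B\<^esub> x)" "c \<odot>\<^bsub>T\<^esub> delta (\<one>\<^bsub>A\<^esub>, x)"] x by (simp add: p.N_smult)
    show "p (delta (\<one>\<^bsub>A\<^esub>, x \<oplus>\<^bsub>B\<^esub> y)) \<le> p (delta (\<one>\<^bsub>A\<^esub>, x)) + p (delta (\<one>\<^bsub>A\<^esub>, y))"
      using R BR_alg(2)[OF A.one_closed A.one_closed x y] x y by (intro tri) auto
    show "p (delta (\<one>\<^bsub>A\<^esub>, x \<otimes>\<^bsub>B\<^esub> y)) \<le> p (delta (\<one>\<^bsub>A\<^esub>, x)) * p (delta (\<one>\<^bsub>A\<^esub>, y))"
      using mult[of "\<one>\<^bsub>A\<^esub>" x "\<one>\<^bsub>A\<^esub>" y] x y by simp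
    show "p (delta (\<one>\<^bsub>A\<^esub>, adj B x \<otimes>\<^bsub>B\<^esub> x)) = (p (delta (\<one>\<^bsub>A\<^esub>, x)))\<^sup>2"
      using star[of "\<one>\<^bsub>A\<^esub>" x] x by simp
  qed
  then have 2: "p (delta (\<one>\<^bsub>A\<^esub>, b)) \<le> nrm B b" by (rule B.cstar_seminorm_le) (rule b)
  have "p (delta (a, b)) \<le> p (delta (a, \<one>\<^bsub>B\<^esub>)) * p (delta (\<one>\<^bsub>A\<^esub>, b))"
    using mult[of a "\<one>\<^bsub>B\<^esub>" "\<one>\<^bsub>A\<^esub>" b] a b by simp
  also have "\<dots> \<le> nrm A a * nrm B b"
    using 1 2 a b by (intro mult_mono A.N_nonneg p.N_nonneg) auto
  finally show ?thesis .
qed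

sublocale TU: universal PM BR
proof
  show "BR \<subseteq> carrier T" by (rule BR_sub)
  show "\<forall>x\<in>carrier T. \<exists>B. \<forall>p. cstar_seminorm T p \<and> (\<forall>r\<in>BR. p r = 0) \<longrightarrow> p x \<le> B"
  proof (rule PM.seminorms_bounded)
    fix m assume "m \<in> carrier PM"
    then obtain a b where m: "m = (a, b)" "a \<in> carrier A" "b \<in> carrier B" by auto
    show "\<exists>B. \<forall>p. cstar_seminorm T p \<and> (\<forall>r\<in>BR. p r = 0) \<longrightarrow> p (delta m) \<le> B"
      unfolding m(1) using seminorm_delta_le m by blast
  qed blast
qed

lemma state_pos_functional: "state A \<omega> \<Longrightarrow> pos_functional A \<omega>" "state B \<omega>' \<Longrightarrow> pos_functional B \<omega>'"
  by (simp_all add: pos_functional_def pos_functional_axioms_def state_def A.star_alg_axioms B.star_alg_axioms)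

lemma product_state_exists:
  assumes s: "state A \<omega>1" "state B \<omega>2"
  obtains \<omega> where "state (cstar_tensor A B) \<omega>"
    "\<And>a b. \<lbrakk>a \<in> carrier A; b \<in> carrier B\<rbrakk> \<Longrightarrow> \<omega> (elem_tensor A B a b) = \<omega>1 a * \<omega>2 b"
proof -
  interpret F1: pos_functional A \<omega>1 using s(1) by (rule state_pos_functional)
  interpret F2: pos_functional B \<omega>2 using s(2) by (rule state_pos_functional)
  define \<phi> where "\<phi> m = \<omega>1 (fst m) * \<omega>2 (snd m)" for m
  note [simp del] = monoid_algebra_simps
  have Tfin: "finite {m. x m \<noteq> 0}" "\<And>m. x m \<noteq> 0 \<Longrightarrow> fst m \<in> carrier A \<and> snd m \<in> carrier B"
    if "x \<in> carrier T" for x using that by (auto simp: monoid_algebra_simps)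
  have schur: "(\<Sum>p | x p \<noteq> 0. \<Sum>q | x q \<noteq> 0. cnj (x p) * x q * (S (fst p) (fst q) * S' (snd p) (snd q))) \<in> \<real>\<^sub>\<ge>\<^sub>0"
    if "pos_form A S" "pos_form B S'" "x \<in> carrier T" for S S' x
    by (rule schur_product_forms[OF that(1,2)]) (use Tfin[OF that(3)] in auto)
  have form: "lin \<phi> (adj T x \<otimes>\<^bsub>T\<^esub> x) = (\<Sum>p | x p \<noteq> 0. \<Sum>q | x q \<noteq> 0. cnj (x p) * x q *
      (\<omega>1 (adj A (fst p) \<otimes>\<^bsub>A\<^esub> fst q) * \<omega>2 (adj B (snd p) \<otimes>\<^bsub>B\<^esub> snd q)))" if x: "x \<in> carrier T" for x
    unfolding PM.lin_adj_mult[OF x x] by (intro sum.cong refl) (auto simp: \<phi>_def)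
  \<comment> \<open>The operator inequality a^* a \<le> ||a||^2 in the GNS picture, written as
    positivity of two forms; \<open>snorm_mult_le\<close> supplies it.\<close>
  have bound1: "pos_form D (\<lambda>x y. of_real ((nrm D a)\<^sup>2) * \<omega> (adj D x \<otimes>\<^bsub>D\<^esub> y) - \<omega> (adj D x \<otimes>\<^bsub>D\<^esub> (adj D a \<otimes>\<^bsub>D\<^esub> a \<otimes>\<^bsub>D\<^esub> y)))"
    "pos_form D (\<lambda>x y. \<omega> (adj D x \<otimes>\<^bsub>D\<^esub> (adj D a \<otimes>\<^bsub>D\<^esub> a \<otimes>\<^bsub>D\<^esub> y)))"
    if "seminormed_star_alg D (nrm D)" "pos_functional D \<omega>" "state D \<omega>" "a \<in> carrier D"
    for D :: "('d, 'z) normed_star_algebra_scheme" and \<omega> a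
  proof -
    interpret D: seminormed_star_alg D "nrm D" by fact
    interpret F: pos_functional D \<omega> by fact
    have sq: "\<omega> (adj D x \<otimes>\<^bsub>D\<^esub> (adj D a \<otimes>\<^bsub>D\<^esub> a \<otimes>\<^bsub>D\<^esub> x)) = of_real ((F.snorm (a \<otimes>\<^bsub>D\<^esub> x))\<^sup>2)" if x: "x \<in> carrier D" for x
      using F.S_self_snorm[of "a \<otimes>\<^bsub>D\<^esub> x"] x \<open>a \<in> carrier D\<close> by (simp add: D.adj_mult D.m_assoc)
    note fs = F.F_add F.F_smult D.l_distr D.r_distr D.smult_mult_l D.smult_mult_r D.adj_add D.adj_smult
    show "pos_form D (\<lambda>x y. \<omega> (adj D x \<otimes>\<^bsub>D\<^esub> (adj D a \<otimes>\<^bsub>D\<^esub> a \<otimes>\<^bsub>D\<^esub> y)))"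
    proof
      show "\<omega> (adj D x \<otimes>\<^bsub>D\<^esub> (adj D a \<otimes>\<^bsub>D\<^esub> a \<otimes>\<^bsub>D\<^esub> x)) \<in> \<real>\<^sub>\<ge>\<^sub>0" if "x \<in> carrier D" for x
        unfolding sq[OF that] by (simp only: nonneg_Reals_of_real_iff zero_le_power2)
    qed (use \<open>a \<in> carrier D\<close> in \<open>simp_all add: fs\<close>)
    show "pos_form D (\<lambda>x y. of_real ((nrm D a)\<^sup>2) * \<omega> (adj D x \<otimes>\<^bsub>D\<^esub> y) - \<omega> (adj D x \<otimes>\<^bsub>D\<^esub> (adj D a \<otimes>\<^bsub>D\<^esub> a \<otimes>\<^bsub>D\<^esub> y)))"
    proof
      fix x assume x: "x \<in> carrier D"
      have "F.snorm (a \<otimes>\<^bsub>D\<^esub> x) \<le> nrm D a * F.snorm x"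
        using \<open>state D \<omega>\<close> \<open>a \<in> carrier D\<close> x by (intro F.snorm_mult_le[OF that(1)]) (auto simp: state_def)
      then have "(F.snorm (a \<otimes>\<^bsub>D\<^esub> x))\<^sup>2 \<le> (nrm D a)\<^sup>2 * (F.snorm x)\<^sup>2"
        using F.snorm_nonneg[of "a \<otimes>\<^bsub>D\<^esub> x"] x \<open>a \<in> carrier D\<close> by (simp add: power_mult_distrib[symmetric] power_mono)
      then show "of_real ((nrm D a)\<^sup>2) * \<omega> (adj D x \<otimes>\<^bsub>D\<^esub> x) - \<omega> (adj D x \<otimes>\<^bsub>D\<^esub> (adj D a \<otimes>\<^bsub>D\<^esub> a \<otimes>\<^bsub>D\<^esub> x)) \<in> \<real>\<^sub>\<ge>\<^sub>0"
        unfolding sq[OF x] F.S_self_snorm[OF x] of_real_mult[symmetric] of_real_diff[symmetric]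
        by (simp only: nonneg_Reals_of_real_iff)
    qed (use \<open>a \<in> carrier D\<close> in \<open>simp_all add: fs algebra_simps\<close>)
  qed
  have "\<exists>\<omega>. state (universal_cstar PM BR) \<omega> \<and> (\<forall>m\<in>carrier PM. \<omega> (universal_gen PM BR m) = \<phi> m)"
  proof (rule TU.state_of_lin[of \<phi>])
    show "\<phi> \<one>\<^bsub>PM\<^esub> = 1" using s by (simp add: \<phi>_def state_def)
    show "lin \<phi> (adj T x \<otimes>\<^bsub>T\<^esub> x) \<in> \<real>\<^sub>\<ge>\<^sub>0" if x: "x \<in> carrier T" for x
      unfolding form[OF x] by (rule schur[OF F1.pos_form_axioms F2.pos_form_axioms x])
    fix r m1 m2 assume r: "r \<in> BR" and m: "m1 \<in> carrier PM" "m2 \<in> carrier PM"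
    obtain a1 b1 a2 b2 where m12: "m1 = (a1, b1)" "m2 = (a2, b2)" and c: "a1 \<in> carrier A" "b1 \<in> carrier B"
      "a2 \<in> carrier A" "b2 \<in> carrier B" using m by auto
    have fd: "finite {x. delta a x \<noteq> 0}" "finite {x. c * delta a x \<noteq> 0}" for a :: "'a \<times> 'b" and c
      by (auto simp: delta_def)
    have fd2: "finite {x. delta a x - delta b x \<noteq> 0}" for a b :: "'a \<times> 'b"
      by (rule finite_subset[of _ "{a, b}"]) (auto simp: delta_def)
    note ls = lin_diff[OF fd(1) fd(2)] lin_diff[OF fd2 fd(1)] lin_diff[OF fd(1) fd(1)] lin_smult
    note as = A.l_distr A.r_distr B.l_distr B.r_distr A.smult_mult_l A.smult_mult_r B.smult_mult_l B.smult_mult_r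
      F1.F_add F1.F_smult F2.F_add F2.F_smult
    show "lin (\<lambda>m. \<phi> (m1 \<otimes>\<^bsub>PM\<^esub> (m \<otimes>\<^bsub>PM\<^esub> m2))) r = 0"
      using r
    proof (cases rule: BR_cases)
      case add_l then show ?thesis using c by (simp add: ls \<phi>_def m12 as) (simp add: algebra_simps)
    next
      case add_r then show ?thesis using c by (simp add: ls \<phi>_def m12 as) (simp add: algebra_simps)
    next
      case smult_l then show ?thesis using c by (simp add: ls \<phi>_def m12 as algebra_simps)
    next
      case smult_r then show ?thesis using c by (simp add: ls \<phi>_def m12 as algebra_simps)
    qed
  next
    fix m assume "m \<in> carrier PM"
    then obtain a b where m: "m = (a, b)" and a: "a \<in> carrier A" and b: "b \<in> carrier B" by auto
    show "\<exists>c. \<forall>y\<in>carrier T. Re (lin \<phi> (adj T (delta m \<otimes>\<^bsub>T\<^esub> y) \<otimes>\<^bsub>T\<^esub> (delta m \<otimes>\<^bsub>T\<^esub> y)))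
        \<le> c\<^sup>2 * Re (lin \<phi> (adj T y \<otimes>\<^bsub>T\<^esub> y))"
    proof (intro exI[of _ "nrm A a * nrm B b"] ballI)
      fix y assume y: "y \<in> carrier T"
      let ?a = "adj A a \<otimes>\<^bsub>A\<^esub> a" and ?b = "adj B b \<otimes>\<^bsub>B\<^esub> b"
      have d: "delta m \<in> carrier T" "delta (?a, ?b) \<in> carrier T" using m a b by (auto intro!: PM.delta_closed)
      have "adj T (delta m \<otimes>\<^bsub>T\<^esub> y) \<otimes>\<^bsub>T\<^esub> (delta m \<otimes>\<^bsub>T\<^esub> y) = adj T y \<otimes>\<^bsub>T\<^esub> (adj T (delta m) \<otimes>\<^bsub>T\<^esub> delta m \<otimes>\<^bsub>T\<^esub> y)"
        using d y by (simp add: TU.MA.adj_mult TU.MA.m_assoc)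
      also have "adj T (delta m) \<otimes>\<^bsub>T\<^esub> delta m = delta (?a, ?b)"
        using a b by (simp add: m PM.delta_adj PM.delta_mult)
      finally have e: "adj T (delta m \<otimes>\<^bsub>T\<^esub> y) \<otimes>\<^bsub>T\<^esub> (delta m \<otimes>\<^bsub>T\<^esub> y) = adj T y \<otimes>\<^bsub>T\<^esub> (delta (?a, ?b) \<otimes>\<^bsub>T\<^esub> y)" .
      let ?S = "\<lambda>x y. \<omega>1 (adj A x \<otimes>\<^bsub>A\<^esub> y)" and ?S' = "\<lambda>x y. \<omega>2 (adj B x \<otimes>\<^bsub>B\<^esub> y)"
      let ?Sa = "\<lambda>x y. \<omega>1 (adj A x \<otimes>\<^bsub>A\<^esub> (?a \<otimes>\<^bsub>A\<^esub> y))" and ?Sb = "\<lambda>x y. \<omega>2 (adj B x \<otimes>\<^bsub>B\<^esub> (?b \<otimes>\<^bsub>B\<^esub> y))"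
      let ?Q = "\<lambda>U V. \<Sum>p | y p \<noteq> 0. \<Sum>q | y q \<noteq> 0. cnj (y p) * y q * (U (fst p) (fst q) * V (snd p) (snd q))"
      have "lin \<phi> (adj T y \<otimes>\<^bsub>T\<^esub> (delta (?a, ?b) \<otimes>\<^bsub>T\<^esub> y)) =
          lin (\<lambda>p. lin (\<lambda>q. \<phi> (p \<otimes>\<^bsub>PM\<^esub> ((?a, ?b) \<otimes>\<^bsub>PM\<^esub> q))) y) (adj T y)"
        using d y by (simp add: PM.MA_lin_mult)
      also have "\<dots> = ?Q ?Sa ?Sb"
        using y by (simp add: PM.MA_lin_adj) (auto simp: lin_def sum_distrib_left mult.assoc \<phi>_def intro!: sum.cong)
      finally have e2: "lin \<phi> (adj T (delta m \<otimes>\<^bsub>T\<^esub> y) \<otimes>\<^bsub>T\<^esub> (delta m \<otimes>\<^bsub>T\<^esub> y)) = ?Q ?Sa ?Sb" unfolding e .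
      have e1: "lin \<phi> (adj T y \<otimes>\<^bsub>T\<^esub> y) = ?Q ?S ?S'" by (rule form[OF y])
      let ?\<alpha> = "complex_of_real ((nrm A a)\<^sup>2)" and ?\<beta> = "complex_of_real ((nrm B b)\<^sup>2)"
      let ?Da = "\<lambda>x y. ?\<alpha> * ?S x y - ?Sa x y" and ?Db = "\<lambda>x y. ?\<beta> * ?S' x y - ?Sb x y"
      have Rm: "Re (of_real r * w) = r * Re w" for r w by simp
      have p1: "?Q ?Da ?S' \<in> \<real>\<^sub>\<ge>\<^sub>0"
        by (rule schur[OF bound1(1)[OF A.seminormed_star_alg_axioms F1.pos_functional_axioms s(1) a] F2.pos_form_axioms y])
      have p2: "?Q ?Sa ?Db \<in> \<real>\<^sub>\<ge>\<^sub>0"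
        by (rule schur[OF bound1(2)[OF A.seminormed_star_alg_axioms F1.pos_functional_axioms s(1) a]
            bound1(1)[OF B.seminormed_star_alg_axioms F2.pos_functional_axioms s(2) b] y])
      \<comment> \<open>Telescoping: the difference of the two tensor forms is a sum of two terms,
        each of which changes one factor only and is positive by Schur's theorem.\<close>
      have "?\<beta> * ?Q ?Da ?S' + ?Q ?Sa ?Db = ?\<beta> * ?\<alpha> * ?Q ?S ?S' - ?Q ?Sa ?Sb"
        unfolding sum_distrib_left sum.distrib[symmetric] sum_subtractf[symmetric]
        by (intro sum.cong refl) (simp add: algebra_simps)
      moreover have "?\<beta> * ?Q ?Da ?S' + ?Q ?Sa ?Db \<in> \<real>\<^sub>\<ge>\<^sub>0"
        by (intro nonneg_Reals_add_I nonneg_Reals_mult_I p1 p2) (simp only: nonneg_Reals_of_real_iff zero_le_power2)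
      ultimately have "0 \<le> Re (?\<beta> * ?\<alpha> * ?Q ?S ?S' - ?Q ?Sa ?Sb)" by (simp only: complex_nonneg_Reals_iff)
      also have "?\<beta> * ?\<alpha> = of_real ((nrm A a * nrm B b)\<^sup>2)" by (simp add: power_mult_distrib mult.commute)
      finally show "Re (lin \<phi> (adj T (delta m \<otimes>\<^bsub>T\<^esub> y) \<otimes>\<^bsub>T\<^esub> (delta m \<otimes>\<^bsub>T\<^esub> y)))
        \<le> (nrm A a * nrm B b)\<^sup>2 * Re (lin \<phi> (adj T y \<otimes>\<^bsub>T\<^esub> y))"
        unfolding e1 e2 minus_complex.sel Rm by simp
    qed
  qed (use that in blast)
  then obtain \<omega> where "state (universal_cstar PM BR) \<omega>" "\<forall>m\<in>carrier PM. \<omega> (universal_gen PM BR m) = \<phi> m" by blast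
  then show thesis using that[of \<omega>] by (simp add: cstar_tensor_def elem_tensor_def \<phi>_def)
qed

lemma product_state:
  assumes s: "state A \<omega>1" "state B \<omega>2"
  shows "state (cstar_tensor A B) (product_state A B \<omega>1 \<omega>2)"
    and "\<And>a b. \<lbrakk>a \<in> carrier A; b \<in> carrier B\<rbrakk> \<Longrightarrow>
      product_state A B \<omega>1 \<omega>2 (elem_tensor A B a b) = \<omega>1 a * \<omega>2 b"
proof -
  let ?P = "\<lambda>\<omega>. state (cstar_tensor A B) \<omega> \<and>
    (\<forall>a\<in>carrier A. \<forall>b\<in>carrier B. \<omega> (elem_tensor A B a b) = \<omega>1 a * \<omega>2 b)"
  obtain \<omega> where \<omega>: "?P \<omega>" using product_state_exists[OF s] by metis
  have "?P (product_state A B \<omega>1 \<omega>2)"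
    unfolding product_state_def
  proof (rule theI[where P = ?P, OF \<omega>])
    fix \<omega>' assume \<omega>': "?P \<omega>'"
    show "\<omega>' = \<omega>"
      by (rule TU.state_eqI_gen) (use \<omega> \<omega>' in \<open>auto simp: cstar_tensor_def elem_tensor_def\<close>)
  qed
  then show "state (cstar_tensor A B) (product_state A B \<omega>1 \<omega>2)"
    "\<And>a b. \<lbrakk>a \<in> carrier A; b \<in> carrier B\<rbrakk> \<Longrightarrow> product_state A B \<omega>1 \<omega>2 (elem_tensor A B a b) = \<omega>1 a * \<omega>2 b" by auto
qed

end

section \<open>Tensors of words\<close>

lemma words_append: "A @ B \<in> words n (k + l) \<longleftrightarrow> A \<in> words n k \<and> B \<in> words n l" if "length A = k"
  using that by (auto simp: words_def)

lemma words_0 [simp]: "words n 0 = {[]}"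
  by (auto simp: words_def)

lemma finite_words [simp]: "finite (words n m)"
  using finite_lists_length_eq[of "{1..n}" m] by (simp add: words_def conj_commute)

lemma words_length: "J \<in> words n m \<Longrightarrow> length J = m"
  by (simp add: words_def)

lemma take_drop_words:
  "L \<in> words n (k + l) \<Longrightarrow> take k L \<in> words n k \<and> drop k L \<in> words n l"
  by (auto simp: words_def dest: in_set_takeD in_set_dropD)

lemma sum_words_add:
  "(\<Sum>L\<in>words n (k + l). h L) = (\<Sum>A\<in>words n k. \<Sum>B\<in>words n l. h (A @ B))"
proof -
  have "(\<Sum>L\<in>words n (k + l). h L) = (\<Sum>(A, B)\<in>words n k \<times> words n l. h (A @ B))"
    by (rule sum.reindex_bij_witness[where i = "\<lambda>(A, B). A @ B" and j = "\<lambda>L. (take k L, drop k L)"])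
      (auto simp: take_drop_words words_append words_length dest: words_length)
  then show ?thesis by (simp add: sum.cartesian_product)
qed

lemma sum_words_Suc: "(\<Sum>L\<in>words n (Suc r). h L) = (\<Sum>i=1..n. \<Sum>L\<in>words n r. h (i # L))"
proof -
  have "words n 1 = (\<lambda>i. [i]) ` {1..n}"
    by (auto simp: words_def length_Suc_conv image_iff)
  then show ?thesis using sum_words_add[of h n 1 r] by (simp add: sum.reindex inj_on_def)
qed

lemma vectors_zero: "\<lbrakk>z \<in> vectors n m; J \<notin> words n m\<rbrakk> \<Longrightarrow> z J = 0"
  by (simp add: vectors_def)

lemma vectors_zero_length: "\<lbrakk>z \<in> vectors n m; length J \<noteq> m\<rbrakk> \<Longrightarrow> z J = 0"
  by (auto simp: vectors_def words_def)

lemma vectors_smult: "z \<in> vectors n m \<Longrightarrow> (\<lambda>J. c * z J) \<in> vectors n m"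
  by (simp add: vectors_def)

lemma vectors_eqI:
  assumes "z \<in> vectors n m" "y \<in> vectors n m" "\<And>J. J \<in> words n m \<Longrightarrow> z J = y J" shows "z = y"
  using assms by (auto simp: vectors_def fun_eq_iff) metis

text \<open>The tensor product of two coordinate functions. The degree \<open>k\<close> of the left
  factor says where a word is to be cut.\<close>

definition tens :: "nat \<Rightarrow> (nat list \<Rightarrow> complex) \<Rightarrow> (nat list \<Rightarrow> complex) \<Rightarrow> nat list \<Rightarrow> complex" where
  "tens k x y J = x (take k J) * y (drop k J)"

lemma tens_append: "length A = k \<Longrightarrow> tens k x y (A @ B) = x A * y B"
  by (simp add: tens_def)

lemma tens_vectors: "\<lbrakk>x \<in> vectors n k; y \<in> vectors n l\<rbrakk> \<Longrightarrow> tens k x y \<in> vectors n (k + l)"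
proof -
  assume xy: "x \<in> vectors n k" "y \<in> vectors n l"
  have "J \<in> words n (k + l)" if "tens k x y J \<noteq> 0" for J
  proof -
    have "take k J \<in> words n k" "drop k J \<in> words n l" using that xy by (auto simp: tens_def vectors_def)
    then show ?thesis using words_append[of "take k J" k "drop k J" n l] words_length[of "take k J" n k] by simp
  qed
  then show ?thesis by (auto simp: vectors_def)
qed

lemma tens_assoc: "tens (k + l) (tens k x y) w = tens k x (tens l y w)"
  by (rule ext) (simp add: tens_def min_def drop_take mult.assoc add.commute)

lemma tens_smult_l: "tens k (\<lambda>J. c * x J) y = (\<lambda>J. c * tens k x y J)"
  and tens_smult_r: "tens k x (\<lambda>J. c * y J) = (\<lambda>J. c * tens k x y J)"
  by (simp_all add: tens_def fun_eq_iff)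

lemma tensor_power_Suc: "tensor_power k x (Suc p) = tens k x (tensor_power k x p)"
  by (rule ext) (simp add: tens_def)

lemma tensor_power_vectors: "x \<in> vectors n k \<Longrightarrow> tensor_power k x p \<in> vectors n (p * k)"
proof (induction p)
  case (Suc p) then show ?case unfolding tensor_power_Suc using tens_vectors by simp
qed (simp add: vectors_def)

lemma tensor_power_add:
  "tensor_power k x (p + q) = tens (p * k) (tensor_power k x p) (tensor_power k x q)"
proof (induction p)
  case 0 show ?case by (rule ext) (simp add: tens_def)
next
  case (Suc p)
  have "tensor_power k x (Suc p + q) = tens k x (tens (p * k) (tensor_power k x p) (tensor_power k x q))"
    using Suc by (simp add: tensor_power_Suc del: tensor_power.simps)
  then show ?case by (simp add: tens_assoc[symmetric] tensor_power_Suc del: tensor_power.simps)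
qed

lemma tensor_power_1: "x \<in> vectors n k \<Longrightarrow> tensor_power k x (Suc 0) = x"
  by (rule ext) (auto simp: vectors_zero_length)

lemma tensor_power_power: "tensor_power (q * k) (tensor_power k x q) p = tensor_power k x (p * q)"
proof (induction p)
  case (Suc p)
  then show ?case using tensor_power_add[of k x q "p * q"] by (simp add: tensor_power_Suc del: tensor_power.simps(2))
qed (simp add: fun_eq_iff)

lemma tensor_power_smult: "tensor_power k (\<lambda>J. c * x J) p = (\<lambda>J. c ^ p * tensor_power k x p J)"
  by (induction p) (auto simp: fun_eq_iff)

lemma tensor_power_comm: "x \<in> vectors n k \<Longrightarrow> tens k x (tensor_power k x p) = tens (p * k) (tensor_power k x p) x"
  using tensor_power_add[of k x p 1] tensor_power_Suc[of k x p] by (simp add: tensor_power_1 del: tensor_power.simps)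

lemma tens_nonzero: "\<lbrakk>x \<in> vectors n k; x A \<noteq> 0; y B \<noteq> 0\<rbrakk> \<Longrightarrow> tens k x y (A @ B) \<noteq> 0"
  by (metis mult_eq_0_iff tens_append vectors_zero_length)

lemma tensor_power_nonzero:
  assumes x: "x \<in> vectors n k" and A: "x A \<noteq> 0" shows "tensor_power k x p (concat (replicate p A)) \<noteq> 0"
proof -
  have "length A = k" using vectors_zero_length[OF x] A by blast
  then show ?thesis using A by (induction p) auto
qed

lemma tensor_power_nonzero_base:
  assumes "tensor_power k x p J \<noteq> 0" "p \<ge> 1" obtains A where "x A \<noteq> 0"
  using assms by (cases p) auto

text \<open>Euclid's algorithm on the degrees, cancelling the shorter tensor from the longer one.\<close>

lemma commuting_tensors_root_le:
  assumes "m \<ge> 1" "m \<le> k" and z: "z \<in> vectors n m" and w: "w \<in> vectors n k"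
    and z0: "z J0 \<noteq> 0" and w0: "w K0 \<noteq> 0" and comm: "\<And>J. tens m z w J = c * tens k w z J"
  shows "c = 1 \<and> (\<exists>x a b. x \<in> vectors n (gcd m k) \<and> z = (\<lambda>J. a * tensor_power (gcd m k) x (m div gcd m k) J) \<and>
    w = (\<lambda>J. b * tensor_power (gcd m k) x (k div gcd m k) J))"
  using assms
proof (induction "m + k" arbitrary: m k z w J0 K0 c rule: less_induct)
  case less
  note z = less.prems(3) and w = less.prems(4) and z0 = less.prems(5) and w0 = less.prems(6) and comm = less.prems(7)
  have lJ: "length J0 = m" using vectors_zero_length[OF z] z0 by blast
  have lK: "length K0 = k" using vectors_zero_length[OF w] w0 by blast
  have c0: "c \<noteq> 0" using comm[of "J0 @ K0"] lJ z0 w0 by (auto simp: tens_append)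
  show ?case
  proof (cases "m = k")
    case True
    have e: "z J * w K = c * (w J * z K)" if "length J = m" for J K
      using comm[of "J @ K"] that True by (simp add: tens_append)
    \<comment> \<open>Equal degrees: freezing the second half at \<open>K0\<close> makes
      \<open>z\<close> a multiple of \<open>w\<close>, and the pair of \<open>K0\<close> with itself
      then forces \<open>c = 1\<close>.\<close>
    define d where "d = c * z K0 / w K0"
    have zd: "z J = d * w J" for J
    proof (cases "length J = m")
      case l: True then show ?thesis using e[OF l, of K0] w0 by (simp add: d_def field_simps)
    next
      case False then show ?thesis using vectors_zero_length[OF z] vectors_zero_length[OF w] True by simp
    qed
    have d0: "d \<noteq> 0" using zd[of J0] z0 by auto
    have "c = 1" using e[of K0 K0] lK True w0 d0 by (simp add: zd)
    moreover have "\<exists>x a b. x \<in> vectors n m \<and> z = (\<lambda>J. a * tensor_power m x 1 J) \<and> w = (\<lambda>J. b * tensor_power m x 1 J)"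
      using z d0 zd tensor_power_1[OF z] by (intro exI[of _ z] exI[of _ 1] exI[of _ "1 / d"]) (auto simp del: tensor_power.simps)
    ultimately show ?thesis using True \<open>m \<ge> 1\<close> by simp
  next
    case False
    then have mk: "m < k" using less.prems(2) by simp
    define l where "l = k - m"
    have k: "k = m + l" and l1: "1 \<le> l" using mk by (auto simp: l_def)
    \<comment> \<open>Freezing the last \<open>m\<close> letters at \<open>J0\<close> turns the
      commutation relation into a factorisation of \<open>w\<close> with left factor
      \<open>z\<close>.\<close>
    define w' where "w' B = w (B @ J0) / (c * z J0)" for B
    have w'v: "w' \<in> vectors n l"
    proof -
      have "B \<in> words n l" if "w' B \<noteq> 0" for B
      proof -
        have "B @ J0 \<in> words n k" using that w by (auto simp: w'_def vectors_def)
        then show ?thesis using lJ k by (auto simp: words_def)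
      qed
      then show ?thesis by (auto simp: vectors_def)
    qed
    have ww: "w = tens m z w'"
    proof
      fix A show "w A = tens m z w' A"
      proof (cases "length A = k")
        case True
        then have "z (take m A) * w (drop m A @ J0) = c * (w A * z J0)"
          using comm[of "A @ J0"] k by (simp add: tens_def)
        then show ?thesis using c0 z0 by (simp add: tens_def w'_def field_simps)
      next
        case False
        then show ?thesis using vectors_zero_length[OF w] vectors_zero_length[OF tens_vectors[OF z w'v]] k by simp
      qed
    qed
    then obtain B0 where B0: "w' B0 \<noteq> 0" using w0 by (auto simp: tens_def)
    \<comment> \<open>Both sides begin with the factor \<open>z\<close>, which is cancelled at words
      starting with \<open>J0\<close>.\<close>
    have comm': "tens m z w' L = c * tens l w' z L" for L
    proof -
      have "tens m z (tens m z w') (J0 @ L) = c * tens m z (tens l w' z) (J0 @ L)"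
        using comm[of "J0 @ L"] unfolding ww k by (simp add: tens_assoc)
      then show ?thesis using z0 lJ by (simp add: tens_append)
    qed
    have "c = 1 \<and> (\<exists>x a b. x \<in> vectors n (gcd m l) \<and> z = (\<lambda>J. a * tensor_power (gcd m l) x (m div gcd m l) J) \<and>
      w' = (\<lambda>J. b * tensor_power (gcd m l) x (l div gcd m l) J))"
    proof (cases "m \<le> l")
      case True
      show ?thesis using less.hyps[OF _ less.prems(1) True z w'v z0 B0 comm'] k less.prems(1) by simp
    next
      case False
      \<comment> \<open>Here the remainder is the shorter vector, so the roles are exchanged and
        \<open>c\<close> is replaced by its inverse.\<close>
      have sw: "tens l w' z L = (1 / c) * tens m z w' L" for L using comm'[of L] c0 by simp
      have "1 / c = 1 \<and> (\<exists>x a b. x \<in> vectors n (gcd l m) \<and> w' = (\<lambda>J. a * tensor_power (gcd l m) x (l div gcd l m) J) \<and>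
        z = (\<lambda>J. b * tensor_power (gcd l m) x (m div gcd l m) J))"
        by (rule less.hyps[OF _ l1 _ w'v z B0 z0 sw]) (use False k less.prems(1) in auto)
      then show ?thesis by (simp add: gcd.commute[of l m]) blast
    qed
    then obtain x a b where c: "c = 1" and x: "x \<in> vectors n (gcd m l)"
      and za: "z = (\<lambda>J. a * tensor_power (gcd m l) x (m div gcd m l) J)"
      and wb: "w' = (\<lambda>J. b * tensor_power (gcd m l) x (l div gcd m l) J)" by blast
    have g: "gcd m k = gcd m l" by (simp add: k)
    have "k div gcd m l = m div gcd m l + l div gcd m l" unfolding k by (simp add: div_plus_div_distrib_dvd_left)
    then have "w = (\<lambda>J. (a * b) * tensor_power (gcd m l) x (k div gcd m l) J)"
      using tensor_power_add[of "gcd m l" x "m div gcd m l" "l div gcd m l"]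
      unfolding ww by (subst za, subst wb) (simp add: tens_smult_l tens_smult_r mult.assoc)
    then show ?thesis unfolding g using c x za by blast
  qed
qed

lemma commuting_tensors_root:
  assumes "m \<ge> 1" "k \<ge> 1" and z: "z \<in> vectors n m" and w: "w \<in> vectors n k"
    and z0: "z J0 \<noteq> 0" and w0: "w K0 \<noteq> 0" and comm: "\<And>J. tens m z w J = c * tens k w z J"
  obtains x a b where "c = 1" "x \<in> vectors n (gcd m k)"
    "z = (\<lambda>J. a * tensor_power (gcd m k) x (m div gcd m k) J)"
    "w = (\<lambda>J. b * tensor_power (gcd m k) x (k div gcd m k) J)"
proof (cases "m \<le> k")
  case True
  then show ?thesis using commuting_tensors_root_le[OF assms(1) True z w z0 w0 comm] that by blast
next
  case False
  have lJ: "length J0 = m" using vectors_zero_length[OF z] z0 by blast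
  have c0: "c \<noteq> 0" using comm[of "J0 @ K0"] lJ z0 w0 by (auto simp: tens_append)
  have sw: "tens k w z L = (1 / c) * tens m z w L" for L using comm[of L] c0 by simp
  have "1 / c = 1 \<and> (\<exists>x a b. x \<in> vectors n (gcd k m) \<and> w = (\<lambda>J. a * tensor_power (gcd k m) x (k div gcd k m) J) \<and>
        z = (\<lambda>J. b * tensor_power (gcd k m) x (m div gcd k m) J))"
    by (rule commuting_tensors_root_le[OF assms(2) _ w z w0 z0 sw]) (use False in auto)
  then show ?thesis using that by (simp add: gcd.commute[of k m]) blast
qed

section \<open>Vectors that commute with a nonperiodic vector or with its powers\<close>

lemma complex_root_exists: assumes "p \<ge> 1" obtains r :: complex where "r ^ p = a"
proof -
  have "(rcis (root p (cmod a)) (Arg a / real p)) ^ p = a"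
    using assms by (simp add: DeMoivre2 rcis_cmod_Arg)
  then show thesis using that by blast
qed

text \<open>A p-th root of the scalar can be absorbed into the base of a p-th power.\<close>

lemma nonperiodic_smult:
  assumes np: "nonperiodic n m z" and a: "a \<noteq> 0" shows "nonperiodic n m (\<lambda>J. a * z J)"
  unfolding nonperiodic_def
proof (intro allI impI ballI, elim conjE)
  fix p k x assume p: "1 \<le> p" and k: "1 \<le> k" and x: "x \<in> vectors n k" and m: "m = p * k"
    and e: "(\<lambda>J. a * z J) = tensor_power k x p"
  obtain r where r: "r ^ p = 1 / a" using complex_root_exists[OF p] by blast
  have "z J = tensor_power k (\<lambda>J. r * x J) p J" for J
    using fun_cong[OF e, of J] a by (simp add: tensor_power_smult r field_simps)
  then have "z = tensor_power k (\<lambda>J. r * x J) p" by (rule ext)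
  then show "p = 1" using np vectors_smult[OF x, of r] p k m unfolding nonperiodic_def by blast
qed

text \<open>The common root is also a root of \<open>z\<close>, once its scalar is absorbed by a
  root of it. Nonperiodicity makes this root a first power, so the gcd of the degrees is
  \<open>m\<close>.\<close>

lemma nonperiodic_commuting:
  assumes m: "m \<ge> 1" and k: "k \<ge> 1" and z: "z \<in> vectors n m" and np: "nonperiodic n m z" and w: "w \<in> vectors n k"
    and z0: "z J0 \<noteq> 0" and w0: "w K0 \<noteq> 0" and comm: "\<And>J. tens m z w J = c * tens k w z J"
  obtains b where "m dvd k" "w = (\<lambda>J. b * tensor_power m z (k div m) J)"
proof -
  obtain x a b where x: "x \<in> vectors n (gcd m k)"
    and za: "z = (\<lambda>J. a * tensor_power (gcd m k) x (m div gcd m k) J)"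
    and wb: "w = (\<lambda>J. b * tensor_power (gcd m k) x (k div gcd m k) J)"
    by (rule commuting_tensors_root[OF m k z w z0 w0 comm]) blast
  define p where "p = m div gcd m k"
  have mp: "m = p * gcd m k" by (simp add: p_def)
  have p1: "p \<ge> 1" using m mp by (metis less_one mult_is_0 not_le)
  obtain r where r: "r ^ p = a" using complex_root_exists[OF p1] by blast
  have "z = tensor_power (gcd m k) (\<lambda>J. r * x J) p"
    unfolding tensor_power_smult r by (simp add: za p_def[symmetric])
  moreover have "1 \<le> gcd m k" using m by (simp add: Suc_le_eq)
  ultimately have "p = 1" using np vectors_smult[OF x, of r] p1 mp unfolding nonperiodic_def by blast
  then have g: "gcd m k = m" using mp by simp
  then have dv: "m dvd k" by (metis gcd_dvd2)
  have z': "z = (\<lambda>J. a * x J)" using za g m tensor_power_1[of x n m] x by (simp del: tensor_power.simps)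
  have a0: "a \<noteq> 0" using z0 z' by auto
  have "tensor_power m z (k div m) = (\<lambda>J. a ^ (k div m) * tensor_power m x (k div m) J)"
    unfolding z' by (rule tensor_power_smult)
  then have "w = (\<lambda>J. (b / a ^ (k div m)) * tensor_power m z (k div m) J)"
    using wb g a0 by simp
  then show thesis using that dv by blast
qed

text \<open>Both \<open>u \<otimes> x\<close> and \<open>x \<otimes> u\<close> are prefixes of a high power of \<open>x\<close>, hence proportional.\<close>

lemma commuting_power:
  assumes k: "k \<ge> 1" and p: "p \<ge> 1" and x: "x \<in> vectors n k" and u: "u \<in> vectors n r"
    and x0: "x J0 \<noteq> 0" and u0: "u K0 \<noteq> 0"
    and comm: "\<And>J. tens r u (tensor_power k x p) J = c * tens (p * k) (tensor_power k x p) u J"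
  obtains d where "\<And>J. tens k x u J = d * tens r u x J"
proof -
  let ?P = "tensor_power k x"
  have lK: "length K0 = r" using vectors_zero_length[OF u] u0 by blast
  define C where "C = concat (replicate p J0)"
  have C: "?P p C \<noteq> 0" unfolding C_def by (rule tensor_power_nonzero[OF x x0])
  have lC: "length C = p * k" using vectors_zero_length[OF tensor_power_vectors[OF x]] C by blast
  have c0: "c \<noteq> 0" using comm[of "K0 @ C"] u0 C lK by (auto simp: tens_append)
  \<comment> \<open>\<open>u\<close> is moved past \<open>N\<close> copies of
    \<open>tensor_power k x p\<close>, each of which costs a factor \<open>c\<close>.\<close>
  have comm': "tens r u (?P (N * p)) = (\<lambda>J. c ^ N * tens (N * p * k) (?P (N * p)) u J)" for N
  proof (induction N)
    case 0
    show ?case using vectors_zero_length[OF u] by (auto simp: tens_def fun_eq_iff)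
  next
    case (Suc N)
    have "tens r u (?P (Suc N * p)) = tens r u (tens (N * p * k) (?P (N * p)) (?P p))"
      using tensor_power_add[of k x "N * p" p] by (simp add: add.commute)
    also have "\<dots> = tens (r + N * p * k) (tens r u (?P (N * p))) (?P p)" by (simp add: tens_assoc)
    also have "\<dots> = (\<lambda>J. c ^ N * tens (N * p * k + r) (tens (N * p * k) (?P (N * p)) u) (?P p) J)"
      unfolding Suc by (simp add: tens_smult_l add.commute)
    also have "\<dots> = (\<lambda>J. c ^ N * tens (N * p * k) (?P (N * p)) (tens r u (?P p)) J)" by (simp add: tens_assoc)
    also have "tens r u (?P p) = (\<lambda>J. c * tens (p * k) (?P p) u J)" by (rule ext) (rule comm)
    also have "(\<lambda>J. c ^ N * tens (N * p * k) (?P (N * p)) (\<lambda>J. c * tens (p * k) (?P p) u J) J) =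
        (\<lambda>J. c ^ Suc N * tens (N * p * k) (?P (N * p)) (tens (p * k) (?P p) u) J)"
      by (simp add: tens_smult_r mult.assoc mult.left_commute)
    also have "tens (N * p * k) (?P (N * p)) (tens (p * k) (?P p) u) = tens (Suc N * p * k) (?P (Suc N * p)) u"
      using tensor_power_add[of k x "N * p" p] by (simp add: tens_assoc[symmetric] add.commute distrib_right)
    finally show ?case .
  qed
  \<comment> \<open>A multiple of \<open>p\<close>, so that \<open>comm'\<close> applies, and large
    enough that degree \<open>Q * k\<close> leaves room for a prefix of degree
    \<open>r + k\<close>.\<close>
  define Q where "Q = Suc r * p"
  have Q1: "Q \<ge> 1" using p by (simp add: Q_def)
  have Qk: "r + k \<le> Q * k"
  proof -
    have "r \<le> r * k" using k by simp
    then have "r + k \<le> Suc r * k * 1" by simp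
    also have "\<dots> \<le> Suc r * k * p" by (intro mult_le_mono2 p)
    finally show ?thesis by (simp add: Q_def algebra_simps)
  qed
  define e where "e = c ^ Suc r"
  have e0: "e \<noteq> 0" using c0 by (simp add: e_def)
  have i: "tens r u (?P Q) = (\<lambda>J. e * tens (Q * k) (?P Q) u J)"
    using comm'[of "Suc r"] unfolding Q_def e_def .
  have PQ: "?P Q = tens k x (?P (Q - 1))" using tensor_power_Suc[of k x "Q - 1"] Q1 by simp
  have i': "tens (r + k) (tens r u x) (?P (Q - 1)) J = e * tens (Q * k) (?P Q) u J" for J
    using fun_cong[OF i, of J] PQ by (simp add: tens_assoc)
  have ii': "tens (k + r) (tens k x u) (?P Q) J = e * tens (Q * k) (?P Q) (tens k x u) J" for J
  proof -
    have "tens (k + r) (tens k x u) (?P Q) = tens k x (\<lambda>J. e * tens (Q * k) (?P Q) u J)"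
      unfolding tens_assoc i ..
    also have "\<dots> = (\<lambda>J. e * tens (k + Q * k) (tens k x (?P Q)) u J)" by (simp add: tens_smult_r tens_assoc)
    also have "\<dots> = (\<lambda>J. e * tens (Q * k) (?P Q) (tens k x u) J)"
      unfolding tensor_power_comm[OF x] add.commute[of k] by (simp add: tens_assoc)
    finally show ?thesis by simp
  qed
  have xu0: "tens k x u (J0 @ K0) \<noteq> 0" using x x0 u0 by (rule tens_nonzero)
  \<comment> \<open>Freezing the trailing word exhibits \<open>?P Q\<close> as
    \<open>tens r u x\<close> followed by \<open>a\<close>, and likewise as
    \<open>tens k x u\<close> followed by \<open>b\<close>.\<close>
  define a where "a E = ?P (Q - 1) (E @ K0) / (e * u K0)" for E
  define b where "b E = ?P Q (E @ (J0 @ K0)) / (e * tens k x u (J0 @ K0))" for E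
  have A: "?P Q D = tens (r + k) (tens r u x) a D" if "length D = Q * k" for D
    using i'[of "D @ K0"] that e0 u0 Qk unfolding tens_def[of "Q * k"] tens_def[of "r + k"]
    by (simp add: a_def field_simps)
  have B: "?P Q D = tens (k + r) (tens k x u) b D" if "length D = Q * k" for D
    using ii'[of "D @ (J0 @ K0)"] that e0 xu0 Qk unfolding tens_def[of "Q * k"] tens_def[of "k + r"]
    by (simp add: b_def field_simps)
  define D where "D = concat (replicate Q J0)"
  have D: "?P Q D \<noteq> 0" unfolding D_def by (rule tensor_power_nonzero[OF x x0])
  have lD: "length D = Q * k" using vectors_zero_length[OF tensor_power_vectors[OF x]] D by blast
  let ?E = "drop (r + k) D"
  have b0: "b ?E \<noteq> 0" using D B[OF lD] by (auto simp: tens_def[of "k + r"] add.commute)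
  have "tens k x u J = (a ?E / b ?E) * tens r u x J" for J
  proof (cases "length J = r + k")
    case True
    have "length (J @ ?E) = Q * k" using True lD Qk by simp
    from A[OF this] B[OF this] have "tens r u x J * a ?E = tens k x u J * b ?E"
      using True by (simp add: tens_def[of "r + k"] tens_def[of "k + r"] add.commute)
    then show ?thesis using b0 by (simp add: field_simps)
  next
    case False
    then show ?thesis
      using vectors_zero_length[OF tens_vectors[OF x u], of J] vectors_zero_length[OF tens_vectors[OF u x], of J]
      by (simp add: add.commute)
  qed
  then show thesis using that by blast
qed

lemma nonperiodic_commuting_power:
  assumes k: "k \<ge> 1" and r: "r \<ge> 1" and p: "p \<ge> 1" and x: "x \<in> vectors n k" and np: "nonperiodic n k x"
    and u: "u \<in> vectors n r" and x0: "x J0 \<noteq> 0" and u0: "u K0 \<noteq> 0"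
    and comm: "\<And>J. tens r u (tensor_power k x p) J = c * tens (p * k) (tensor_power k x p) u J"
  obtains b where "k dvd r" "u = (\<lambda>J. b * tensor_power k x (r div k) J)"
proof -
  obtain d where d: "\<And>J. tens k x u J = d * tens r u x J"
    by (rule commuting_power[OF k p x u x0 u0 comm]) blast
  show thesis by (rule nonperiodic_commuting[OF k r x np u x0 u0 d]) (rule that)
qed

text \<open>The base \<open>u\<close> commutes with its own power, hence with the power of
  \<open>z\<close>, and its degree is then restricted by
  \<open>nonperiodic_commuting_power\<close>.\<close>

lemma nonperiodic_power_eq:
  assumes m: "m \<ge> 1" and k: "k \<ge> 1" and \<alpha>: "\<alpha> \<ge> 1" and p: "p \<ge> 1"
    and z: "z \<in> vectors n m" and np: "nonperiodic n m z" and u: "u \<in> vectors n k" and z0: "z J0 \<noteq> 0"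
    and eq: "\<And>J. tensor_power m z \<alpha> J = c * tensor_power k u p J"
  shows "m dvd k"
proof -
  have Z: "tensor_power m z \<alpha> (concat (replicate \<alpha> J0)) \<noteq> 0" by (rule tensor_power_nonzero[OF z z0])
  then have "tensor_power k u p (concat (replicate \<alpha> J0)) \<noteq> 0" using eq by auto
  then obtain K0 where u0: "u K0 \<noteq> 0" using p by (rule tensor_power_nonzero_base)
  have e: "tensor_power m z \<alpha> = (\<lambda>J. c * tensor_power k u p J)" using eq by (rule ext)
  have len: "\<alpha> * m = p * k"
    using Z eq vectors_zero_length[OF tensor_power_vectors[OF z]] vectors_zero_length[OF tensor_power_vectors[OF u]]
    by (metis mult_zero_right)
  have "tens k u (tensor_power m z \<alpha>) J = 1 * tens (\<alpha> * m) (tensor_power m z \<alpha>) u J" for J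
    unfolding e len by (simp add: tens_smult_l tens_smult_r tensor_power_comm[OF u])
  then show ?thesis by (rule nonperiodic_commuting_power[OF m k \<alpha> z np u z0 u0]) blast
qed

section \<open>Norms and the box product\<close>

lemma norm_tens:
  "(\<Sum>J\<in>words n (k + l). (cmod (tens k x y J))\<^sup>2) = (\<Sum>J\<in>words n k. (cmod (x J))\<^sup>2) * (\<Sum>J\<in>words n l. (cmod (y J))\<^sup>2)"
  unfolding sum_words_add sum_product
  by (intro sum.cong refl) (simp add: tens_append words_length norm_mult power_mult_distrib)

lemma norm_tensor_power:
  "(\<Sum>J\<in>words n (p * k). (cmod (tensor_power k x p J))\<^sup>2) = (\<Sum>J\<in>words n k. (cmod (x J))\<^sup>2) ^ p"
proof (induction p)
  case (Suc p)
  then show ?case using norm_tens[of k x "tensor_power k x p" n "p * k"] by (simp add: tensor_power_Suc del: tensor_power.simps)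
qed simp

lemma tensor_power_unit: "x \<in> unit_vectors n k \<Longrightarrow> tensor_power k x p \<in> unit_vectors n (p * k)"
  using norm_tensor_power[where n = n and p = p and k = k and x = x] by (simp add: unit_vectors_def tensor_power_vectors)

lemma unit_vectors_vectors: "x \<in> unit_vectors n k \<Longrightarrow> x \<in> vectors n k"
  by (simp add: unit_vectors_def)

lemma unit_vectors_nonzero: assumes "x \<in> unit_vectors n k" obtains J where "x J \<noteq> 0"
proof -
  have "\<exists>J. x J \<noteq> 0"
  proof (rule ccontr)
    assume "\<nexists>J. x J \<noteq> 0"
    then show False using assms by (simp add: unit_vectors_def)
  qed
  then show thesis using that by blast
qed

text \<open>\<open>box_fst\<close> and \<open>box_snd\<close> invert \<open>boxtimes_word\<close>
  letter by letter. Letters start at 1 and digits at 0, hence the shifts around \<open>div\<close>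
  and \<open>mod\<close>.\<close>

definition box_fst :: "nat \<Rightarrow> nat list \<Rightarrow> nat list" where "box_fst n' L = map (\<lambda>l. (l - 1) div n' + 1) L"
definition box_snd :: "nat \<Rightarrow> nat list \<Rightarrow> nat list" where "box_snd n' L = map (\<lambda>l. (l - 1) mod n' + 1) L"

lemma length_box [simp]: "length (box_fst n' L) = length L" "length (box_snd n' L) = length L"
  by (simp_all add: box_fst_def box_snd_def)

lemma box_letter:
  assumes "l \<in> {1..n * n' :: nat}"
  shows "(l - 1) div n' + 1 \<in> {1..n}" "(l - 1) mod n' + 1 \<in> {1..n'}"
proof -
  have n': "0 < n'" using assms by (cases n') auto
  have "l - 1 < n * n'" using assms by auto
  then have "(l - 1) div n' < n" by (simp add: less_mult_imp_div_less)
  then show "(l - 1) div n' + 1 \<in> {1..n}" by simp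
  show "(l - 1) mod n' + 1 \<in> {1..n'}" using n' by (simp add: Suc_le_eq)
qed

lemma box_letter_inv:
  assumes "j \<in> {1..n :: nat}" "k \<in> {1..n' :: nat}"
  shows "n' * (j - 1) + k \<in> {1..n * n'}" "(n' * (j - 1) + k - 1) div n' + 1 = j" "(n' * (j - 1) + k - 1) mod n' + 1 = k"
proof -
  have n': "0 < n'" using assms by auto
  have "n' * (j - 1) + k \<le> n' * (j - 1) + n' * 1" using assms by simp
  also have "\<dots> = n' * j" using assms by (cases j) auto
  also have "\<dots> \<le> n * n'" using assms by (simp add: mult.commute)
  finally show "n' * (j - 1) + k \<in> {1..n * n'}" using assms by simp
  define a b where "a = j - 1" and "b = k - 1"
  have ab: "n' * (j - 1) + k - 1 = b + n' * a" "b < n'" "j = a + 1" "k = b + 1" using assms by (auto simp: a_def b_def)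
  show "(n' * (j - 1) + k - 1) div n' + 1 = j" "(n' * (j - 1) + k - 1) mod n' + 1 = k"
    unfolding ab(1) using ab(2-4) by auto
qed

lemma box_words:
  assumes "L \<in> words (n * n') m"
  shows "box_fst n' L \<in> words n m" "box_snd n' L \<in> words n' m" "boxtimes_word n' (box_fst n' L) (box_snd n' L) = L"
proof -
  show "box_fst n' L \<in> words n m" "box_snd n' L \<in> words n' m"
    using assms box_letter by (auto simp: words_def box_fst_def box_snd_def subset_iff simp del: atLeastAtMost_iff)
  have "n' * ((l - 1) div n' + 1 - 1) + ((l - 1) mod n' + 1) = l" if "l \<in> {1..n * n'}" for l
    using that mult_div_mod_eq[of n' "l - 1"] by auto
  then show "boxtimes_word n' (box_fst n' L) (box_snd n' L) = L"
    using assms by (auto simp: boxtimes_word_def box_fst_def box_snd_def words_def zip_map1 zip_map2 zip_same_conv_map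
        subset_iff simp del: atLeastAtMost_iff intro!: map_idI)
qed

lemma boxtimes_word_words:
  assumes "J \<in> words n m" "K \<in> words n' m"
  shows "boxtimes_word n' J K \<in> words (n * n') m" "box_fst n' (boxtimes_word n' J K) = J" "box_snd n' (boxtimes_word n' J K) = K"
proof -
  have l: "length J = length K" and JK: "set J \<subseteq> {1..n}" "set K \<subseteq> {1..n'}" using assms by (auto simp: words_def)
  have "set (boxtimes_word n' J K) \<subseteq> {1..n * n'} \<and> box_fst n' (boxtimes_word n' J K) = J \<and> box_snd n' (boxtimes_word n' J K) = K"
    using l JK
  proof (induction J K rule: list_induct2)
    case (Cons j J k K)
    then show ?case using box_letter_inv[of j n k n'] by (simp add: boxtimes_word_def box_fst_def box_snd_def)
  qed (simp add: boxtimes_word_def box_fst_def box_snd_def)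
  moreover have "length (boxtimes_word n' J K) = m" using assms by (simp add: boxtimes_word_def words_def)
  ultimately show "boxtimes_word n' J K \<in> words (n * n') m" "box_fst n' (boxtimes_word n' J K) = J" "box_snd n' (boxtimes_word n' J K) = K"
    by (auto simp: words_def)
qed

lemma boxtimes_eq:
  "boxtimes n n' m z y L = (if L \<in> words (n * n') m then z (box_fst n' L) * y (box_snd n' L) else 0)"
proof -
  have "{(J, K). J \<in> words n m \<and> K \<in> words n' m \<and> boxtimes_word n' J K = L} =
    (if L \<in> words (n * n') m then {(box_fst n' L, box_snd n' L)} else {})"
    using box_words boxtimes_word_words by auto
  then show ?thesis unfolding boxtimes_def by simp
qed

lemma boxtimes_vectors: "boxtimes n n' m z y \<in> vectors (n * n') m"
  by (simp add: vectors_def boxtimes_eq)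

lemma norm_boxtimes:
  "(\<Sum>L\<in>words (n * n') m. (cmod (boxtimes n n' m z y L))\<^sup>2) =
    (\<Sum>J\<in>words n m. (cmod (z J))\<^sup>2) * (\<Sum>K\<in>words n' m. (cmod (y K))\<^sup>2)"
proof -
  have "(\<Sum>L\<in>words (n * n') m. (cmod (boxtimes n n' m z y L))\<^sup>2) =
    (\<Sum>(J, K)\<in>words n m \<times> words n' m. (cmod (z J))\<^sup>2 * (cmod (y K))\<^sup>2)"
    by (rule sum.reindex_bij_witness[where i = "\<lambda>(J, K). boxtimes_word n' J K" and j = "\<lambda>L. (box_fst n' L, box_snd n' L)"])
      (auto simp: box_words boxtimes_word_words boxtimes_eq norm_mult power_mult_distrib)
  then show ?thesis by (simp add: sum_product sum.cartesian_product)
qed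

lemma boxtimes_tens:
  "boxtimes n n' (k + l) (tens k z z') (tens k y y') = tens k (boxtimes n n' k z y) (boxtimes n n' l z' y')"
proof
  fix L
  show "boxtimes n n' (k + l) (tens k z z') (tens k y y') L = tens k (boxtimes n n' k z y) (boxtimes n n' l z' y') L"
  proof (cases "L \<in> words (n * n') (k + l)")
    case True
    then show ?thesis using take_drop_words[OF True]
      by (simp add: boxtimes_eq tens_def box_fst_def box_snd_def take_map drop_map)
  next
    case False
    then show ?thesis
      using vectors_zero[OF tens_vectors[OF boxtimes_vectors boxtimes_vectors]] by (simp add: boxtimes_eq)
  qed
qed

lemma boxtimes_tensor_power:
  "boxtimes n n' (p * k) (tensor_power k z p) (tensor_power k y p) = tensor_power k (boxtimes n n' k z y) p"
proof (induction p)
  case 0 show ?case by (rule ext) (simp add: boxtimes_eq box_fst_def box_snd_def)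
next
  case (Suc p)
  then show ?case
    using boxtimes_tens[of n n' k "p * k" z "tensor_power k z p" y "tensor_power k y p"]
    by (simp add: tensor_power_Suc del: tensor_power.simps)
qed

text \<open>A letter over the triple alphabet has three digits in mixed radix, and both bracketings
  read the same digits.\<close>

lemma boxtimes_assoc:
  assumes "n' \<ge> 1" "n'' \<ge> 1"
  shows "boxtimes (n * n') n'' m (boxtimes n n' m z y) w = boxtimes n (n' * n'') m z (boxtimes n' n'' m y w)"
proof
  fix L
  show "boxtimes (n * n') n'' m (boxtimes n n' m z y) w L = boxtimes n (n' * n'') m z (boxtimes n' n'' m y w) L"
  proof (cases "L \<in> words (n * n' * n'') m")
    case True
    have 1: "box_fst n' (box_fst n'' L) = box_fst (n' * n'') L"
      by (simp add: box_fst_def div_mult2_eq[symmetric] mult.commute)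
    have 2: "box_snd n' (box_fst n'' L) = box_fst n'' (box_snd (n' * n'') L)"
      by (simp add: box_fst_def box_snd_def mod_mult2_eq[of _ n'' n'] mult.commute[of n' n'']) (use assms in auto)
    have 3: "box_snd n'' L = box_snd n'' (box_snd (n' * n'') L)"
      by (simp add: box_snd_def mod_mult2_eq[of _ n'' n'] mult.commute[of n' n''])
    have b1: "box_fst n'' L \<in> words (n * n') m" using box_words(1)[OF True] .
    have b2: "box_snd (n' * n'') L \<in> words (n' * n'') m" using box_words(2)[of L n "n' * n''" m] True by (simp add: mult.assoc)
    show ?thesis using True b1 b2 1 2 3 by (simp add: boxtimes_eq mult.assoc)
  qed (simp add: boxtimes_eq mult.assoc)
qed

section \<open>The semigroup of nonperiodic vectors\<close>

text \<open>Powers of a box product are box products of powers. Raising to a common multiple of all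
  degrees reduces associativity of the product to \<open>boxtimes_assoc\<close>.\<close>

lemma vector_prod_power:
  assumes "l > 0" "m > 0" "lcm m l dvd d"
  shows "tensor_power (lcm m l) (boxtimes n n' (lcm m l) (tensor_power m z (lcm m l div m)) (tensor_power l y (lcm m l div l))) (d div lcm m l)
    = boxtimes n n' d (tensor_power m z (d div m)) (tensor_power l y (d div l))"
proof -
  let ?c = "lcm m l"
  obtain q where q: "d = ?c * q" using assms(3) by blast
  have c: "?c > 0" using assms by (simp add: lcm_pos_nat)
  have m: "(?c div m) * m = ?c" and l: "(?c div l) * l = ?c" by simp_all
  have dm: "d div m = q * (?c div m)" "d div l = q * (?c div l)"
    using q by (simp_all add: div_mult_swap mult.commute)
  have p: "tensor_power ?c (tensor_power m z (?c div m)) q = tensor_power m z (d div m)"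
    "tensor_power ?c (tensor_power l y (?c div l)) q = tensor_power l y (d div l)"
    using tensor_power_power[of "?c div m" m z q] tensor_power_power[of "?c div l" l y q] unfolding m l dm by simp_all
  have "d div ?c = q" using q c by simp
  then show ?thesis
    using boxtimes_tensor_power[of n n' q ?c "tensor_power m z (?c div m)" "tensor_power l y (?c div l)"]
    unfolding p using q by (simp add: mult.commute)
qed

lemma vector_prod_assoc:
  assumes "n' \<ge> 1" "n'' \<ge> 1" "m > 0" "l > 0" "k > 0"
  shows "vector_prod (vector_prod (n, m, z) (n', l, y)) (n'', k, w) = vector_prod (n, m, z) (vector_prod (n', l, y) (n'', k, w))"
proof -
  let ?d = "lcm m (lcm l k)"
  have d: "lcm (lcm m l) k = ?d" by (rule lcm.assoc)
  have "lcm m l dvd ?d" "lcm l k dvd ?d" by (auto simp flip: d)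
  then show ?thesis
    using vector_prod_power[of l m ?d n n' z y] vector_prod_power[of k l ?d n' n'' y w] boxtimes_assoc[OF assms(1,2)] assms
    by (simp add: d mult.assoc)
qed

text \<open>If one component is the periodic word built from a single block, every block of
  \<open>x\<close> is cut at the same place, so a slice of the power is the power of a
  slice.\<close>

lemma tensor_power_slice:
  assumes x: "x \<in> vectors (n * n') k"
  shows "\<lbrakk>K0 \<in> words n' k; J \<in> words n (p * k)\<rbrakk> \<Longrightarrow>
      tensor_power k x p (boxtimes_word n' J (concat (replicate p K0))) =
      tensor_power k (\<lambda>J. if J \<in> words n k then x (boxtimes_word n' J K0) else 0) p J"
    and "\<lbrakk>J0 \<in> words n k; K \<in> words n' (p * k)\<rbrakk> \<Longrightarrow>
      tensor_power k x p (boxtimes_word n' (concat (replicate p J0)) K) =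
      tensor_power k (\<lambda>K. if K \<in> words n' k then x (boxtimes_word n' J0 K) else 0) p K"
proof -
  show "tensor_power k x p (boxtimes_word n' J (concat (replicate p K0))) =
      tensor_power k (\<lambda>J. if J \<in> words n k then x (boxtimes_word n' J K0) else 0) p J"
    if "K0 \<in> words n' k" "J \<in> words n (p * k)"
    using that(2)
  proof (induction p arbitrary: J)
    case (Suc p)
    have td: "take k J \<in> words n k" "drop k J \<in> words n (p * k)"
      using take_drop_words[of J n k "p * k"] Suc.prems by auto
    have l: "length K0 = k" using that(1) by (rule words_length)
    have "take k (boxtimes_word n' J (K0 @ X)) = boxtimes_word n' (take k J) K0"
         "drop k (boxtimes_word n' J (K0 @ X)) = boxtimes_word n' (drop k J) X" for X
      using l by (simp_all add: boxtimes_word_def take_map drop_map take_zip drop_zip)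
    then show ?case using Suc.IH[OF td(2)] td by simp
  qed (simp add: boxtimes_word_def)
  show "tensor_power k x p (boxtimes_word n' (concat (replicate p J0)) K) =
      tensor_power k (\<lambda>K. if K \<in> words n' k then x (boxtimes_word n' J0 K) else 0) p K"
    if "J0 \<in> words n k" "K \<in> words n' (p * k)"
    using that(2)
  proof (induction p arbitrary: K)
    case (Suc p)
    have td: "take k K \<in> words n' k" "drop k K \<in> words n' (p * k)"
      using take_drop_words[of K n' k "p * k"] Suc.prems by auto
    have l: "length J0 = k" using that(1) by (rule words_length)
    have "take k (boxtimes_word n' (J0 @ X) K) = boxtimes_word n' J0 (take k K)"
         "drop k (boxtimes_word n' (J0 @ X) K) = boxtimes_word n' X (drop k K)" for X
      using l by (simp_all add: boxtimes_word_def take_map drop_map take_zip drop_zip)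
    then show ?case using Suc.IH[OF td(2)] td by simp
  qed (simp add: boxtimes_word_def)
qed

lemma concat_replicate_words: "J \<in> words n k \<Longrightarrow> concat (replicate p J) \<in> words n (p * k)"
  by (induction p) (auto simp: words_def)

text \<open>If \<open>z \<boxtimes> y\<close> is a power of \<open>x\<close>, then \<open>z\<close> and \<open>y\<close> are multiples of the same power of slices of \<open>x\<close>.\<close>

lemma nonperiodic_vector_prod:
  assumes m: "m \<ge> 1" and l: "l \<ge> 1" and z: "z \<in> unit_vectors n m" and y: "y \<in> unit_vectors n' l"
    and npz: "nonperiodic n m z" and npy: "nonperiodic n' l y"
  defines "d \<equiv> lcm m l"
  defines "Z \<equiv> tensor_power m z (d div m)" and "Y \<equiv> tensor_power l y (d div l)"
  shows "boxtimes n n' d Z Y \<in> unit_vectors (n * n') d" "nonperiodic (n * n') d (boxtimes n n' d Z Y)"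
proof -
  note zv = unit_vectors_vectors[OF z] and yv = unit_vectors_vectors[OF y]
  have d0: "d > 0" using m l by (simp add: d_def lcm_pos_nat)
  have dm: "d div m * m = d" "d div l * l = d" by (simp_all add: d_def)
  then have pos: "d div m \<ge> 1" "d div l \<ge> 1" using d0 by (metis less_one mult_is_0 not_le less_irrefl)+
  have ZY: "Z \<in> unit_vectors n d" "Y \<in> unit_vectors n' d"
    using tensor_power_unit[OF z, of "d div m"] tensor_power_unit[OF y, of "d div l"] by (simp_all add: Z_def Y_def dm)
  then show u: "boxtimes n n' d Z Y \<in> unit_vectors (n * n') d"
    using norm_boxtimes[of n n' d Z Y] by (simp add: unit_vectors_def boxtimes_vectors)
  obtain Jz where Jz: "z Jz \<noteq> 0" using unit_vectors_nonzero[OF z] by blast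
  obtain Jy where Jy: "y Jy \<noteq> 0" using unit_vectors_nonzero[OF y] by blast
  show "nonperiodic (n * n') d (boxtimes n n' d Z Y)"
    unfolding nonperiodic_def
  proof (intro allI impI ballI, elim conjE)
    fix p k x assume p: "1 \<le> p" and k: "1 \<le> k" and x: "x \<in> vectors (n * n') k" and dpk: "d = p * k"
      and e: "boxtimes n n' d Z Y = tensor_power k x p"
    have at: "Z J * Y K = tensor_power k x p (boxtimes_word n' J K)" if "J \<in> words n d" "K \<in> words n' d" for J K
      using fun_cong[OF e, of "boxtimes_word n' J K"] boxtimes_word_words[OF that] by (simp add: boxtimes_eq)
    obtain L0 where "boxtimes n n' d Z Y L0 \<noteq> 0" using unit_vectors_nonzero[OF u] by blast
    then obtain L where L: "x L \<noteq> 0" using p tensor_power_nonzero_base[of k x p L0] e by auto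
    then have Lw: "L \<in> words (n * n') k" using x by (auto simp: vectors_def)
    \<comment> \<open>The slices are taken at the two components of a word in the support of
      \<open>x\<close>, so that they do not vanish.\<close>
    define J0 K0 where "J0 = box_fst n' L" and "K0 = box_snd n' L"
    have JK: "J0 \<in> words n k" "K0 \<in> words n' k" "boxtimes_word n' J0 K0 = L" using box_words[OF Lw] by (simp_all add: J0_def K0_def)
    let ?Jp = "concat (replicate p J0)" and ?Kp = "concat (replicate p K0)"
    have JKp: "?Jp \<in> words n d" "?Kp \<in> words n' d" using concat_replicate_words[OF JK(1)] concat_replicate_words[OF JK(2)] dpk by auto
    define u v where "u = (\<lambda>J. if J \<in> words n k then x (boxtimes_word n' J K0) else 0)"
      and "v = (\<lambda>K. if K \<in> words n' k then x (boxtimes_word n' J0 K) else 0)"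
    have uv: "u \<in> vectors n k" "v \<in> vectors n' k" by (simp_all add: u_def v_def vectors_def)
    have "u J0 \<noteq> 0" using JK L by (simp add: u_def)
    then have "tensor_power k u p ?Jp \<noteq> 0" by (rule tensor_power_nonzero[OF uv(1)])
    moreover have eqZ: "Z J * Y ?Kp = tensor_power k u p J" if "J \<in> words n d" for J
      using at[OF that JKp(2)] tensor_power_slice(1)[OF x JK(2), of J p] that dpk by (simp add: u_def)
    moreover have eqY: "Z ?Jp * Y K = tensor_power k v p K" if "K \<in> words n' d" for K
      using at[OF JKp(1) that] tensor_power_slice(2)[OF x JK(1), of K p] that dpk by (simp add: v_def)
    ultimately have nz: "Z ?Jp \<noteq> 0" "Y ?Kp \<noteq> 0" using JKp by (metis mult_eq_0_iff)+
    have "tensor_power m z (d div m) J = (1 / Y ?Kp) * tensor_power k u p J" for J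
    proof (cases "J \<in> words n d")
      case True then show ?thesis using eqZ[OF True] nz by (simp add: Z_def field_simps)
    next
      case False then show ?thesis
        using vectors_zero[OF unit_vectors_vectors[OF ZY(1)], of J] vectors_zero[OF tensor_power_vectors[OF uv(1)], of J p] dpk
        by (simp add: Z_def)
    qed
    then have 1: "m dvd k" by (rule nonperiodic_power_eq[OF m k pos(1) p zv npz uv(1) Jz])
    have "tensor_power l y (d div l) K = (1 / Z ?Jp) * tensor_power k v p K" for K
    proof (cases "K \<in> words n' d")
      case True then show ?thesis using eqY[OF True] nz by (simp add: Y_def field_simps)
    next
      case False then show ?thesis
        using vectors_zero[OF unit_vectors_vectors[OF ZY(2)], of K] vectors_zero[OF tensor_power_vectors[OF uv(2)], of K p] dpk
        by (simp add: Y_def)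
    qed
    then have 2: "l dvd k" by (rule nonperiodic_power_eq[OF l k pos(2) p yv npy uv(2) Jy])
    \<comment> \<open>Both degrees divide \<open>k\<close>, hence so does their least common
      multiple \<open>d\<close>, which equals \<open>p * k\<close>.\<close>
    have "d dvd k" using 1 2 by (simp add: d_def)
    then have "p * k \<le> 1 * k" using k dpk by (simp add: dvd_imp_le)
    then show "p = 1" using k p by simp
  qed
qed

lemma semigroup_vectors: "semigroup_on nonperiodic_all vector_prod"
  unfolding semigroup_on_def
proof (intro conjI ballI)
  fix x y assume "x \<in> nonperiodic_all" "y \<in> nonperiodic_all"
  then obtain n m z n' l w where x: "x = (n, m, z)" "2 \<le> n" "1 \<le> m" "z \<in> unit_vectors n m" "nonperiodic n m z"
    and y: "y = (n', l, w)" "2 \<le> n'" "1 \<le> l" "w \<in> unit_vectors n' l" "nonperiodic n' l w"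
    by (auto simp: nonperiodic_all_def nonperiodic_vectors_def)
  have "1 \<le> lcm m l" using x y by (simp add: lcm_pos_nat Suc_le_eq)
  moreover have "2 * 1 \<le> n * n'" using x y by (intro mult_mono) auto
  ultimately show "vector_prod x y \<in> nonperiodic_all"
    using nonperiodic_vector_prod[OF x(3) y(3) x(4) y(4) x(5) y(5)]
    by (simp add: x(1) y(1) nonperiodic_all_def nonperiodic_vectors_def)
next
  fix x y z assume "x \<in> nonperiodic_all" "y \<in> nonperiodic_all" "z \<in> nonperiodic_all"
  then show "vector_prod (vector_prod x y) z = vector_prod x (vector_prod y z)"
    by (cases x; cases y; cases z) (auto simp: nonperiodic_all_def nonperiodic_vectors_def intro!: vector_prod_assoc simp del: vector_prod.simps)
qed

section \<open>States of Cuntz algebras as functions of words\<close>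

definition letters :: "nat \<Rightarrow> letter set" where "letters n = Gen ` {1..n} \<union> Gen_adj ` {1..n}"

lemma letters_iff [simp]: "Gen i \<in> letters n \<longleftrightarrow> i \<in> {1..n}" "Gen_adj i \<in> letters n \<longleftrightarrow> i \<in> {1..n}"
  by (auto simp: letters_def)

abbreviation (input) gens :: "nat list \<Rightarrow> letter list" where "gens J \<equiv> map Gen J"

abbreviation (input) adjs :: "nat list \<Rightarrow> letter list" where "adjs J \<equiv> rev (map Gen_adj J)"

lemma word_monoid_simps [simp]:
  "carrier (word_monoid n) = lists (letters n)"
  "mult (word_monoid n) = (@)"
  "one (word_monoid n) = []"
  "invol (word_monoid n) w = rev (map letter_adj w)"
  by (simp_all add: word_monoid_def letters_def)

lemma letter_adj_letter_adj [simp]: "letter_adj (letter_adj l) = l"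
  by (cases l) auto

lemma letter_adj_comp [simp]: "letter_adj \<circ> Gen = Gen_adj" "letter_adj \<circ> Gen_adj = Gen"
  by (auto simp: fun_eq_iff)

lemma letter_adj_letters [simp]: "letter_adj l \<in> letters n \<longleftrightarrow> l \<in> letters n"
  by (cases l) auto

lemma star_mon_word_monoid: "star_mon (word_monoid n)"
proof (intro star_mon.intro monoidI star_mon_axioms.intro)
  fix w assume "w \<in> carrier (word_monoid n)"
  then show "invol (word_monoid n) w \<in> carrier (word_monoid n)"
    by (auto simp: in_lists_conv_set)
qed (auto simp: rev_map comp_def)

interpretation WM: star_mon "word_monoid n" for n
  by (rule star_mon_word_monoid)

abbreviation WA :: "nat \<Rightarrow> (letter list \<Rightarrow> complex) star_algebra" where "WA n \<equiv> monoid_algebra (word_monoid n)"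

interpretation WA: star_alg "WA n" for n
  by (rule WM.star_alg_MA)

lemma invol_gens [simp]: "rev (map letter_adj (gens J)) = adjs J"
  by (simp add: comp_def)

lemma invol_adjs [simp]: "rev (map letter_adj (adjs J)) = gens J"
  by (simp add: rev_map comp_def)

lemma words_lists:
  assumes "J \<in> words n m" shows "gens J \<in> lists (letters n)" "adjs J \<in> lists (letters n)"
  using assms by (auto simp: words_def in_lists_conv_set)

lemma fin_delta: "finite {x. c * delta a x \<noteq> 0}" "finite {x. delta a x \<noteq> 0}"
  by (auto simp: delta_def)

lemma lin_rel1:
  "lin \<psi> (\<lambda>w. delta [Gen_adj i, Gen j] w - (if i = j then delta [] w else 0)) =
    \<psi> [Gen_adj i, Gen j] - (if i = j then \<psi> [] else 0)"
  by (cases "i = j") (simp_all add: lin_diff fin_delta)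

lemma lin_rel2:
  "lin \<psi> (\<lambda>w. (\<Sum>i\<in>{1..n}. delta [Gen i, Gen_adj i] w) - delta [] w) = (\<Sum>i\<in>{1..n}. \<psi> [Gen i, Gen_adj i]) - \<psi> []"
  by (subst lin_diff) (simp_all add: lin_sum fin_delta)

lemma cuntz_relations_cases:
  assumes "r \<in> cuntz_relations n"
  obtains (orth) i j where "i \<in> {1..n}" "j \<in> {1..n}"
      "r = (\<lambda>w. delta [Gen_adj i, Gen j] w - (if i = j then delta [] w else 0))"
  | (unit) "r = (\<lambda>w. (\<Sum>i\<in>{1..n}. delta [Gen i, Gen_adj i] w) - delta [] w)"
  using assms unfolding cuntz_relations_def by blast

lemma cuntz_relations_sub: "cuntz_relations n \<subseteq> carrier (WA n)"
proof
  fix r assume "r \<in> cuntz_relations n"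
  then show "r \<in> carrier (WA n)"
  proof (cases rule: cuntz_relations_cases)
    case (orth i j)
    have "{w. r w \<noteq> 0} \<subseteq> {[Gen_adj i, Gen j], []}" by (auto simp: orth(3) delta_def split: if_splits)
    moreover from this have "finite {w. r w \<noteq> 0}" by (rule finite_subset) simp
    moreover have "{[Gen_adj i, Gen j], []} \<subseteq> lists (letters n)" using orth(1,2) by auto
    ultimately show ?thesis unfolding monoid_algebra_simps word_monoid_simps by blast
  next
    case unit
    have "r w = 0" if "w \<notin> insert [] ((\<lambda>i. [Gen i, Gen_adj i]) ` {1..n})" for w
      using that by (auto simp: unit delta_def intro!: sum.neutral)
    then have "{w. r w \<noteq> 0} \<subseteq> insert [] ((\<lambda>i. [Gen i, Gen_adj i]) ` {1..n})" by blast
    moreover from this have "finite {w. r w \<noteq> 0}" by (rule finite_subset) simp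
    moreover have "insert [] ((\<lambda>i. [Gen i, Gen_adj i]) ` {1..n}) \<subseteq> lists (letters n)" by auto
    ultimately show ?thesis unfolding monoid_algebra_simps word_monoid_simps by blast
  qed
qed

text \<open>A C*-seminorm that respects the relations sees each generator as an isometry, so it is
  at most 1 on every letter and hence on every word.\<close>

interpretation CU: universal "word_monoid n" "cuntz_relations n" for n
proof
  show "cuntz_relations n \<subseteq> carrier (WA n)" by (rule cuntz_relations_sub)
  show "\<forall>x\<in>carrier (WA n). \<exists>B. \<forall>p. cstar_seminorm (WA n) p \<and> (\<forall>r\<in>cuntz_relations n. p r = 0) \<longrightarrow> p x \<le> B"
  proof (rule WM.seminorms_bounded)
    fix w assume w: "w \<in> carrier (word_monoid n)"
    have "p (delta w) \<le> 1" if p: "cstar_seminorm (WA n) p \<and> (\<forall>r\<in>cuntz_relations n. p r = 0)" for p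
    proof -
      interpret p: seminormed_star_alg "WA n" p
        using p WM.star_alg_MA by (simp add: seminormed_star_alg_def seminormed_star_alg_axioms_def)
      note [simp del] = monoid_algebra_simps
      have one: "p (delta []) \<le> 1" using p.N_one_le by (simp add: monoid_algebra_simps)
      have gen: "p (delta [Gen i]) \<le> 1" if i: "i \<in> {1..n}" for i
      proof -
        have d: "delta [Gen_adj i, Gen i] \<in> carrier (WA n)" "delta [] \<in> carrier (WA n)" "delta [Gen i] \<in> carrier (WA n)"
          using i by (auto intro!: WM.delta_closed)
        have "delta [Gen_adj i, Gen i] \<ominus>\<^bsub>WA n\<^esub> delta [] = (\<lambda>w. delta [Gen_adj i, Gen i] w - (if i = i then delta [] w else 0))"
          by (simp add: WM.MA_minus[OF d(1,2)])
        then have "p (delta [Gen_adj i, Gen i] \<ominus>\<^bsub>WA n\<^esub> delta []) = 0"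
          using p i unfolding cuntz_relations_def by blast
        then have "p (delta [Gen_adj i, Gen i]) = p (delta [])" using p.N_diff_le[OF d(1,2)] by simp
        moreover have "adj (WA n) (delta [Gen i]) \<otimes>\<^bsub>WA n\<^esub> delta [Gen i] = delta [Gen_adj i, Gen i]"
          using i by (simp add: WM.delta_adj WM.delta_mult)
        ultimately have "(p (delta [Gen i]))\<^sup>2 \<le> 1" using p.N_star[OF d(3)] one by simp
        then show ?thesis using power2_le_imp_le[of "p (delta [Gen i])" 1] by simp
      qed
      have let1: "p (delta [l]) \<le> 1" if "l \<in> letters n" for l
      proof (cases l)
        case (Gen i) then show ?thesis using that gen by auto
      next
        case (Gen_adj i)
        then have i: "i \<in> {1..n}" using that by auto
        have "p (delta [Gen_adj i]) = p (delta [Gen i])"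
        proof -
          have "p (adj (WA n) (delta [Gen i])) = p (delta [Gen i])"
            using i by (intro p.N_adj WM.delta_closed) simp
          then show ?thesis using i by (simp add: WM.delta_adj)
        qed
        then show ?thesis using Gen_adj gen[OF i] by simp
      qed
      from w show ?thesis unfolding word_monoid_simps
      proof (induction rule: lists.induct)
        case (Cons l w)
        have "delta [l] \<in> carrier (WA n)" "delta w \<in> carrier (WA n)" using Cons by (auto intro!: WM.delta_closed)
        then have "p (delta (l # w)) \<le> p (delta [l]) * p (delta w)" "0 \<le> p (delta w)"
          using p.N_mult[of "delta [l]" "delta w"] Cons WM.delta_mult[of "[l]" n w] p.N_nonneg by auto
        then show ?case using let1[OF Cons(1)] Cons(3) mult_mono[of "p (delta [l])" 1 "p (delta w)" 1] by simp
      qed (rule one)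
    qed
    then show "\<exists>B. \<forall>p. cstar_seminorm (WA n) p \<and> (\<forall>r\<in>cuntz_relations n. p r = 0) \<longrightarrow> p (delta w) \<le> B" by blast
  qed blast
qed

abbreviation cgen :: "nat \<Rightarrow> letter list \<Rightarrow> cuntz_elem" where
  "cgen n \<equiv> universal_gen (word_monoid n) (cuntz_relations n)"

lemma cuntz_universal: "universal_cstar (word_monoid n) (cuntz_relations n) = cuntz n"
  by (simp add: cuntz_def)

lemma cuntz_word_eq: "J \<in> words n m \<Longrightarrow> cuntz_word n J = cgen n (gens J)"
proof (induction J arbitrary: m)
  case Nil
  show ?case using CU.gen_one[of n] by (simp add: cuntz_word_def cuntz_universal)
next
  case (Cons j J)
  have J: "j \<in> {1..n}" "J \<in> words n (length J)" using Cons.prems by (auto simp: words_def)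
  then show ?case
    using Cons.IH[OF J(2)] CU.gen_mult[of "[Gen j]" n "gens J"] words_lists[OF J(2)]
    by (simp add: cuntz_word_def cuntz_gen_def cuntz_universal)
qed

text \<open>The restriction of a state to words, with the relations inserted at arbitrary places.
  \<open>cuntz_kernel_of_state\<close> and \<open>state_exists\<close> translate in both
  directions.\<close>

locale cuntz_kernel =
  fixes n :: nat and \<phi> :: "letter list \<Rightarrow> complex"
  assumes empty: "\<phi> [] = 1"
    and orth: "\<lbrakk>u \<in> lists (letters n); v \<in> lists (letters n); i \<in> {1..n}; j \<in> {1..n}\<rbrakk> \<Longrightarrow>
      \<phi> (u @ Gen_adj i # Gen j # v) = (if i = j then \<phi> (u @ v) else 0)"
    and unit: "\<lbrakk>u \<in> lists (letters n); v \<in> lists (letters n)\<rbrakk> \<Longrightarrow>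
      (\<Sum>i=1..n. \<phi> (u @ Gen i # Gen_adj i # v)) = \<phi> (u @ v)"
    and psd: "x \<in> carrier (WA n) \<Longrightarrow> lin \<phi> (adj (WA n) x \<otimes>\<^bsub>WA n\<^esub> x) \<in> \<real>\<^sub>\<ge>\<^sub>0"
begin

sublocale F: pos_functional "WA n" "lin \<phi>"
  by standard (use psd in \<open>simp_all add: WM.MA_lin_add WM.MA_lin_smult del: monoid_algebra_simps\<close>)

end

lemma cuntz_kernel_of_state:
  assumes s: "state (cuntz n) \<omega>" shows "cuntz_kernel n (\<lambda>w. \<omega> (cgen n w))"
proof -
  let ?\<phi> = "\<lambda>w. \<omega> (cgen n w)"
  note s' = s[folded cuntz_universal]
  have rel: "lin (\<lambda>m. ?\<phi> (u @ m @ v)) r = 0" if r: "r \<in> cuntz_relations n" and "u \<in> lists (letters n)" "v \<in> lists (letters n)" for r u v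
  proof -
    have c: "delta u \<in> carrier (WA n)" "delta v \<in> carrier (WA n)" "r \<in> carrier (WA n)"
      using that by (auto intro!: WM.delta_closed subsetD[OF cuntz_relations_sub] simp del: monoid_algebra_simps)
    show ?thesis
      using CU.lin_R_zero[OF s' r c(1,2)] c
      by (simp add: WM.MA_lin_mult WM.MA_closed del: monoid_algebra_simps)
  qed
  show ?thesis
  proof
    show "?\<phi> [] = 1" using s CU.gen_one[of n] by (simp add: cuntz_universal state_def)
  next
    fix u v i j assume u: "u \<in> lists (letters n)" and v: "v \<in> lists (letters n)" and ij: "i \<in> {1..n}" "j \<in> {1..n}"
    have "(\<lambda>w. delta [Gen_adj i, Gen j] w - (if i = j then delta [] w else 0)) \<in> cuntz_relations n"
      using ij unfolding cuntz_relations_def by blast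
    from rel[OF this u v] show "?\<phi> (u @ Gen_adj i # Gen j # v) = (if i = j then ?\<phi> (u @ v) else 0)"
      by (simp add: lin_rel1 split: if_splits)
  next
    fix u v assume u: "u \<in> lists (letters n)" and v: "v \<in> lists (letters n)"
    have "(\<lambda>w. (\<Sum>i\<in>{1..n}. delta [Gen i, Gen_adj i] w) - delta [] w) \<in> cuntz_relations n"
      unfolding cuntz_relations_def by blast
    from rel[OF this u v] show "(\<Sum>i=1..n. ?\<phi> (u @ Gen i # Gen_adj i # v)) = ?\<phi> (u @ v)"
      unfolding lin_rel2 by simp
  next
    fix x assume x: "x \<in> carrier (WA n)"
    have c: "adj (WA n) x \<otimes>\<^bsub>WA n\<^esub> x \<in> carrier (WA n)" using x by (intro WM.MA_closed)
    have "lin ?\<phi> (adj (WA n) x \<otimes>\<^bsub>WA n\<^esub> x) = \<omega> (embed (WA n) (CU.usn n) (adj (WA n) x \<otimes>\<^bsub>WA n\<^esub> x))"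
      by (rule CU.state_embed_lin[OF s' c, symmetric])
    also have "\<dots> = \<omega> (adj (cuntz n) (embed (WA n) (CU.usn n) x) \<otimes>\<^bsub>cuntz n\<^esub> embed (WA n) (CU.usn n) x)"
      using x by (simp add: CU.U.embed_mult CU.U.embed_adj WM.MA_closed cuntz_def CU.universal_cstar_eq del: monoid_algebra_simps)
    also have "\<dots> \<in> \<real>\<^sub>\<ge>\<^sub>0"
      using s CU.U.embed_closed[OF x] by (simp add: state_def cuntz_def CU.universal_cstar_eq)
    finally show "lin ?\<phi> (adj (WA n) x \<otimes>\<^bsub>WA n\<^esub> x) \<in> \<real>\<^sub>\<ge>\<^sub>0" .
  qed
qed

lemma (in cuntz_kernel) lin_sandwich:
  assumes y: "y \<in> carrier (WA n)" and w: "w \<in> lists (letters n)"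
  shows "lin \<phi> (adj (WA n) y \<otimes>\<^bsub>WA n\<^esub> (delta w \<otimes>\<^bsub>WA n\<^esub> y)) = lin (\<lambda>a. lin (\<lambda>b. \<phi> (a @ w @ b)) y) (adj (WA n) y)"
  using y w WM.delta_closed[of w n] by (simp add: WM.MA_lin_mult WM.MA_closed del: monoid_algebra_simps)

text \<open>Each letter acts contractively: a generator preserves \<open>F.snorm\<close> by
  \<open>orth\<close>, and by \<open>unit\<close> the squared norms of all s_j^* y add up to that of
  y.\<close>

lemma (in cuntz_kernel) delta_bound:
  assumes w: "w \<in> lists (letters n)" and y: "y \<in> carrier (WA n)"
  shows "F.snorm (delta w \<otimes>\<^bsub>WA n\<^esub> y) \<le> F.snorm y"
  using w y
proof (induction arbitrary: y rule: lists.induct)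
  case Nil
  have "delta [] \<otimes>\<^bsub>WA n\<^esub> y = y" using WA.l_one[OF Nil] by simp
  then show ?case by simp
next
  case (Cons l w)
  have cl: "delta [l] \<in> carrier (WA n)" "delta w \<in> carrier (WA n)" using Cons WM.delta_closed by auto
  note y = Cons.prems
  have split: "delta (l # w) \<otimes>\<^bsub>WA n\<^esub> y = delta [l] \<otimes>\<^bsub>WA n\<^esub> (delta w \<otimes>\<^bsub>WA n\<^esub> y)"
    using WM.delta_mult[of "[l]" n w] Cons WA.m_assoc[OF cl y] by simp
  have step: "F.snorm (delta [l] \<otimes>\<^bsub>WA n\<^esub> y) \<le> F.snorm y" if y: "y \<in> carrier (WA n)" for y
  proof (rule power2_le_imp_le)
    have ay: "adj (WA n) y \<in> carrier (WA n)" using WM.MA_closed(4)[OF y y] .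
    have sq: "(F.snorm (delta [k] \<otimes>\<^bsub>WA n\<^esub> y))\<^sup>2 = Re (lin (\<lambda>a. lin (\<lambda>b. \<phi> (a @ [letter_adj k, k] @ b)) y) (adj (WA n) y))"
      if k: "k \<in> letters n" for k
    proof -
      have d: "delta [k] \<in> carrier (WA n)" "delta [letter_adj k] \<in> carrier (WA n)" using k WM.delta_closed by auto
      have "adj (WA n) (delta [k] \<otimes>\<^bsub>WA n\<^esub> y) \<otimes>\<^bsub>WA n\<^esub> (delta [k] \<otimes>\<^bsub>WA n\<^esub> y) =
        adj (WA n) y \<otimes>\<^bsub>WA n\<^esub> (adj (WA n) (delta [k]) \<otimes>\<^bsub>WA n\<^esub> delta [k] \<otimes>\<^bsub>WA n\<^esub> y)"
        using d y ay by (simp add: WA.adj_mult WA.m_assoc del: monoid_algebra_simps)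
      also have "adj (WA n) (delta [k]) \<otimes>\<^bsub>WA n\<^esub> delta [k] = delta [letter_adj k, k]"
        using k by (simp add: WM.delta_adj WM.delta_mult)
      finally show ?thesis
        using lin_sandwich[OF y, of "[letter_adj k, k]"] k d y by (simp add: F.snorm_sq WM.MA_closed del: monoid_algebra_simps)
    qed
    have y2: "(F.snorm y)\<^sup>2 = Re (lin (\<lambda>a. lin (\<lambda>b. \<phi> (a @ b)) y) (adj (WA n) y))"
      using y ay by (simp add: F.snorm_sq WM.MA_lin_mult del: monoid_algebra_simps)
    show "(F.snorm (delta [l] \<otimes>\<^bsub>WA n\<^esub> y))\<^sup>2 \<le> (F.snorm y)\<^sup>2"
    proof (cases l)
      case (Gen i)
      then have i: "i \<in> {1..n}" using Cons by auto
      have "lin (\<lambda>a. lin (\<lambda>b. \<phi> (a @ [Gen_adj i, Gen i] @ b)) y) (adj (WA n) y) = lin (\<lambda>a. lin (\<lambda>b. \<phi> (a @ b)) y) (adj (WA n) y)"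
        by (intro WM.MA_lin_cong[OF ay] WM.MA_lin_cong[OF y]) (use i orth in auto)
      then show ?thesis using sq[of l] y2 Gen Cons by simp
    next
      case (Gen_adj i)
      then have i: "i \<in> {1..n}" using Cons by auto
      have "lin (\<lambda>a. lin (\<lambda>b. \<phi> (a @ b)) y) (adj (WA n) y) =
        lin (\<lambda>a. lin (\<lambda>b. \<Sum>j=1..n. \<phi> (a @ [Gen j, Gen_adj j] @ b)) y) (adj (WA n) y)"
        by (intro WM.MA_lin_cong[OF ay] WM.MA_lin_cong[OF y]) (use unit in auto)
      also have "\<dots> = (\<Sum>j=1..n. lin (\<lambda>a. lin (\<lambda>b. \<phi> (a @ [Gen j, Gen_adj j] @ b)) y) (adj (WA n) y))"
        by (simp only: lin_fun_sum)
      finally have "(F.snorm y)\<^sup>2 = (\<Sum>j=1..n. (F.snorm (delta [Gen_adj j] \<otimes>\<^bsub>WA n\<^esub> y))\<^sup>2)"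
        using sq[of "Gen_adj j" for j] by (simp add: y2)
      also have "\<dots> \<ge> (F.snorm (delta [Gen_adj i] \<otimes>\<^bsub>WA n\<^esub> y))\<^sup>2"
        using i by (intro member_le_sum) auto
      finally show ?thesis using Gen_adj by simp
    qed
  qed (use y F.snorm_nonneg in auto)
  have dy: "delta w \<otimes>\<^bsub>WA n\<^esub> y \<in> carrier (WA n)" using cl(2) y by (rule WM.MA_closed)
  show ?case unfolding split using step[OF dy] Cons.IH[OF y] by linarith
qed

lemma (in cuntz_kernel) state_exists:
  obtains \<omega> where "state (cuntz n) \<omega>" "\<And>w. w \<in> lists (letters n) \<Longrightarrow> \<omega> (cgen n w) = \<phi> w"
proof -
  have "\<exists>\<omega>. state (universal_cstar (word_monoid n) (cuntz_relations n)) \<omega> \<and>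
    (\<forall>w\<in>carrier (word_monoid n). \<omega> (cgen n w) = \<phi> w)"
  proof (rule CU.state_of_lin[of \<phi>])
    show "\<phi> \<one>\<^bsub>word_monoid n\<^esub> = 1" by (simp add: empty)
    show "lin \<phi> (adj (WA n) x \<otimes>\<^bsub>WA n\<^esub> x) \<in> \<real>\<^sub>\<ge>\<^sub>0" if "x \<in> carrier (WA n)" for x using that by (rule psd)
    fix r a b assume r: "r \<in> cuntz_relations n" and "a \<in> carrier (word_monoid n)" "b \<in> carrier (word_monoid n)"
    then have ab: "a \<in> lists (letters n)" "b \<in> lists (letters n)" by auto
    show "lin (\<lambda>m. \<phi> (a \<otimes>\<^bsub>word_monoid n\<^esub> (m \<otimes>\<^bsub>word_monoid n\<^esub> b))) r = 0"
      using r
    proof (cases rule: cuntz_relations_cases)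
      case (orth i j) then show ?thesis using cuntz_kernel.orth[OF cuntz_kernel_axioms ab] by (simp add: lin_rel1)
    next
      case unit
      show ?thesis unfolding unit lin_rel2 using cuntz_kernel.unit[OF cuntz_kernel_axioms ab] by simp
    qed
  next
    fix w assume w: "w \<in> carrier (word_monoid n)"
    show "\<exists>c. \<forall>y\<in>carrier (WA n). Re (lin \<phi> (adj (WA n) (delta w \<otimes>\<^bsub>WA n\<^esub> y) \<otimes>\<^bsub>WA n\<^esub> (delta w \<otimes>\<^bsub>WA n\<^esub> y)))
      \<le> c\<^sup>2 * Re (lin \<phi> (adj (WA n) y \<otimes>\<^bsub>WA n\<^esub> y))"
    proof (intro exI[of _ 1] ballI)
      fix y assume y: "y \<in> carrier (WA n)"
      have dy: "delta w \<otimes>\<^bsub>WA n\<^esub> y \<in> carrier (WA n)" using WM.delta_closed[OF w] y by (rule WM.MA_closed)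
      have "(F.snorm (delta w \<otimes>\<^bsub>WA n\<^esub> y))\<^sup>2 \<le> (F.snorm y)\<^sup>2"
        using delta_bound[of w y] w y F.snorm_nonneg[OF dy] by (intro power_mono) auto
      then show "Re (lin \<phi> (adj (WA n) (delta w \<otimes>\<^bsub>WA n\<^esub> y) \<otimes>\<^bsub>WA n\<^esub> (delta w \<otimes>\<^bsub>WA n\<^esub> y)))
        \<le> 1\<^sup>2 * Re (lin \<phi> (adj (WA n) y \<otimes>\<^bsub>WA n\<^esub> y))"
        using y dy by (simp add: F.snorm_sq del: monoid_algebra_simps)
    qed
  qed blast
  then show thesis using that by (auto simp: cuntz_universal)
qed

lemma cuntz_state_eqI:
  assumes "state (cuntz n) \<omega>" "state (cuntz n) \<omega>'" "\<And>w. w \<in> lists (letters n) \<Longrightarrow> \<omega> (cgen n w) = \<omega>' (cgen n w)"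
  shows "\<omega> = \<omega>'"
  by (rule CU.state_eqI_gen) (use assms in \<open>auto simp: cuntz_universal\<close>)

section \<open>Sub-Cuntz functionals\<close>

text \<open>The element s(z), a linear combination of words of length \<open>m\<close>; in the
  algebra it is an isometry when \<open>z\<close> is a unit vector.\<close>

definition svec :: "nat \<Rightarrow> nat \<Rightarrow> (nat list \<Rightarrow> complex) \<Rightarrow> letter list \<Rightarrow> complex" where
  "svec n m z w = (\<Sum>J\<in>words n m. z J * delta (gens J) w)"

lemma lin_svec: "lin \<psi> (svec n m z) = (\<Sum>J\<in>words n m. z J * \<psi> (gens J))"
  unfolding svec_def by (subst lin_sum) (simp_all add: fin_delta lin_smult)

lemma svec_closed: "svec n m z \<in> carrier (WA n)"
proof -
  have "svec n m z w = 0" if "w \<notin> gens ` words n m" for w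
    using that by (auto simp: svec_def delta_def intro!: sum.neutral)
  then have "{w. svec n m z w \<noteq> 0} \<subseteq> gens ` words n m" by blast
  moreover from this have "finite {w. svec n m z w \<noteq> 0}" by (rule finite_subset) simp
  moreover have "gens ` words n m \<subseteq> lists (letters n)" using words_lists(1) by blast
  ultimately show ?thesis by auto
qed

section \<open>The cyclic vector of a sub-Cuntz state\<close>

context cuntz_kernel begin

lemma F_form:
  assumes "x \<in> carrier (WA n)" "y \<in> carrier (WA n)"
  shows "lin \<phi> (adj (WA n) x \<otimes>\<^bsub>WA n\<^esub> y) = cnj (lin (\<lambda>a. cnj (lin (\<lambda>b. \<phi> (rev (map letter_adj a) @ b)) y)) x)"
  using assms by (simp add: WM.MA_lin_mult WM.MA_lin_adj WM.MA_closed del: monoid_algebra_simps)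

lemma hermitian: "w \<in> lists (letters n) \<Longrightarrow> \<phi> (rev (map letter_adj w)) = cnj (\<phi> w)"
  using F.F_adj[of "delta w"] WM.delta_closed[of w n] WM.delta_adj[of w n] by simp

lemma word_orth:
  assumes "u \<in> lists (letters n)" "v \<in> lists (letters n)" "J \<in> words n m" "K \<in> words n m"
  shows "\<phi> (u @ adjs J @ gens K @ v) = (if J = K then \<phi> (u @ v) else 0)"
  using assms(3,4)
proof (induction J arbitrary: K m)
  case Nil then show ?case using words_length[of "[]" n m] words_length[of K n m] by simp
next
  case (Cons j J)
  then obtain k K' where K: "K = k # K'" by (cases K) (auto simp: words_def)
  have w: "J \<in> words n (length J)" "K' \<in> words n (length J)" "j \<in> {1..n}" "k \<in> {1..n}"
    using Cons.prems by (auto simp: words_def K)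
  have "\<phi> (u @ adjs (j # J) @ gens K @ v) = \<phi> ((u @ adjs J) @ Gen_adj j # Gen k # (gens K' @ v))" by (simp add: K)
  also have "\<dots> = (if j = k then \<phi> ((u @ adjs J) @ (gens K' @ v)) else 0)"
    using assms(1,2) words_lists[OF w(1)] words_lists[OF w(2)] w(3,4) by (intro orth) auto
  also have "\<dots> = (if j # J = K then \<phi> (u @ v) else 0)"
    using Cons.IH[OF w(1,2)] unfolding K by (auto split: if_splits)
  finally show ?case .
qed

lemma word_unit:
  assumes "u \<in> lists (letters n)" "v \<in> lists (letters n)"
  shows "(\<Sum>L\<in>words n r. \<phi> (u @ gens L @ adjs L @ v)) = \<phi> (u @ v)"
  using assms
proof (induction r arbitrary: u v)
  case (Suc r)
  have "(\<Sum>L\<in>words n (Suc r). \<phi> (u @ gens L @ adjs L @ v)) =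
    (\<Sum>i=1..n. \<Sum>L\<in>words n r. \<phi> ((u @ [Gen i]) @ gens L @ adjs L @ ([Gen_adj i] @ v)))"
    unfolding sum_words_Suc by simp
  also have "\<dots> = (\<Sum>i=1..n. \<phi> ((u @ [Gen i]) @ ([Gen_adj i] @ v)))"
    using Suc.prems by (intro sum.cong refl Suc.IH) auto
  also have "\<dots> = \<phi> (u @ v)" using unit[OF Suc.prems] by simp
  finally show ?case .
qed simp

lemma snorm_svec:
  assumes z: "z \<in> unit_vectors n m" shows "F.snorm (svec n m z) = 1"
proof -
  have "lin \<phi> (adj (WA n) (svec n m z) \<otimes>\<^bsub>WA n\<^esub> svec n m z) =
    (\<Sum>J\<in>words n m. cnj (z J) * (\<Sum>K\<in>words n m. z K * \<phi> (adjs J @ gens K)))"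
    unfolding F_form[OF svec_closed svec_closed] lin_svec by simp
  also have "\<dots> = (\<Sum>J\<in>words n m. cnj (z J) * (\<Sum>K\<in>words n m. z K * (if J = K then 1 else 0)))"
    using word_orth[of "[]" "[]"] by (intro sum.cong refl arg_cong2[where f = "(*)"]) (auto simp: empty)
  also have "\<dots> = (\<Sum>J\<in>words n m. of_real ((cmod (z J))\<^sup>2))"
    by (intro sum.cong refl) (simp add: if_distrib[of "\<lambda>x. _ * x"] complex_norm_square mult.commute del: of_real_power cong: if_cong)
  also have "\<dots> = of_real 1" using z by (simp add: unit_vectors_def of_real_sum[symmetric] del: of_real_sum of_real_power)
  finally show ?thesis by (simp add: F.snorm_def)
qed

lemma cmod_svec_le: "z \<in> unit_vectors n m \<Longrightarrow> cmod (\<Sum>J\<in>words n m. z J * \<phi> (gens J)) \<le> 1"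
  using F.Cauchy_Schwarz[OF WM.delta_closed svec_closed, of "[]" m z] F_form[OF WM.delta_closed svec_closed, of "[]" m z]
    snorm_svec[of z m] F_form[OF WM.delta_closed WM.delta_closed, of "[]" "[]"]
  by (simp add: lin_svec F.snorm_def empty)

text \<open>In the GNS picture the hypothesis says that the isometry \<open>s(z)\<close> fixes the cyclic vector.\<close>

lemma svec_fixes:
  assumes z: "z \<in> unit_vectors n m" and one: "(\<Sum>J\<in>words n m. z J * \<phi> (gens J)) = 1" and u: "u \<in> lists (letters n)"
  shows "(\<Sum>J\<in>words n m. z J * \<phi> (u @ gens J)) = \<phi> u"
proof -
  \<comment> \<open>This is s(z) - 1. Its GNS vector turns out to have norm 0 and is therefore
    orthogonal to all word vectors.\<close>
  define x where "x = (\<lambda>w. svec n m z w - delta [] w)"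
  have fin: "finite {w. svec n m z w \<noteq> 0}" using svec_closed[of n m z] by simp
  have d: "delta [] \<in> carrier (WA n)" by (intro WM.delta_closed) simp
  have x: "x \<in> carrier (WA n)"
    using WM.MA_minus[OF svec_closed d] WA.minus_closed[OF svec_closed d, of m z] by (simp add: x_def)
  have lx: "lin \<psi> x = (\<Sum>J\<in>words n m. z J * \<psi> (gens J)) - \<psi> []" for \<psi>
    unfolding x_def using lin_diff[OF fin fin_delta(2)] by (simp add: lin_svec)
  have nz: "(\<Sum>J\<in>words n m. z J * cnj (z J)) = 1"
  proof -
    have "(\<Sum>J\<in>words n m. z J * cnj (z J)) = of_real (\<Sum>J\<in>words n m. (cmod (z J))\<^sup>2)"
      by (simp add: complex_norm_square del: of_real_power)
    moreover have "(\<Sum>J\<in>words n m. (cmod (z J))\<^sup>2) = 1" using z by (simp add: unit_vectors_def)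
    ultimately show ?thesis by (simp only: of_real_1)
  qed
  have in1: "lin (\<lambda>b. \<phi> (adjs J @ b)) x = z J - cnj (\<phi> (gens J))" if J: "J \<in> words n m" for J
  proof -
    have "(\<Sum>K\<in>words n m. z K * \<phi> (adjs J @ gens K)) = (\<Sum>K\<in>words n m. z K * (if J = K then 1 else 0))"
      using word_orth[of "[]" "[]" J m] J by (intro sum.cong refl arg_cong2[where f = "(*)"]) (auto simp: empty)
    also have "\<dots> = z J" using J by (simp add: if_distrib[of "\<lambda>x. _ * x"] cong: if_cong)
    finally show ?thesis using hermitian[OF words_lists(1)[OF J]] by (simp add: lx)
  qed
  have "lin \<phi> (adj (WA n) x \<otimes>\<^bsub>WA n\<^esub> x) = cnj ((\<Sum>J\<in>words n m. z J * cnj (lin (\<lambda>b. \<phi> (adjs J @ b)) x)) - cnj (lin \<phi> x))"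
    unfolding F_form[OF x x] lx[of "\<lambda>a. cnj (lin (\<lambda>b. \<phi> (rev (map letter_adj a) @ b)) x)"] by simp
  also have "lin \<phi> x = 0" using one by (simp add: lx empty)
  also have "(\<Sum>J\<in>words n m. z J * cnj (lin (\<lambda>b. \<phi> (adjs J @ b)) x)) = (\<Sum>J\<in>words n m. z J * cnj (z J) - z J * \<phi> (gens J))"
    by (intro sum.cong refl) (simp add: in1 right_diff_distrib)
  also have "\<dots> = 0" by (simp add: sum_subtractf nz one)
  finally have xx: "lin \<phi> (adj (WA n) x \<otimes>\<^bsub>WA n\<^esub> x) = 0" by simp
  let ?u = "rev (map letter_adj u)"
  have u': "?u \<in> lists (letters n)" "rev (map letter_adj ?u) = u"
    using WM.invol_closed[of u n] WM.invol_invol[of u n] u by auto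
  have "lin \<phi> (adj (WA n) (delta ?u) \<otimes>\<^bsub>WA n\<^esub> x) = 0"
    using F.S_null(2)[OF x WM.delta_closed xx] u'(1) by simp
  then have "lin (\<lambda>b. \<phi> (u @ b)) x = 0"
    using F_form[OF WM.delta_closed x, of ?u] u' by simp
  then show ?thesis by (simp add: lx)
qed

text \<open>Since s(z) fixes the cyclic vector, it may be inserted at the right end, where s_K^*
  s(z) reduces to the scalar \<open>z K\<close>. The cyclic vector is thus an eigenvector of
  s_K^*.\<close>

lemma adjs_eigen:
  assumes z: "z \<in> unit_vectors n m" and one: "(\<Sum>J\<in>words n m. z J * \<phi> (gens J)) = 1"
    and u: "u \<in> lists (letters n)" and K: "K \<in> words n m"
  shows "\<phi> (u @ adjs K) = z K * \<phi> u"
proof -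
  have "\<phi> (u @ adjs K) = (\<Sum>J\<in>words n m. z J * \<phi> ((u @ adjs K) @ gens J))"
    using u words_lists[OF K] by (intro svec_fixes[OF z one, symmetric]) auto
  also have "\<dots> = (\<Sum>J\<in>words n m. z J * (if K = J then \<phi> u else 0))"
    using word_orth[OF u _ K, of "[]"] by (intro sum.cong refl arg_cong2[where f = "(*)"]) auto
  also have "\<dots> = z K * \<phi> u" using K by (simp add: if_distrib[of "\<lambda>x. _ * x"] cong: if_cong)
  finally show ?thesis .
qed

lemma gens_value:
  assumes "z \<in> unit_vectors n m" "(\<Sum>J\<in>words n m. z J * \<phi> (gens J)) = 1" "K \<in> words n m"
  shows "\<phi> (gens K) = cnj (z K)"
  using adjs_eigen[OF assms(1,2) _ assms(3), of "[]"] hermitian[OF words_lists(1)[OF assms(3)]]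
  by (metis append_Nil complex_cnj_cnj empty invol_gens lists.Nil mult.right_neutral)

lemma adjs_eigen_power:
  assumes z: "z \<in> unit_vectors n m" and one: "(\<Sum>J\<in>words n m. z J * \<phi> (gens J)) = 1"
    and u: "u \<in> lists (letters n)" and K: "K \<in> words n (a * m)"
  shows "\<phi> (u @ adjs K) = tensor_power m z a K * \<phi> u"
  using K
proof (induction a arbitrary: K)
  case (Suc a)
  have td: "take m K \<in> words n m" "drop m K \<in> words n (a * m)" using take_drop_words[of K n m "a * m"] Suc.prems by auto
  have "adjs K = adjs (drop m K) @ adjs (take m K)" by (metis append_take_drop_id map_append rev_append)
  then have "\<phi> (u @ adjs K) = \<phi> ((u @ adjs (drop m K)) @ adjs (take m K))" by simp
  also have "\<dots> = z (take m K) * \<phi> (u @ adjs (drop m K))"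
    using u words_lists(2)[OF td(2)] by (intro adjs_eigen[OF z one _ td(1)]) auto
  finally show ?case using Suc.IH[OF td(2)] by simp
qed simp

text \<open>In the GNS picture, the coordinates of the cyclic vector with respect to the isometries \<open>s\<^sub>K\<close>.\<close>

definition coeffs :: "nat \<Rightarrow> nat list \<Rightarrow> complex" where
  "coeffs r K = (if K \<in> words n r then \<phi> (adjs K) else 0)"

lemma coeffs_vectors: "coeffs r \<in> vectors n r"
  by (simp add: coeffs_def vectors_def)

lemma gens_coeffs: "K \<in> words n r \<Longrightarrow> \<phi> (gens K) = cnj (coeffs r K)"
  using hermitian[of "gens K"] words_lists(1)[of K n r] by (simp add: coeffs_def)

lemma coeffs_eq:
  assumes "z \<in> unit_vectors n m" "(\<Sum>J\<in>words n m. z J * \<phi> (gens J)) = 1" shows "coeffs m = z"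
  using adjs_eigen[OF assms, of "[]"] by (intro vectors_eqI[OF coeffs_vectors unit_vectors_vectors[OF assms(1)]])
    (simp add: coeffs_def empty)

text \<open>Equality in the Cauchy-Schwarz inequality for \<open>z \<otimes> w\<close> and \<open>w \<otimes> z\<close>.\<close>

lemma coeffs_commute:
  assumes z: "z \<in> unit_vectors n m" and one: "(\<Sum>J\<in>words n m. z J * \<phi> (gens J)) = 1"
  shows "tens m z (coeffs r) = tens r (coeffs r) z"
proof -
  let ?w = "coeffs r"
  let ?a = "tens m z ?w" and ?b = "tens r ?w z"
  define s where "s = (\<Sum>K\<in>words n r. (cmod (?w K))\<^sup>2)"
  have nz: "(\<Sum>J\<in>words n m. (cmod (z J))\<^sup>2) = 1" using z by (simp add: unit_vectors_def)
  have v: "?a \<in> vectors n (m + r)" "?b \<in> vectors n (m + r)"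
    using tens_vectors[OF unit_vectors_vectors[OF z] coeffs_vectors[of r]] tens_vectors[OF coeffs_vectors[of r] unit_vectors_vectors[OF z]]
    by (simp_all add: add.commute)
  have na: "(\<Sum>L\<in>words n (m + r). (cmod (?a L))\<^sup>2) = s" using norm_tens[of m z ?w n r] nz by (simp add: s_def)
  have nb: "(\<Sum>L\<in>words n (m + r). (cmod (?b L))\<^sup>2) = s"
    using norm_tens[of r ?w z n m] nz by (simp add: s_def add.commute)
  \<comment> \<open>The prefix of length \<open>m\<close> is the part of the adjoint word that acts
    first on the cyclic vector, so it contributes the eigenvalue.\<close>
  have a: "cnj (?a L) = \<phi> (gens L)" if L: "L \<in> words n (m + r)" for L
  proof -
    have td: "take m L \<in> words n m" "drop m L \<in> words n r" using take_drop_words[OF L] by auto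
    have "adjs L = adjs (drop m L) @ adjs (take m L)" by (metis append_take_drop_id map_append rev_append)
    then have "\<phi> (adjs L) = ?a L"
      using adjs_eigen[OF z one words_lists(2)[OF td(2)] td(1)] td by (simp add: tens_def coeffs_def)
    then show ?thesis using gens_coeffs[OF L] L by (simp add: coeffs_def)
  qed
  \<comment> \<open>In the inner product the trailing s(z) meets the cyclic vector and disappears;
    it comes out as the common squared norm \<open>s\<close>, so the two tensors are at distance
    0.\<close>
  have "(\<Sum>L\<in>words n (m + r). cnj (?a L) * ?b L) = (\<Sum>L\<in>words n (r + m). \<phi> (gens L) * ?b L)"
    using a by (simp add: add.commute)
  also have "\<dots> = (\<Sum>A\<in>words n r. ?w A * (\<Sum>B\<in>words n m. z B * \<phi> (gens A @ gens B)))"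
    unfolding sum_words_add sum_distrib_left by (intro sum.cong refl) (simp add: tens_append words_length)
  also have "\<dots> = (\<Sum>A\<in>words n r. ?w A * cnj (?w A))"
    using svec_fixes[OF z one] words_lists(1) gens_coeffs by (intro sum.cong refl) simp
  also have "\<dots> = of_real s" by (simp add: s_def complex_norm_square del: of_real_power)
  finally have ab: "(\<Sum>L\<in>words n (m + r). cnj (?a L) * ?b L) = of_real s" .
  have "(\<Sum>L\<in>words n (m + r). (cmod (?a L - ?b L))\<^sup>2) =
    (\<Sum>L\<in>words n (m + r). (cmod (?a L))\<^sup>2 + (cmod (?b L))\<^sup>2 - 2 * Re (cnj (?a L) * ?b L))"
    by (intro sum.cong refl) (simp add: cmod_power2, simp add: power2_eq_square algebra_simps)
  also have "\<dots> = s + s - 2 * Re (\<Sum>L\<in>words n (m + r). cnj (?a L) * ?b L)"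
    by (simp only: sum_subtractf sum.distrib na nb Re_sum sum_distrib_left)
  also have "\<dots> = 0" by (simp add: ab)
  finally have "\<forall>L\<in>words n (m + r). (cmod (?a L - ?b L))\<^sup>2 = 0"
    by (subst (asm) sum_nonneg_eq_0_iff) auto
  then show ?thesis by (intro vectors_eqI[OF v]) simp
qed

text \<open>The coordinates of each degree commute with \<open>z\<close>. If they do not all vanish,
  the degree is a multiple of \<open>m\<close>, and then the eigenvalue property computes
  them.\<close>

lemma coeffs_nonperiodic:
  assumes m: "m \<ge> 1" and z: "z \<in> unit_vectors n m" and np: "nonperiodic n m z"
    and one: "(\<Sum>J\<in>words n m. z J * \<phi> (gens J)) = 1" and K: "K \<in> words n r"
  shows "\<phi> (adjs K) = (if m dvd r then tensor_power m z (r div m) K else 0)"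
proof (cases "m dvd r")
  case True
  then show ?thesis using adjs_eigen_power[OF z one, of "[]" K "r div m"] K by (simp add: empty)
next
  case False
  then have r: "r \<ge> 1" by (cases r) auto
  have "coeffs r K = 0"
  proof (rule ccontr)
    assume w0: "coeffs r K \<noteq> 0"
    obtain J where z0: "z J \<noteq> 0" using unit_vectors_nonzero[OF z] by blast
    have "m dvd r"
      by (rule nonperiodic_commuting[OF m r unit_vectors_vectors[OF z] np coeffs_vectors z0 w0, of 1])
        (simp_all add: coeffs_commute[OF z one])
    then show False using False by simp
  qed
  then show ?thesis using False K by (simp add: coeffs_def)
qed

end

text \<open>In a word to which the orthogonality relation cannot be applied, no adjoint stands
  before a generator.\<close>

lemma word_cases:
  assumes "w \<in> lists (letters n)"
  shows "(\<exists>u v i j. w = u @ Gen_adj i # Gen j # v) \<or> (\<exists>J K. w = gens J @ adjs K)"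
  using assms
proof (induction rule: lists.induct)
  case Nil
  have "[] = gens [] @ adjs []" by simp
  then show ?case by blast
next
  case (Cons a w)
  from Cons.IH show ?case
  proof (elim disjE exE)
    fix u v i j assume "w = u @ Gen_adj i # Gen j # v"
    then have "a # w = (a # u) @ Gen_adj i # Gen j # v" by simp
    then show ?thesis by blast
  next
    fix J K assume w: "w = gens J @ adjs K"
    show ?thesis
    proof (cases a)
      case (Gen i)
      then have "a # w = gens (i # J) @ adjs K" using w by simp
      then show ?thesis by blast
    next
      case (Gen_adj i)
      show ?thesis
      proof (cases J)
        case Nil
        then have "a # w = gens [] @ adjs (K @ [i])" using w Gen_adj by simp
        then show ?thesis by blast
      next
        case (Cons j J')
        then have "a # w = [] @ Gen_adj i # Gen j # (gens J' @ adjs K)" using w Gen_adj by simp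
        then show ?thesis by blast
      qed
    qed
  qed
qed

text \<open>Orthogonality reduces a word to the form s_J s_K^*. Inserting a sum of s_L s_L^*
  lengthens \<open>K\<close> to a multiple of \<open>m\<close>, and the adjoints then become scalars
  by the eigenvalue property; only words without adjoints remain.\<close>

lemma cuntz_kernel_eqI:
  assumes \<phi>: "cuntz_kernel n \<phi>" and \<psi>: "cuntz_kernel n \<psi>" and m: "m \<ge> 1" and z: "z \<in> unit_vectors n m"
    and one: "(\<Sum>J\<in>words n m. z J * \<phi> (gens J)) = 1" "(\<Sum>J\<in>words n m. z J * \<psi> (gens J)) = 1"
    and eq: "\<And>r K. K \<in> words n r \<Longrightarrow> \<phi> (gens K) = \<psi> (gens K)"
    and w: "w \<in> lists (letters n)"
  shows "\<phi> w = \<psi> w"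
  using w
proof (induction "length w" arbitrary: w rule: less_induct)
  case less
  interpret \<phi>: cuntz_kernel n \<phi> by fact
  interpret \<psi>: cuntz_kernel n \<psi> by fact
  from word_cases[OF less.prems] show ?case
  proof (elim disjE exE)
    fix u v i j assume we: "w = u @ Gen_adj i # Gen j # v"
    then have uv: "u \<in> lists (letters n)" "v \<in> lists (letters n)" "i \<in> {1..n}" "j \<in> {1..n}" using less.prems by auto
    have "\<phi> (u @ v) = \<psi> (u @ v)" using we uv by (intro less.hyps) auto
    then show ?thesis unfolding we using \<phi>.orth[OF uv] \<psi>.orth[OF uv] by simp
  next
    fix J K assume we: "w = gens J @ adjs K"
    have "\<forall>j\<in>set J. Gen j \<in> letters n" "\<forall>k\<in>set K. Gen_adj k \<in> letters n"
      using less.prems unfolding we by (auto simp only: in_lists_conv_set set_append set_rev set_map Un_iff image_iff)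
    then have J: "J \<in> words n (length J)" and K: "K \<in> words n (length K)"
      by (auto simp: words_def)
    \<comment> \<open>This padding raises the length of \<open>K\<close> to
      \<open>length K * m\<close>.\<close>
    define r where "r = length K * (m - 1)"
    have len: "length K + r = length K * m" using m by (cases m) (auto simp: r_def)
    have *: "\<chi> w = (\<Sum>L\<in>words n r. tensor_power m z (length K) (K @ L) * \<chi> (gens (J @ L)))"
      if \<chi>: "cuntz_kernel n \<chi>" and o: "(\<Sum>J\<in>words n m. z J * \<chi> (gens J)) = 1" for \<chi>
    proof -
      interpret \<chi>: cuntz_kernel n \<chi> by fact
      have "\<chi> w = (\<Sum>L\<in>words n r. \<chi> (gens J @ gens L @ adjs L @ adjs K))"
        unfolding we by (rule \<chi>.word_unit[OF words_lists(1)[OF J] words_lists(2)[OF K], symmetric])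
      also have "\<dots> = (\<Sum>L\<in>words n r. \<chi> (gens (J @ L) @ adjs (K @ L)))" by simp
      also have "\<dots> = (\<Sum>L\<in>words n r. tensor_power m z (length K) (K @ L) * \<chi> (gens (J @ L)))"
      proof (intro sum.cong refl \<chi>.adjs_eigen_power[OF z o])
        fix L assume L: "L \<in> words n r"
        show "gens (J @ L) \<in> lists (letters n)" using words_lists(1)[OF J] words_lists(1)[OF L] by simp
        show "K @ L \<in> words n (length K * m)" using K L words_append[of K "length K" L n r] len by simp
      qed
      finally show ?thesis .
    qed
    have "\<phi> (gens (J @ L)) = \<psi> (gens (J @ L))" if "L \<in> words n r" for L
      using J that words_append[of J "length J" L n r] by (intro eq[of _ "length J + r"]) simp
    then show ?thesis using *[OF \<phi> one(1)] *[OF \<psi> one(2)] by simp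
  qed
qed

lemma cuntz_kernel_unique:
  assumes \<phi>: "cuntz_kernel n \<phi>" and \<psi>: "cuntz_kernel n \<psi>" and m: "m \<ge> 1" and z: "z \<in> unit_vectors n m"
    and np: "nonperiodic n m z"
    and one: "(\<Sum>J\<in>words n m. z J * \<phi> (gens J)) = 1" "(\<Sum>J\<in>words n m. z J * \<psi> (gens J)) = 1"
    and w: "w \<in> lists (letters n)"
  shows "\<phi> w = \<psi> w"
proof (rule cuntz_kernel_eqI[OF \<phi> \<psi> m z one _ w])
  fix r K assume K: "K \<in> words n r"
  have "\<phi> (adjs K) = \<psi> (adjs K)"
    using cuntz_kernel.coeffs_nonperiodic[OF \<phi> m z np one(1) K] cuntz_kernel.coeffs_nonperiodic[OF \<psi> m z np one(2) K] by simp
  then show "\<phi> (gens K) = \<psi> (gens K)"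
    using cuntz_kernel.gens_coeffs[OF \<phi> K] cuntz_kernel.gens_coeffs[OF \<psi> K] K
    by (simp add: cuntz_kernel.coeffs_def[OF \<phi>] cuntz_kernel.coeffs_def[OF \<psi>])
qed

section \<open>Existence of sub-Cuntz states\<close>

text \<open>
  The operators \<open>s\<^sub>i\<close> and \<open>s\<^sub>i\<^sup>*\<close> act on functions of words by prepending and removing the letter \<open>i\<close>.
  Functions that are eventually multiplicative with respect to appending \<open>z\<close> form the inductive
  limit of the spaces of vectors of degree \<open>j\<close> along \<open>v \<mapsto> v \<otimes> z\<close>, two functions being identified if
  they agree on long words; the inner product of the limit is computed on any window of \<open>m\<close>
  consecutive large lengths.
\<close>

fun letter_act :: "letter \<Rightarrow> (nat list \<Rightarrow> complex) \<Rightarrow> nat list \<Rightarrow> complex" where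
  "letter_act (Gen i) \<xi> [] = 0"
| "letter_act (Gen i) \<xi> (j # J) = (if j = i then \<xi> J else 0)"
| "letter_act (Gen_adj i) \<xi> J = \<xi> (i # J)"

definition word_act :: "letter list \<Rightarrow> (nat list \<Rightarrow> complex) \<Rightarrow> nat list \<Rightarrow> complex" where
  "word_act w \<xi> = foldr letter_act w \<xi>"

lemma word_act_simps [simp]:
  "word_act [] \<xi> = \<xi>" "word_act (l # w) \<xi> = letter_act l (word_act w \<xi>)"
  "word_act (u @ v) \<xi> = word_act u (word_act v \<xi>)"
  by (simp_all add: word_act_def)

lemma letter_act_zero: "letter_act l (\<lambda>_. 0) = (\<lambda>_. 0)"
proof
  fix J show "letter_act l (\<lambda>_. 0) J = 0" by (cases l; cases J) auto
qed

lemma word_act_zero: "word_act w (\<lambda>_. 0) = (\<lambda>_. 0)"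
  by (induction w) (simp_all add: letter_act_zero)

lemma word_act_adjs: "word_act (adjs K) \<xi> = (\<lambda>L. \<xi> (K @ L))"
  by (induction K arbitrary: \<xi>) (simp_all add: fun_eq_iff)

lemma letter_act_orth: "letter_act (Gen_adj i) (letter_act (Gen j) \<xi>) = (if i = j then \<xi> else (\<lambda>_. 0))"
  by (auto simp: fun_eq_iff)

lemma nonneg_Reals_sum: "(\<And>i. i \<in> I \<Longrightarrow> f i \<in> \<real>\<^sub>\<ge>\<^sub>0) \<Longrightarrow> (\<Sum>i\<in>I. f i :: complex) \<in> \<real>\<^sub>\<ge>\<^sub>0"
  by (induction I rule: infinite_finite_induct) auto

context
  fixes n m :: nat and z :: "nat list \<Rightarrow> complex"
  assumes m: "m \<ge> 1" and z: "z \<in> unit_vectors n m"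
begin

definition consistent :: "nat \<Rightarrow> (nat list \<Rightarrow> complex) \<Rightarrow> bool" where
  "consistent M \<xi> \<longleftrightarrow> (\<forall>J K. length J \<ge> M \<longrightarrow> K \<in> words n m \<longrightarrow> \<xi> (J @ K) = \<xi> J * z K)"

text \<open>The cyclic vector. As it vanishes at lengths that are not multiples of \<open>m\<close>,
  each window meets it at a single length.\<close>

definition omega :: "nat list \<Rightarrow> complex" where
  "omega J = (if m dvd length J then tensor_power m z (length J div m) J else 0)"

definition window :: "nat \<Rightarrow> (nat list \<Rightarrow> complex) \<Rightarrow> (nat list \<Rightarrow> complex) \<Rightarrow> complex" where
  "window M \<xi> \<eta> = (\<Sum>i<m. \<Sum>J\<in>words n (M + i). cnj (\<xi> J) * \<eta> J)"

definition limit_form :: "(nat list \<Rightarrow> complex) \<Rightarrow> (nat list \<Rightarrow> complex) \<Rightarrow> complex" where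
  "limit_form \<xi> \<eta> = lim (\<lambda>M. window M \<xi> \<eta>)"

lemma omega_append:
  assumes K: "K \<in> words n m" shows "omega (J @ K) = omega J * z K" "omega (K @ J) = z K * omega J"
proof -
  have l: "length K = m" using K by (rule words_length)
  have p1: "tensor_power m z (Suc 0) K = z K"
    using tensor_power_1[OF unit_vectors_vectors[OF z]] by (rule fun_cong)
  show "omega (J @ K) = omega J * z K"
  proof (cases "m dvd length J")
    case True
    then obtain a where a: "length J = a * m" by (metis dvdE mult.commute)
    have "(length J + m) div m = a + 1" using m a by simp
    then show ?thesis
      using tensor_power_add[of m z a 1] a True l p1 m
      by (simp add: omega_def tens_append del: tensor_power.simps)
  qed (simp add: omega_def l)
  show "omega (K @ J) = z K * omega J"
    using l m by (simp add: omega_def tensor_power_Suc[of m z "length J div m"] tens_append del: tensor_power.simps)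
qed

lemma consistent_omega: "consistent 0 omega"
  by (simp add: consistent_def omega_append)

lemma consistent_mono: "consistent M \<xi> \<Longrightarrow> M \<le> M' \<Longrightarrow> consistent M' \<xi>"
  by (auto simp: consistent_def)

lemma consistent_letter_act: "consistent M \<xi> \<Longrightarrow> consistent (Suc M) (letter_act l \<xi>)"
  unfolding consistent_def
proof (intro allI impI)
  fix J K :: "nat list" assume c: "\<forall>J K. M \<le> length J \<longrightarrow> K \<in> words n m \<longrightarrow> \<xi> (J @ K) = \<xi> J * z K"
    and J: "Suc M \<le> length J" and K: "K \<in> words n m"
  then obtain j J' where "J = j # J'" by (cases J) auto
  then show "letter_act l \<xi> (J @ K) = letter_act l \<xi> J * z K"
    using c[rule_format, of J' K] c[rule_format, of "i # J" K for i] J K by (cases l) auto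
qed

lemma consistent_word_act: "\<exists>M. consistent M (word_act w omega)"
  by (induction w) (auto intro: consistent_omega consistent_letter_act)

text \<open>Moving the window by one replaces length \<open>M\<close> by \<open>M + m\<close>. A
  consistent function gains a factor \<open>z\<close> on the last \<open>m\<close> letters, and
  \<open>z\<close> has norm 1, so both lengths give the same sum.\<close>

lemma window_const:
  assumes "consistent M0 \<xi>" "consistent M0 \<eta>" "M0 \<le> M" shows "window M \<xi> \<eta> = window M0 \<xi> \<eta>"
  using assms(3)
proof (induction M rule: dec_induct)
  case (step M)
  let ?s = "\<lambda>j. \<Sum>J\<in>words n j. cnj (\<xi> J) * \<eta> J"
  have nz: "(\<Sum>K\<in>words n m. cnj (z K) * z K) = 1"
  proof -
    have "(\<Sum>K\<in>words n m. cnj (z K) * z K) = of_real (\<Sum>J\<in>words n m. (cmod (z J))\<^sup>2)"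
      by (simp add: complex_norm_square mult.commute del: of_real_power)
    moreover have "(\<Sum>J\<in>words n m. (cmod (z J))\<^sup>2) = 1" using z by (simp add: unit_vectors_def)
    ultimately show ?thesis by (simp only: of_real_1)
  qed
  have "?s (M + m) = (\<Sum>A\<in>words n M. \<Sum>B\<in>words n m. (cnj (\<xi> A) * \<eta> A) * (cnj (z B) * z B))"
    unfolding sum_words_add
    using assms(1,2) step.hyps by (intro sum.cong refl) (auto simp: consistent_def words_length)
  also have "\<dots> = ?s M" unfolding sum_distrib_left[symmetric] nz by simp
  finally have e: "?s (M + m) = ?s M" .
  have "window (Suc M) \<xi> \<eta> + ?s M = (\<Sum>i<Suc m. ?s (M + i))"
    unfolding sum.lessThan_Suc_shift by (simp add: window_def add.commute)
  also have "\<dots> = window M \<xi> \<eta> + ?s (M + m)" by (simp add: window_def)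
  finally show ?case using step.IH e by simp
qed simp

lemma limit_form_eventually:
  assumes "\<exists>M. consistent M \<xi>" "\<exists>M. consistent M \<eta>"
  shows "\<forall>\<^sub>F M in sequentially. window M \<xi> \<eta> = limit_form \<xi> \<eta>"
proof -
  obtain A B where "consistent A \<xi>" "consistent B \<eta>" using assms by blast
  then have c: "consistent (max A B) \<xi>" "consistent (max A B) \<eta>" by (auto intro: consistent_mono)
  have ev: "\<forall>\<^sub>F M in sequentially. window M \<xi> \<eta> = window (max A B) \<xi> \<eta>"
    unfolding eventually_sequentially using window_const[OF c] by blast
  then have "(\<lambda>M. window M \<xi> \<eta>) \<longlonglongrightarrow> window (max A B) \<xi> \<eta>" by (rule tendsto_eventually)
  then have "limit_form \<xi> \<eta> = window (max A B) \<xi> \<eta>" unfolding limit_form_def by (rule limI)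
  then show ?thesis using ev by simp
qed

lemma limit_form_cnj:
  assumes "\<exists>M. consistent M \<xi>" "\<exists>M. consistent M \<eta>" shows "limit_form \<eta> \<xi> = cnj (limit_form \<xi> \<eta>)"
proof -
  obtain M where "window M \<xi> \<eta> = limit_form \<xi> \<eta>" "window M \<eta> \<xi> = limit_form \<eta> \<xi>"
    using eventually_happens'[OF sequentially_bot
      eventually_conj[OF limit_form_eventually[OF assms] limit_form_eventually[OF assms(2,1)]]] by blast
  moreover have "window M \<eta> \<xi> = cnj (window M \<xi> \<eta>)" by (simp add: window_def mult.commute)
  ultimately show ?thesis by simp
qed

text \<open>A generator raises lengths by one, so the window at \<open>Suc M\<close> on one side
  matches the window at \<open>M\<close> on the other; the limits agree.\<close>

lemma limit_form_gen:
  assumes c: "\<exists>M. consistent M \<xi>" "\<exists>M. consistent M \<eta>" and i: "i \<in> {1..n}"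
  shows "limit_form (letter_act (Gen i) \<xi>) \<eta> = limit_form \<xi> (letter_act (Gen_adj i) \<eta>)"
proof -
  have "(\<Sum>J\<in>words n (Suc r). cnj (letter_act (Gen i) \<xi> J) * \<eta> J) = (\<Sum>L\<in>words n r. cnj (\<xi> L) * \<eta> (i # L))" for r
  proof -
    have "(\<Sum>J\<in>words n (Suc r). cnj (letter_act (Gen i) \<xi> J) * \<eta> J) =
      (\<Sum>k=1..n. if k = i then (\<Sum>L\<in>words n r. cnj (\<xi> L) * \<eta> (i # L)) else 0)"
      unfolding sum_words_Suc by (intro sum.cong refl) auto
    then show ?thesis using i by simp
  qed
  then have w: "window (Suc M) (letter_act (Gen i) \<xi>) \<eta> = window M \<xi> (letter_act (Gen_adj i) \<eta>)" for M
    by (simp add: window_def)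
  have c': "\<exists>M. consistent M (letter_act (Gen i) \<xi>)" "\<exists>M. consistent M (letter_act (Gen_adj i) \<eta>)"
    using c consistent_letter_act by blast+
  have "\<forall>\<^sub>F M in sequentially. window (Suc M) (letter_act (Gen i) \<xi>) \<eta> = limit_form (letter_act (Gen i) \<xi>) \<eta>"
    by (rule eventually_compose_filterlim[OF limit_form_eventually[OF c'(1) c(2)] filterlim_Suc])
  then obtain M where "window (Suc M) (letter_act (Gen i) \<xi>) \<eta> = limit_form (letter_act (Gen i) \<xi>) \<eta>"
    "window M \<xi> (letter_act (Gen_adj i) \<eta>) = limit_form \<xi> (letter_act (Gen_adj i) \<eta>)"
    using eventually_happens'[OF sequentially_bot eventually_conj[OF _ limit_form_eventually[OF c(1) c'(2)]]] by blast
  then show ?thesis using w[of M] by simp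
qed

lemma limit_form_letter:
  assumes c: "\<exists>M. consistent M \<xi>" "\<exists>M. consistent M \<eta>" and l: "l \<in> letters n"
  shows "limit_form (letter_act l \<xi>) \<eta> = limit_form \<xi> (letter_act (letter_adj l) \<eta>)"
proof (cases l)
  case (Gen i) then show ?thesis using limit_form_gen[OF c] l by simp
next
  case (Gen_adj i)
  have c': "\<exists>M. consistent M (letter_act (Gen_adj i) \<xi>)" "\<exists>M. consistent M (letter_act (Gen i) \<eta>)"
    using c consistent_letter_act by blast+
  show ?thesis
    using limit_form_gen[OF c(2,1), of i] limit_form_cnj[OF c'(1) c(2)] limit_form_cnj[OF c(1) c'(2)] l Gen_adj by simp
qed

lemma limit_form_word:
  assumes "u \<in> lists (letters n)"
  shows "limit_form (word_act u (word_act v omega)) (word_act w omega) =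
    limit_form (word_act v omega) (word_act (rev (map letter_adj u)) (word_act w omega))"
  using assms
proof (induction arbitrary: w rule: lists.induct)
  case (Cons l u)
  have "limit_form (word_act (l # u) (word_act v omega)) (word_act w omega) =
    limit_form (word_act u (word_act v omega)) (word_act ([letter_adj l] @ w) omega)"
    using limit_form_letter[OF consistent_word_act[of "u @ v"] consistent_word_act[of w] Cons(1)] by simp
  then show ?case using Cons(3)[of "[letter_adj l] @ w"] by simp
qed simp

lemma sub_cuntz_kernel_exists:
  obtains \<phi> where "cuntz_kernel n \<phi>" "\<And>J. J \<in> words n m \<Longrightarrow> \<phi> (gens J) = cnj (z J)"
proof -
  define \<phi> where "\<phi> w = limit_form omega (word_act w omega)" for w
  note cw = consistent_word_act
  have split: "\<phi> (u @ v) = limit_form (word_act (rev (map letter_adj u)) omega) (word_act v omega)"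
    if u: "u \<in> lists (letters n)" for u v
  proof -
    have "rev (map letter_adj u) \<in> lists (letters n)" "rev (map letter_adj (rev (map letter_adj u))) = u"
      using WM.invol_closed[of u n] WM.invol_invol[of u n] u by auto
    then show ?thesis using limit_form_word[of "rev (map letter_adj u)" "[]" v] by (simp add: \<phi>_def)
  qed
  have zero: "limit_form \<xi> (\<lambda>_. 0) = 0" for \<xi> by (simp add: limit_form_def window_def)
  have win1: "window M omega omega = 1" for M
  proof -
    \<comment> \<open>The window starting at 0 contains just one multiple of \<open>m\<close>, the
      length of the empty word, where \<open>omega\<close> is 1.\<close>
    have "window M omega omega = window 0 omega omega"
      using consistent_omega by (intro window_const) auto
    also have "\<dots> = (\<Sum>i<m. if i = 0 then 1 else 0)"
      unfolding window_def
    proof (intro sum.cong refl)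
      fix i assume i: "i \<in> {..<m}"
      show "(\<Sum>J\<in>words n (0 + i). cnj (omega J) * omega J) = (if i = 0 then 1 else 0)"
      proof (cases "i = 0")
        case True then show ?thesis by (simp add: omega_def)
      next
        case False
        then have "omega J = 0" if "J \<in> words n i" for J
          using that i by (auto simp: omega_def words_length dest: dvd_imp_le)
        then show ?thesis using False by simp
      qed
    qed
    also have "\<dots> = 1" using m by simp
    finally show ?thesis .
  qed
  have one: "limit_form omega omega = 1" unfolding limit_form_def win1 by (rule limI) (rule tendsto_const)
  have kernel: "cuntz_kernel n \<phi>"
  proof
    show "\<phi> [] = 1" using one by (simp add: \<phi>_def)
    fix u v i j assume "u \<in> lists (letters n)" "v \<in> lists (letters n)" "i \<in> {1..n}" "j \<in> {1..n}"
    show "\<phi> (u @ Gen_adj i # Gen j # v) = (if i = j then \<phi> (u @ v) else 0)"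
      by (simp add: \<phi>_def letter_act_orth word_act_zero zero del: letter_act.simps)
  next
    fix u v assume u: "u \<in> lists (letters n)" and v: "v \<in> lists (letters n)"
    let ?\<xi> = "word_act (rev (map letter_adj u)) omega" and ?\<eta> = "word_act v omega"
    let ?P = "\<lambda>i. word_act ([Gen i, Gen_adj i] @ v) omega"
    have e1: "\<forall>\<^sub>F M in sequentially. \<forall>i\<in>{1..n}. window M ?\<xi> (?P i) = limit_form ?\<xi> (?P i)"
      by (intro eventually_ball_finite ballI limit_form_eventually cw) simp
    \<comment> \<open>The sum of s_i s_i^* acts as the identity except at the empty word, where it
      gives 0; hence \<open>M \<ge> 1\<close>.\<close>
    have P_sum: "(\<Sum>i=1..n. ?P i J) = ?\<eta> J" if J: "J \<in> words n (M + k)" and M: "M \<ge> 1" for J M k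
    proof -
      obtain j J' where "J = j # J'" "j \<in> {1..n}" using J M by (cases J) (auto simp: words_def)
      then show ?thesis by simp
    qed
    have "(\<Sum>i=1..n. window M ?\<xi> (?P i)) = window M ?\<xi> ?\<eta>" if "M \<ge> 1" for M
    proof -
      have "(\<Sum>i=1..n. window M ?\<xi> (?P i)) = (\<Sum>k<m. \<Sum>J\<in>words n (M + k). \<Sum>i=1..n. cnj (?\<xi> J) * ?P i J)"
        unfolding window_def by (subst sum.swap) (intro sum.cong refl sum.swap)
      also have "\<dots> = window M ?\<xi> ?\<eta>"
        unfolding window_def sum_distrib_left[symmetric]
        using P_sum[OF _ that] by (intro sum.cong refl) simp
      finally show ?thesis .
    qed
    then have "\<forall>\<^sub>F M in sequentially. (\<Sum>i=1..n. window M ?\<xi> (?P i)) = window M ?\<xi> ?\<eta>"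
      unfolding eventually_sequentially by blast
    from eventually_conj[OF this eventually_conj[OF e1 limit_form_eventually[OF cw cw, of "rev (map letter_adj u)" v]]]
    have "\<forall>\<^sub>F M::nat in sequentially. (\<Sum>i=1..n. limit_form ?\<xi> (?P i)) = limit_form ?\<xi> ?\<eta>"
      by (rule eventually_mono) (auto simp del: word_act_simps)
    then have "(\<Sum>i=1..n. limit_form ?\<xi> (?P i)) = limit_form ?\<xi> ?\<eta>" by simp
    moreover have "\<phi> (u @ Gen i # Gen_adj i # v) = limit_form ?\<xi> (?P i)" for i
      using split[OF u, of "[Gen i, Gen_adj i] @ v"] by simp
    ultimately show "(\<Sum>i=1..n. \<phi> (u @ Gen i # Gen_adj i # v)) = \<phi> (u @ v)" using split[OF u, of v] by simp
  next
    fix x assume x: "x \<in> carrier (WA n)"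
    let ?S = "{a. x a \<noteq> 0}" and ?\<xi> = "\<lambda>a. word_act a omega"
    have S: "finite ?S" "\<And>a. a \<in> ?S \<Longrightarrow> a \<in> lists (letters n)" using x by auto
    \<comment> \<open>One window serves all pairs from the finite support, which turns the form into
      a finite sum of rank-one terms, one for each word in the window.\<close>
    have "\<forall>\<^sub>F M in sequentially. \<forall>p\<in>?S. \<forall>q\<in>?S. window M (?\<xi> p) (?\<xi> q) = limit_form (?\<xi> p) (?\<xi> q)"
      by (intro eventually_ball_finite ballI limit_form_eventually cw S(1))
    then obtain M where M: "\<And>p q. \<lbrakk>p \<in> ?S; q \<in> ?S\<rbrakk> \<Longrightarrow> window M (?\<xi> p) (?\<xi> q) = limit_form (?\<xi> p) (?\<xi> q)"
      by (auto simp: eventually_sequentially)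
    let ?W = "Sigma {..<m} (\<lambda>i. words n (M + i))"
    have "lin \<phi> (adj (WA n) x \<otimes>\<^bsub>WA n\<^esub> x) = (\<Sum>p\<in>?S. \<Sum>q\<in>?S. cnj (x p) * x q * \<phi> (rev (map letter_adj p) @ q))"
      unfolding WM.lin_adj_mult[OF x x] by simp
    also have "\<dots> = (\<Sum>p\<in>?S. \<Sum>q\<in>?S. \<Sum>k\<in>?W. cnj (x p) * x q * (cnj (?\<xi> p (snd k)) * ?\<xi> q (snd k)))"
    proof (intro sum.cong refl)
      fix p q assume p: "p \<in> ?S" and q: "q \<in> ?S"
      have "rev (map letter_adj p) \<in> lists (letters n)" "rev (map letter_adj (rev (map letter_adj p))) = p"
        using WM.invol_closed[of p n] WM.invol_invol[of p n] S(2)[OF p] by auto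
      then have "\<phi> (rev (map letter_adj p) @ q) = window M (?\<xi> p) (?\<xi> q)"
        using split[of "rev (map letter_adj p)" q] M[OF p q] by simp
      also have "\<dots> = (\<Sum>k\<in>?W. cnj (?\<xi> p (snd k)) * ?\<xi> q (snd k))"
        unfolding window_def by (subst sum.Sigma) (auto simp: case_prod_beta)
      finally show "cnj (x p) * x q * \<phi> (rev (map letter_adj p) @ q) =
        (\<Sum>k\<in>?W. cnj (x p) * x q * (cnj (?\<xi> p (snd k)) * ?\<xi> q (snd k)))" by (simp add: sum_distrib_left)
    qed
    also have "\<dots> = (\<Sum>p\<in>?S. \<Sum>k\<in>?W. \<Sum>q\<in>?S. cnj (x p) * x q * (cnj (?\<xi> p (snd k)) * ?\<xi> q (snd k)))"
      by (intro sum.cong refl sum.swap)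
    also have "\<dots> = (\<Sum>k\<in>?W. \<Sum>p\<in>?S. \<Sum>q\<in>?S. cnj (x p) * x q * (cnj (?\<xi> p (snd k)) * ?\<xi> q (snd k)))"
      by (rule sum.swap)
    also have "\<dots> \<in> \<real>\<^sub>\<ge>\<^sub>0" by (intro nonneg_Reals_sum psd_rank_one)
    finally show "lin \<phi> (adj (WA n) x \<otimes>\<^bsub>WA n\<^esub> x) \<in> \<real>\<^sub>\<ge>\<^sub>0" .
  qed
  interpret cuntz_kernel n \<phi> by (rule kernel)
  have "\<phi> (gens J) = cnj (z J)" if J: "J \<in> words n m" for J
  proof -
    \<comment> \<open>Removing the prefix \<open>J\<close> from \<open>omega\<close> leaves
      \<open>z J\<close> times \<open>omega\<close>, so \<open>z J\<close> is the eigenvalue of the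
      adjoint word.\<close>
    have "window M omega (\<lambda>L. z J * omega L) = z J * window M omega omega" for M
      by (simp add: window_def sum_distrib_left mult.left_commute)
    then have "limit_form omega (\<lambda>L. z J * omega L) = z J"
      unfolding limit_form_def by (intro limI) (simp add: win1)
    then have "\<phi> (adjs J) = z J"
      using omega_append(2)[OF J] by (simp add: \<phi>_def word_act_adjs)
    then show ?thesis using hermitian[OF words_lists(2)[OF J]] by simp
  qed
  then show thesis using that kernel by blast
qed

end

section \<open>Sub-Cuntz states\<close>

lemma unit_vectors_sum: "z \<in> unit_vectors n m \<Longrightarrow> (\<Sum>J\<in>words n m. z J * cnj (z J)) = 1"
proof -
  assume z: "z \<in> unit_vectors n m"
  have "(\<Sum>J\<in>words n m. z J * cnj (z J)) = of_real (\<Sum>J\<in>words n m. (cmod (z J))\<^sup>2)"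
    by (simp add: complex_norm_square del: of_real_power)
  moreover have "(\<Sum>J\<in>words n m. (cmod (z J))\<^sup>2) = 1" using z by (simp add: unit_vectors_def)
  ultimately show ?thesis by (simp only: of_real_1)
qed

text \<open>The sum is the inner product of the cyclic vector with its image under s(z). Both have
  norm 1, so the value 1 means that s(z) fixes the cyclic vector, and \<open>gens_value\<close>
  yields all the values.\<close>

lemma is_sub_cuntz_state_iff:
  assumes z: "z \<in> unit_vectors n m" and s: "state (cuntz n) \<omega>"
  shows "is_sub_cuntz_state n m z \<omega> \<longleftrightarrow> (\<Sum>J\<in>words n m. z J * \<omega> (cgen n (gens J))) = 1"
proof -
  interpret cuntz_kernel n "\<lambda>w. \<omega> (cgen n w)" by (rule cuntz_kernel_of_state[OF s])
  show ?thesis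
    using gens_value[OF z] unit_vectors_sum[OF z] s
    by (auto simp: is_sub_cuntz_state_def cuntz_word_eq)
qed

lemma sub_cuntz_state_unique:
  assumes m: "m \<ge> 1" and z: "z \<in> unit_vectors n m" and np: "nonperiodic n m z"
    and s: "is_sub_cuntz_state n m z \<omega>" "is_sub_cuntz_state n m z \<omega>'"
  shows "\<omega> = \<omega>'"
proof -
  have st: "state (cuntz n) \<omega>" "state (cuntz n) \<omega>'" using s by (auto simp: is_sub_cuntz_state_def)
  show ?thesis
    by (rule cuntz_state_eqI[OF st])
      (rule cuntz_kernel_unique[OF cuntz_kernel_of_state[OF st(1)] cuntz_kernel_of_state[OF st(2)] m z np];
        use s st z is_sub_cuntz_state_iff in blast)
qed

lemma sub_cuntz_state_exists:
  assumes m: "m \<ge> 1" and z: "z \<in> unit_vectors n m" obtains \<omega> where "is_sub_cuntz_state n m z \<omega>"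
proof -
  obtain \<phi> where \<phi>: "cuntz_kernel n \<phi>" "\<And>J. J \<in> words n m \<Longrightarrow> \<phi> (gens J) = cnj (z J)"
    using sub_cuntz_kernel_exists[OF m z] by blast
  obtain \<omega> where "state (cuntz n) \<omega>" "\<And>w. w \<in> lists (letters n) \<Longrightarrow> \<omega> (cgen n w) = \<phi> w"
    using cuntz_kernel.state_exists[OF \<phi>(1)] by blast
  then have "is_sub_cuntz_state n m z \<omega>"
    using \<phi>(2) words_lists(1) by (simp add: is_sub_cuntz_state_def cuntz_word_eq)
  then show thesis using that by blast
qed

lemma sub_cuntz_state_eqI:
  assumes "m \<ge> 1" "z \<in> unit_vectors n m" "nonperiodic n m z" "is_sub_cuntz_state n m z \<omega>"
  shows "sub_cuntz_state n (m, z) = \<omega>"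
  unfolding sub_cuntz_state_def split_conv using assms sub_cuntz_state_unique by (intro the_equality) blast+

lemma sub_cuntz_state_is:
  assumes "m \<ge> 1" "z \<in> unit_vectors n m" "nonperiodic n m z"
  shows "is_sub_cuntz_state n m z (sub_cuntz_state n (m, z))"
proof -
  obtain \<omega> where "is_sub_cuntz_state n m z \<omega>" by (rule sub_cuntz_state_exists[OF assms(1,2)])
  then show ?thesis using sub_cuntz_state_eqI[OF assms] by simp
qed

text \<open>The coordinates of degree \<open>m\<close> are those of \<open>z\<close> and hence not
  all zero; by \<open>coeffs_nonperiodic\<close> for \<open>y\<close>, the degree \<open>l\<close>
  divides \<open>m\<close>. By symmetry the degrees agree, and so do the coordinates.\<close>

lemma sub_cuntz_state_inj:
  assumes m: "m \<ge> 1" and z: "z \<in> unit_vectors n m" and npz: "nonperiodic n m z"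
    and l: "l \<ge> 1" and y: "y \<in> unit_vectors n l" and npy: "nonperiodic n l y"
    and s: "is_sub_cuntz_state n m z \<omega>" "is_sub_cuntz_state n l y \<omega>"
  shows "m = l \<and> z = y"
proof -
  have st: "state (cuntz n) \<omega>" using s by (simp add: is_sub_cuntz_state_def)
  interpret cuntz_kernel n "\<lambda>w. \<omega> (cgen n w)" by (rule cuntz_kernel_of_state[OF st])
  note one = s[unfolded is_sub_cuntz_state_iff[OF z st] is_sub_cuntz_state_iff[OF y st]]
  have cz: "coeffs m = z" "coeffs l = y" using coeffs_eq z y one by auto
  have dv: "a dvd b" if a: "a \<ge> 1" "x \<in> unit_vectors n a" "nonperiodic n a x" "(\<Sum>J\<in>words n a. x J * \<omega> (cgen n (gens J))) = 1"
    and b: "coeffs b \<in> unit_vectors n b" for a b x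
  proof (rule ccontr)
    assume nd: "\<not> a dvd b"
    obtain K where K: "coeffs b K \<noteq> 0" using unit_vectors_nonzero[OF b] by blast
    then have "K \<in> words n b" by (auto simp: coeffs_def split: if_splits)
    then show False using coeffs_nonperiodic[OF a, of K b] K nd by (simp add: coeffs_def)
  qed
  have "m dvd l" "l dvd m" using dv[OF m z npz one(1), of l] dv[OF l y npy one(2), of m] z y cz by auto
  then have "m = l" by (rule dvd_antisym)
  then show ?thesis using cz by simp
qed

lemma state_convex:
  assumes "star_alg A" "state A \<omega>1" "state A \<omega>2" and t: "0 \<le> t" "t \<le> 1"
  shows "state A (restrict (\<lambda>x. of_real t * \<omega>1 x + of_real (1 - t) * \<omega>2 x) (carrier A))"
proof -
  interpret star_alg A by fact
  have n: "cmod (of_real t * \<omega>1 x + of_real (1 - t) * \<omega>2 x) \<le> nrm A x" if x: "x \<in> carrier A" for x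
  proof -
    have b: "cmod (\<omega>1 x) \<le> nrm A x" "cmod (\<omega>2 x) \<le> nrm A x" using assms(2,3) x by (auto simp: state_def)
    have "cmod (of_real t * \<omega>1 x + of_real (1 - t) * \<omega>2 x) \<le> t * cmod (\<omega>1 x) + (1 - t) * cmod (\<omega>2 x)"
      using norm_triangle_ineq[of "of_real t * \<omega>1 x" "of_real (1 - t) * \<omega>2 x"] t by (simp add: norm_mult del: of_real_diff)
    also have "\<dots> \<le> t * nrm A x + (1 - t) * nrm A x" using t b by (intro add_mono mult_left_mono) auto
    finally show ?thesis by (simp add: algebra_simps)
  qed
  have p: "of_real t * a + of_real (1 - t) * b \<in> \<real>\<^sub>\<ge>\<^sub>0" if "a \<in> \<real>\<^sub>\<ge>\<^sub>0" "b \<in> \<real>\<^sub>\<ge>\<^sub>0" for a b :: complex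
    using that t by (intro nonneg_Reals_add_I nonneg_Reals_mult_I) (simp_all del: of_real_diff)
  note s1 = assms(2)[unfolded state_def] and s2 = assms(3)[unfolded state_def]
  show ?thesis
    unfolding state_def
  proof (intro conjI ballI allI)
    fix x y c assume x: "x \<in> carrier A" and y: "y \<in> carrier A"
    let ?\<omega> = "restrict (\<lambda>x. of_real t * \<omega>1 x + of_real (1 - t) * \<omega>2 x) (carrier A)"
    show "?\<omega> (x \<oplus>\<^bsub>A\<^esub> y) = ?\<omega> x + ?\<omega> y" "?\<omega> (c \<odot>\<^bsub>A\<^esub> x) = c * ?\<omega> x"
      using s1 s2 x y by (simp_all add: algebra_simps)
    show "?\<omega> (adj A x \<otimes>\<^bsub>A\<^esub> x) \<in> \<real>\<^sub>\<ge>\<^sub>0" using p s1 s2 x by (simp del: of_real_diff)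
    show "cmod (?\<omega> x) \<le> nrm A x" using n[OF x] x by simp
  qed (use s1 s2 in \<open>auto simp: algebra_simps\<close>)
qed

lemma star_alg_cuntz: "star_alg (cuntz n)"
  using CU.UC.star_alg_axioms[of n] by (simp add: cuntz_universal)

text \<open>The convex combination is itself a state, and states are determined by their values on
  words.\<close>

lemma cuntz_state_convex_eqI:
  assumes s: "state (cuntz n) \<omega>" "state (cuntz n) \<omega>1" "state (cuntz n) \<omega>2" and t: "0 \<le> t" "t \<le> 1"
    and eq: "\<And>w. w \<in> lists (letters n) \<Longrightarrow> \<omega> (cgen n w) = of_real t * \<omega>1 (cgen n w) + of_real (1 - t) * \<omega>2 (cgen n w)"
    and x: "x \<in> carrier (cuntz n)"
  shows "\<omega> x = of_real t * \<omega>1 x + of_real (1 - t) * \<omega>2 x"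
proof -
  let ?\<omega> = "restrict (\<lambda>x. of_real t * \<omega>1 x + of_real (1 - t) * \<omega>2 x) (carrier (cuntz n))"
  have g: "cgen n w \<in> carrier (cuntz n)" if "w \<in> lists (letters n)" for w
    using CU.gen_closed[of w n] that by (simp add: cuntz_universal)
  have "\<omega> = ?\<omega>"
    by (rule cuntz_state_eqI[OF s(1) state_convex[OF star_alg_cuntz s(2,3) t]]) (simp add: eq g)
  then have "\<omega> x = ?\<omega> x" by (rule fun_cong)
  then show ?thesis using x by (simp del: of_real_diff)
qed

text \<open>The number 1 is an extreme point of the closed unit disc, which contains the expectation
  of s(z) in every state. Both components of a convex decomposition are therefore sub-Cuntz by
  \<open>z\<close>, and uniqueness applies.\<close>

lemma sub_cuntz_pure:
  assumes m: "m \<ge> 1" and z: "z \<in> unit_vectors n m" and np: "nonperiodic n m z" and s: "is_sub_cuntz_state n m z \<omega>"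
  shows "pure_state (cuntz n) \<omega>"
  unfolding pure_state_def
proof (intro conjI[of "state (cuntz n) \<omega>"] allI impI)
  show st: "state (cuntz n) \<omega>" using s by (simp add: is_sub_cuntz_state_def)
  fix \<omega>1 \<omega>2 and t :: real
  assume a: "state (cuntz n) \<omega>1 \<and> state (cuntz n) \<omega>2 \<and> 0 < t \<and> t < 1 \<and>
    (\<forall>x\<in>carrier (cuntz n). \<omega> x = of_real t * \<omega>1 x + of_real (1 - t) * \<omega>2 x)"
  then have s1: "state (cuntz n) \<omega>1" and s2: "state (cuntz n) \<omega>2" and t: "0 < t" "t < 1"
    and c: "\<forall>x\<in>carrier (cuntz n). \<omega> x = of_real t * \<omega>1 x + of_real (1 - t) * \<omega>2 x" by blast+
  define v where "v \<omega>' = (\<Sum>J\<in>words n m. z J * \<omega>' (cgen n (gens J)))" for \<omega>'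
  have g: "cgen n w \<in> carrier (cuntz n)" if "w \<in> lists (letters n)" for w
    using CU.gen_closed[of w n] that by (simp add: cuntz_universal)
  have "v \<omega> = (\<Sum>J\<in>words n m. of_real t * (z J * \<omega>1 (cgen n (gens J))) + of_real (1 - t) * (z J * \<omega>2 (cgen n (gens J))))"
    unfolding v_def
  proof (intro sum.cong refl)
    fix J assume "J \<in> words n m"
    then have "\<omega> (cgen n (gens J)) = of_real t * \<omega>1 (cgen n (gens J)) + of_real (1 - t) * \<omega>2 (cgen n (gens J))"
      using c g words_lists(1) by blast
    then show "z J * \<omega> (cgen n (gens J)) =
      of_real t * (z J * \<omega>1 (cgen n (gens J))) + of_real (1 - t) * (z J * \<omega>2 (cgen n (gens J)))"
      by (simp only: distrib_left mult.left_commute)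
  qed
  also have "\<dots> = of_real t * v \<omega>1 + of_real (1 - t) * v \<omega>2"
    by (simp only: v_def sum.distrib sum_distrib_left)
  finally have "of_real t * v \<omega>1 + of_real (1 - t) * v \<omega>2 = 1"
    using s is_sub_cuntz_state_iff[OF z st] by (simp add: v_def)
  then have "Re (of_real t * v \<omega>1 + of_real (1 - t) * v \<omega>2) = 1" by simp
  then have re: "t * Re (v \<omega>1) + (1 - t) * Re (v \<omega>2) = 1" by (simp del: of_real_diff)
  have b: "cmod (v \<omega>1) \<le> 1" "cmod (v \<omega>2) \<le> 1"
    unfolding v_def using cuntz_kernel.cmod_svec_le[OF cuntz_kernel_of_state[OF s1] z]
      cuntz_kernel.cmod_svec_le[OF cuntz_kernel_of_state[OF s2] z] by auto
  have r: "Re (v \<omega>1) \<le> 1" "Re (v \<omega>2) \<le> 1" using b complex_Re_le_cmod order_trans by blast+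
  have "Re (v \<omega>1) = 1"
  proof (rule ccontr)
    assume "Re (v \<omega>1) \<noteq> 1"
    then have "t * Re (v \<omega>1) < t * 1" using r t by (intro mult_strict_left_mono) auto
    moreover have "(1 - t) * Re (v \<omega>2) \<le> (1 - t) * 1" using r t by (intro mult_left_mono) auto
    ultimately show False using re by simp
  qed
  moreover from this have "(1 - t) * (Re (v \<omega>2) - 1) = 0" using re by (simp add: algebra_simps)
  then have "Re (v \<omega>2) = 1" using t by simp
  moreover have "w = 1" if "cmod w \<le> 1" "Re w = 1" for w
  proof -
    have "(Re w)\<^sup>2 + (Im w)\<^sup>2 \<le> 1" using that(1) power_mono[OF that(1), of 2] by (simp add: cmod_power2)
    then show ?thesis using that(2) by (simp add: complex_eq_iff)
  qed
  ultimately have "v \<omega>1 = 1" "v \<omega>2 = 1" using b by auto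
  then have "is_sub_cuntz_state n m z \<omega>1" "is_sub_cuntz_state n m z \<omega>2"
    using is_sub_cuntz_state_iff[OF z s1] is_sub_cuntz_state_iff[OF z s2] by (auto simp: v_def)
  then show "\<omega>1 = \<omega> \<and> \<omega>2 = \<omega>" using sub_cuntz_state_unique[OF m z np _ s] by auto
qed

section \<open>Pure sub-Cuntz states come from nonperiodic vectors\<close>

text \<open>Descent on the degree. A p-th root of a unit vector is again a unit vector, since the
  p-th power of its squared norm is 1.\<close>

lemma nonperiodic_root:
  assumes "m \<ge> 1" "z \<in> unit_vectors n m"
  obtains k p x where "k \<ge> 1" "p \<ge> 1" "m = p * k" "x \<in> unit_vectors n k" "nonperiodic n k x" "z = tensor_power k x p"
proof -
  have "\<exists>k p x. k \<ge> 1 \<and> p \<ge> 1 \<and> m = p * k \<and> x \<in> unit_vectors n k \<and> nonperiodic n k x \<and> z = tensor_power k x p"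
    using assms
  proof (induction m arbitrary: z rule: less_induct)
    case (less m)
    show ?case
    proof (cases "nonperiodic n m z")
      case True
      have "z = tensor_power m z 1" using tensor_power_1[OF unit_vectors_vectors[OF less.prems(2)]] by (simp del: tensor_power.simps)
      then show ?thesis using True less.prems by (intro exI[of _ m] exI[of _ 1] exI[of _ z]) auto
    next
      case False
      then obtain p k y where p: "p \<ge> 1" "p \<noteq> 1" and k: "k \<ge> 1" and y: "y \<in> vectors n k" and mk: "m = p * k" and zy: "z = tensor_power k y p"
        unfolding nonperiodic_def by blast
      let ?s = "\<Sum>J\<in>words n k. (cmod (y J))\<^sup>2"
      have "?s ^ p = 1" using less.prems(2) norm_tensor_power[where n = n and p = p and k = k and x = y] by (simp add: unit_vectors_def mk zy)
      then have "?s = 1" using p by (intro power_eq_imp_eq_base[of ?s p 1]) (auto simp: sum_nonneg)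
      then have y1: "y \<in> unit_vectors n k" using y by (simp add: unit_vectors_def)
      have "k < m" using p k mk by (cases p) auto
      from less.IH[OF this k y1] obtain k' q x where x: "k' \<ge> 1" "q \<ge> 1" "k = q * k'" "x \<in> unit_vectors n k'" "nonperiodic n k' x" "y = tensor_power k' x q"
        by blast
      have "z = tensor_power k' x (p * q)" unfolding zy x(6) x(3) by (rule tensor_power_power)
      moreover have "p * q \<ge> 1" "m = p * q * k'" using p x mk by auto
      ultimately show ?thesis using x by blast
    qed
  qed
  then show thesis using that by blast
qed

section \<open>Conjugation of a state by an element of the word algebra\<close>

context cuntz_kernel begin

text \<open>The unnormalised vector functional of \<open>e\<close> applied to the cyclic vector, w
  \<mapsto> <e Omega, w e Omega>.\<close>

definition sandwich :: "(letter list \<Rightarrow> complex) \<Rightarrow> letter list \<Rightarrow> complex" where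
  "sandwich e w = lin (\<lambda>a. lin (\<lambda>b. \<phi> (a @ w @ b)) e) (adj (WA n) e)"

text \<open>The relations hold between any two words, so they survive conjugation. Positivity at
  \<open>x\<close> is that of \<open>\<phi>\<close> at the product of \<open>x\<close> and
  \<open>e\<close>.\<close>

lemma sandwich_kernel:
  assumes e: "e \<in> carrier (WA n)" and nz: "sandwich e [] \<noteq> 0"
  shows "cuntz_kernel n (\<lambda>w. sandwich e w / sandwich e [])"
proof -
  let ?N = "sandwich e []"
  have ae: "adj (WA n) e \<in> carrier (WA n)" using WM.MA_closed(4)[OF e e] .
  have N: "?N = lin \<phi> (adj (WA n) e \<otimes>\<^bsub>WA n\<^esub> e)"
    using e ae by (simp add: sandwich_def WM.MA_lin_mult del: monoid_algebra_simps)
  show ?thesis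
  proof
    show "sandwich e [] / ?N = 1" using nz by simp
    fix u v i j assume uv: "u \<in> lists (letters n)" "v \<in> lists (letters n)" and ij: "i \<in> {1..n}" "j \<in> {1..n}"
    have "sandwich e (u @ Gen_adj i # Gen j # v) = lin (\<lambda>a. lin (\<lambda>b. if i = j then \<phi> (a @ (u @ v) @ b) else 0) e) (adj (WA n) e)"
      unfolding sandwich_def
      by (intro WM.MA_lin_cong[OF ae] WM.MA_lin_cong[OF e]) (use uv ij orth[of "_ @ u" "v @ _" i j] in auto)
    then have "sandwich e (u @ Gen_adj i # Gen j # v) = (if i = j then sandwich e (u @ v) else 0)"
      by (simp add: sandwich_def) (simp add: lin_def)
    then show "sandwich e (u @ Gen_adj i # Gen j # v) / ?N = (if i = j then sandwich e (u @ v) / ?N else 0)" by simp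
  next
    fix u v assume uv: "u \<in> lists (letters n)" "v \<in> lists (letters n)"
    have "(\<Sum>i=1..n. sandwich e (u @ Gen i # Gen_adj i # v)) =
      lin (\<lambda>a. lin (\<lambda>b. \<Sum>i=1..n. \<phi> (a @ (u @ Gen i # Gen_adj i # v) @ b)) e) (adj (WA n) e)"
      by (simp only: sandwich_def lin_fun_sum)
    also have "\<dots> = sandwich e (u @ v)"
      unfolding sandwich_def
    proof (intro WM.MA_lin_cong[OF ae] WM.MA_lin_cong[OF e])
      fix a b assume "a \<in> carrier (word_monoid n)" "b \<in> carrier (word_monoid n)"
      then show "(\<Sum>i=1..n. \<phi> (a @ (u @ Gen i # Gen_adj i # v) @ b)) = \<phi> (a @ (u @ v) @ b)"
        using unit[of "a @ u" "v @ b"] uv by simp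
    qed
    finally show "(\<Sum>i=1..n. sandwich e (u @ Gen i # Gen_adj i # v) / ?N) = sandwich e (u @ v) / ?N"
      by (simp only: sum_divide_distrib[symmetric])
  next
    fix x assume x: "x \<in> carrier (WA n)"
    let ?y = "adj (WA n) x \<otimes>\<^bsub>WA n\<^esub> x"
    have ax: "adj (WA n) x \<in> carrier (WA n)" using WM.MA_closed(4)[OF x x] .
    have y: "?y \<in> carrier (WA n)" by (rule WM.MA_closed(1)[OF ax x])
    have xe: "x \<otimes>\<^bsub>WA n\<^esub> e \<in> carrier (WA n)" by (rule WM.MA_closed(1)[OF x e])
    have "lin (\<lambda>w. sandwich e w) ?y = lin (\<lambda>a. lin (\<lambda>w. lin (\<lambda>b. \<phi> (a @ w @ b)) e) ?y) (adj (WA n) e)"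
      unfolding sandwich_def by (rule lin_swap)
    also have "\<dots> = lin \<phi> (adj (WA n) e \<otimes>\<^bsub>WA n\<^esub> (?y \<otimes>\<^bsub>WA n\<^esub> e))"
      using ae y e by (subst WM.MA_lin_mult) (simp_all add: WM.MA_lin_mult WM.MA_closed del: monoid_algebra_simps)
    also have "adj (WA n) e \<otimes>\<^bsub>WA n\<^esub> (?y \<otimes>\<^bsub>WA n\<^esub> e) = adj (WA n) (x \<otimes>\<^bsub>WA n\<^esub> e) \<otimes>\<^bsub>WA n\<^esub> (x \<otimes>\<^bsub>WA n\<^esub> e)"
      using ae ax x e by (simp add: WA.adj_mult WA.m_assoc del: monoid_algebra_simps)
    finally have "lin (\<lambda>w. sandwich e w) ?y \<in> \<real>\<^sub>\<ge>\<^sub>0" using psd[OF xe] by simp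
    moreover have "?N \<in> \<real>\<^sub>\<ge>\<^sub>0" using psd[OF e] N by simp
    ultimately have "inverse ?N * lin (\<lambda>w. sandwich e w) ?y \<in> \<real>\<^sub>\<ge>\<^sub>0" by simp
    then show "lin (\<lambda>w. sandwich e w / ?N) ?y \<in> \<real>\<^sub>\<ge>\<^sub>0"
      using lin_fun_smult[of "inverse ?N" "sandwich e" ?y] by (simp add: divide_inverse mult.commute)
  qed
qed

lemma sandwich_svec:
  "sandwich (svec n k x) w = (\<Sum>J\<in>words n k. \<Sum>K\<in>words n k. cnj (x J) * x K * \<phi> (adjs J @ w @ gens K))"
  unfolding sandwich_def WM.MA_lin_adj[OF svec_closed] lin_svec
  by (simp add: sum_distrib_left mult.assoc)

text \<open>The coordinates of degree \<open>r\<close> commute with a power of \<open>x\<close>, so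
  they are a multiple of \<open>tensor_power k x (r div k)\<close>, if not zero. Pairing with this
  unit vector recovers the factor from a moment of s(x).\<close>

lemma coeffs_root:
  assumes k: "k \<ge> 1" and p: "p \<ge> 1" and x: "x \<in> unit_vectors n k" and np: "nonperiodic n k x"
    and one: "(\<Sum>J\<in>words n (p * k). tensor_power k x p J * \<phi> (gens J)) = 1" and r: "r \<ge> 1"
  shows "coeffs r K = (if k dvd r then cnj (\<Sum>L\<in>words n r. tensor_power k x (r div k) L * \<phi> (gens L)) * tensor_power k x (r div k) K else 0)"
proof (cases "\<exists>K. coeffs r K \<noteq> 0")
  case False
  then have "\<phi> (gens L) = 0" if "L \<in> words n r" for L using gens_coeffs[OF that] by simp
  then show ?thesis using False by simp
next
  case True
  then obtain K0 where w0: "coeffs r K0 \<noteq> 0" by blast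
  note z = tensor_power_unit[OF x, of p]
  obtain J0 where x0: "x J0 \<noteq> 0" using unit_vectors_nonzero[OF x] by blast
  have comm: "tens r (coeffs r) (tensor_power k x p) J = 1 * tens (p * k) (tensor_power k x p) (coeffs r) J" for J
    using coeffs_commute[OF z one, of r] by simp
  obtain b where dv: "k dvd r" and b: "coeffs r = (\<lambda>J. b * tensor_power k x (r div k) J)"
    by (rule nonperiodic_commuting_power[OF k r p unit_vectors_vectors[OF x] np coeffs_vectors x0 w0 comm])
  have rk: "r div k * k = r" using dv by simp
  have "(\<Sum>L\<in>words n r. tensor_power k x (r div k) L * \<phi> (gens L)) =
    (\<Sum>L\<in>words n r. cnj b * (tensor_power k x (r div k) L * cnj (tensor_power k x (r div k) L)))"
    using gens_coeffs by (intro sum.cong refl) (simp add: b mult.left_commute)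
  also have "\<dots> = cnj b" using unit_vectors_sum[OF tensor_power_unit[OF x, of "r div k"]] rk
    by (simp add: sum_distrib_left[symmetric])
  finally show ?thesis using dv b by simp
qed

text \<open>As s(x) is an isometry, conjugation by it preserves the moments <Omega, s(x)^b Omega>.
  By \<open>coeffs_root\<close> the moments determine the coordinates of the cyclic vector, hence
  the state.\<close>

lemma svec_conjugation:
  assumes k: "k \<ge> 1" and p: "p \<ge> 1" and x: "x \<in> unit_vectors n k" and np: "nonperiodic n k x"
    and one: "(\<Sum>J\<in>words n (p * k). tensor_power k x p J * \<phi> (gens J)) = 1" and w: "w \<in> lists (letters n)"
  shows "sandwich (svec n k x) w = \<phi> w"
proof -
  let ?\<psi> = "sandwich (svec n k x)"
  \<comment> \<open>The adjoint of s(x) absorbs the first \<open>k\<close> letters \<open>A\<close>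
    and leaves the scalar \<open>cnj (x A)\<close>.\<close>
  have psi_gens: "?\<psi> (gens (A @ B)) = cnj (x A) * (\<Sum>K\<in>words n k. x K * \<phi> (gens (B @ K)))"
    if A: "A \<in> words n k" and B: "B \<in> words n r" for A B r
  proof -
    have "?\<psi> (gens (A @ B)) = (\<Sum>J\<in>words n k. if J = A then cnj (x A) * (\<Sum>K\<in>words n k. x K * \<phi> (gens (B @ K))) else 0)"
      unfolding sandwich_svec
    proof (intro sum.cong refl)
      fix J assume J: "J \<in> words n k"
      have "\<phi> (adjs J @ gens (A @ B) @ gens K) = (if J = A then \<phi> (gens (B @ K)) else 0)" if K: "K \<in> words n k" for K
        using word_orth[OF _ _ J A, of "[]" "gens (B @ K)"] words_lists(1)[OF B] words_lists(1)[OF K] by simp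
      then show "(\<Sum>K\<in>words n k. cnj (x J) * x K * \<phi> (adjs J @ gens (A @ B) @ gens K)) =
        (if J = A then cnj (x A) * (\<Sum>K\<in>words n k. x K * \<phi> (gens (B @ K))) else 0)"
        by (simp add: sum_distrib_left mult.assoc)
    qed
    also have "\<dots> = cnj (x A) * (\<Sum>K\<in>words n k. x K * \<phi> (gens (B @ K)))" using A by simp
    finally show ?thesis .
  qed
  have e1: "?\<psi> [] = 1"
  proof -
    have "?\<psi> [] = (\<Sum>J\<in>words n k. \<Sum>K\<in>words n k. cnj (x J) * x K * (if J = K then 1 else 0))"
      unfolding sandwich_svec using word_orth[of "[]" "[]"]
      by (intro sum.cong refl arg_cong2[where f = "(*)"]) (auto simp: empty)
    also have "\<dots> = (\<Sum>J\<in>words n k. x J * cnj (x J))"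
      by (intro sum.cong refl) (simp add: if_distrib[of "\<lambda>y. _ * y"] mult.commute cong: if_cong)
    finally show ?thesis using unit_vectors_sum[OF x] by simp
  qed
  have ker: "cuntz_kernel n ?\<psi>" using sandwich_kernel[OF svec_closed, of k x] e1 by simp
  \<comment> \<open>One factor \<open>x\<close> is split off at the left, where it contributes its
    norm 1, and one is appended at the right; powers of \<open>x\<close> commute with
    \<open>x\<close>.\<close>
  have power_eq: "(\<Sum>L\<in>words n (b * k). tensor_power k x b L * ?\<psi> (gens L)) = (\<Sum>L\<in>words n (b * k). tensor_power k x b L * \<phi> (gens L))"
    if b: "b \<ge> 1" for b
  proof -
    obtain c where c: "b = Suc c" using b by (cases b) auto
    let ?X = "tensor_power k x c"
    have "(\<Sum>L\<in>words n (k + c * k). tens k x ?X L * ?\<psi> (gens L)) =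
      (\<Sum>A\<in>words n k. \<Sum>B\<in>words n (c * k). x A * ?X B * (cnj (x A) * (\<Sum>K\<in>words n k. x K * \<phi> (gens (B @ K)))))"
      unfolding sum_words_add by (intro sum.cong refl) (simp add: tens_append words_length psi_gens del: map_append)
    also have "\<dots> = (\<Sum>A\<in>words n k. x A * cnj (x A)) * (\<Sum>B\<in>words n (c * k). ?X B * (\<Sum>K\<in>words n k. x K * \<phi> (gens (B @ K))))"
      unfolding sum_product by (intro sum.cong refl) (simp add: mult_ac)
    also have "\<dots> = (\<Sum>L\<in>words n (c * k + k). tens (c * k) ?X x L * \<phi> (gens L))"
      unfolding unit_vectors_sum[OF x] sum_words_add
      by (simp add: sum_distrib_left mult.assoc tens_append words_length del: map_append)
    finally show ?thesis
      unfolding c using tensor_power_comm[OF unit_vectors_vectors[OF x], of c] tensor_power_Suc[of k x c]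
      by (simp add: add.commute del: tensor_power.simps)
  qed
  have one': "(\<Sum>J\<in>words n (p * k). tensor_power k x p J * ?\<psi> (gens J)) = 1" using power_eq[OF p] one by simp
  have pk: "p * k \<ge> 1" using p k by simp
  show ?thesis
  proof (rule cuntz_kernel_eqI[OF ker cuntz_kernel_axioms pk tensor_power_unit[OF x] one' one _ w])
    fix r K assume K: "K \<in> words n r"
    show "?\<psi> (gens K) = \<phi> (gens K)"
    proof (cases "r = 0")
      case True then show ?thesis using K e1 empty by simp
    next
      case False
      then have r: "r \<ge> 1" by simp
      have "cuntz_kernel.coeffs n ?\<psi> r K = coeffs r K"
        unfolding coeffs_root[OF k p x np one r] cuntz_kernel.coeffs_root[OF ker k p x np one' r]
      proof (cases "k dvd r")
        case True
        then have "r div k \<ge> 1" "r div k * k = r" using r k by (auto simp: Suc_le_eq div_greater_zero_iff dvd_imp_le)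
        then show "(if k dvd r then cnj (\<Sum>L\<in>words n r. tensor_power k x (r div k) L * ?\<psi> (gens L)) * tensor_power k x (r div k) K else 0) =
          (if k dvd r then cnj (\<Sum>L\<in>words n r. tensor_power k x (r div k) L * \<phi> (gens L)) * tensor_power k x (r div k) K else 0)"
          using power_eq[of "r div k"] by simp
      qed simp
      then show ?thesis using gens_coeffs[OF K] cuntz_kernel.gens_coeffs[OF ker K] by simp
    qed
  qed
qed

end

text \<open>
  For \<open>V = s(x)\<close> and \<open>|c| = 1\<close>, the state is a convex combination of its conjugates by \<open>2 + cV\<close> and
  \<open>2 - cV\<close>. Purity makes it equal to both, and comparing \<open>c = 1\<close> with \<open>c = \<i>\<close> shows that the cyclic
  vector is an eigenvector of \<open>V\<close>.
\<close>

lemma pure_sub_cuntz_eigenvalue: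
  assumes pure: "pure_state (cuntz n) \<omega>" and k: "k \<ge> 1" and p: "p \<ge> 1" and x: "x \<in> unit_vectors n k" and np: "nonperiodic n k x"
    and sub: "is_sub_cuntz_state n (p * k) (tensor_power k x p) \<omega>"
  shows "cmod (\<Sum>J\<in>words n k. x J * \<omega> (cgen n (gens J))) = 1"
proof -
  have st: "state (cuntz n) \<omega>" using pure by (simp add: pure_state_def)
  define \<phi> where "\<phi> w = \<omega> (cgen n w)" for w
  interpret cuntz_kernel n \<phi> unfolding \<phi>_def by (rule cuntz_kernel_of_state[OF st])
  have one: "(\<Sum>J\<in>words n (p * k). tensor_power k x p J * \<phi> (gens J)) = 1"
    using sub is_sub_cuntz_state_iff[OF tensor_power_unit[OF x] st] by (simp add: \<phi>_def)
  \<comment> \<open>With V = s(x), \<open>P w\<close> is <Omega, w V Omega> and \<open>Q w\<close>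
    is <V Omega, w Omega>.\<close>
  define P Q where "P w = (\<Sum>K\<in>words n k. x K * \<phi> (w @ gens K))"
    and "Q w = (\<Sum>J\<in>words n k. cnj (x J) * \<phi> (adjs J @ w))" for w
  define v where "v = P []"
  have v1: "cmod v \<le> 1" using cmod_svec_le[OF x] by (simp add: v_def P_def)
  have Qv: "Q [] = cnj v"
    using gens_coeffs by (simp add: Q_def v_def P_def) (intro sum.cong refl, simp add: coeffs_def)
  \<comment> \<open>The element 2 + cV.\<close>
  define e where "e c w = 2 * delta [] w + c * svec n k x w" for c w
  have d: "delta [] \<in> carrier (WA n)" by (intro WM.delta_closed) simp
  have sv: "svec n k x \<in> carrier (WA n)" by (rule svec_closed)
  have ec: "e c \<in> carrier (WA n)" for c
    using WM.MA_closed(2)[OF WM.MA_closed(3)[OF d d, of 2] WM.MA_closed(3)[OF sv sv, of c]]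
    by (simp add: e_def[abs_def] del: monoid_algebra_simps(1))
  have fin: "finite {w. 2 * delta [] w \<noteq> (0::complex)}" "finite {w. c * svec n k x w \<noteq> 0}" for c
    using fin_delta svec_closed[of n k x] by (auto intro: finite_subset[rotated])
  have le: "lin \<psi> (e c) = 2 * \<psi> [] + c * (\<Sum>K\<in>words n k. x K * \<psi> (gens K))" for \<psi> c
    unfolding e_def[abs_def] using lin_add[OF fin] by (simp add: lin_smult lin_svec)
  \<comment> \<open>The coefficient 5 is 4 + 1: the product of the two scalars 2, and 1 from
    conjugation by V, which reproduces \<open>\<phi>\<close>.\<close>
  have se: "sandwich (e c) w = 5 * \<phi> w + 2 * c * P w + 2 * cnj c * Q w"
    if c: "c * cnj c = 1" and w: "w \<in> lists (letters n)" for c w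
  proof -
    have "sandwich (e c) w = 2 * (2 * \<phi> w + c * P w) +
      cnj c * (\<Sum>J\<in>words n k. cnj (x J) * (2 * \<phi> (adjs J @ w) + c * (\<Sum>K\<in>words n k. x K * \<phi> (adjs J @ w @ gens K))))"
      unfolding sandwich_def WM.MA_lin_adj[OF ec] le by (simp add: P_def)
    also have "(\<Sum>J\<in>words n k. cnj (x J) * (2 * \<phi> (adjs J @ w) + c * (\<Sum>K\<in>words n k. x K * \<phi> (adjs J @ w @ gens K)))) =
      2 * Q w + c * sandwich (svec n k x) w"
      unfolding sandwich_svec Q_def
      by (simp add: distrib_left sum.distrib sum_distrib_left mult_ac)
    also have "sandwich (svec n k x) w = \<phi> w" by (rule svec_conjugation[OF k p x np one w])
    finally show ?thesis using c by (simp add: algebra_simps)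
  qed
  have key: "c * P w + cnj c * Q w = (c * v + cnj c * cnj v) * \<phi> w"
    if c: "c * cnj c = 1" and w: "w \<in> lists (letters n)" for c w
  proof -
    have cm: "(-c) * cnj (-c) = 1" using c by simp
    \<comment> \<open>The squared norm of (2 + cV) Omega. It is at least 1, since |c| = 1 and |v|
      \<le> 1.\<close>
    define N where "N c = 5 + 4 * Re (c * v)" for c
    have sN: "sandwich (e c) [] = of_real (N c)" if "c * cnj c = 1" for c
    proof -
      have "c * v + cnj c * cnj v = of_real (2 * Re (c * v))" using complex_add_cnj[of "c * v"] by simp
      then have "5 + 2 * (c * v + cnj c * cnj v) = of_real (N c)" by (simp add: N_def)
      moreover have "sandwich (e c) [] = 5 + 2 * (c * v + cnj c * cnj v)"
        using se[OF that, of "[]"] by (simp add: empty v_def[symmetric] Qv algebra_simps)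
      ultimately show ?thesis by simp
    qed
    have cn: "cmod c = 1" if "c * cnj c = 1" for c
    proof (rule power2_eq_imp_eq)
      show "(cmod c)\<^sup>2 = 1\<^sup>2" using that complex_norm_square[of c] by (metis of_real_eq_1_iff power_one)
    qed simp_all
    have Npos: "N c > 0" if "c * cnj c = 1" for c
    proof -
      have "\<bar>Re (c * v)\<bar> \<le> cmod c * cmod v" using abs_Re_le_cmod[of "c * v"] by (simp add: norm_mult)
      then have "\<bar>Re (c * v)\<bar> \<le> 1" using cn[OF that] v1 by simp
      then show ?thesis by (simp add: N_def abs_le_iff)
    qed
    have ex: "\<exists>\<omega>'. state (cuntz n) \<omega>' \<and> (\<forall>w\<in>lists (letters n). \<omega>' (cgen n w) = sandwich (e c) w / of_real (N c))"
      if "c * cnj c = 1" for c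
      using cuntz_kernel.state_exists[OF sandwich_kernel[OF ec, of c]] sN[OF that] Npos[OF that] by (metis less_irrefl of_real_eq_0_iff)
    obtain \<omega>1 where 1: "state (cuntz n) \<omega>1" "\<And>w. w \<in> lists (letters n) \<Longrightarrow> \<omega>1 (cgen n w) = sandwich (e c) w / of_real (N c)"
      using ex[OF c] by blast
    obtain \<omega>2 where 2: "state (cuntz n) \<omega>2" "\<And>w. w \<in> lists (letters n) \<Longrightarrow> \<omega>2 (cgen n w) = sandwich (e (-c)) w / of_real (N (-c))"
      using ex[OF cm] by blast
    \<comment> \<open>The weights are proportional to the squared norms, whose sum is 10 because the
      terms linear in \<open>c\<close> cancel; this also makes the mixed terms in the combination
      cancel.\<close>
    define t where "t = N c / 10"
    have N10: "N c + N (-c) = 10" by (simp add: N_def)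
    have t: "0 < t" "t < 1" using Npos[OF c] Npos[OF cm] N10 by (auto simp: t_def)
    have t': "1 - t = N (-c) / 10" using N10 by (simp add: t_def field_simps)
    have "\<omega> y = of_real t * \<omega>1 y + of_real (1 - t) * \<omega>2 y" if "y \<in> carrier (cuntz n)" for y
    proof (rule cuntz_state_convex_eqI[OF st 1(1) 2(1) _ _ _ that])
      fix w assume w: "w \<in> lists (letters n)"
      have "of_real t * \<omega>1 (cgen n w) = sandwich (e c) w / 10" using Npos[OF c] 1(2)[OF w] by (simp add: t_def)
      moreover have "of_real (1 - t) * \<omega>2 (cgen n w) = sandwich (e (-c)) w / 10"
        unfolding t' using Npos[OF cm] 2(2)[OF w] by simp
      moreover have "sandwich (e c) w / 10 + sandwich (e (-c)) w / 10 = \<phi> w"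
        unfolding se[OF c w] se[OF cm w] by (simp add: field_simps)
      ultimately show "\<omega> (cgen n w) = of_real t * \<omega>1 (cgen n w) + of_real (1 - t) * \<omega>2 (cgen n w)"
        by (simp only: \<phi>_def)
    qed (use t in auto)
    then have "\<omega>1 = \<omega>" using pure 1(1) 2(1) t unfolding pure_state_def by blast
    then have "sandwich (e c) w = of_real (N c) * \<phi> w" using 1(2)[OF w] Npos[OF c] by (simp add: \<phi>_def)
    moreover have "of_real (N c) = 5 + 2 * c * v + 2 * cnj c * cnj v"
      using sN[OF c] se[OF c, of "[]"] by (simp add: empty v_def[symmetric] Qv)
    ultimately have "2 * (c * P w + cnj c * Q w) = 2 * ((c * v + cnj c * cnj v) * \<phi> w)"
      using se[OF c w] by (simp add: algebra_simps)
    then show ?thesis by (simp only: mult_cancel_left) simp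
  qed
  have Pv: "P w = v * \<phi> w" if w: "w \<in> lists (letters n)" for w
  proof -
    have "P w + Q w = (v + cnj v) * \<phi> w" using key[of 1, OF _ w] by simp
    moreover have "\<i> * (P w - Q w) = \<i> * ((v - cnj v) * \<phi> w)" using key[of \<i>, OF _ w] by (simp add: algebra_simps)
    then have "P w - Q w = (v - cnj v) * \<phi> w" by simp
    ultimately have "(P w + Q w) + (P w - Q w) = (v + cnj v) * \<phi> w + (v - cnj v) * \<phi> w" by simp
    then show ?thesis by (simp add: algebra_simps)
  qed
  \<comment> \<open>The squared norm of V Omega is 1; replacing V Omega by v Omega turns it into
    |v|^2.\<close>
  have "1 = sandwich (svec n k x) []" using svec_conjugation[OF k p x np one, of "[]"] by (simp add: empty)
  also have "\<dots> = (\<Sum>J\<in>words n k. cnj (x J) * P (adjs J))"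
    unfolding sandwich_svec P_def by (simp add: sum_distrib_left mult.assoc)
  also have "\<dots> = (\<Sum>J\<in>words n k. v * (cnj (x J) * \<phi> (adjs J @ [])))"
    using Pv words_lists(2) by (intro sum.cong refl) simp
  also have "\<dots> = v * cnj v" unfolding sum_distrib_left[symmetric] Q_def[symmetric] Qv ..
  finally have "(cmod v)\<^sup>2 = 1\<^sup>2" using complex_norm_square[of v] by (metis of_real_eq_1_iff power_one)
  then have "cmod v = 1" by (rule power2_eq_imp_eq) simp_all
  then show ?thesis by (simp add: v_def P_def \<phi>_def)
qed

lemma pure_sub_cuntz_nonperiodic:
  assumes "\<omega> \<in> pure_sub_cuntz_states n"
  obtains m z where "m \<ge> 1" "z \<in> unit_vectors n m" "nonperiodic n m z" "is_sub_cuntz_state n m z \<omega>"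
proof -
  obtain m z where pure: "pure_state (cuntz n) \<omega>" and m: "m \<ge> 1" and z: "z \<in> unit_vectors n m" and s: "is_sub_cuntz_state n m z \<omega>"
    using assms by (auto simp: pure_sub_cuntz_states_def)
  have st: "state (cuntz n) \<omega>" using pure by (simp add: pure_state_def)
  obtain k p x where x: "k \<ge> 1" "p \<ge> 1" "m = p * k" "x \<in> unit_vectors n k" "nonperiodic n k x" "z = tensor_power k x p"
    by (rule nonperiodic_root[OF m z])
  define v where "v = (\<Sum>J\<in>words n k. x J * \<omega> (cgen n (gens J)))"
  have v: "cmod v = 1" unfolding v_def using s x by (intro pure_sub_cuntz_eigenvalue[OF pure x(1,2,4,5)]) simp
  \<comment> \<open>Multiplying \<open>x\<close> by the conjugate of the eigenvalue turns the
    eigenvector of s(x) into a fixed vector of s(y).\<close>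
  define y where "y J = cnj v * x J" for J
  have y: "y \<in> unit_vectors n k"
    using x(4) v vectors_smult[of x n k "cnj v"] by (simp add: unit_vectors_def y_def[abs_def] norm_mult)
  have "nonperiodic n k y" unfolding y_def[abs_def] using v by (intro nonperiodic_smult x(5)) auto
  moreover have "(\<Sum>J\<in>words n k. y J * \<omega> (cgen n (gens J))) = cnj v * v"
    by (simp add: y_def v_def sum_distrib_left mult.assoc)
  then have "(\<Sum>J\<in>words n k. y J * \<omega> (cgen n (gens J))) = 1"
    using complex_norm_square[of v] v by (simp add: mult.commute)
  then have "is_sub_cuntz_state n k y \<omega>" using is_sub_cuntz_state_iff[OF y st] by simp
  ultimately show thesis using that x(1) y by blast
qed

section \<open>Tensor products of Cuntz algebras\<close>

context universal begin

lemma finite_sum_closed: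
  assumes "finite I" "\<And>i. i \<in> I \<Longrightarrow> f i \<in> carrier MA" shows "(\<lambda>m. \<Sum>i\<in>I. f i m) \<in> carrier MA"
  using assms
proof (induction I rule: finite_induct)
  case (insert i I)
  then have "(\<lambda>m. f i m + (\<Sum>i\<in>I. f i m)) \<in> carrier MA" by (intro monoid_algebra_add_closed) auto
  then show ?case using insert.hyps by simp
qed simp

lemma embed_sum:
  assumes "finite I" "\<And>i. i \<in> I \<Longrightarrow> f i \<in> carrier MA"
  shows "embed MA usn (\<lambda>m. \<Sum>i\<in>I. f i m) = finsum (universal_cstar M R) (\<lambda>i. embed MA usn (f i)) I"
  using assms
proof (induction I rule: finite_induct)
  case empty
  have "embed MA usn (\<lambda>m. 0) = \<zero>\<^bsub>universal_cstar M R\<^esub>"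
    using U.embed_zero by (simp add: universal_cstar_eq)
  then show ?case by simp
next
  case (insert i I)
  have f: "f j \<in> carrier MA" if "j \<in> insert i I" for j using insert.prems that by blast
  have e: "embed MA usn (f j) \<in> carrier (universal_cstar M R)" if "j \<in> insert i I" for j
    unfolding universal_cstar_eq using f[OF that] by (rule U.embed_closed)
  have s: "(\<lambda>m. \<Sum>i\<in>I. f i m) \<in> carrier MA" using insert.hyps(1) f by (intro finite_sum_closed) auto
  have "embed MA usn (\<lambda>m. \<Sum>j\<in>insert i I. f j m) = embed MA usn (f i \<oplus>\<^bsub>MA\<^esub> (\<lambda>m. \<Sum>j\<in>I. f j m))"
    using insert.hyps by simp
  also have "\<dots> = embed MA usn (f i) \<oplus>\<^bsub>universal_cstar M R\<^esub> embed MA usn (\<lambda>m. \<Sum>j\<in>I. f j m)"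
    unfolding universal_cstar_eq using f s by (intro U.embed_add) auto
  also have "\<dots> = finsum (universal_cstar M R) (\<lambda>i. embed MA usn (f i)) (insert i I)"
    using insert.hyps insert.IH f e by (subst UC.finsum_insert) auto
  finally show ?case .
qed

lemma embed_R:
  assumes "f \<in> carrier MA" "g \<in> carrier MA" "(\<lambda>m. f m - g m) \<in> R"
  shows "embed MA usn f = embed MA usn g"
  using assms usn_R[OF assms(3)] MA_minus[OF assms(1,2)] U.embed_eq_iff[OF assms(1,2)] by simp

end

lemma universal_hom_eqI:
  assumes "universal M R" "universal M' R'"
    and h: "unital_star_hom (universal_cstar M R) (universal_cstar M' R') h"
    and h': "unital_star_hom (universal_cstar M R) (universal_cstar M' R') h'"
    and eq: "\<And>a. a \<in> carrier M \<Longrightarrow> h (universal_gen M R a) = h' (universal_gen M R a)"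
  shows "h = h'"
proof -
  interpret U: universal M R by fact
  interpret U': universal M' R' by fact
  note hs = h[unfolded U.universal_cstar_eq U'.universal_cstar_eq] h'[unfolded U.universal_cstar_eq U'.universal_cstar_eq]
  note hd = hs[unfolded unital_star_hom_def]
  show ?thesis
  proof (rule hom_unique[OF U.U.seminormed_star_alg_axioms U'.U.seminormed_star_alg_axioms hs])
    fix x assume x: "x \<in> carrier U.MA"
    let ?e = "embed U.MA U.usn"
    have ad: "k (?e (f \<oplus>\<^bsub>U.MA\<^esub> g)) = k (?e f) \<oplus>\<^bsub>U'.U.C\<^esub> k (?e g)"
      if "f \<in> carrier U.MA" "g \<in> carrier U.MA" "k \<in> {h, h'}" for f g k
      unfolding U.U.embed_add[OF that(1,2)] using hd U.U.embed_closed[OF that(1)] U.U.embed_closed[OF that(2)] that(3) by auto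
    have sm: "k (?e (c \<odot>\<^bsub>U.MA\<^esub> f)) = c \<odot>\<^bsub>U'.U.C\<^esub> k (?e f)" if "f \<in> carrier U.MA" "k \<in> {h, h'}" for c f k
      unfolding U.U.embed_smult[OF that(1)] using hd U.U.embed_closed[OF that(1)] that(2) by auto
    have d: "k (?e (\<lambda>m. c * delta a m)) = c \<odot>\<^bsub>U'.U.C\<^esub> k (universal_gen M R a)" if "a \<in> carrier M" "k \<in> {h, h'}" for c a k
      using sm[OF U.delta_closed[OF that(1)] that(2), of c] by (simp add: universal_gen_def)
    show "h (?e x) = h' (?e x)"
      using x
    proof (induction rule: monoid_algebra_induct)
      case zero
      have "carrier M \<noteq> {}" using U.one_closed by blast
      then show ?case using d[of "\<one>\<^bsub>M\<^esub>" h 0] d[of "\<one>\<^bsub>M\<^esub>" h' 0] eq[of "\<one>\<^bsub>M\<^esub>"] by simp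
    next
      case (add f g)
      then show ?case using ad[of f g h] ad[of f g h'] by simp
    next
      case (delta c a)
      then show ?case using d[of a h c] d[of a h' c] eq[of a] by simp
    qed
  qed
qed

lemma complete_star_alg_cuntz: "complete_star_alg (cuntz n) (nrm (cuntz n))"
  using CU.UC.complete_star_alg_axioms[of n] by (simp add: cuntz_universal)

lemma cstar_pair_cuntz: "cstar_pair (cuntz n) (cuntz n')"
  by (intro cstar_pair.intro complete_star_alg_cuntz)

lemma cgen_closed [simp, intro]: "w \<in> lists (letters n) \<Longrightarrow> cgen n w \<in> carrier (cuntz n)"
  using CU.gen_closed[of w n] by (simp add: cuntz_universal)

lemma cgen_append: "\<lbrakk>u \<in> lists (letters n); v \<in> lists (letters n)\<rbrakk> \<Longrightarrow> cgen n (u @ v) = cgen n u \<otimes>\<^bsub>cuntz n\<^esub> cgen n v"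
  using CU.gen_mult[of u n v] by (simp add: cuntz_universal)

lemma cgen_invol: "w \<in> lists (letters n) \<Longrightarrow> cgen n (rev (map letter_adj w)) = adj (cuntz n) (cgen n w)"
  using CU.gen_adj[of w n] by (simp add: cuntz_universal)

lemma cgen_Nil: "cgen n [] = \<one>\<^bsub>cuntz n\<^esub>"
  using CU.gen_one[of n] by (simp add: cuntz_universal)

lemma cgen_orth:
  assumes ij: "i \<in> {1..n}" "j \<in> {1..n}"
  shows "cgen n [Gen_adj i, Gen j] = (if i = j then \<one>\<^bsub>cuntz n\<^esub> else \<zero>\<^bsub>cuntz n\<^esub>)"
proof -
  have r: "(\<lambda>w. delta [Gen_adj i, Gen j] w - (if i = j then delta [] w else 0)) \<in> cuntz_relations n"
    using ij unfolding cuntz_relations_def by blast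
  have c: "delta [Gen_adj i, Gen j] \<in> carrier (WA n)" "delta [] \<in> carrier (WA n)" "(\<lambda>w. 0) \<in> carrier (WA n)"
    using ij by (auto intro!: WM.delta_closed simp del: monoid_algebra_simps(1)) simp
  show ?thesis
  proof (cases "i = j")
    case True
    then show ?thesis
      using CU.embed_R[OF c(1,2)] r cgen_Nil[of n] by (simp add: universal_gen_def)
  next
    case False
    then have "cgen n [Gen_adj i, Gen j] = embed (WA n) (CU.usn n) (\<lambda>w. 0)"
      using CU.embed_R[OF c(1,3)] r by (simp add: universal_gen_def)
    also have "\<dots> = \<zero>\<^bsub>cuntz n\<^esub>"
      using CU.U.embed_zero[of n] by (simp add: cuntz_def CU.universal_cstar_eq)
    finally show ?thesis using False by simp
  qed
qed

lemma cgen_unit: "finsum (cuntz n) (\<lambda>i. cgen n [Gen i, Gen_adj i]) {1..n} = \<one>\<^bsub>cuntz n\<^esub>"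
proof -
  have d: "delta [Gen i, Gen_adj i] \<in> carrier (WA n)" if "i \<in> {1..n}" for i using that by (intro WM.delta_closed) simp
  have c: "(\<lambda>w. \<Sum>i\<in>{1..n}. delta [Gen i, Gen_adj i] w) \<in> carrier (WA n)"
    by (rule CU.finite_sum_closed) (use d in auto)
  have d0: "delta [] \<in> carrier (WA n)" by (intro WM.delta_closed) simp
  have "(\<lambda>w. (\<Sum>i\<in>{1..n}. delta [Gen i, Gen_adj i] w) - delta [] w) \<in> cuntz_relations n"
    unfolding cuntz_relations_def by blast
  from CU.embed_R[OF c d0 this]
  have "finsum (universal_cstar (word_monoid n) (cuntz_relations n)) (\<lambda>i. embed (WA n) (CU.usn n) (delta [Gen i, Gen_adj i])) {1..n}
    = embed (WA n) (CU.usn n) (delta [])"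
    by (subst CU.embed_sum[symmetric]) (use d in auto)
  then show ?thesis using cgen_Nil[of n] by (simp add: universal_gen_def cuntz_universal)
qed

section \<open>Bilinearity of elementary tensors in the completed tensor product\<close>

context cstar_pair begin

abbreviation "TC \<equiv> universal_cstar PM BR"
abbreviation "et a b \<equiv> universal_gen PM BR (a, b)"

lemma et_closed: "\<lbrakk>a \<in> carrier A; b \<in> carrier B\<rbrakk> \<Longrightarrow> et a b \<in> carrier TC"
  by (intro TU.gen_closed) simp

lemma et_add:
  assumes "a \<in> carrier A" "a' \<in> carrier A" "b \<in> carrier B" "b' \<in> carrier B"
  shows "et (a \<oplus>\<^bsub>A\<^esub> a') b = et a b \<oplus>\<^bsub>TC\<^esub> et a' b" "et a (b \<oplus>\<^bsub>B\<^esub> b') = et a b \<oplus>\<^bsub>TC\<^esub> et a b'"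
proof -
  have d: "delta (u, v) \<in> carrier T" if "u \<in> carrier A" "v \<in> carrier B" for u v
    using that by (intro PM.delta_closed) simp
  have r: "universal_gen PM BR m = universal_gen PM BR m1 \<oplus>\<^bsub>TC\<^esub> universal_gen PM BR m2"
    if "m \<in> carrier PM" "m1 \<in> carrier PM" "m2 \<in> carrier PM" "(\<lambda>x. delta m x - delta m1 x - delta m2 x) \<in> BR" for m m1 m2
  proof -
    note dm = PM.delta_closed[OF that(1)] PM.delta_closed[OF that(2)] PM.delta_closed[OF that(3)]
    have "(\<lambda>x. delta m x - (delta m1 \<oplus>\<^bsub>T\<^esub> delta m2) x) \<in> BR" using that(4) by (simp add: diff_diff_eq)
    from TU.embed_R[OF dm(1) PM.MA_closed(2)[OF dm(2,3)] this]
    show ?thesis unfolding universal_gen_def TU.universal_cstar_eq TU.U.embed_add[OF dm(2,3)] .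
  qed
  show "et (a \<oplus>\<^bsub>A\<^esub> a') b = et a b \<oplus>\<^bsub>TC\<^esub> et a' b"
  proof (rule r)
    show "(\<lambda>m. delta (a \<oplus>\<^bsub>A\<^esub> a', b) m - delta (a, b) m - delta (a', b) m) \<in> BR"
      unfolding bilinear_relations_def
      by (rule UnI1, rule UnI1, rule UnI1, rule CollectI, intro exI conjI, rule refl) (rule assms)+
  qed (use assms in simp_all)
  show "et a (b \<oplus>\<^bsub>B\<^esub> b') = et a b \<oplus>\<^bsub>TC\<^esub> et a b'"
  proof (rule r)
    show "(\<lambda>m. delta (a, b \<oplus>\<^bsub>B\<^esub> b') m - delta (a, b) m - delta (a, b') m) \<in> BR"
      unfolding bilinear_relations_def
      by (rule UnI1, rule UnI1, rule UnI2, rule CollectI, intro exI conjI, rule refl) (rule assms)+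
  qed (use assms in simp_all)
qed

lemma et_zero:
  assumes "a \<in> carrier A" "b \<in> carrier B"
  shows "et \<zero>\<^bsub>A\<^esub> b = \<zero>\<^bsub>TC\<^esub>" "et a \<zero>\<^bsub>B\<^esub> = \<zero>\<^bsub>TC\<^esub>"
  using et_add(1)[of "\<zero>\<^bsub>A\<^esub>" "\<zero>\<^bsub>A\<^esub>" b b] et_add(2)[of a a "\<zero>\<^bsub>B\<^esub>" "\<zero>\<^bsub>B\<^esub>"] assms
    et_closed[of "\<zero>\<^bsub>A\<^esub>" b] et_closed[of a "\<zero>\<^bsub>B\<^esub>"]
    TU.UC.add.l_cancel_one[of "et \<zero>\<^bsub>A\<^esub> b" "et \<zero>\<^bsub>A\<^esub> b"] TU.UC.add.l_cancel_one[of "et a \<zero>\<^bsub>B\<^esub>" "et a \<zero>\<^bsub>B\<^esub>"]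
  by auto

lemma et_finsum_l:
  assumes "finite I" "\<And>i. i \<in> I \<Longrightarrow> x i \<in> carrier A" "b \<in> carrier B"
  shows "et (finsum A x I) b = finsum TC (\<lambda>i. et (x i) b) I"
  using assms
proof (induction I rule: finite_induct)
  case empty then show ?case using et_zero(1)[of "\<zero>\<^bsub>A\<^esub>" b] by simp
next
  case (insert i I)
  then have c: "x i \<in> carrier A" "finsum A x I \<in> carrier A" "x \<in> I \<rightarrow> carrier A" "(\<lambda>i. et (x i) b) \<in> I \<rightarrow> carrier TC" "et (x i) b \<in> carrier TC"
    by (auto intro!: A.finsum_closed et_closed)
  show ?case
    using insert c by (simp add: A.finsum_insert TU.UC.finsum_insert et_add(1)[OF c(1,2) insert.prems(2,2)])
qed

lemma et_finsum_r:
  assumes "finite I" "\<And>i. i \<in> I \<Longrightarrow> y i \<in> carrier B" "a \<in> carrier A"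
  shows "et a (finsum B y I) = finsum TC (\<lambda>i. et a (y i)) I"
  using assms
proof (induction I rule: finite_induct)
  case empty then show ?case using et_zero(2)[of a "\<zero>\<^bsub>B\<^esub>"] by simp
next
  case (insert i I)
  then have c: "y i \<in> carrier B" "finsum B y I \<in> carrier B" "y \<in> I \<rightarrow> carrier B" "(\<lambda>i. et a (y i)) \<in> I \<rightarrow> carrier TC" "et a (y i) \<in> carrier TC"
    by (auto intro!: B.finsum_closed et_closed)
  show ?case
    using insert c by (simp add: B.finsum_insert TU.UC.finsum_insert et_add(2)[OF insert.prems(2,2) c(1,2)])
qed

end

text \<open>The first digit of a letter; the kind of the letter is kept because the adjoint of a
  tensor is the tensor of the adjoints.\<close>

fun letter_fst :: "nat \<Rightarrow> letter \<Rightarrow> letter" where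
  "letter_fst n' (Gen l) = Gen ((l - 1) div n' + 1)"
| "letter_fst n' (Gen_adj l) = Gen_adj ((l - 1) div n' + 1)"

fun letter_snd :: "nat \<Rightarrow> letter \<Rightarrow> letter" where
  "letter_snd n' (Gen l) = Gen ((l - 1) mod n' + 1)"
| "letter_snd n' (Gen_adj l) = Gen_adj ((l - 1) mod n' + 1)"

lemma letter_box_adj: "letter_fst n' (letter_adj l) = letter_adj (letter_fst n' l)" "letter_snd n' (letter_adj l) = letter_adj (letter_snd n' l)"
  by (cases l; simp)+

lemma letter_box_letters:
  assumes "l \<in> letters (n * n')" shows "letter_fst n' l \<in> letters n" "letter_snd n' l \<in> letters n'"
  using assms box_letter by (cases l; simp del: atLeastAtMost_iff)+

lemma letter_box_lists:
  assumes "w \<in> lists (letters (n * n'))"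
  shows "map (letter_fst n') w \<in> lists (letters n)" "map (letter_snd n') w \<in> lists (letters n')"
  using assms letter_box_letters by (auto simp: in_lists_conv_set)

definition split_word :: "nat \<Rightarrow> nat \<Rightarrow> letter list \<Rightarrow> cuntz_elem \<times> cuntz_elem" where
  "split_word n n' w = (cgen n (map (letter_fst n') w), cgen n' (map (letter_snd n') w))"

text \<open>The tensors of the generators satisfy the Cuntz relations for \<open>n * n'\<close>;
  this is what the universal property of the source requires.\<close>

lemma split_word_relations:
  assumes r: "r \<in> cuntz_relations (n * n')"
  shows "universal_seminorm (monoid_algebra (pair_monoid (cuntz n) (cuntz n')))
    (bilinear_relations (cuntz n) (cuntz n')) (push (split_word n n') r) = 0"
proof -
  interpret CP: cstar_pair "cuntz n" "cuntz n'" by (rule cstar_pair_cuntz)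
  let ?T = "monoid_algebra (pair_monoid (cuntz n) (cuntz n'))" and ?N = "CP.TU.usn" and ?h = "split_word n n'"
  have fr: "finite {w. r w \<noteq> 0}" using cuntz_relations_sub[of "n * n'"] r by auto
  have h: "?h w \<in> carrier (pair_monoid (cuntz n) (cuntz n'))" if "w \<in> lists (letters (n * n'))" for w
    using letter_box_lists[OF that] by (simp add: split_word_def)
  have zero: "?N f = 0" if "f \<in> carrier ?T" "embed ?T ?N f = \<zero>\<^bsub>CP.TC\<^esub>" for f
    using CP.TU.U.embed_nrm[OF that(1)] that(2) CP.TU.UC.N_zero by (simp add: CP.TU.universal_cstar_eq)
  show ?thesis
    using r
  proof (cases rule: cuntz_relations_cases)
    case (orth i j)
    let ?w = "[Gen_adj i, Gen j]"
    have w: "?w \<in> lists (letters (n * n'))" using orth by simp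
    have ps: "push ?h r = (\<lambda>m. delta (?h ?w) m - (if i = j then delta (?h []) m else 0))"
    proof (rule lin_ext[OF finite_support_push[OF fr]])
      show "finite {m. delta (?h ?w) m - (if i = j then delta (?h []) m else 0) \<noteq> 0}"
        by (rule finite_subset[of _ "{?h ?w, ?h []}"]) (auto simp: delta_def split: if_splits)
      show "lin \<phi> (push ?h r) = lin \<phi> (\<lambda>m. delta (?h ?w) m - (if i = j then delta (?h []) m else 0))" for \<phi>
      proof -
        have "lin \<phi> (push ?h r) = lin (\<lambda>w. \<phi> (?h w)) r" by (rule lin_push[OF fr])
        also have "\<dots> = \<phi> (?h ?w) - (if i = j then \<phi> (?h []) else 0)" unfolding orth(3) by (rule lin_rel1)
        finally show ?thesis by (cases "i = j") (simp_all add: lin_diff fin_delta)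
      qed
    qed
    define a a' b b' where "a = (i - 1) div n' + 1" and "a' = (j - 1) div n' + 1" and "b = (i - 1) mod n' + 1" and "b' = (j - 1) mod n' + 1"
    have ab: "a \<in> {1..n}" "a' \<in> {1..n}" "b \<in> {1..n'}" "b' \<in> {1..n'}"
      using box_letter[OF orth(1)] box_letter[OF orth(2)] by (simp_all add: a_def a'_def b_def b'_def del: atLeastAtMost_iff)
    have hw: "?h ?w = (cgen n [Gen_adj a, Gen a'], cgen n' [Gen_adj b, Gen b'])"
      by (simp add: split_word_def a_def a'_def b_def b'_def)
    have h0: "?h [] = (\<one>\<^bsub>cuntz n\<^esub>, \<one>\<^bsub>cuntz n'\<^esub>)" by (simp add: split_word_def cgen_Nil)
    show ?thesis
    proof (cases "i = j")
      case True
      then have "push ?h r = \<zero>\<^bsub>?T\<^esub>" unfolding ps hw h0 using ab by (simp add: cgen_orth a_def a'_def b_def b'_def)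
      then show ?thesis using CP.TU.U.N_zero by simp
    next
      case False
      \<comment> \<open>Different letters differ in at least one digit, so at least one tensor
        factor is zero by orthogonality.\<close>
      have "\<not> (a = a' \<and> b = b')"
      proof
        assume "a = a' \<and> b = b'"
        then have "(i - 1) div n' = (j - 1) div n'" "(i - 1) mod n' = (j - 1) mod n'" by (auto simp: a_def a'_def b_def b'_def)
        then have "i - 1 = j - 1" by (metis div_mult_mod_eq)
        then have "i = j" using orth(1,2) by (cases i; cases j) auto
        then show False using False by simp
      qed
      then have "universal_gen (pair_monoid (cuntz n) (cuntz n')) (bilinear_relations (cuntz n) (cuntz n')) (?h ?w) = \<zero>\<^bsub>CP.TC\<^esub>"
        unfolding hw cgen_orth[OF ab(1,2)] cgen_orth[OF ab(3,4)]
        using CP.et_zero(1)[OF CP.A.one_closed CP.B.one_closed] CP.et_zero(1)[OF CP.A.one_closed CP.B.zero_closed]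
          CP.et_zero(2)[OF CP.A.one_closed CP.B.one_closed] by (auto split: if_splits)
      then have "?N (delta (?h ?w)) = 0"
        using CP.PM.delta_closed[OF h[OF w]] by (intro zero) (simp_all add: universal_gen_def)
      then show ?thesis unfolding ps using False by simp
    qed
  next
    case unit
    let ?x = "\<lambda>a. cgen n [Gen a, Gen_adj a]" and ?y = "\<lambda>b. cgen n' [Gen b, Gen_adj b]"
    let ?f = "\<lambda>m. \<Sum>a\<in>{1..n}. \<Sum>b\<in>{1..n'}. delta (?x a, ?y b) m"
    have xy: "?x a \<in> carrier (cuntz n)" "?y b \<in> carrier (cuntz n')" if "a \<in> {1..n}" "b \<in> {1..n'}" for a b using that by auto
    have d: "delta (?x a, ?y b) \<in> carrier ?T" if "a \<in> {1..n}" "b \<in> {1..n'}" for a b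
      using xy[OF that] by (intro CP.PM.delta_closed) simp
    have f1: "(\<lambda>m. \<Sum>b\<in>{1..n'}. delta (?x a, ?y b) m) \<in> carrier ?T" if "a \<in> {1..n}" for a
      using that by (intro CP.TU.finite_sum_closed d) auto
    have f: "?f \<in> carrier ?T" by (intro CP.TU.finite_sum_closed f1) auto
    have d1: "delta (\<one>\<^bsub>cuntz n\<^esub>, \<one>\<^bsub>cuntz n'\<^esub>) \<in> carrier ?T" by (intro CP.PM.delta_closed) simp
    have ps: "push ?h r = (\<lambda>m. ?f m - delta (\<one>\<^bsub>cuntz n\<^esub>, \<one>\<^bsub>cuntz n'\<^esub>) m)"
    proof (rule lin_ext[OF finite_support_push[OF fr]])
      have "(\<lambda>m. ?f m - delta (\<one>\<^bsub>cuntz n\<^esub>, \<one>\<^bsub>cuntz n'\<^esub>) m) \<in> carrier ?T"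
        using CP.PM.MA_minus[OF f d1] CP.TU.MA.minus_closed[OF f d1] by simp
      then show "finite {m. ?f m - delta (\<one>\<^bsub>cuntz n\<^esub>, \<one>\<^bsub>cuntz n'\<^esub>) m \<noteq> 0}" by simp
      fix \<phi>
      have "lin \<phi> (push ?h r) = lin (\<lambda>w. \<phi> (?h w)) r" by (rule lin_push[OF fr])
      also have "\<dots> = (\<Sum>l\<in>{1..n * n'}. \<phi> (?h [Gen l, Gen_adj l])) - \<phi> (?h [])"
        unfolding unit by (rule lin_rel2)
      also have "(\<Sum>l\<in>{1..n * n'}. \<phi> (?h [Gen l, Gen_adj l])) = (\<Sum>(a, b)\<in>{1..n} \<times> {1..n'}. \<phi> (?x a, ?y b))"
      proof (rule sum.reindex_bij_witness[where i = "\<lambda>(a, b). n' * (a - 1) + b" and j = "\<lambda>l. ((l - 1) div n' + 1, (l - 1) mod n' + 1)"])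
        fix l assume l: "l \<in> {1..n * n'}"
        show "((l - 1) div n' + 1, (l - 1) mod n' + 1) \<in> {1..n} \<times> {1..n'}" using box_letter[OF l] by simp
        show "(case ((l - 1) div n' + 1, (l - 1) mod n' + 1) of (a, b) \<Rightarrow> n' * (a - 1) + b) = l"
          using l mult_div_mod_eq[of n' "l - 1"] by auto
        show "(case ((l - 1) div n' + 1, (l - 1) mod n' + 1) of (a, b) \<Rightarrow> \<phi> (?x a, ?y b)) = \<phi> (?h [Gen l, Gen_adj l])"
          by (simp add: split_word_def)
      qed (use box_letter_inv in \<open>auto simp del: atLeastAtMost_iff\<close>)
      also have "\<dots> = (\<Sum>a\<in>{1..n}. \<Sum>b\<in>{1..n'}. \<phi> (?x a, ?y b))" by (simp only: sum.cartesian_product)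
      also have "\<dots> = (\<Sum>a\<in>{1..n}. lin \<phi> (\<lambda>m. \<Sum>b\<in>{1..n'}. delta (?x a, ?y b) m))"
        by (intro sum.cong refl) (simp add: lin_sum(2)[OF finite_atLeastAtMost fin_delta(2)])
      also have "\<dots> = lin \<phi> ?f"
        by (rule lin_sum(2)[OF finite_atLeastAtMost lin_sum(1)[OF finite_atLeastAtMost fin_delta(2)], symmetric])
      finally have "lin \<phi> (push ?h r) = lin \<phi> ?f - \<phi> (?h [])" .
      moreover have "lin \<phi> (\<lambda>m. ?f m - delta (\<one>\<^bsub>cuntz n\<^esub>, \<one>\<^bsub>cuntz n'\<^esub>) m) = lin \<phi> ?f - \<phi> (\<one>\<^bsub>cuntz n\<^esub>, \<one>\<^bsub>cuntz n'\<^esub>)"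
        using f by (subst lin_diff) (simp_all add: fin_delta)
      ultimately show "lin \<phi> (push ?h r) = lin \<phi> (\<lambda>m. ?f m - delta (\<one>\<^bsub>cuntz n\<^esub>, \<one>\<^bsub>cuntz n'\<^esub>) m)"
        by (simp add: split_word_def cgen_Nil)
    qed
    \<comment> \<open>The double sum of range projections is summed by bilinearity, first in the
      right factor and then in the left one, and each sum is a unit.\<close>
    have "embed ?T ?N ?f = finsum (CP.TC) (\<lambda>a. finsum (CP.TC) (\<lambda>b. CP.et (?x a) (?y b)) {1..n'}) {1..n}"
    proof -
      have "embed ?T ?N ?f = finsum (CP.TC) (\<lambda>a. embed ?T ?N (\<lambda>m. \<Sum>b\<in>{1..n'}. delta (?x a, ?y b) m)) {1..n}"
        by (rule CP.TU.embed_sum) (use f1 in auto)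
      also have "\<dots> = finsum (CP.TC) (\<lambda>a. finsum (CP.TC) (\<lambda>b. CP.et (?x a) (?y b)) {1..n'}) {1..n}"
      proof (rule CP.TU.UC.finsum_cong')
        show "(\<lambda>a. finsum (CP.TC) (\<lambda>b. CP.et (?x a) (?y b)) {1..n'}) \<in> {1..n} \<rightarrow> carrier (CP.TC)"
          by (intro Pi_I CP.TU.UC.finsum_closed CP.et_closed xy)
        show "embed ?T ?N (\<lambda>m. \<Sum>b\<in>{1..n'}. delta (?x a, ?y b) m) = finsum (CP.TC) (\<lambda>b. CP.et (?x a) (?y b)) {1..n'}"
          if a: "a \<in> {1..n}" for a
          unfolding universal_gen_def[of "pair_monoid (cuntz n) (cuntz n')"]
          by (rule CP.TU.embed_sum[OF finite_atLeastAtMost d[OF a]])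
      qed simp
      finally show ?thesis .
    qed
    also have "\<dots> = finsum (CP.TC) (\<lambda>a. CP.et (?x a) \<one>\<^bsub>cuntz n'\<^esub>) {1..n}"
    proof (rule CP.TU.UC.finsum_cong')
      show "(\<lambda>a. CP.et (?x a) \<one>\<^bsub>cuntz n'\<^esub>) \<in> {1..n} \<rightarrow> carrier (CP.TC)"
        by (intro Pi_I CP.et_closed) auto
      show "finsum (CP.TC) (\<lambda>b. CP.et (?x a) (?y b)) {1..n'} = CP.et (?x a) \<one>\<^bsub>cuntz n'\<^esub>" if "a \<in> {1..n}" for a
        using CP.et_finsum_r[of "{1..n'}" ?y "?x a"] that unfolding cgen_unit by simp
    qed simp
    also have "\<dots> = CP.et \<one>\<^bsub>cuntz n\<^esub> \<one>\<^bsub>cuntz n'\<^esub>"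
      using CP.et_finsum_l[of "{1..n}" ?x "\<one>\<^bsub>cuntz n'\<^esub>"] unfolding cgen_unit by simp
    finally have "?N (?f \<ominus>\<^bsub>?T\<^esub> delta (\<one>\<^bsub>cuntz n\<^esub>, \<one>\<^bsub>cuntz n'\<^esub>)) = 0"
      using CP.TU.U.embed_eq_iff[OF f d1] by (simp add: universal_gen_def)
    then show ?thesis unfolding ps CP.PM.MA_minus[OF f d1] .
  qed
qed

lemma unital_star_hom_mult: "\<lbrakk>unital_star_hom A B f; x \<in> carrier A; y \<in> carrier A\<rbrakk> \<Longrightarrow> f (x \<otimes>\<^bsub>A\<^esub> y) = f x \<otimes>\<^bsub>B\<^esub> f y"
  and unital_star_hom_adj: "\<lbrakk>unital_star_hom A B f; x \<in> carrier A\<rbrakk> \<Longrightarrow> f (adj A x) = adj B (f x)"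
  and unital_star_hom_one: "unital_star_hom A B f \<Longrightarrow> f \<one>\<^bsub>A\<^esub> = \<one>\<^bsub>B\<^esub>"
  and unital_star_hom_closed: "\<lbrakk>unital_star_hom A B f; x \<in> carrier A\<rbrakk> \<Longrightarrow> f x \<in> carrier B"
  by (auto simp: unital_star_hom_def)

lemma cuntz_hom_eqI:
  assumes f: "unital_star_hom (cuntz n) B f" and g: "unital_star_hom (cuntz n) B g"
    and eq: "\<And>i. i \<in> {1..n} \<Longrightarrow> f (cgen n [Gen i]) = g (cgen n [Gen i])" and w: "w \<in> lists (letters n)"
  shows "f (cgen n w) = g (cgen n w)"
  using w
proof (induction rule: lists.induct)
  case Nil
  show ?case using unital_star_hom_one[OF f] unital_star_hom_one[OF g] by (simp add: cgen_Nil)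
next
  case (Cons l w)
  have l: "f (cgen n [l]) = g (cgen n [l])"
  proof (cases l)
    case (Gen i) then show ?thesis using eq Cons(1) by simp
  next
    case (Gen_adj i)
    then have i: "i \<in> {1..n}" using Cons(1) by simp
    then have "cgen n [l] = adj (cuntz n) (cgen n [Gen i])" using cgen_invol[of "[Gen i]" n] Gen_adj by simp
    then show ?thesis
      using unital_star_hom_adj[OF f, of "cgen n [Gen i]"] unital_star_hom_adj[OF g, of "cgen n [Gen i]"] eq[OF i] i by simp
  qed
  have "cgen n (l # w) = cgen n [l] \<otimes>\<^bsub>cuntz n\<^esub> cgen n w" using cgen_append[of "[l]" n w] Cons by simp
  then show ?case
    using unital_star_hom_mult[OF f, of "cgen n [l]" "cgen n w"] unital_star_hom_mult[OF g, of "cgen n [l]" "cgen n w"] l Cons by simp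
qed

text \<open>\<open>universal_hom\<close> provides such a homomorphism with explicit values on all
  words. Agreement on generators extends to words and, by continuity, to the algebra, so the
  definite description picks this one.\<close>

lemma cuntz_embedding:
  shows "unital_star_hom (cuntz (n * n')) (cstar_tensor (cuntz n) (cuntz n')) (cuntz_embedding n n')"
    and "\<And>w. w \<in> lists (letters (n * n')) \<Longrightarrow> cuntz_embedding n n' (cgen (n * n') w) =
      elem_tensor (cuntz n) (cuntz n') (cgen n (map (letter_fst n') w)) (cgen n' (map (letter_snd n') w))"
proof -
  interpret CP: cstar_pair "cuntz n" "cuntz n'" by (rule cstar_pair_cuntz)
  let ?A = "cuntz n" and ?B = "cuntz n'"
  have "\<exists>f. unital_star_hom (universal_cstar (word_monoid (n * n')) (cuntz_relations (n * n'))) (CP.TC) f \<and>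
    (\<forall>w\<in>carrier (word_monoid (n * n')). f (cgen (n * n') w) = universal_gen (pair_monoid ?A ?B) (bilinear_relations ?A ?B) (split_word n n' w))"
  proof (rule universal_hom[OF CU.universal_axioms CP.TU.universal_axioms, of "n * n'" "split_word n n'"])
    fix w assume "w \<in> carrier (word_monoid (n * n'))"
    then have w: "w \<in> lists (letters (n * n'))" by simp
    note bl = letter_box_lists[OF w]
    show "split_word n n' w \<in> carrier (pair_monoid ?A ?B)" using bl by (simp add: split_word_def)
    have "map (letter_fst n') (rev (map letter_adj w)) = rev (map letter_adj (map (letter_fst n') w))"
      "map (letter_snd n') (rev (map letter_adj w)) = rev (map letter_adj (map (letter_snd n') w))"
      by (simp_all add: rev_map comp_def letter_box_adj)
    then show "split_word n n' (invol (word_monoid (n * n')) w) = invol (pair_monoid ?A ?B) (split_word n n' w)"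
      using cgen_invol[OF bl(1)] cgen_invol[OF bl(2)] by (simp add: split_word_def del: map_map)
  next
    fix u v assume "u \<in> carrier (word_monoid (n * n'))" "v \<in> carrier (word_monoid (n * n'))"
    then have uv: "u \<in> lists (letters (n * n'))" "v \<in> lists (letters (n * n'))" by auto
    note bl = letter_box_lists[OF uv(1)] letter_box_lists[OF uv(2)]
    show "split_word n n' (u \<otimes>\<^bsub>word_monoid (n * n')\<^esub> v) = split_word n n' u \<otimes>\<^bsub>pair_monoid ?A ?B\<^esub> split_word n n' v"
      using cgen_append[OF bl(1,3)] cgen_append[OF bl(2,4)] by (simp add: split_word_def)
  next
    show "split_word n n' \<one>\<^bsub>word_monoid (n * n')\<^esub> = \<one>\<^bsub>pair_monoid ?A ?B\<^esub>" by (simp add: split_word_def cgen_Nil)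
  next
    fix r assume "r \<in> cuntz_relations (n * n')"
    then show "CP.TU.usn (push (split_word n n') r) = 0" by (rule split_word_relations)
  next
    fix f assume "unital_star_hom (universal_cstar (word_monoid (n * n')) (cuntz_relations (n * n'))) (CP.TC) f"
      and "\<And>w. w \<in> carrier (word_monoid (n * n')) \<Longrightarrow> f (cgen (n * n') w) = universal_gen (pair_monoid ?A ?B) (bilinear_relations ?A ?B) (split_word n n' w)"
    then show ?thesis by blast
  qed
  then obtain f where f: "unital_star_hom (cuntz (n * n')) (cstar_tensor ?A ?B) f"
    "\<And>w. w \<in> lists (letters (n * n')) \<Longrightarrow> f (cgen (n * n') w) = elem_tensor ?A ?B (cgen n (map (letter_fst n') w)) (cgen n' (map (letter_snd n') w))"
    unfolding cuntz_universal cstar_tensor_def[symmetric] elem_tensor_def[symmetric] split_word_def by auto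
  let ?P = "\<lambda>f. unital_star_hom (cuntz (n * n')) (cstar_tensor ?A ?B) f \<and>
    (\<forall>i\<in>{1..n}. \<forall>j\<in>{1..n'}. f (cuntz_gen (n * n') (n' * (i - 1) + j)) = elem_tensor ?A ?B (cuntz_gen n i) (cuntz_gen n' j))"
  have "cuntz_embedding n n' = f"
    unfolding cuntz_embedding_def
  proof (rule the_equality)
    show "?P f"
    proof (intro conjI f(1) ballI)
      fix i j assume ij: "i \<in> {1..n}" "j \<in> {1..n'}"
      have "[Gen (n' * (i - 1) + j)] \<in> lists (letters (n * n'))" using box_letter_inv(1)[OF ij] by simp
      from f(2)[OF this] show "f (cuntz_gen (n * n') (n' * (i - 1) + j)) = elem_tensor ?A ?B (cuntz_gen n i) (cuntz_gen n' j)"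
        using box_letter_inv(2,3)[OF ij] by (simp add: cuntz_gen_def)
    qed
    fix g assume g: "?P g"
    have "g (cgen (n * n') [Gen l]) = f (cgen (n * n') [Gen l])" if l: "l \<in> {1..n * n'}" for l
    proof -
      let ?i = "(l - 1) div n' + 1" and ?j = "(l - 1) mod n' + 1"
      have ij: "?i \<in> {1..n}" "?j \<in> {1..n'}" using box_letter[OF l] by auto
      have "n' * (?i - 1) + ?j = l" using l mult_div_mod_eq[of n' "l - 1"] by auto
      then have "g (cgen (n * n') [Gen l]) = elem_tensor ?A ?B (cuntz_gen n ?i) (cuntz_gen n' ?j)"
        using g ij by (metis cuntz_gen_def)
      then show ?thesis using f(2)[of "[Gen l]"] l by (simp add: cuntz_gen_def)
    qed
    then have "g (cgen (n * n') w) = f (cgen (n * n') w)" if "w \<in> lists (letters (n * n'))" for w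
      using cuntz_hom_eqI[OF conjunct1[OF g] f(1) _ that] by blast
    then show "g = f"
      using universal_hom_eqI[OF CU.universal_axioms CP.TU.universal_axioms, of "n * n'" g f] g f(1)
      by (simp add: cuntz_universal cstar_tensor_def)
  qed
  then show "unital_star_hom (cuntz (n * n')) (cstar_tensor ?A ?B) (cuntz_embedding n n')"
    "\<And>w. w \<in> lists (letters (n * n')) \<Longrightarrow> cuntz_embedding n n' (cgen (n * n') w) =
      elem_tensor ?A ?B (cgen n (map (letter_fst n') w)) (cgen n' (map (letter_snd n') w))"
    using f by simp_all
qed

lemma state_compose_hom:
  assumes "star_alg A" and f: "unital_star_hom A B f" and s: "state B \<omega>"
  shows "state A (compose (carrier A) \<omega> f)"
proof -
  interpret star_alg A by fact
  show ?thesis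
    unfolding state_def
  proof (intro conjI ballI allI)
    fix x y c assume x: "x \<in> carrier A" and y: "y \<in> carrier A"
    have fx: "f x \<in> carrier B" "f y \<in> carrier B" using f x y by (auto simp: unital_star_hom_def)
    note simps = compose_eq x y fx
    show "compose (carrier A) \<omega> f (x \<oplus>\<^bsub>A\<^esub> y) = compose (carrier A) \<omega> f x + compose (carrier A) \<omega> f y"
      "compose (carrier A) \<omega> f (c \<odot>\<^bsub>A\<^esub> x) = c * compose (carrier A) \<omega> f x"
      "compose (carrier A) \<omega> f (adj A x \<otimes>\<^bsub>A\<^esub> x) \<in> \<real>\<^sub>\<ge>\<^sub>0"
      using f s by (simp_all add: simps unital_star_hom_def state_def)
    have "cmod (\<omega> (f x)) \<le> nrm B (f x)" "nrm B (f x) \<le> nrm A x" using f s x fx by (auto simp: unital_star_hom_def state_def)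
    then show "cmod (compose (carrier A) \<omega> f x) \<le> nrm A x" by (simp add: simps)
  qed (use f s in \<open>auto simp: compose_eq unital_star_hom_def state_def\<close>)
qed

text \<open>The embedding splits a word into its two digit words, and the product state is
  multiplicative on the resulting elementary tensor.\<close>

lemma state_prod_state:
  assumes s: "state (cuntz n) \<omega>1" "state (cuntz n') \<omega>2"
  obtains \<omega> where "state_prod (n, \<omega>1) (n', \<omega>2) = (n * n', \<omega>)" "state (cuntz (n * n')) \<omega>"
    "\<And>w. w \<in> lists (letters (n * n')) \<Longrightarrow>
      \<omega> (cgen (n * n') w) = \<omega>1 (cgen n (map (letter_fst n') w)) * \<omega>2 (cgen n' (map (letter_snd n') w))"
proof -
  interpret CP: cstar_pair "cuntz n" "cuntz n'" by (rule cstar_pair_cuntz)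
  let ?\<omega> = "compose (carrier (cuntz (n * n'))) (product_state (cuntz n) (cuntz n') \<omega>1 \<omega>2) (cuntz_embedding n n')"
  have "state_prod (n, \<omega>1) (n', \<omega>2) = (n * n', ?\<omega>)" by simp
  moreover have "state (cuntz (n * n')) ?\<omega>"
    by (rule state_compose_hom[OF star_alg_cuntz cuntz_embedding(1) CP.product_state(1)[OF s]])
  moreover have "?\<omega> (cgen (n * n') w) = \<omega>1 (cgen n (map (letter_fst n') w)) * \<omega>2 (cgen n' (map (letter_snd n') w))"
    if w: "w \<in> lists (letters (n * n'))" for w
    using w letter_box_lists[OF w] by (simp add: compose_eq cuntz_embedding(2) CP.product_state(2)[OF s])
  ultimately show thesis by (rule that)
qed

section \<open>The isomorphism\<close>

lemma sub_cuntz_power_value: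
  assumes z: "z \<in> unit_vectors n m" and s: "is_sub_cuntz_state n m z \<omega>" and J: "J \<in> words n (a * m)"
  shows "\<omega> (cgen n (gens J)) = cnj (tensor_power m z a J)"
proof -
  have st: "state (cuntz n) \<omega>" using s by (simp add: is_sub_cuntz_state_def)
  interpret cuntz_kernel n "\<lambda>w. \<omega> (cgen n w)" by (rule cuntz_kernel_of_state[OF st])
  have one: "(\<Sum>J\<in>words n m. z J * \<omega> (cgen n (gens J))) = 1" using s is_sub_cuntz_state_iff[OF z st] by simp
  have "\<omega> (cgen n (adjs J)) = tensor_power m z a J"
    using adjs_eigen_power[OF z one _ J, of "[]"] by (simp add: empty)
  then show ?thesis using hermitian[OF words_lists(2)[OF J]] by simp
qed

text \<open>On words of length \<open>lcm m l\<close> both states are given by powers of their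
  vectors, so the product has the coordinates of the product vector. Nonperiodicity of that vector
  identifies the state.\<close>

lemma state_prod_sub_cuntz:
  assumes m: "m \<ge> 1" and z: "z \<in> unit_vectors n m" and npz: "nonperiodic n m z"
    and l: "l \<ge> 1" and y: "y \<in> unit_vectors n' l" and npy: "nonperiodic n' l y"
  shows "state_prod (n, sub_cuntz_state n (m, z)) (n', sub_cuntz_state n' (l, y)) =
    (n * n', sub_cuntz_state (n * n') (snd (vector_prod (n, m, z) (n', l, y))))"
proof -
  let ?d = "lcm m l"
  let ?v = "boxtimes n n' ?d (tensor_power m z (?d div m)) (tensor_power l y (?d div l))"
  let ?\<omega>1 = "sub_cuntz_state n (m, z)" and ?\<omega>2 = "sub_cuntz_state n' (l, y)"
  note s1 = sub_cuntz_state_is[OF m z npz] and s2 = sub_cuntz_state_is[OF l y npy]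
  have st: "state (cuntz n) ?\<omega>1" "state (cuntz n') ?\<omega>2" using s1 s2 by (simp_all add: is_sub_cuntz_state_def)
  obtain \<omega> where \<omega>: "state_prod (n, ?\<omega>1) (n', ?\<omega>2) = (n * n', \<omega>)" "state (cuntz (n * n')) \<omega>"
    "\<And>w. w \<in> lists (letters (n * n')) \<Longrightarrow>
      \<omega> (cgen (n * n') w) = ?\<omega>1 (cgen n (map (letter_fst n') w)) * ?\<omega>2 (cgen n' (map (letter_snd n') w))"
    using state_prod_state[OF st] by blast
  have d: "?d \<ge> 1" using m l by (simp add: lcm_pos_nat Suc_le_eq)
  have dm: "?d div m * m = ?d" "?d div l * l = ?d" by simp_all
  have "is_sub_cuntz_state (n * n') ?d ?v \<omega>"
    unfolding is_sub_cuntz_state_def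
  proof (intro conjI \<omega>(2) ballI)
    fix L assume L: "L \<in> words (n * n') ?d"
    have b: "box_fst n' L \<in> words n (?d div m * m)" "box_snd n' L \<in> words n' (?d div l * l)"
      using box_words(1,2)[OF L] unfolding dm by auto
    have "\<omega> (cuntz_word (n * n') L) = ?\<omega>1 (cgen n (map (letter_fst n') (gens L))) * ?\<omega>2 (cgen n' (map (letter_snd n') (gens L)))"
      unfolding cuntz_word_eq[OF L] by (rule \<omega>(3)[OF words_lists(1)[OF L]])
    also have "map (letter_fst n') (gens L) = gens (box_fst n' L)" by (simp add: box_fst_def)
    also have "map (letter_snd n') (gens L) = gens (box_snd n' L)" by (simp add: box_snd_def)
    also have "?\<omega>1 (cgen n (gens (box_fst n' L))) * ?\<omega>2 (cgen n' (gens (box_snd n' L))) = cnj (?v L)"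
      using sub_cuntz_power_value[OF z s1 b(1)] sub_cuntz_power_value[OF y s2 b(2)] L by (simp add: boxtimes_eq)
    finally show "\<omega> (cuntz_word (n * n') L) = cnj (?v L)" .
  qed
  then have "sub_cuntz_state (n * n') (?d, ?v) = \<omega>"
    using nonperiodic_vector_prod[OF m l z y npz npy] by (intro sub_cuntz_state_eqI d) auto
  then show ?thesis using \<omega>(1) by simp
qed

text \<open>Closure and associativity are transported along \<open>h\<close>. Associativity of
  \<open>state_prod\<close> is thus inherited from the vectors, without comparing iterated tensor
  products.\<close>

lemma semigroup_on_image:
  assumes "semigroup_on A f" "h ` A = B" "\<And>x y. \<lbrakk>x \<in> A; y \<in> A\<rbrakk> \<Longrightarrow> h (f x y) = g (h x) (h y)"
  shows "semigroup_on B g"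
  unfolding semigroup_on_def
proof (intro conjI ballI)
  fix b c assume "b \<in> B" "c \<in> B"
  then obtain x y where xy: "x \<in> A" "y \<in> A" "b = h x" "c = h y" using assms(2) by blast
  then have "h (f x y) \<in> B" using assms(1,2) by (auto simp: semigroup_on_def)
  then show "g b c \<in> B" using assms(3)[OF xy(1,2)] xy by simp
next
  fix b c d assume "b \<in> B" "c \<in> B" "d \<in> B"
  then obtain x y w where xyw: "x \<in> A" "y \<in> A" "w \<in> A" "b = h x" "c = h y" "d = h w" using assms(2) by blast
  have fxy: "f x y \<in> A" "f y w \<in> A" using assms(1) xyw by (auto simp: semigroup_on_def)
  have "g (g b c) d = h (f (f x y) w)" using xyw fxy assms(3) by simp
  also have "\<dots> = h (f x (f y w))" using assms(1) xyw by (simp add: semigroup_on_def)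
  also have "\<dots> = g b (g c d)" using xyw fxy assms(3) by simp
  finally show "g (g b c) d = g b (g c d)" .
qed

theorem corollary1p13:
  shows "semigroup_on nonperiodic_all vector_prod \<and>
    semigroup_on pure_sub_cuntz_all state_prod \<and>
    (\<exists>Q. (\<forall>n\<ge>2. \<forall>z\<in>nonperiodic_vectors n. Q (n, z) = (n, sub_cuntz_state n z)) \<and>
         semigroup_iso nonperiodic_all vector_prod pure_sub_cuntz_all state_prod Q)"
proof -
  define Q :: "graded_vector \<Rightarrow> nat \<times> (cuntz_elem \<Rightarrow> complex)" where "Q = (\<lambda>(n, z). (n, sub_cuntz_state n z))"
  have all: "\<exists>n m z. x = (n, m, z) \<and> 2 \<le> n \<and> 1 \<le> m \<and> z \<in> unit_vectors n m \<and> nonperiodic n m z" if "x \<in> nonperiodic_all" for x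
    using that by (auto simp: nonperiodic_all_def nonperiodic_vectors_def)
  have hom: "Q (vector_prod x y) = state_prod (Q x) (Q y)" if x: "x \<in> nonperiodic_all" and y: "y \<in> nonperiodic_all" for x y
  proof -
    obtain n m z where x: "x = (n, m, z)" "1 \<le> m" "z \<in> unit_vectors n m" "nonperiodic n m z" using all[OF x] by blast
    obtain n' l w where y: "y = (n', l, w)" "1 \<le> l" "w \<in> unit_vectors n' l" "nonperiodic n' l w" using all[OF y] by blast
    show ?thesis
      using state_prod_sub_cuntz[OF x(2-4) y(2-4)] by (simp add: Q_def x(1) y(1) del: state_prod.simps)
  qed
  have img: "Q ` nonperiodic_all = pure_sub_cuntz_all"
  proof
    show "Q ` nonperiodic_all \<subseteq> pure_sub_cuntz_all"
    proof
      fix b assume "b \<in> Q ` nonperiodic_all"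
      then obtain n m z where x: "b = Q (n, m, z)" "2 \<le> n" "1 \<le> m" "z \<in> unit_vectors n m" "nonperiodic n m z" using all by blast
      note s = sub_cuntz_state_is[OF x(3-5)]
      have "sub_cuntz_state n (m, z) \<in> pure_sub_cuntz_states n"
        unfolding pure_sub_cuntz_states_def using sub_cuntz_pure[OF x(3-5) s] s x(3,4) by blast
      then show "b \<in> pure_sub_cuntz_all" using x by (simp add: Q_def pure_sub_cuntz_all_def)
    qed
    show "pure_sub_cuntz_all \<subseteq> Q ` nonperiodic_all"
    proof
      fix b assume "b \<in> pure_sub_cuntz_all"
      then obtain n \<omega> where b: "b = (n, \<omega>)" "2 \<le> n" "\<omega> \<in> pure_sub_cuntz_states n" by (auto simp: pure_sub_cuntz_all_def)
      obtain m z where z: "m \<ge> 1" "z \<in> unit_vectors n m" "nonperiodic n m z" "is_sub_cuntz_state n m z \<omega>"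
        by (rule pure_sub_cuntz_nonperiodic[OF b(3)])
      have "b = Q (n, m, z)" using sub_cuntz_state_eqI[OF z] b by (simp add: Q_def)
      moreover have "(n, m, z) \<in> nonperiodic_all" using z b by (simp add: nonperiodic_all_def nonperiodic_vectors_def)
      ultimately show "b \<in> Q ` nonperiodic_all" by blast
    qed
  qed
  have inj: "inj_on Q nonperiodic_all"
  proof (rule inj_onI)
    fix x y assume x: "x \<in> nonperiodic_all" and y: "y \<in> nonperiodic_all" and e: "Q x = Q y"
    obtain n m z where x: "x = (n, m, z)" "1 \<le> m" "z \<in> unit_vectors n m" "nonperiodic n m z" using all[OF x] by blast
    obtain n' l w where y: "y = (n', l, w)" "1 \<le> l" "w \<in> unit_vectors n' l" "nonperiodic n' l w" using all[OF y] by blast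
    have n: "n = n'" using e by (simp add: Q_def x(1) y(1))
    then have q: "sub_cuntz_state n (m, z) = sub_cuntz_state n' (l, w)" using e by (simp add: Q_def x(1) y(1))
    have "m = l \<and> z = w"
      using sub_cuntz_state_inj[OF x(2-4) y(2-4)[folded n]] sub_cuntz_state_is[OF x(2-4)] sub_cuntz_state_is[OF y(2-4)] q n by simp
    then show "x = y" using x(1) y(1) n by simp
  qed
  have "semigroup_iso nonperiodic_all vector_prod pure_sub_cuntz_all state_prod Q"
    using hom img inj by (simp add: semigroup_iso_def bij_betw_def)
  moreover have "semigroup_on pure_sub_cuntz_all state_prod"
    using semigroup_vectors img
  proof (rule semigroup_on_image)
    show "Q (vector_prod x y) = state_prod (Q x) (Q y)" if "x \<in> nonperiodic_all" "y \<in> nonperiodic_all" for x y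
      using that by (rule hom)
  qed
  moreover have "\<forall>n\<ge>2. \<forall>z\<in>nonperiodic_vectors n. Q (n, z) = (n, sub_cuntz_state n z)"
    unfolding Q_def split_conv by (intro allI impI ballI refl)
  ultimately show ?thesis
    by (intro conjI semigroup_vectors exI[of _ Q])
qed

end
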